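(* A looped simple graph is balanced and $\mathcal{M}_{lc}$-connected if and only if it can be obtained from $K_1^{[3]}$ by recursively applying the operations of performing a $1$-extension and adding a new edge or loop.
   Context: A looped simple graph $G=(V,E,L)$: $E$ is a set of non-loop edges with no parallel edges, $L$ a set of loops (several may be at one vertex). $K_1^{[3]}$ is one vertex with three loops. $G$ is balanced if for every $X\subseteq V$ with $|X|=2$ each connected component of $G-X$ contains a loop. For $F\subseteq E\cup L$ let $V_F$ be the set of vertices incident to $F$; $\mathcal{M}_{lc}(G)$ is the matroid on $E\cup L$ whose independent sets are those $F$ with $|F'|\le 2|V_{F'}|$ for all $F'\subseteq F$ and $|F'|\le 2|V_{F'}|-3$ for all nonempty $F'\subseteq F\cap E$; $G$ is $\mathcal{M}_{lc}$-connected if every pair of elements of $E\cup L$ lies in a common circuit. The $1$-extension at an edge $uw$ deletes $uw$ and adds a new vertex $v$, edges $uv,wv$ and either an edge $vx$ ($x\in V\setminus\{u,w\}$) or a loop at $v$; the $1$-extension at a loop at $u$ deletes it and adds a new vertex $v$, an edge $uv$, a loop at $v$ and either an edge $wv$ ($w\in V-u$) or a second loop at $v$. Adding an edge must keep the graph a looped simple graph.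
   Formalization: Graphs are nonempty, and "has no isolated vertices" is added to the left side: a single vertex without loops, or K_1^{[3]} plus an isolated vertex, is vacuously balanced and M_lc-connected but cannot be obtained from K_1^{[3]}. *)

theory Defs
  imports Main
begin

(* Elements of the ground set: a non-loop edge is the set of its two ends, so there are no
   parallel edges; Loop u i is the loop at u with label i, so that a vertex can carry several
   loops that are different elements. *)
datatype 'v element = Edge "'v set" | Loop 'v nat

fun ends :: "'v element \<Rightarrow> 'v set" where
  "ends (Edge e) = e"
| "ends (Loop u i) = {u}"

record 'v lgraph =
  verts :: "'v set"
  edges :: "'v element set"
  loops :: "'v element set"

definition looped_simple_graph :: "'v lgraph \<Rightarrow> bool" where
  "looped_simple_graph G \<longleftrightarrow>
     finite (verts G) \<and> verts G \<noteq> {} \<and>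
     edges G \<subseteq> {Edge {u, w} | u w. u \<in> verts G \<and> w \<in> verts G \<and> u \<noteq> w} \<and>
     loops G \<subseteq> {Loop u i | u i. u \<in> verts G} \<and> finite (loops G)"

abbreviation elements :: "'v lgraph \<Rightarrow> 'v element set" where
  "elements G \<equiv> edges G \<union> loops G"

definition span_verts :: "'v element set \<Rightarrow> 'v set" where
  "span_verts F = (\<Union>f\<in>F. ends f)"

(* The matroid does not see isolated vertices; without this convention K_1, two isolated vertices,
   and a vertex with at least three loops next to an isolated vertex would count as balanced and
   connected only vacuously. *)
definition no_isolated_vertices :: "'v lgraph \<Rightarrow> bool" where
  "no_isolated_vertices G \<longleftrightarrow> verts G = span_verts (elements G)"

definition delete_verts :: "'v lgraph \<Rightarrow> 'v set \<Rightarrow> 'v lgraph" where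
  "delete_verts G X =
     \<lparr>verts = verts G - X,
      edges = {e \<in> edges G. ends e \<inter> X = {}},
      loops = {l \<in> loops G. ends l \<inter> X = {}}\<rparr>"

definition adjacency :: "'v lgraph \<Rightarrow> ('v \<times> 'v) set" where
  "adjacency G = {(u, w). Edge {u, w} \<in> edges G}"

(* Connected components, given by their vertex sets. *)
definition components :: "'v lgraph \<Rightarrow> 'v set set" where
  "components G = {{w \<in> verts G. (u, w) \<in> (adjacency G)\<^sup>*} | u. u \<in> verts G}"

definition balanced :: "'v lgraph \<Rightarrow> bool" where
  "balanced G \<longleftrightarrow>
     (\<forall>X \<subseteq> verts G. card X = 2 \<longrightarrow>
        (\<forall>C \<in> components (delete_verts G X).
           \<exists>l \<in> loops (delete_verts G X). ends l \<subseteq> C))"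

definition lc_indep :: "'v lgraph \<Rightarrow> 'v element set \<Rightarrow> bool" where
  "lc_indep G F \<longleftrightarrow>
     F \<subseteq> elements G \<and>
     (\<forall>F' \<subseteq> F. card F' \<le> 2 * card (span_verts F')) \<and>
     (\<forall>F' \<subseteq> F \<inter> edges G. F' \<noteq> {} \<longrightarrow>
        int (card F') \<le> 2 * int (card (span_verts F')) - 3)"

definition lc_circuit :: "'v lgraph \<Rightarrow> 'v element set \<Rightarrow> bool" where
  "lc_circuit G C \<longleftrightarrow>
     C \<subseteq> elements G \<and> \<not> lc_indep G C \<and> (\<forall>D. D \<subset> C \<longrightarrow> lc_indep G D)"

(* e = f is allowed: a coloop is in no circuit, so e.g. one vertex with one loop is not
   connected in this sense. *)
definition lc_connected :: "'v lgraph \<Rightarrow> bool" where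
  "lc_connected G \<longleftrightarrow>
     (\<forall>e \<in> elements G. \<forall>f \<in> elements G. \<exists>C. lc_circuit G C \<and> e \<in> C \<and> f \<in> C)"

(* The label of a loop only serves to tell it apart from the other loops at its vertex, and the
   new vertex v is arbitrary, so no closure under isomorphism is needed below. *)
inductive one_extension :: "'v lgraph \<Rightarrow> 'v lgraph \<Rightarrow> bool" where
  at_edge_add_edge:
    "\<lbrakk>Edge {u, w} \<in> edges G; v \<notin> verts G; x \<in> verts G - {u, w}\<rbrakk> \<Longrightarrow>
     one_extension G
       \<lparr>verts = insert v (verts G),
        edges = (edges G - {Edge {u, w}}) \<union> {Edge {u, v}, Edge {w, v}, Edge {v, x}},
        loops = loops G\<rparr>"
| at_edge_add_loop:
    "\<lbrakk>Edge {u, w} \<in> edges G; v \<notin> verts G\<rbrakk> \<Longrightarrow>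
     one_extension G
       \<lparr>verts = insert v (verts G),
        edges = (edges G - {Edge {u, w}}) \<union> {Edge {u, v}, Edge {w, v}},
        loops = loops G \<union> {Loop v i}\<rparr>"
| at_loop_add_edge:
    "\<lbrakk>Loop u k \<in> loops G; v \<notin> verts G; w \<in> verts G - {u}\<rbrakk> \<Longrightarrow>
     one_extension G
       \<lparr>verts = insert v (verts G),
        edges = edges G \<union> {Edge {u, v}, Edge {w, v}},
        loops = (loops G - {Loop u k}) \<union> {Loop v i}\<rparr>"
| at_loop_add_loop:
    "\<lbrakk>Loop u k \<in> loops G; v \<notin> verts G; i \<noteq> j\<rbrakk> \<Longrightarrow>
     one_extension G
       \<lparr>verts = insert v (verts G),
        edges = edges G \<union> {Edge {u, v}},
        loops = (loops G - {Loop u k}) \<union> {Loop v i, Loop v j}\<rparr>"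

inductive add_element :: "'v lgraph \<Rightarrow> 'v lgraph \<Rightarrow> bool" where
  add_edge:
    "\<lbrakk>u \<in> verts G; w \<in> verts G; u \<noteq> w; Edge {u, w} \<notin> edges G\<rbrakk> \<Longrightarrow>
     add_element G (G\<lparr>edges := insert (Edge {u, w}) (edges G)\<rparr>)"
| add_loop:
    "\<lbrakk>u \<in> verts G; Loop u i \<notin> loops G\<rbrakk> \<Longrightarrow>
     add_element G (G\<lparr>loops := insert (Loop u i) (loops G)\<rparr>)"

definition is_K1_3 :: "'v lgraph \<Rightarrow> bool" where
  "is_K1_3 G \<longleftrightarrow>
     (\<exists>u. verts G = {u} \<and> edges G = {} \<and> loops G \<subseteq> {Loop u i | i. True} \<and> card (loops G) = 3)"

inductive obtainable_from_K1_3 :: "'v lgraph \<Rightarrow> bool" where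
  base: "is_K1_3 G \<Longrightarrow> obtainable_from_K1_3 G"
| extend: "\<lbrakk>obtainable_from_K1_3 G; one_extension G H\<rbrakk> \<Longrightarrow> obtainable_from_K1_3 H"
| add: "\<lbrakk>obtainable_from_K1_3 G; add_element G H\<rbrakk> \<Longrightarrow> obtainable_from_K1_3 H"

end

theory Submission
  imports Defs "HOL-Library.Disjoint_Sets"
begin

text \<open>
  Replace a loop at \<open>u\<close> by an edge from \<open>u\<close> to a new outer vertex of its own, and let \<open>V\<close> be the set of
  original vertices. A graph without isolated vertices is balanced and connected in the sense of the
  matroid iff it is connected as a graph, the matroid has rank \<open>2|V|\<close> and keeps this rank when any
  element is deleted, and every nonempty \<open>D \<subseteq> V\<close> has at least three neighbours outside \<open>D\<close>. The last
  two properties (\<open>solid\<close> below) make sense for arbitrary outer vertices, survive one-extensions and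
  additions, and pass to every subset of \<open>V\<close>, the other vertices becoming outer.

  For the converse, take a circuit, with vertex set \<open>W \<subseteq> V\<close>. If \<open>W \<noteq> V\<close>, reduce \<open>V - W\<close> by induction;
  if \<open>W = V\<close> but the circuit is not everything, delete another edge; and if the graph is a circuit,
  a count of tight sets gives a vertex of degree three whose removal can be repaired by a new edge.
  If the result has a set \<open>D\<close> with only two outer neighbours, the step is exchanged for one inside \<open>D\<close>,
  which by induction can be chosen so as to keep a prescribed edge to an outer vertex. That edge is
  what allows the step inside \<open>D\<close> to be lifted. The same device reduces inside a smallest side of a
  bridge, so that connectedness of the graph is not lost.
\<close>

subsection \<open>Matroids and intersecting submodular counts\<close>

text \<open>The bounds \<open>2 * n - 3\<close> and \<open>2 * n\<close> are those of generic
  rigidity in the plane, for bars alone and for bars together with constraints against a fixed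
  ground. Giving every loop an end of its own makes both bounds functions of the vertex set of a set
  of edges; a part of the graph then differs from the whole only in \<open>V\<close>, not in
  \<open>E\<close>. Rank alone forces two outer neighbours on every nonempty \<open>D\<close>:
  \<open>2 * card D\<close> edges at \<open>D\<close> need
  \<open>2 * card D + 3 \<le> 2 * (card D + k)\<close> if \<open>D\<close> has \<open>k\<close>
  neighbours. The third neighbour is what balance adds, and it is no count: a vertex can be removed
  without loss of rank and yet leave some \<open>D\<close> hinged at two vertices \<open>x\<close>
  and \<open>y\<close>. To the rest of the graph such a \<open>D\<close> acts like a single edge
  \<open>xy\<close>, so the rest stays redundantly rigid with \<open>xy\<close> in place of
  \<open>D\<close>, while \<open>D\<close> itself has to be reduced with a third attachment kept.
  Asking for a prescribed attachment in the induction has its price: it is not enough that a circuit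
  has a reducible vertex, there must be one away from the root.\<close>

locale matroid =
  fixes ind :: "'e set \<Rightarrow> bool"
  assumes ind_empty: "ind {}"
    and ind_finite: "ind I \<Longrightarrow> finite I"
    and ind_mono: "ind I \<Longrightarrow> J \<subseteq> I \<Longrightarrow> ind J"
    and augment: "ind I \<Longrightarrow> ind J \<Longrightarrow> card I < card J \<Longrightarrow> \<exists>e\<in>J - I. ind (insert e I)"
begin

definition rk :: "'e set \<Rightarrow> nat" where
  "rk A = Max (card ` {I. I \<subseteq> A \<and> ind I})"

definition circuit :: "'e set \<Rightarrow> bool" where
  "circuit C \<longleftrightarrow> finite C \<and> \<not> ind C \<and> (\<forall>x\<in>C. ind (C - {x}))"

text \<open>Connectedness of the matroid restricted to \<open>A\<close>, in terms of ranks because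
  the counts below bound ranks. The lemmas \<open>insep_common_circuit\<close> and
  \<open>insep_if_common_circuits\<close> relate it to common circuits of pairs of elements.\<close>

definition insep :: "'e set \<Rightarrow> bool" where
  "insep A \<longleftrightarrow> (\<forall>S T. S \<union> T = A \<and> S \<inter> T = {} \<and> S \<noteq> {} \<and> T \<noteq> {} \<longrightarrow> rk A < rk S + rk T)"

lemma ind_card_le_rk:
  assumes "finite A" "I \<subseteq> A" "ind I"
  shows "card I \<le> rk A"
proof -
  have "finite {I. I \<subseteq> A \<and> ind I}" using assms(1) by simp
  then show ?thesis unfolding rk_def using assms by (intro Max_ge) auto
qed

lemma basis_exists:
  assumes "finite A"
  obtains I where "I \<subseteq> A" "ind I" "card I = rk A"
proof -
  have "finite {I. I \<subseteq> A \<and> ind I}" using assms by simp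
  moreover have "{} \<in> {I. I \<subseteq> A \<and> ind I}" using ind_empty by simp
  ultimately have "rk A \<in> card ` {I. I \<subseteq> A \<and> ind I}"
    unfolding rk_def by (intro Max_in) auto
  then show ?thesis using that by auto
qed

lemma basis_extend:
  assumes "finite A" "J \<subseteq> A" "ind J"
  obtains I where "J \<subseteq> I" "I \<subseteq> A" "ind I" "card I = rk A"
proof -
  have "\<exists>I. J \<subseteq> I \<and> I \<subseteq> A \<and> ind I \<and> card I = rk A"
    using assms(2,3)
  proof (induction "rk A - card J" arbitrary: J)
    case 0
    then show ?case using ind_card_le_rk[OF assms(1)] by (metis diff_is_0_eq le_antisym order_refl)
  next
    case (Suc n)
    obtain B where B: "B \<subseteq> A" "ind B" "card B = rk A" using basis_exists[OF assms(1)] .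
    have "card J < card B" using Suc B by simp
    from augment[OF Suc(4) B(2) this] obtain e where e: "e \<in> B - J" "ind (insert e J)" by blast
    have "card (insert e J) = Suc (card J)" using e ind_finite[OF Suc(4)] by simp
    then have "n = rk A - card (insert e J)" using Suc by simp
    from Suc(1)[OF this _ e(2)] e B Suc(3) show ?case by blast
  qed
  then show ?thesis using that by blast
qed

lemma rk_mono:
  "finite B \<Longrightarrow> A \<subseteq> B \<Longrightarrow> rk A \<le> rk B"
proof -
  assume a: "finite B" "A \<subseteq> B"
  then have "finite A" using finite_subset by blast
  then obtain I where "I \<subseteq> A" "ind I" "card I = rk A" using basis_exists by blast
  then show "rk A \<le> rk B" using ind_card_le_rk[OF a(1), of I] a by auto
qed

lemma rk_ind: "ind I \<Longrightarrow> rk I = card I"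
proof -
  assume a: "ind I"
  obtain J where "J \<subseteq> I" "ind J" "card J = rk I" using basis_exists[OF ind_finite[OF a]] .
  then show "rk I = card I"
    using ind_card_le_rk[OF ind_finite[OF a] order_refl a] card_mono[OF ind_finite[OF a], of J] by simp
qed

lemma ind_iff_rk: "finite A \<Longrightarrow> ind A \<longleftrightarrow> rk A = card A"
proof -
  assume a: "finite A"
  obtain J where "J \<subseteq> A" "ind J" "card J = rk A" using basis_exists[OF a] .
  then show "ind A \<longleftrightarrow> rk A = card A" using card_subset_eq[OF a, of J] rk_ind by auto
qed

lemma rk_le_card: "finite A \<Longrightarrow> rk A \<le> card A"
proof -
  assume a: "finite A"
  obtain J where "J \<subseteq> A" "ind J" "card J = rk A" using basis_exists[OF a] .
  then show "rk A \<le> card A" using card_mono[OF a, of J] by simp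
qed

lemma rk_Un_le:
  assumes "finite A" "finite B"
  shows "rk (A \<union> B) \<le> rk A + rk B"
proof -
  obtain I where I: "I \<subseteq> A \<union> B" "ind I" "card I = rk (A \<union> B)"
    using basis_exists[of "A \<union> B"] assms by auto
  have "I = (I \<inter> A) \<union> (I \<inter> B)" using I by auto
  then have "card I \<le> card (I \<inter> A) + card (I \<inter> B)" by (metis card_Un_le)
  moreover have "card (I \<inter> A) \<le> rk A" "card (I \<inter> B) \<le> rk B"
    by (intro ind_card_le_rk assms ind_mono[OF I(2)]; blast)+
  ultimately show ?thesis using I by linarith
qed

lemma dependent_has_circuit:
  assumes "finite A" "\<not> ind A"
  obtains C where "circuit C" "C \<subseteq> A"
proof -
  define \<C> where "\<C> = {C. C \<subseteq> A \<and> \<not> ind C}"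
  have "finite \<C>" "\<C> \<noteq> {}" using assms by (auto simp: \<C>_def)
  then obtain C where C: "C \<in> \<C>" "\<forall>D\<in>\<C>. D \<subseteq> C \<longrightarrow> D = C"
    using finite_has_minimal[of \<C>] by (metis subset_antisym)
  have "circuit C" unfolding circuit_def
  proof (intro conjI ballI)
    show "finite C" "\<not> ind C" using C assms(1) finite_subset by (auto simp: \<C>_def)
    fix x assume "x \<in> C"
    then have "C - {x} \<subseteq> A" "C - {x} \<subseteq> C" "C - {x} \<noteq> C" using C by (auto simp: \<C>_def)
    then show "ind (C - {x})" using C(2) unfolding \<C>_def by blast
  qed
  then show ?thesis using C that by (auto simp: \<C>_def)
qed

lemma circuit_psubset_ind: "circuit C \<Longrightarrow> D \<subset> C \<Longrightarrow> ind D"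
proof -
  assume a: "circuit C" "D \<subset> C"
  then obtain x where x: "x \<in> C" "D \<subseteq> C - {x}" by blast
  then show "ind D" using a ind_mono unfolding circuit_def by blast
qed

lemma circuit_subset_eq: "circuit C \<Longrightarrow> circuit D \<Longrightarrow> D \<subseteq> C \<Longrightarrow> D = C"
  using circuit_psubset_ind unfolding circuit_def by blast

lemma circuit_nonempty: "circuit C \<Longrightarrow> C \<noteq> {}"
  using ind_empty unfolding circuit_def by blast

lemma circuit_through:
  assumes "ind I" "\<not> ind (insert e I)"
  obtains C where "circuit C" "e \<in> C" "C \<subseteq> insert e I"
proof -
  obtain C where C: "circuit C" "C \<subseteq> insert e I"
    using dependent_has_circuit[of "insert e I"] assms ind_finite by blast
  then have "e \<in> C" using assms ind_mono unfolding circuit_def by blast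
  then show ?thesis using C that by blast
qed

lemma circuit_rk: "circuit C \<Longrightarrow> rk C + 1 = card C"
proof -
  assume C: "circuit C"
  then obtain x where x: "x \<in> C" using circuit_nonempty by blast
  have f: "finite C" using C by (simp add: circuit_def)
  have "rk C \<le> card C" "rk C \<noteq> card C" using rk_le_card f ind_iff_rk C by (auto simp: circuit_def)
  moreover have "card (C - {x}) \<le> rk C"
    using C x f by (intro ind_card_le_rk) (auto simp: circuit_def)
  moreover have "card (C - {x}) + 1 = card C" using x f by (metis Suc_eq_plus1 card.remove)
  ultimately show ?thesis by linarith
qed

lemma rk_delete_circuit:
  assumes "circuit C" "C \<subseteq> A" "finite A" "g \<in> C"
  shows "rk (A - {g}) = rk A"
proof -
  have "ind (C - {g})" "C - {g} \<subseteq> A" using assms by (auto simp: circuit_def)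
  then obtain I where I: "C - {g} \<subseteq> I" "I \<subseteq> A" "ind I" "card I = rk A"
    using basis_extend[OF assms(3)] by blast
  have "g \<notin> I"
  proof
    assume "g \<in> I"
    then have "C \<subseteq> I" using I by blast
    then show False using I assms ind_mono unfolding circuit_def by blast
  qed
  then have "rk A \<le> rk (A - {g})" using I ind_card_le_rk[of "A - {g}" I] assms(3) by auto
  then show ?thesis using rk_mono[of A "A - {g}"] assms(3) by auto
qed

lemma circuit_of_rk_delete:
  assumes "finite A" "rk (A - {g}) = rk A" "g \<in> A"
  obtains C where "circuit C" "C \<subseteq> A" "g \<in> C"
proof -
  obtain I where I: "I \<subseteq> A - {g}" "ind I" "card I = rk A"
    using basis_exists[of "A - {g}"] assms by auto
  have "\<not> ind (insert g I)"
  proof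
    assume "ind (insert g I)"
    then have "card (insert g I) \<le> rk A"
      using I(1) assms(3) by (intro ind_card_le_rk[OF assms(1)]) auto
    moreover have "g \<notin> I" using I(1) by blast
    then have "card (insert g I) = Suc (card I)" using ind_finite[OF I(2)] by simp
    ultimately show False using I by simp
  qed
  then obtain C where "circuit C" "g \<in> C" "C \<subseteq> insert g I" using circuit_through I by blast
  then show ?thesis using that I assms by blast
qed

text \<open>Ranks do the work: \<open>f\<close> and then \<open>e\<close> can be deleted from the
  union without loss, since \<open>C2\<close> avoids \<open>f\<close>. Hence \<open>f\<close> can
  also be deleted after \<open>e\<close>, which puts it in a circuit that avoids
  \<open>e\<close>.\<close>

lemma strong_elimination:
  assumes C1: "circuit C1" and C2: "circuit C2" and e: "e \<in> C1 \<inter> C2" and f: "f \<in> C1 - C2"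
  obtains C3 where "circuit C3" "C3 \<subseteq> C1 \<union> C2 - {e}" "f \<in> C3"
proof -
  let ?U = "C1 \<union> C2"
  have fin: "finite ?U" using C1 C2 by (simp add: circuit_def)
  have "rk (?U - {e}) = rk ?U" using rk_delete_circuit[OF C2, of ?U e] fin e by auto
  moreover have "rk (?U - {f}) = rk ?U" using rk_delete_circuit[OF C1, of ?U f] fin f by auto
  moreover have "rk (?U - {f} - {e}) = rk (?U - {f})"
    using rk_delete_circuit[OF C2, of "?U - {f}" e] fin e f by auto
  moreover have "?U - {e} - {f} = ?U - {f} - {e}" by blast
  ultimately have "rk (?U - {e} - {f}) = rk (?U - {e})" by simp
  moreover have "f \<in> ?U - {e}" using e f by blast
  ultimately obtain C where "circuit C" "C \<subseteq> ?U - {e}" "f \<in> C"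
    using circuit_of_rk_delete[of "?U - {e}" f] fin by auto
  then show ?thesis using that by blast
qed

text \<open>Induction on the size of the union. Eliminating a common element \<open>e\<close> once
  in favour of \<open>x\<close> and once in favour of \<open>y\<close> gives circuits
  \<open>C3\<close> and \<open>C4\<close>; either \<open>C3\<close> and \<open>C2\<close>, or
  \<open>C3\<close> and \<open>C4\<close>, meet and have a smaller union.\<close>

lemma circuit_transitive:
  assumes "circuit C1" "circuit C2" "x \<in> C1" "y \<in> C2" "C1 \<inter> C2 \<noteq> {}"
  shows "\<exists>C. circuit C \<and> C \<subseteq> C1 \<union> C2 \<and> x \<in> C \<and> y \<in> C"
  using assms
proof (induction "card (C1 \<union> C2)" arbitrary: C1 C2 rule: less_induct)
  case less
  show ?case
  proof (cases "y \<in> C1 \<or> x \<in> C2")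
    case True
    then show ?thesis using less by blast
  next
    case False
    have fin: "finite (C1 \<union> C2)" using less by (simp add: circuit_def)
    obtain e where e: "e \<in> C1 \<inter> C2" using less by blast
    obtain C3 where C3: "circuit C3" "C3 \<subseteq> C1 \<union> C2 - {e}" "x \<in> C3"
      using strong_elimination[OF less(2,3) e] False less by blast
    obtain C4 where C4: "circuit C4" "C4 \<subseteq> C2 \<union> C1 - {e}" "y \<in> C4"
      using strong_elimination[OF less(3,2), of e y] e False less by blast
    have 3: "C3 \<inter> (C2 - C1) \<noteq> {}"
    proof
      assume "C3 \<inter> (C2 - C1) = {}"
      then have "C3 \<subseteq> C1 - {e}" using C3 by blast
      then show False using circuit_subset_eq[OF less(2) C3(1)] e by blast
    qed
    have 4: "C4 \<inter> (C1 - C2) \<noteq> {}"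
    proof
      assume "C4 \<inter> (C1 - C2) = {}"
      then have "C4 \<subseteq> C2 - {e}" using C4 by blast
      then show False using circuit_subset_eq[OF less(3) C4(1)] e by blast
    qed
    show ?thesis
    proof (cases "C3 \<union> C2 = C1 \<union> C2")
      case False
      then have "C3 \<union> C2 \<subset> C1 \<union> C2" using C3 by blast
      then have "card (C3 \<union> C2) < card (C1 \<union> C2)" by (rule psubset_card_mono[OF fin])
      moreover have "C3 \<inter> C2 \<noteq> {}" using 3 by auto
      ultimately obtain C where "circuit C" "C \<subseteq> C3 \<union> C2" "x \<in> C" "y \<in> C"
        using less(1)[OF _ C3(1) less(3) C3(3) less(5)] by auto
      then show ?thesis using C3(2) by (intro exI[of _ C]) auto
    next
      case True
      \<comment> \<open>\<open>C3\<close> now covers all of \<open>C1 - C2\<close>, where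
        \<open>C4\<close> has an element.\<close>
      then have "C4 \<inter> C3 \<noteq> {}" using 4 by blast
      moreover have "C3 \<union> C4 \<subset> C1 \<union> C2" using C3 C4 e by blast
      then have "card (C3 \<union> C4) < card (C1 \<union> C2)" by (rule psubset_card_mono[OF fin])
      ultimately obtain C where "circuit C" "C \<subseteq> C3 \<union> C4" "x \<in> C" "y \<in> C"
        using less(1)[OF _ C3(1) C4(1) C3(3) C4(3)] by (metis Int_commute)
      then show ?thesis using C3(2) C4(2) by (intro exI[of _ C]) auto
    qed
  qed
qed

text \<open>The elements that share a circuit with \<open>x\<close> form a class \<open>S\<close>
  that no circuit leaves, by transitivity. Bases of \<open>S\<close> and of its complement then have
  an independent union, so a nonempty complement would be a separation.\<close>

lemma insep_common_circuit:
  assumes "insep A" "finite A" "x \<in> A" "y \<in> A" "x \<noteq> y"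
  obtains C where "circuit C" "C \<subseteq> A" "x \<in> C" "y \<in> C"
proof -
  define S where "S = {u \<in> A. u = x \<or> (\<exists>C. circuit C \<and> C \<subseteq> A \<and> x \<in> C \<and> u \<in> C)}"
  define T where "T = A - S"
  have "T = {}"
  proof (rule ccontr)
    assume "T \<noteq> {}"
    have fin: "finite S" "finite T" using assms(2) by (auto simp: S_def T_def)
    have cross: "C \<subseteq> S \<or> C \<subseteq> T" if C: "circuit C" "C \<subseteq> A" for C
    proof (rule ccontr)
      assume "\<not> (C \<subseteq> S \<or> C \<subseteq> T)"
      then obtain s t where st: "s \<in> C" "s \<in> S" "t \<in> C" "t \<in> T" using C T_def by blast
      have "\<exists>D. circuit D \<and> D \<subseteq> A \<and> x \<in> D \<and> t \<in> D"
      proof (cases "s = x")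
        case True
        then show ?thesis using st C by blast
      next
        case False
        then obtain D where D: "circuit D" "D \<subseteq> A" "x \<in> D" "s \<in> D" using st S_def by blast
        then show ?thesis using circuit_transitive[OF D(1) C(1) D(3) st(3)] st C by blast
      qed
      then show False using st by (auto simp: T_def S_def)
    qed
    obtain I where I: "I \<subseteq> S" "ind I" "card I = rk S" using basis_exists[OF fin(1)] .
    obtain J where J: "J \<subseteq> T" "ind J" "card J = rk T" using basis_exists[OF fin(2)] .
    have "ind (I \<union> J)"
    proof (rule ccontr)
      assume "\<not> ind (I \<union> J)"
      then obtain C where C: "circuit C" "C \<subseteq> I \<union> J"
        using dependent_has_circuit[of "I \<union> J"] I J ind_finite by blast
      have "C \<subseteq> A" using C I J by (auto simp: S_def T_def)
      then have "C \<subseteq> I \<or> C \<subseteq> J" using cross[OF C(1)] C I J T_def by blast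
      then show False using C I J ind_mono unfolding circuit_def by blast
    qed
    moreover have "card (I \<union> J) = card I + card J"
      using I J ind_finite T_def by (intro card_Un_disjoint) auto
    ultimately have le: "rk S + rk T \<le> rk A"
      using ind_card_le_rk[OF assms(2), of "I \<union> J"] I J by (auto simp: S_def T_def)
    have "x \<in> S" using assms by (auto simp: S_def)
    have "S \<union> T = A" "S \<inter> T = {}" "S \<noteq> {}" using \<open>x \<in> S\<close> by (auto simp: S_def T_def)
    then have "rk A < rk S + rk T" using assms(1) \<open>T \<noteq> {}\<close> unfolding insep_def by simp
    then show False using le by simp
  qed
  then have "y \<in> S" using assms T_def by blast
  then show ?thesis using assms that S_def by blast
qed

lemma insep_circuit: "circuit C \<Longrightarrow> insep C"
  unfolding insep_def
proof (intro allI impI)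
  fix S T assume C: "circuit C" and ST: "S \<union> T = C \<and> S \<inter> T = {} \<and> S \<noteq> {} \<and> T \<noteq> {}"
  have "S \<subset> C" "T \<subset> C" using ST by blast+
  then have "ind S" "ind T" by (simp_all add: circuit_psubset_ind[OF C])
  moreover from this have "card C = card S + card T"
    using ST ind_finite[of S] ind_finite[of T] card_Un_disjoint[of S T] by simp
  ultimately show "rk C < rk S + rk T" using circuit_rk[OF C] rk_ind by simp
qed

text \<open>A separation of \<open>A\<close> that splits \<open>H\<close> separates
  \<open>H\<close>; one that does not leaves the full rank on one side, and the other side still has
  positive rank.\<close>

lemma insep_superset:
  assumes "insep H" "H \<subseteq> A" "finite A" "rk H = rk A" "\<And>x. x \<in> A \<Longrightarrow> ind {x}"
  shows "insep A"
  unfolding insep_def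
proof (intro allI impI)
  fix S T assume ST: "S \<union> T = A \<and> S \<inter> T = {} \<and> S \<noteq> {} \<and> T \<noteq> {}"
  have fin: "finite S" "finite T" using ST assms(3) by auto
  have H: "S \<inter> H \<union> T \<inter> H = H" "(S \<inter> H) \<inter> (T \<inter> H) = {}" using ST assms(2) by auto
  have le: "rk (S \<inter> H) \<le> rk S" "rk (T \<inter> H) \<le> rk T" using rk_mono fin by auto
  have pos: "0 < rk U" if "U \<subseteq> A" "U \<noteq> {}" for U
  proof -
    from that(2) obtain x where "x \<in> U" by auto
    then have "card {x} \<le> rk U"
      using that(1) assms(5) finite_subset[OF that(1) assms(3)] by (intro ind_card_le_rk) auto
    then show ?thesis by simp
  qed
  show "rk A < rk S + rk T"
  proof (cases "S \<inter> H = {} \<or> T \<inter> H = {}")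
    case False
    then have "rk H < rk (S \<inter> H) + rk (T \<inter> H)" using assms(1) H unfolding insep_def by metis
    then show ?thesis using le assms(4) by linarith
  next
    case True
    then have "H \<subseteq> S \<or> H \<subseteq> T" using H by blast
    then have "rk A \<le> rk S \<or> rk A \<le> rk T" using rk_mono fin assms(4) by metis
    then show ?thesis using pos ST by force
  qed
qed

end

section \<open>Matroids defined by a submodular count\<close>

locale counting =
  fixes f :: "'e set \<Rightarrow> int" and U :: "'e set"
  assumes f_mono: "finite B \<Longrightarrow> B \<subseteq> U \<Longrightarrow> A \<subseteq> B \<Longrightarrow> A \<noteq> {} \<Longrightarrow> f A \<le> f B"
    and f_submod: "finite A \<Longrightarrow> finite B \<Longrightarrow> A \<union> B \<subseteq> U \<Longrightarrow> A \<inter> B \<noteq> {} \<Longrightarrow>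
      f (A \<union> B) + f (A \<inter> B) \<le> f A + f B"
    and f_single: "e \<in> U \<Longrightarrow> f {e} \<le> 1"
begin

definition cind :: "'e set \<Rightarrow> bool" where
  "cind I \<longleftrightarrow> finite I \<and> I \<subseteq> U \<and> (\<forall>T\<subseteq>I. T \<noteq> {} \<longrightarrow> int (card T) \<le> f T)"

definition tight :: "'e set \<Rightarrow> 'e set \<Rightarrow> bool" where
  "tight I T \<longleftrightarrow> T \<subseteq> I \<and> T \<noteq> {} \<and> f T = int (card T)"

lemma cind_mono: "cind I \<Longrightarrow> J \<subseteq> I \<Longrightarrow> cind J"
  unfolding cind_def by (meson finite_subset subset_trans)

lemma cind_card: "cind I \<Longrightarrow> T \<subseteq> I \<Longrightarrow> T \<noteq> {} \<Longrightarrow> int (card T) \<le> f T"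
  unfolding cind_def by simp

text \<open>Uncrossing. The common element is essential, because \<open>f\<close> is submodular only
  on intersecting pairs.\<close>

lemma tight_Un:
  assumes I: "cind I" and S: "tight I S" and T: "tight I T" and ne: "S \<inter> T \<noteq> {}"
  shows "tight I (S \<union> T)"
proof -
  have fin: "finite S" "finite T" and U: "S \<union> T \<subseteq> U"
    using finite_subset[of S I] finite_subset[of T I] I S T unfolding cind_def tight_def by auto
  have sub: "S \<union> T \<subseteq> I" "S \<inter> T \<subseteq> I" using S T by (auto simp: tight_def)
  have "f (S \<union> T) + f (S \<inter> T) \<le> int (card S) + int (card T)"
    using f_submod[OF fin U ne] S T by (simp add: tight_def)
  also have "\<dots> = int (card (S \<union> T)) + int (card (S \<inter> T))"
    using card_Un_Int[OF fin] by simp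
  finally have "f (S \<union> T) = int (card (S \<union> T))"
    using cind_card[OF I sub(2) ne] cind_card[OF I sub(1)] S by (auto simp: tight_def)
  then show ?thesis using sub ne by (auto simp: tight_def)
qed

lemma f_Un_le:
  assumes "finite R" "finite S" "S \<noteq> {}" "R \<union> S \<subseteq> U" "R \<inter> S = {}"
    "\<And>a. a \<in> R \<Longrightarrow> f (insert a S) \<le> f S"
  shows "f (S \<union> R) \<le> f S"
  using assms
proof (induction R rule: finite_induct)
  case empty
  then show ?case by simp
next
  case (insert a R)
  have eq: "(S \<union> R) \<union> insert a S = S \<union> insert a R" "(S \<union> R) \<inter> insert a S = S"
    using insert by auto
  have "f ((S \<union> R) \<union> insert a S) + f ((S \<union> R) \<inter> insert a S) \<le> f (S \<union> R) + f (insert a S)"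
    using insert by (intro f_submod) auto
  then have "f (S \<union> insert a R) + f S \<le> f (S \<union> R) + f (insert a S)" by (simp only: eq)
  moreover have "f (S \<union> R) \<le> f S" using insert by auto
  moreover have "f (insert a S) \<le> f S" using insert by auto
  ultimately show ?case by linarith
qed

text \<open>The rank formula of such a count, read off from a maximal \<open>I\<close>: tight sets
  that meet have tight unions, so the maximal ones partition \<open>I\<close>, and each remaining
  element of \<open>A\<close> can join one of them without raising \<open>f\<close>. An element with
  \<open>f {a} \<le> 0\<close> need not fit into any block, whence the last assumption.\<close>

lemma rank_partition:
  assumes A: "finite A" "A \<subseteq> U" and I: "cind I" "I \<subseteq> A"
    and max: "\<And>a. a \<in> A - I \<Longrightarrow> \<not> cind (insert a I)"
    and single: "\<And>a. a \<in> A \<Longrightarrow> 1 \<le> f {a}"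
  obtains P where "finite P" "\<Union>P = A" "disjoint P" "{} \<notin> P"
    "\<And>F. F \<in> P \<Longrightarrow> f F = int (card (F \<inter> I))"
proof -
  have finI: "finite I" using I by (simp add: cind_def)
  have "\<exists>T. tight I T \<and> e \<in> T \<and> (\<forall>T'. tight I T' \<and> e \<in> T' \<longrightarrow> T' \<subseteq> T)" if e: "e \<in> I" for e
  proof -
    define \<T> where "\<T> = {T. tight I T \<and> e \<in> T}"
    have "\<T> \<subseteq> Pow I" by (auto simp: \<T>_def tight_def)
    then have fin: "finite \<T>" using finI by (simp add: finite_subset)
    have "f {e} = 1" using f_single[of e] single[of e] e I A by (auto intro: antisym)
    then have "{e} \<in> \<T>" using e by (auto simp: \<T>_def tight_def)
    then have ne: "\<T> \<noteq> {}" by auto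
    obtain T where T: "T \<in> \<T>" "\<forall>T'\<in>\<T>. T \<subseteq> T' \<longrightarrow> T = T'"
      using finite_has_maximal[OF fin ne] by metis
    have "T' \<subseteq> T" if "tight I T'" "e \<in> T'" for T'
    proof -
      have "T \<union> T' \<in> \<T>" using tight_Un[OF I(1), of T T'] T(1) that by (auto simp: \<T>_def)
      then have "T = T \<union> T'" using T(2) by (meson Un_upper1)
      then show ?thesis by blast
    qed
    then show ?thesis using T(1) by (auto simp: \<T>_def)
  qed
  then obtain M where M: "\<And>e. e \<in> I \<Longrightarrow> tight I (M e)" "\<And>e. e \<in> I \<Longrightarrow> e \<in> M e"
    "\<And>e T. e \<in> I \<Longrightarrow> tight I T \<Longrightarrow> e \<in> T \<Longrightarrow> T \<subseteq> M e" by metis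
  have MI: "M e \<subseteq> I" if "e \<in> I" for e using M(1)[OF that] by (simp add: tight_def)
  have M_eq: "M x = M y" if xy: "x \<in> I" "y \<in> I" and z: "z \<in> M x" "z \<in> M y" for x y z
  proof -
    have t: "tight I (M x \<union> M y)" using tight_Un[OF I(1) M(1)[OF xy(1)] M(1)[OF xy(2)]] z by auto
    have "M x \<union> M y \<subseteq> M x" "M x \<union> M y \<subseteq> M y" using M(3)[OF _ t] M(2) xy by auto
    then show ?thesis by blast
  qed
  \<comment> \<open>A set violating the count contains \<open>a\<close>, and without
    \<open>a\<close> it is tight with the same value of \<open>f\<close>; submodularity carries this
    over to the maximal tight set around it.\<close>
  have "\<exists>S\<in>M ` I. f (insert a S) \<le> f S" if a: "a \<in> A - I" for a
  proof -
    have "\<not> cind (insert a I)" "finite (insert a I)" "insert a I \<subseteq> U"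
      using max[OF a] finI a A I by auto
    then obtain T where T: "T \<subseteq> insert a I" "T \<noteq> {}" "f T < int (card T)"
      unfolding cind_def by (auto simp: not_le)
    have aT: "a \<in> T"
    proof (rule ccontr)
      assume "a \<notin> T"
      then show False using T cind_card[OF I(1), of T] by auto
    qed
    define T0 where "T0 = T - {a}"
    have T0: "T0 \<subseteq> I" "insert a T0 = T" "a \<notin> T0" using T aT by (auto simp: T0_def)
    have finT: "finite T0" using finite_subset[OF T0(1) finI] .
    have cT: "card T = Suc (card T0)" using T0 finT by (metis card_insert_disjoint)
    have ne: "T0 \<noteq> {}" using T single[of a] a T0 by auto
    have TU: "T \<subseteq> U" using T A I a by auto
    have "f T0 \<le> f T" using f_mono[OF _ TU, of T0] T0 finT ne by auto
    moreover have "int (card T0) \<le> f T0" using cind_card[OF I(1)] T0 ne by simp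
    ultimately have t: "tight I T0" "f T \<le> f T0" using T cT ne T0 by (auto simp: tight_def)
    obtain e where e: "e \<in> T0" using ne by auto
    have eI: "e \<in> I" using e T0 by auto
    have sub: "T0 \<subseteq> M e" using M(3)[OF eI t(1) e] .
    have "a \<notin> M e" using MI[OF eI] a by auto
    have eq: "T \<union> M e = insert a (M e)" "T \<inter> M e = T0" using T0 sub \<open>a \<notin> M e\<close> by auto
    have "f (T \<union> M e) + f (T \<inter> M e) \<le> f T + f (M e)"
    proof (rule f_submod)
      show "finite T" using finT T0(2) by auto
      show "finite (M e)" using finite_subset[OF MI[OF eI] finI] .
      show "T \<union> M e \<subseteq> U" using TU MI[OF eI] I(2) A(2) by blast
      show "T \<inter> M e \<noteq> {}" using eq(2) ne by simp
    qed
    then have "f (insert a (M e)) \<le> f (M e)" using t(2) by (simp add: eq)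
    then show ?thesis using eI by auto
  qed
  then obtain \<psi> where \<psi>: "\<And>a. a \<in> A - I \<Longrightarrow> \<psi> a \<in> M ` I" "\<And>a. a \<in> A - I \<Longrightarrow> f (insert a (\<psi> a)) \<le> f (\<psi> a)"
    by metis
  define m where "m x = (if x \<in> I then M x else \<psi> x)" for x
  define Bk where "Bk S = {x \<in> A. m x = S}" for S
  have BI: "Bk S \<inter> I = S" if S: "S \<in> M ` I" for S
  proof -
    obtain e where e: "e \<in> I" "S = M e" using S by auto
    show ?thesis
    proof
      show "Bk S \<inter> I \<subseteq> S" using M(2) by (auto simp: Bk_def m_def)
      show "S \<subseteq> Bk S \<inter> I"
      proof
        fix x assume x: "x \<in> S"
        then have xI: "x \<in> I" using MI e by auto
        then have "M x = S" using M_eq[of x e x] M(2)[OF xI] x e by auto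
        then show "x \<in> Bk S \<inter> I" using xI I(2) by (auto simp: Bk_def m_def)
      qed
    qed
  qed
  have fB: "f (Bk S) = int (card S)" if S: "S \<in> M ` I" for S
  proof -
    obtain e where e: "e \<in> I" "S = M e" using S by auto
    have t: "tight I S" using M(1) e by auto
    then have Sne: "S \<noteq> {}" "finite S" "S \<subseteq> I" using finI finite_subset[of S I] by (auto simp: tight_def)
    define R where "R = Bk S - I"
    have eq: "Bk S = S \<union> R" using BI[OF S] by (auto simp: R_def)
    have "f (S \<union> R) \<le> f S"
    proof (rule f_Un_le)
      show "finite R" "finite S" "S \<noteq> {}" using A Sne by (auto simp: R_def Bk_def)
      show "R \<union> S \<subseteq> U" using A I Sne by (auto simp: R_def Bk_def)
      show "R \<inter> S = {}" using Sne by (auto simp: R_def)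
      show "f (insert a S) \<le> f S" if "a \<in> R" for a
        using \<psi>(2)[of a] that by (auto simp: R_def Bk_def m_def)
    qed
    moreover have "f S \<le> f (S \<union> R)" using A I Sne by (intro f_mono) (auto simp: R_def Bk_def)
    ultimately show ?thesis using t eq by (auto simp: tight_def)
  qed
  show ?thesis
  proof (rule that[of "Bk ` (M ` I)"])
    show "finite (Bk ` (M ` I))" using finI by simp
    show "\<Union> (Bk ` (M ` I)) = A"
    proof
      show "A \<subseteq> \<Union> (Bk ` (M ` I))"
      proof
        fix x assume x: "x \<in> A"
        then have "m x \<in> M ` I" using \<psi>(1)[of x] by (auto simp: m_def)
        moreover have "x \<in> Bk (m x)" using x by (simp add: Bk_def)
        ultimately show "x \<in> \<Union> (Bk ` (M ` I))" by blast
      qed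
    qed (auto simp: Bk_def)
    show "disjoint (Bk ` (M ` I))" by (auto simp: disjoint_def Bk_def)
    show "{} \<notin> Bk ` (M ` I)"
    proof
      assume "{} \<in> Bk ` (M ` I)"
      then obtain e where e: "e \<in> I" "Bk (M e) = {}" by (metis imageE)
      then have "M e = {}" using BI[of "M e"] by auto
      then show False using M(2)[OF e(1)] by simp
    qed
    show "f F = int (card (F \<inter> I))" if "F \<in> Bk ` (M ` I)" for F
      using that fB BI by auto
  qed
qed

lemma sum_block_card:
  assumes "finite P" "\<Union>P = A" "disjoint P" "I \<subseteq> A" "finite I"
  shows "card I = (\<Sum>F\<in>P. card (F \<inter> I))"
proof -
  have "I = (\<Union>F\<in>P. F \<inter> I)" using assms by auto
  then have "card I = card (\<Union>F\<in>P. F \<inter> I)" by simp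
  also have "\<dots> = (\<Sum>F\<in>P. card (F \<inter> I))"
    using assms by (intro card_UN_disjoint) (auto simp: disjoint_def)
  finally show ?thesis .
qed

text \<open>If nothing from \<open>J\<close> can be added to \<open>I\<close>, then \<open>I\<close>
  is maximal in the union and attains, in every block of \<open>rank_partition\<close>, the bound
  that also holds for \<open>J\<close>; so \<open>J\<close> is not larger.\<close>

lemma matroid_cind: "matroid cind"
proof
  show "cind {}" by (simp add: cind_def)
  show "cind I \<Longrightarrow> finite I" for I by (simp add: cind_def)
  show "cind I \<Longrightarrow> J \<subseteq> I \<Longrightarrow> cind J" for I J by (rule cind_mono)
  show "\<exists>e\<in>J - I. cind (insert e I)" if I: "cind I" and J: "cind J" and lt: "card I < card J" for I J
  proof (rule ccontr)
    assume no: "\<not> (\<exists>e\<in>J - I. cind (insert e I))"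
    have fin: "finite (I \<union> J)" "I \<union> J \<subseteq> U" using I J by (auto simp: cind_def)
    have single: "1 \<le> f {a}" if "a \<in> I \<union> J" for a
      using cind_card[OF I, of "{a}"] cind_card[OF J, of "{a}"] that by auto
    have max: "\<not> cind (insert a I)" if "a \<in> I \<union> J - I" for a using no that by auto
    obtain P where P: "finite P" "\<Union>P = I \<union> J" "disjoint P" "{} \<notin> P"
      "\<And>F. F \<in> P \<Longrightarrow> f F = int (card (F \<inter> I))"
      by (rule rank_partition[OF fin I Un_upper1 max single]) auto
    have "card J = (\<Sum>F\<in>P. card (F \<inter> J))"
      using sum_block_card[OF P(1-3), of J] J by (auto simp: cind_def)
    also have "\<dots> \<le> (\<Sum>F\<in>P. card (F \<inter> I))"
    proof (rule sum_mono)
      fix F assume F: "F \<in> P"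
      show "card (F \<inter> J) \<le> card (F \<inter> I)"
      proof (cases "F \<inter> J = {}")
        case False
        have FU: "F \<subseteq> U" "finite F" using F P(2) fin finite_subset[of F "I \<union> J"] by auto
        have "int (card (F \<inter> J)) \<le> f (F \<inter> J)" using cind_card[OF J _ False] by simp
        also have "\<dots> \<le> f F" using f_mono[OF FU(2,1) _ False] by simp
        finally show ?thesis using P(5)[OF F] by simp
      qed simp
    qed
    also have "\<dots> = card I" using sum_block_card[OF P(1-3), of I] I by (auto simp: cind_def)
    finally show False using lt by simp
  qed
qed

end

subsection \<open>The count matroid of a graph with outer vertices\<close>

definition inc :: "'a set \<Rightarrow> 'a set set \<Rightarrow> 'a set set" where
  "inc V E = {e \<in> E. e \<inter> V \<noteq> {}}"

definition nb :: "'a set set \<Rightarrow> 'a set \<Rightarrow> 'a set" where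
  "nb E D = {y. y \<notin> D \<and> (\<exists>x\<in>D. {x, y} \<in> E)}"

text \<open>Vertices outside \<open>V\<close> count only in the first bound, so an edge to a private outer vertex acts as a loop,
  and an edge not meeting \<open>V\<close> is dependent.\<close>

definition ind :: "'a set \<Rightarrow> 'a set set \<Rightarrow> bool" where
  "ind V F \<longleftrightarrow> finite F \<and> (\<forall>e\<in>F. card e = 2) \<and>
     (\<forall>T\<subseteq>F. T \<noteq> {} \<longrightarrow> card T + 3 \<le> 2 * card (\<Union>T) \<and> card T \<le> 2 * card (\<Union>T \<inter> V))"

definition cnt :: "'a set \<Rightarrow> 'a set set \<Rightarrow> int" where
  "cnt V T = min (2 * int (card (\<Union>T)) - 3) (2 * int (card (\<Union>T \<inter> V)))"

lemma finite_Union_pairs: "finite T \<Longrightarrow> (\<And>e. e \<in> T \<Longrightarrow> card e = 2) \<Longrightarrow> finite (\<Union>T)"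
  by (metis card.infinite finite_Union zero_neq_numeral)

text \<open>The critical case of submodularity is the mixed one, with the minimum attained by the
  pure bound for one set and by the ground bound for the other. Then the union is estimated by its
  ground bound and the intersection by its pure bound, since outer vertices common to both sets are
  outer vertices of the first.\<close>

lemma counting_cnt: "counting (cnt V) {e. card e = 2}"
proof
  fix A B :: "'a set set"
  assume B: "finite B" "B \<subseteq> {e. card e = 2}" "A \<subseteq> B"
  have "finite (\<Union>B)" using B by (intro finite_Union_pairs) auto
  then have "card (\<Union>A) \<le> card (\<Union>B)" "card (\<Union>A \<inter> V) \<le> card (\<Union>B \<inter> V)"
    using B(3) by (auto intro!: card_mono)
  then show "cnt V A \<le> cnt V B" by (auto simp: cnt_def)
next
  fix A B :: "'a set set"
  assume fin: "finite A" "finite B" and U: "A \<union> B \<subseteq> {e. card e = 2}"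
  define a b where "a = \<Union>A" and "b = \<Union>B"
  have fab: "finite a" "finite b" unfolding a_def b_def using fin U by (auto intro!: finite_Union_pairs)
  have un: "\<Union>(A \<union> B) = a \<union> b" by (auto simp: a_def b_def)
  have int: "\<Union>(A \<inter> B) \<subseteq> a \<inter> b" by (auto simp: a_def b_def)
  have le: "card (\<Union>(A \<inter> B)) \<le> card (a \<inter> b)" "card (\<Union>(A \<inter> B) \<inter> V) \<le> card (a \<inter> b \<inter> V)"
    using int fab by (auto intro!: card_mono)
  have e1: "card (a \<union> b) + card (a \<inter> b) = card a + card b" using card_Un_Int[OF fab] by simp
  have e2: "card ((a \<union> b) \<inter> V) + card (a \<inter> b \<inter> V) = card (a \<inter> V) + card (b \<inter> V)"
    using card_Un_Int[of "a \<inter> V" "b \<inter> V"] fab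
    by (simp add: Int_Un_distrib2 inf.left_commute inf.assoc)
  have split: "card x = card (x \<inter> V) + card (x - V)" if "finite x" for x
    using card_Int_Diff[OF that] .
  have e3: "card a = card (a \<inter> V) + card (a - V)" "card b = card (b \<inter> V) + card (b - V)"
    "card (a \<inter> b) = card (a \<inter> b \<inter> V) + card (a \<inter> b - V)"
    using split[OF fab(1)] split[OF fab(2)] split[of "a \<inter> b"] fab by blast+
  have e4: "card (a \<inter> b - V) \<le> card (a - V)" "card (a \<inter> b - V) \<le> card (b - V)"
    using fab by (auto intro!: card_mono)
  show "cnt V (A \<union> B) + cnt V (A \<inter> B) \<le> cnt V A + cnt V B"
    unfolding cnt_def un a_def[symmetric] b_def[symmetric] using le e1 e2 e3 e4 by linarith
next
  fix e :: "'a set" assume "e \<in> {e. card e = 2}"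
  then show "cnt V {e} \<le> 1" by (simp add: cnt_def)
qed

lemma ind_cind: "ind V = counting.cind (cnt V) {e. card e = 2}"
proof
  fix F :: "'a set set"
  have "(c + 3 \<le> 2 * u \<and> c \<le> 2 * w) = (int c \<le> min (2 * int u - 3) (2 * int w))" for c u w :: nat
    by linarith
  moreover have "(\<forall>e\<in>F. card e = 2) = (F \<subseteq> {e. card e = 2})" by auto
  ultimately show "ind V F = counting.cind (cnt V) {e. card e = 2} F"
    unfolding ind_def counting.cind_def[OF counting_cnt] cnt_def by simp
qed

interpretation M: matroid "ind V" for V :: "'a set"
  unfolding ind_cind by (rule counting.matroid_cind[OF counting_cnt])

lemma ind_finite_Union: "ind V F \<Longrightarrow> T \<subseteq> F \<Longrightarrow> finite (\<Union>T)"
  unfolding ind_def by (meson finite_Union_pairs finite_subset subsetD)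

lemma ind_pure: "ind V F \<Longrightarrow> T \<subseteq> F \<Longrightarrow> T \<noteq> {} \<Longrightarrow> card T + 3 \<le> 2 * card (\<Union>T)"
  unfolding ind_def by blast

lemma ind_ground: "ind V F \<Longrightarrow> T \<subseteq> F \<Longrightarrow> card T \<le> 2 * card (\<Union>T \<inter> V)"
  unfolding ind_def by (cases "T = {}") auto

lemma ind_meets: "ind V F \<Longrightarrow> e \<in> F \<Longrightarrow> e \<inter> V \<noteq> {}"
  using ind_ground[of V F "{e}"] by auto

lemma ind_single: "card e = 2 \<Longrightarrow> finite V \<Longrightarrow> e \<inter> V \<noteq> {} \<Longrightarrow> ind V {e}"
  unfolding ind_def by (auto simp: subset_singleton_iff Suc_le_eq card_gt_0_iff)

lemma ind_le_card:
  assumes "ind V F" "finite V" "\<Union>F \<inter> V \<subseteq> X" "finite X"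
  shows "card F \<le> 2 * card X"
  using ind_ground[OF assms(1) order_refl] card_mono[OF assms(4,3)] by linarith

lemma inc_subset: "inc V E \<subseteq> E" by (auto simp: inc_def)

lemma inc_mono: "E \<subseteq> E' \<Longrightarrow> inc V E \<subseteq> inc V E'" by (auto simp: inc_def)

lemma finite_inc: "finite E \<Longrightarrow> finite (inc V E)" by (auto simp: inc_def)

text \<open>Full rank, by \<open>rk_le\<close>. The outer vertices are thought of as fixed, so that
  every vertex of \<open>V\<close> has two degrees of freedom to be removed.\<close>

definition rigid :: "'a set \<Rightarrow> 'a set set \<Rightarrow> bool" where
  "rigid V E \<longleftrightarrow> (\<exists>I\<subseteq>E. ind V I \<and> card I = 2 * card V)"

lemma rigid_mono: "rigid V E \<Longrightarrow> E \<subseteq> E' \<Longrightarrow> rigid V E'"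
  unfolding rigid_def by blast

lemma rigid_inc: "rigid V (inc V E) = rigid V E"
proof
  assume "rigid V E"
  then obtain I where I: "I \<subseteq> E" "ind V I" "card I = 2 * card V" unfolding rigid_def by blast
  then have "I \<subseteq> inc V E" using ind_meets by (auto simp: inc_def)
  then show "rigid V (inc V E)" using I unfolding rigid_def by blast
qed (use rigid_mono inc_subset in blast)

lemma rk_le: "finite E \<Longrightarrow> finite V \<Longrightarrow> M.rk V E \<le> 2 * card V"
  using M.basis_exists[of E V] ind_le_card[of V _ V] by (metis Int_lower2)

lemma rigid_rk: "finite E \<Longrightarrow> finite V \<Longrightarrow> rigid V E \<longleftrightarrow> M.rk V E = 2 * card V"
proof
  assume "finite E" "finite V" "rigid V E"
  then show "M.rk V E = 2 * card V"
    unfolding rigid_def using rk_le[of E V] M.ind_card_le_rk[of E _ V] by (metis le_antisym)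
next
  assume "finite E" "finite V" "M.rk V E = 2 * card V"
  then show "rigid V E" unfolding rigid_def using M.basis_exists[of E V] by metis
qed

text \<open>Edges of \<open>J\<close> may end in \<open>X\<close>, but those of \<open>I\<close>
  must stay away from \<open>Y\<close>. Then the edges coming from \<open>J\<close> are charged to
  their vertices in \<open>Y\<close> by the ground bound alone, and the \<open>3\<close> of the pure
  bound is paid for by the edges from \<open>I\<close>.\<close>

lemma ind_compose:
  assumes X: "ind X I" and Y: "ind Y J" and dis: "X \<inter> Y = {}" and IY: "\<Union>I \<inter> Y = {}"
    and fin: "finite X" "finite Y"
  shows "ind (X \<union> Y) (I \<union> J)"
  unfolding ind_def
proof (intro conjI ballI allI impI)
  show "finite (I \<union> J)" using X Y by (simp add: ind_def)
  show "card e = 2" if "e \<in> I \<union> J" for e using that X Y by (auto simp: ind_def)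
  fix T assume T: "T \<subseteq> I \<union> J" "T \<noteq> {}"
  define A B where "A = T \<inter> I" and "B = T - I"
  have AB: "A \<subseteq> I" "B \<subseteq> J" "T = A \<union> B" "A \<inter> B = {}" using T by (auto simp: A_def B_def)
  have finT: "finite A" "finite B" using AB X Y by (auto simp: ind_def intro: finite_subset)
  have fU: "finite (\<Union>A)" "finite (\<Union>B)" using ind_finite_Union[OF X] ind_finite_Union[OF Y] AB by auto
  have cT: "card T = card A + card B" using AB finT by (simp add: card_Un_disjoint)
  have UT: "\<Union>T = \<Union>A \<union> \<Union>B" using AB by auto
  have dAB: "\<Union>A \<inter> (\<Union>B \<inter> Y) = {}" using IY AB by blast
  have gB: "card B \<le> 2 * card (\<Union>B \<inter> Y)" using ind_ground[OF Y AB(2)] .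
  show "card T \<le> 2 * card (\<Union>T \<inter> (X \<union> Y))"
  proof -
    have "card (\<Union>A \<inter> X) + card (\<Union>B \<inter> Y) = card ((\<Union>A \<inter> X) \<union> (\<Union>B \<inter> Y))"
      using dis fU by (intro card_Un_disjoint[symmetric]) auto
    also have "\<dots> \<le> card (\<Union>T \<inter> (X \<union> Y))" using fU UT by (intro card_mono) auto
    finally show ?thesis using gB ind_ground[OF X AB(1)] cT by linarith
  qed
  show "card T + 3 \<le> 2 * card (\<Union>T)"
  proof (cases "A = {}")
    case True
    then show ?thesis using ind_pure[OF Y AB(2)] T cT UT AB by auto
  next
    case False
    have "card (\<Union>A) + card (\<Union>B \<inter> Y) = card (\<Union>A \<union> (\<Union>B \<inter> Y))"
      using dAB fU by (intro card_Un_disjoint[symmetric]) auto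
    also have "\<dots> \<le> card (\<Union>T)" using fU UT by (intro card_mono) auto
    finally show ?thesis using gB ind_pure[OF X AB(1) False] cT by linarith
  qed
qed

lemma ind_compose_card:
  assumes X: "ind X I" and Y: "ind Y J" and IY: "\<Union>I \<inter> Y = {}"
  shows "card (I \<union> J) = card I + card J"
proof -
  have "I \<inter> J = {}" using ind_meets[OF Y] IY by blast
  then show ?thesis using M.ind_finite[OF X] M.ind_finite[OF Y] by (simp add: card_Un_disjoint)
qed

lemma rigid_compose:
  assumes X: "rigid X E1" and Y: "rigid Y E" and dis: "X \<inter> Y = {}" and E1: "E1 \<subseteq> E" "\<Union>E1 \<inter> Y = {}"
    and fin: "finite X" "finite Y"
  shows "rigid (X \<union> Y) E"
proof -
  obtain I where I: "I \<subseteq> E1" "ind X I" "card I = 2 * card X" using X unfolding rigid_def by blast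
  obtain J where J: "J \<subseteq> E" "ind Y J" "card J = 2 * card Y" using Y unfolding rigid_def by blast
  have IY: "\<Union>I \<inter> Y = {}" using I(1) E1(2) by blast
  have "ind (X \<union> Y) (I \<union> J)" by (rule ind_compose[OF I(2) J(2) dis IY fin])
  moreover have "card (I \<union> J) = 2 * card (X \<union> Y)"
    using ind_compose_card[OF I(2) J(2) IY] I J card_Un_disjoint[OF fin dis] by simp
  ultimately show ?thesis unfolding rigid_def using I J E1 by blast
qed

text \<open>Every edge meets \<open>V\<close>, so no single edge has count zero and the partition of
  the general rank formula is available.\<close>

lemma rank_blocks:
  assumes E: "finite E" "\<And>e. e \<in> E \<Longrightarrow> card e = 2" "\<And>e. e \<in> E \<Longrightarrow> e \<inter> V \<noteq> {}" and V: "finite V"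
    and I: "ind V I" "I \<subseteq> E" "card I = M.rk V E"
  obtains P where "finite P" "\<Union>P = E" "disjoint P" "{} \<notin> P"
    "\<And>F. F \<in> P \<Longrightarrow> cnt V F = int (card (F \<inter> I))" "card I = (\<Sum>F\<in>P. card (F \<inter> I))"
proof -
  interpret C: counting "cnt V" "{e. card e = 2}" by (rule counting_cnt)
  have max: "\<not> C.cind (insert a I)" if a: "a \<in> E - I" for a
  proof
    assume "C.cind (insert a I)"
    then have "card (insert a I) \<le> M.rk V E"
      using a I(2) by (intro M.ind_card_le_rk[OF E(1)]) (auto simp: ind_cind)
    then show False using a I(3) M.ind_finite[OF I(1)] by simp
  qed
  have single: "1 \<le> cnt V {a}" if "a \<in> E" for a
  proof -
    have "0 < card (a \<inter> V)" using E(3)[OF that] V by (simp add: card_gt_0_iff)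
    then show ?thesis using E(2)[OF that] by (simp add: cnt_def)
  qed
  have "E \<subseteq> {e. card e = 2}" using E by auto
  then obtain P where P: "finite P" "\<Union>P = E" "disjoint P" "{} \<notin> P"
    "\<And>F. F \<in> P \<Longrightarrow> cnt V F = int (card (F \<inter> I))"
    using C.rank_partition[OF E(1) _ _ I(2) max single] I(1) unfolding ind_cind by metis
  then show ?thesis using that C.sum_block_card[OF P(1-3) I(2)] M.ind_finite[OF I(1)] by blast
qed

text \<open>A partition of the edges at \<open>D\<close> computes their rank, and a deficit there
  would carry over to \<open>V\<close>: the blocks that use the ground bound are merged with all
  vertices outside \<open>D\<close> into one set obeying the ground bound of \<open>V\<close>, and
  the other blocks use the pure bound, which is the same for \<open>D\<close> and
  \<open>V\<close>.\<close>

lemma rigid_contract: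
  assumes r: "rigid V E" and D: "D \<subseteq> V" and V: "finite V" and E: "finite E" "\<And>e. e \<in> E \<Longrightarrow> card e = 2"
  shows "rigid D E"
proof -
  obtain I where I: "I \<subseteq> E" "ind V I" "card I = 2 * card V" using r unfolding rigid_def by blast
  let ?E = "inc D E"
  have fD: "finite D" using D V finite_subset by blast
  have fE: "finite ?E" using E(1) by (rule finite_inc)
  obtain J where J: "J \<subseteq> ?E" "ind D J" "card J = M.rk D ?E" using M.basis_exists[OF fE] .
  obtain P where P: "finite P" "\<Union>P = ?E" "disjoint P" "{} \<notin> P"
    "\<And>F. F \<in> P \<Longrightarrow> cnt D F = int (card (F \<inter> J))" "card J = (\<Sum>F\<in>P. card (F \<inter> J))"
    by (rule rank_blocks[OF fE _ _ fD J(2,1,3)]) (auto simp: inc_def E)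
  \<comment> \<open>\<open>G\<close> collects the blocks with the ground bound, \<open>U\<close>
    their vertices in \<open>D\<close>, and \<open>K\<close> the part of \<open>I\<close> in these
    blocks or away from \<open>D\<close>.\<close>
  define G where "G = {F \<in> P. cnt D F = 2 * int (card (\<Union>F \<inter> D))}"
  define U where "U = (\<Union>F\<in>G. \<Union>F \<inter> D)"
  define K where "K = (I - ?E) \<union> (\<Union>F\<in>G. F \<inter> I)"
  have finP: "finite F" "F \<subseteq> E" "finite (\<Union>F)" if "F \<in> P" for F
    using that P(2) fE finite_subset[of F ?E] inc_subset[of D E] finite_Union_pairs[of F] E(2) by blast+
  have finI: "finite I" using I(2) by (rule M.ind_finite)
  have fU: "finite U" using fD by (auto simp: U_def intro: finite_subset)
  have "\<Union>K \<inter> V \<subseteq> (V - D) \<union> U" using D I(1) by (auto simp: K_def inc_def U_def)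
  then have "card K \<le> 2 * card ((V - D) \<union> U)"
    using ind_le_card[of V K "(V - D) \<union> U"] I(2) M.ind_mono[OF I(2), of K] V fU by (auto simp: K_def)
  moreover have "card ((V - D) \<union> U) \<le> card (V - D) + card U" by (rule card_Un_le)
  moreover have "card U \<le> (\<Sum>F\<in>G. card (\<Union>F \<inter> D))"
    unfolding U_def using P(1) by (intro card_UN_le) (auto simp: G_def)
  moreover have "2 * (\<Sum>F\<in>G. card (\<Union>F \<inter> D)) = (\<Sum>F\<in>G. card (F \<inter> J))"
    using P(5) by (auto simp: G_def sum_distrib_left intro!: sum.cong)
  ultimately have K: "card K \<le> 2 * card (V - D) + (\<Sum>F\<in>G. card (F \<inter> J))" by linarith
  have rest: "card (F \<inter> I) \<le> card (F \<inter> J)" if F: "F \<in> P - G" for F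
  proof (cases "F \<inter> I = {}")
    case False
    have "cnt D F = 2 * int (card (\<Union>F)) - 3" using F by (auto simp: G_def cnt_def min_def split: if_splits)
    moreover have "card (F \<inter> I) + 3 \<le> 2 * card (\<Union>(F \<inter> I))" using ind_pure[OF I(2) _ False] by simp
    moreover have "card (\<Union>(F \<inter> I)) \<le> card (\<Union>F)" using finP[of F] F by (intro card_mono) auto
    ultimately show ?thesis using P(5)[of F] F by simp
  qed simp
  have "I \<subseteq> K \<union> (\<Union>F\<in>P - G. F \<inter> I)" using P(2) by (auto simp: K_def)
  then have "card I \<le> card (K \<union> (\<Union>F\<in>P - G. F \<inter> I))"
    using P(1) finI by (intro card_mono) (auto simp: K_def G_def)
  also have "\<dots> \<le> card K + card (\<Union>F\<in>P - G. F \<inter> I)" by (rule card_Un_le)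
  also have "card (\<Union>F\<in>P - G. F \<inter> I) \<le> (\<Sum>F\<in>P - G. card (F \<inter> I))"
    using P(1) by (intro card_UN_le) auto
  also have "\<dots> \<le> (\<Sum>F\<in>P - G. card (F \<inter> J))" by (intro sum_mono rest)
  finally have "card I \<le> 2 * card (V - D) + ((\<Sum>F\<in>G. card (F \<inter> J)) + (\<Sum>F\<in>P - G. card (F \<inter> J)))"
    using K by linarith
  also have "(\<Sum>F\<in>G. card (F \<inter> J)) + (\<Sum>F\<in>P - G. card (F \<inter> J)) = card J"
    using P(1,6) by (subst add.commute, subst sum.subset_diff[symmetric]) (auto simp: G_def)
  finally have "2 * card V \<le> 2 * card (V - D) + card J" using I by simp
  moreover have "card V = card (V - D) + card D" using D V fD by (metis card_Diff_subset card_mono le_add_diff_inverse2)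
  ultimately have "2 * card D \<le> M.rk D ?E" using J by simp
  then have "M.rk D ?E = 2 * card D" using rk_le[OF fE fD] by simp
  then have "rigid D ?E" using rigid_rk[OF fE fD] by simp
  then show ?thesis by (simp add: rigid_inc)
qed

subsection \<open>Redundant rigidity and one-extensions\<close>

definition graph :: "'a set \<Rightarrow> 'a set set \<Rightarrow> bool" where
  "graph V E \<longleftrightarrow> finite V \<and> finite E \<and> (\<forall>e\<in>E. card e = 2)"

text \<open>\<open>RR\<close> stands for redundantly rigid.\<close>

definition RR :: "'a set \<Rightarrow> 'a set set \<Rightarrow> bool" where
  "RR V E \<longleftrightarrow> rigid V E \<and> (\<forall>g\<in>E. rigid V (E - {g}))"

text \<open>A neighbour of \<open>D\<close> is either the private end of a loop at \<open>D\<close>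
  or a vertex around \<open>D\<close>. Quantifying over all \<open>D\<close>, and not only over the
  components left by two vertices, makes the property pass to subsets of \<open>V\<close>.\<close>

definition bal :: "'a set \<Rightarrow> 'a set set \<Rightarrow> bool" where
  "bal V E \<longleftrightarrow> (\<forall>D\<subseteq>V. D \<noteq> {} \<longrightarrow> 3 \<le> card (nb E D))"

definition solid :: "'a set \<Rightarrow> 'a set set \<Rightarrow> bool" where
  "solid V E \<longleftrightarrow> graph V E \<and> RR V E \<and> bal V E"

lemma graphD: "graph V E \<Longrightarrow> finite V" "graph V E \<Longrightarrow> finite E" "graph V E \<Longrightarrow> e \<in> E \<Longrightarrow> card e = 2"
  by (auto simp: graph_def)

lemma graph_subset: "graph V E \<Longrightarrow> D \<subseteq> V \<Longrightarrow> F \<subseteq> E \<Longrightarrow> graph D F"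
  unfolding graph_def using finite_subset[of D V] finite_subset[of F E] by auto

lemma pair_other:
  assumes "card e = 2" "x \<in> e" "y \<in> e" "x \<noteq> y"
  shows "e = {x, y}"
  using assms by (auto simp: card_2_iff)

lemma nbI: "card e = 2 \<Longrightarrow> e \<in> E \<Longrightarrow> e \<inter> D \<noteq> {} \<Longrightarrow> y \<in> e \<Longrightarrow> y \<notin> D \<Longrightarrow> y \<in> nb E D"
proof -
  assume a: "card e = 2" "e \<in> E" "e \<inter> D \<noteq> {}" "y \<in> e" "y \<notin> D"
  then obtain x where x: "x \<in> e" "x \<in> D" by auto
  then have "e = {x, y}" using a pair_other[of e x y] by auto
  then show "y \<in> nb E D" using x a by (auto simp: nb_def)
qed

lemma nb_iff: "y \<in> nb E D \<longleftrightarrow> y \<notin> D \<and> (\<exists>x\<in>D. {x, y} \<in> E)"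
  by (simp add: nb_def)

lemma nb_mono: "E \<subseteq> E' \<Longrightarrow> nb E D \<subseteq> nb E' D"
  by (auto simp: nb_def)

lemma nb_inc: "D \<subseteq> V \<Longrightarrow> nb (inc V E) D = nb E D"
  by (auto simp: nb_def inc_def)

lemma finite_nb: "graph V E \<Longrightarrow> finite (nb E D)"
proof -
  assume "graph V E"
  then have "finite (\<Union>E)" by (auto simp: graph_def intro: finite_Union_pairs)
  moreover have "nb E D \<subseteq> \<Union>E" by (auto simp: nb_def)
  ultimately show ?thesis by (rule finite_subset[rotated])
qed

lemma edges_subset_nb:
  assumes "\<And>e. e \<in> F \<Longrightarrow> card e = 2 \<and> e \<in> E \<and> e \<inter> D \<noteq> {}"
  shows "\<Union>F \<subseteq> D \<union> nb E D"
proof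
  fix y assume "y \<in> \<Union>F"
  then obtain e where "e \<in> F" "y \<in> e" by auto
  then show "y \<in> D \<union> nb E D" using nbI[of e E D y] assms[of e] by auto
qed

lemma RR_rigid: "RR V E \<Longrightarrow> rigid V E" by (simp add: RR_def)

lemma RR_delete: "RR V E \<Longrightarrow> rigid V (E - {g})"
  by (cases "g \<in> E") (auto simp: RR_def)

lemma RR_mono: "RR V E \<Longrightarrow> E \<subseteq> E' \<Longrightarrow> RR V E'"
  unfolding RR_def[of V E'] using rigid_mono[OF RR_delete] rigid_mono[OF RR_rigid]
  by (meson Diff_mono order_refl)

lemma RR_inc: "RR V (inc V E) = RR V E"
proof
  assume "RR V E"
  then have "rigid V (inc V E - {g})" for g
  proof -
    have "inc V (E - {g}) = inc V E - {g}" by (auto simp: inc_def)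
    then show ?thesis using RR_delete[OF \<open>RR V E\<close>, of g] rigid_inc[of V "E - {g}"] by simp
  qed
  then show "RR V (inc V E)" using \<open>RR V E\<close> by (auto simp: RR_def rigid_inc)
qed (use RR_mono inc_subset in blast)

lemma bal_mono: "bal V E \<Longrightarrow> E \<subseteq> E' \<Longrightarrow> graph V E' \<Longrightarrow> bal V E'"
  unfolding bal_def using card_mono[OF finite_nb[of V E'] nb_mono[of E E']] by (meson le_trans)

lemma solid_mono: "solid V E \<Longrightarrow> E \<subseteq> E' \<Longrightarrow> graph V E' \<Longrightarrow> solid V E'"
  unfolding solid_def using RR_mono bal_mono by blast

lemma solid_inc: "solid V E \<Longrightarrow> solid V (inc V E)"
  unfolding solid_def bal_def using RR_inc[of V E] nb_inc[of _ V E] graph_subset[OF _ order_refl inc_subset[of V E]]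
  by simp

lemma solid_cong: "solid V E \<Longrightarrow> inc V E \<subseteq> E' \<Longrightarrow> graph V E' \<Longrightarrow> solid V E'"
  using solid_inc solid_mono by blast

lemma RR_contract: "graph V E \<Longrightarrow> RR V E \<Longrightarrow> D \<subseteq> V \<Longrightarrow> RR D E"
  unfolding RR_def graph_def using rigid_contract[of V E D] rigid_contract[of V "E - {_}" D] by simp

lemma solid_contract: "solid V E \<Longrightarrow> D \<subseteq> V \<Longrightarrow> solid D E"
  unfolding solid_def bal_def using RR_contract[of V E D] graph_subset[of V E D E] by auto

lemma RR_compose:
  assumes X: "RR X E1" and Y: "RR Y E" and dis: "X \<inter> Y = {}" and E1: "E1 \<subseteq> E" "\<Union>E1 \<inter> Y = {}"
    and fin: "finite X" "finite Y"
  shows "RR (X \<union> Y) E"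
proof -
  have "rigid (X \<union> Y) (E - {g})" for g
    using rigid_compose[OF RR_delete[OF X, of g] RR_delete[OF Y, of g] dis _ _ fin] E1 by blast
  \<comment> \<open>Rigidity of \<open>E\<close> itself comes from deleting an arbitrary element,
    here the empty set.\<close>
  then show ?thesis using rigid_mono[of "X \<union> Y" "E - {{}}" E] unfolding RR_def by blast
qed

lemma rigid_empty: "rigid {} E"
  unfolding rigid_def by (intro exI[of _ "{}"]) (simp add: M.ind_empty)

lemma RR_empty: "RR {} E"
  by (simp add: RR_def rigid_empty)

lemma solid_empty: "graph {} E \<Longrightarrow> solid {} E"
  by (simp add: solid_def bal_def RR_empty)

section \<open>One-extensions preserve solidity\<close>

lemma subset_pair_cases: "T \<subseteq> {p, q} \<Longrightarrow> T \<noteq> {} \<Longrightarrow> T = {p} \<or> T = {q} \<or> T = {p, q}"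
  by auto

lemma rigid_star:
  assumes "{v, a} \<in> E" "{v, b} \<in> E" "a \<noteq> b" "v \<noteq> a" "v \<noteq> b"
  shows "rigid {v} E"
proof -
  let ?I = "{{v, a}, {v, b}}"
  have ne: "{v, a} \<noteq> {v, b}" using assms by (auto simp: doubleton_eq_iff)
  have "ind {v} ?I" unfolding ind_def
  proof (intro conjI ballI allI impI)
    show "finite ?I" by simp
    show "card e = 2" if "e \<in> ?I" for e using that assms by auto
    fix T assume T: "T \<subseteq> ?I" "T \<noteq> {}"
    then consider "T = {{v, a}}" | "T = {{v, b}}" | "T = ?I" using subset_pair_cases by metis
    then have "card T + 3 \<le> 2 * card (\<Union>T) \<and> card T \<le> 2 * card (\<Union>T \<inter> {v})"
      using assms(3-5) ne by cases (simp_all add: card_insert_if)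
    then show "card T + 3 \<le> 2 * card (\<Union>T)" "card T \<le> 2 * card (\<Union>T \<inter> {v})" by simp_all
  qed
  moreover have "card ?I = 2 * card {v}" using ne by simp
  ultimately show ?thesis unfolding rigid_def using assms(1,2) by (intro exI[of _ ?I]) simp
qed

lemma rigid_add_vertex:
  assumes "rigid V E" "v \<notin> V" "finite V" "v \<notin> \<Union>E" "E \<subseteq> E'" "{v, a} \<in> E'" "{v, b} \<in> E'" "a \<noteq> b" "v \<noteq> a" "v \<noteq> b"
  shows "rigid (insert v V) E'"
  using rigid_compose[OF assms(1) rigid_star[of v a E' b], of ] assms by auto

text \<open>If the basis avoids \<open>ab\<close>, two of the new edges suffice. Otherwise
  \<open>ab\<close> is traded for all three, which raises the size by two. A set with all three is
  compared with the old set that contains \<open>ab\<close> instead; one or two of them are paid for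
  by \<open>v\<close> alone.\<close>

lemma one_ext_rigid:
  assumes V: "finite V" and r: "rigid V E" and v: "v \<notin> V" "v \<notin> \<Union>E" and d: "distinct [v, a, b, c]"
    and ab: "{a, b} \<in> E \<or> {a, b} \<inter> V = {}"
  shows "rigid (insert v V) (E - {{a, b}} \<union> {{v, a}, {v, b}, {v, c}})"
proof -
  let ?ab = "{a, b}" and ?S = "{{v, a}, {v, b}, {v, c}}"
  obtain I where I: "I \<subseteq> E" "ind V I" "card I = 2 * card V" using r unfolding rigid_def by blast
  show ?thesis
  proof (cases "?ab \<in> I")
    case False
    have "rigid V (E - {?ab})" using I False unfolding rigid_def by blast
    then show ?thesis using v V d by (intro rigid_add_vertex[of V "E - {?ab}" v _ a b]) auto
  next
    case True
    have abV: "?ab \<inter> V \<noteq> {}" using ind_meets[OF I(2) True] .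
    have finI: "finite I" using I(2) by (rule M.ind_finite)
    have vI: "v \<notin> \<Union>I" using v I by blast
    let ?J = "(I - {?ab}) \<union> ?S"
    have cS: "card ?S = 3" using d by (auto simp: doubleton_eq_iff card_insert_if)
    have dis: "(I - {?ab}) \<inter> ?S = {}" using vI by auto
    have "card ?J = card (I - {?ab}) + 3" using dis finI cS by (subst card_Un_disjoint) auto
    also have "card (I - {?ab}) + 3 = card I + 2"
      using card.remove[OF finI True] by simp
    finally have cJ: "card ?J = 2 * card (insert v V)" using I(3) v V by simp
    have "ind (insert v V) ?J" unfolding ind_def
    proof (intro conjI ballI allI impI)
      show "finite ?J" using finI by simp
      show "card e = 2" if "e \<in> ?J" for e using that d I(2) by (auto simp: ind_def)
      fix T assume T: "T \<subseteq> ?J" "T \<noteq> {}"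
      define A B where "A = T - ?S" and "B = T \<inter> ?S"
      have A0: "A \<subseteq> I - {?ab}" unfolding A_def using T(1) by blast
      have AB0: "T = A \<union> B" "A \<inter> B = {}" "B \<subseteq> ?S" unfolding A_def B_def by blast+
      have AB: "T = A \<union> B" "A \<inter> B = {}" "A \<subseteq> I" "B \<subseteq> ?S" "?ab \<notin> A"
        using A0 AB0 by blast+
      have finA: "finite A" "finite (\<Union>A)"
        using finite_subset[OF AB(3) finI] ind_finite_Union[OF I(2) AB(3)] by blast+
      have finB: "finite B" "finite (\<Union>B)" using AB finite_subset[of B ?S] by auto
      have cT: "card T = card A + card B" using AB finA finB by (simp add: card_Un_disjoint)
      have UT: "\<Union>T = \<Union>A \<union> \<Union>B" using AB by auto
      have vA: "v \<notin> \<Union>A" using vI AB by blast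
      have cB: "card B \<le> 3" using card_mono[of ?S B] AB(4) cS by simp
      have gA: "card A \<le> 2 * card (\<Union>A \<inter> V)" using ind_ground[OF I(2) AB(3)] .
      have "card T + 3 \<le> 2 * card (\<Union>T) \<and> card T \<le> 2 * card (\<Union>T \<inter> insert v V)"
      proof (cases "B = {}")
        case True
        have "card (\<Union>A \<inter> V) \<le> card (\<Union>A \<inter> insert v V)" using finA by (intro card_mono) auto
        then show ?thesis using AB True T ind_pure[OF I(2) AB(3)] gA by auto
      next
        case Bne: False
        have vB: "v \<in> \<Union>B" using Bne AB(4) by blast
        have s1: "card (insert v (\<Union>A)) \<le> card (\<Union>T)" using UT vB finA finB by (intro card_mono) auto
        have s2: "card (insert v (\<Union>A \<inter> V)) \<le> card (\<Union>T \<inter> insert v V)"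
          using UT vB finA finB by (intro card_mono) auto
        have vA': "v \<notin> \<Union>A \<inter> V" using vA by blast
        show ?thesis
        proof (cases "card B \<le> 2")
          case True
          have g: "card T \<le> 2 * card (\<Union>T \<inter> insert v V)" using cT True gA s2 vA' finA by simp
          have "card T + 3 \<le> 2 * card (\<Union>T)"
          proof (cases "A = {}")
            case False
            then show ?thesis using cT True ind_pure[OF I(2) AB(3) False] s1 vA finA by simp
          next
            case True': True
            obtain e where e: "e \<in> B" using Bne by auto
            have ce: "card e = 2" using e AB(4) d by auto
            have c1: "2 \<le> card (\<Union>B)" using card_mono[of "\<Union>B" e] finB e ce by auto
            show ?thesis
            proof (cases "card B \<le> 1")
              case True
              then show ?thesis using c1 cT UT True' by simp
            next
              case False
              then obtain e' where e': "e' \<in> B" "e' \<noteq> e" using e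
                using card_le_Suc0_iff_eq[OF finB(1)] by auto
              obtain p where p: "e = {v, p}" "p \<noteq> v" using e AB(4) d by auto
              obtain q where q: "e' = {v, q}" "q \<noteq> v" using e' AB(4) d by auto
              have "p \<noteq> q" using p q e' by auto
              then have "2 < card (e \<union> e')" using p q by (simp add: card_insert_if)
              moreover have "card (e \<union> e') \<le> card (\<Union>B)" using e e' finB by (intro card_mono) auto
              ultimately show ?thesis using True cT UT True' by simp
            qed
          qed
          with g show ?thesis by simp
        next
          case False
          then have B: "B = ?S" using card_subset_eq[of ?S B] AB(4) cS cB by simp
          have UB: "\<Union>B = {v, a, b, c}" using B by auto
          \<comment> \<open>With \<open>ab\<close> in place of the star, the set has two edges and
            at least the vertex \<open>v\<close> less.\<close>
          have A': "insert ?ab A \<subseteq> I" "insert ?ab A \<noteq> {}" using AB True by auto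
          have cA': "card (insert ?ab A) = card A + 1" using AB finA by simp
          have U': "\<Union>(insert ?ab A) = {a, b} \<union> \<Union>A" by auto
          have "card (insert v ({a, b} \<union> \<Union>A)) \<le> card (\<Union>T)"
            using UT UB finA by (intro card_mono) auto
          moreover have "v \<notin> {a, b} \<union> \<Union>A" using vA d by auto
          ultimately have "card ({a, b} \<union> \<Union>A) + 1 \<le> card (\<Union>T)" using finA by simp
          moreover have "card (insert v (({a, b} \<union> \<Union>A) \<inter> V)) \<le> card (\<Union>T \<inter> insert v V)"
            using UT UB finA by (intro card_mono) auto
          then have "card (({a, b} \<union> \<Union>A) \<inter> V) + 1 \<le> card (\<Union>T \<inter> insert v V)"
            using v(1) finA by simp
          ultimately show ?thesis using ind_pure[OF I(2) A'] ind_ground[OF I(2) A'(1)] cA' U' cT cB by simp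
        qed
      qed
      then show "card T + 3 \<le> 2 * card (\<Union>T)" "card T \<le> 2 * card (\<Union>T \<inter> insert v V)" by auto
    qed
    then show ?thesis unfolding rigid_def using cJ I(1) by (intro exI[of _ ?J]) auto
  qed
qed

text \<open>Deleting an old edge commutes with the extension; after deleting a new one, the other
  two attach \<open>v\<close> to the old graph, which is rigid even without
  \<open>ab\<close>.\<close>

lemma RR_one_ext:
  assumes V: "finite V" and r: "RR V E" and v: "v \<notin> V" "v \<notin> \<Union>E" and d: "distinct [v, a, b, c]"
    and ab: "{a, b} \<in> E \<or> {a, b} \<inter> V = {}"
  shows "RR (insert v V) (E - {{a, b}} \<union> {{v, a}, {v, b}, {v, c}})" (is "RR ?V ?E")
proof -
  have r0: "rigid V (E - {{a, b}})" using RR_delete[OF r] .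
  have ne: "{v, a} \<noteq> {v, b}" "{v, b} \<noteq> {v, c}" "{v, a} \<noteq> {v, c}" using d by (auto simp: doubleton_eq_iff)
  have vE: "{v, x} \<notin> E" for x using v by auto
  have two: "rigid ?V (?E - {g})" if "{v, x} \<noteq> g" "{v, y} \<noteq> g" "x \<in> {a, b, c}" "y \<in> {a, b, c}" "x \<noteq> y" "g \<notin> E" for g x y
    using that d v V by (intro rigid_add_vertex[OF r0, of v _ x y]) auto
  have "rigid ?V (?E - {g})" if g: "g \<in> ?E" for g
  proof (cases "g \<in> E")
    case True
    then have gab: "g \<noteq> {a, b}" using g v by auto
    have "rigid ?V (E - {g} - {{a, b}} \<union> {{v, a}, {v, b}, {v, c}})"
      using ab gab v by (intro one_ext_rigid[OF V RR_delete[OF r] _ _ d]) auto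
    moreover have "E - {g} - {{a, b}} \<union> {{v, a}, {v, b}, {v, c}} \<subseteq> ?E - {g}" using True vE by auto
    ultimately show ?thesis by (rule rigid_mono)
  next
    case False
    then consider "g = {v, a}" | "g = {v, b}" | "g = {v, c}" using g by blast
    then show ?thesis
    proof cases
      case 1 then show ?thesis using two[of b g c] False ne d by auto
    next
      case 2 then show ?thesis using two[of a g c] False ne d by auto
    next
      case 3 then show ?thesis using two[of a g b] False ne d by auto
    qed
  qed
  then show ?thesis using one_ext_rigid[OF V RR_rigid[OF r] v d ab] unfolding RR_def by blast
qed

text \<open>Neighbours that \<open>D\<close> loses with \<open>ab\<close> are replaced: if
  \<open>v\<close> is in \<open>D\<close>, it is joined to both \<open>a\<close> and
  \<open>b\<close>; if not, only one neighbour can be lost, and \<open>v\<close> becomes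
  one.\<close>

lemma bal_one_ext:
  assumes g: "graph V E" and b: "bal V E" and v: "v \<notin> V" "v \<notin> \<Union>E" and d: "distinct [v, a, b, c]"
  shows "bal (insert v V) (E - {{a, b}} \<union> {{v, a}, {v, b}, {v, c}})" (is "bal _ ?E")
  unfolding bal_def
proof (intro allI impI)
  fix D assume D: "D \<subseteq> insert v V" "D \<noteq> {}"
  have g': "graph V ?E" using g d by (auto simp: graph_def)
  note fin = finite_nb[OF g']
  show "3 \<le> card (nb ?E D)"
  proof (cases "v \<in> D")
    case True
    define D0 where "D0 = D - {v}"
    show ?thesis
    proof (cases "D0 = {}")
      case True
      then have "D = {v}" using \<open>v \<in> D\<close> by (auto simp: D0_def)
      then have "{a, b, c} \<subseteq> nb ?E D" using d by (auto simp: nb_def)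
      then have "card {a, b, c} \<le> card (nb ?E D)" using fin by (intro card_mono)
      then show ?thesis using d by simp
    next
      case False
      have "D0 \<subseteq> V" using D by (auto simp: D0_def)
      then have "3 \<le> card (nb E D0)" using b False by (auto simp: bal_def)
      also have "nb E D0 \<subseteq> nb ?E D"
      proof
        fix y assume y: "y \<in> nb E D0"
        then obtain x where x: "x \<in> D0" "{x, y} \<in> E" "y \<notin> D0" by (auto simp: nb_def)
        have "y \<noteq> v" using x v by auto
        then have yD: "y \<notin> D" using x by (auto simp: D0_def)
        show "y \<in> nb ?E D"
        proof (cases "{x, y} = {a, b}")
          case True
          moreover have "y \<in> {x, y}" by simp
          ultimately have "y = a \<or> y = b" by simp
          then have "{v, y} \<in> ?E" by blast
          then show ?thesis unfolding nb_iff using yD \<open>v \<in> D\<close> by blast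
        next
          case False
          then have "{x, y} \<in> ?E" "x \<in> D" using x by (simp_all add: D0_def)
          then show ?thesis unfolding nb_iff using yD by blast
        qed
      qed
      then have "card (nb E D0) \<le> card (nb ?E D)" using fin by (intro card_mono)
      finally show ?thesis .
    qed
  next
    case False
    then have DV: "D \<subseteq> V" using D by auto
    then have 3: "3 \<le> card (nb E D)" using b D by (auto simp: bal_def)
    have vnb: "v \<notin> nb E D" using v by (auto simp: nb_def)
    have key: "y \<in> nb ?E D" if "y \<in> nb E D" "\<not> (\<exists>x\<in>D. {x, y} = {a, b})" for y
    proof -
      obtain x where "x \<in> D" "{x, y} \<in> E" "y \<notin> D" using \<open>y \<in> nb E D\<close> unfolding nb_iff by auto
      moreover from this have "{x, y} \<noteq> {a, b}" using that(2) by auto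
      ultimately show ?thesis unfolding nb_iff by (intro conjI bexI[of _ x]) simp_all
    qed
    show ?thesis
    proof (cases "nb E D \<subseteq> nb ?E D")
      case True
      then show ?thesis using 3 card_mono[OF fin True] by simp
    next
      case False
      then obtain y where y: "y \<in> nb E D" "y \<notin> nb ?E D" by auto
      then obtain x where x: "x \<in> D" "{x, y} = {a, b}" using key by blast
      have "x \<in> {a, b}" using x(2) by (metis insertI1)
      then have "{v, x} \<in> ?E" by blast
      then have "{x, v} \<in> ?E" by (simp add: insert_commute)
      then have "v \<in> nb ?E D" unfolding nb_iff using x(1) \<open>v \<notin> D\<close> by blast
      moreover have "nb E D - {y} \<subseteq> nb ?E D"
      proof
        fix z assume z: "z \<in> nb E D - {y}"
        have "\<not> (\<exists>x'\<in>D. {x', z} = {a, b})"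
        proof
          assume "\<exists>x'\<in>D. {x', z} = {a, b}"
          then obtain x' where "{x', z} = {x, y}" using x(2) by metis
          moreover have "z \<in> {x', z}" by simp
          ultimately have "z = y \<or> z = x" by blast
          then show False using z y(1) x(1) by (auto simp: nb_def)
        qed
        then show "z \<in> nb ?E D" using key z by auto
      qed
      ultimately have "insert v (nb E D - {y}) \<subseteq> nb ?E D" by simp
      then have "card (insert v (nb E D - {y})) \<le> card (nb ?E D)" using fin by (intro card_mono)
      moreover have "card (insert v (nb E D - {y})) = card (nb E D)"
        using vnb card.remove[OF finite_nb[OF g] y(1)] finite_nb[OF g] by simp
      ultimately show ?thesis using 3 by simp
    qed
  qed
qed

lemma solid_one_ext:
  assumes s: "solid V E" and v: "v \<notin> V" "v \<notin> \<Union>E" and d: "distinct [v, a, b, c]"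
    and ab: "{a, b} \<in> E \<or> {a, b} \<inter> V = {}"
  shows "solid (insert v V) (E - {{a, b}} \<union> {{v, a}, {v, b}, {v, c}})"
  using assms RR_one_ext[OF _ _ v d ab] bal_one_ext[OF _ _ v d]
  by (auto simp: solid_def graph_def)

text \<open>First \<open>ab\<close> is added, then the extension is made at it; an edge
  \<open>ab\<close> that was there already is put back by monotonicity.\<close>

lemma solid_vertex_add:
  assumes s: "solid V E" and v: "v \<notin> V" "v \<notin> \<Union>E" and d: "distinct [v, a, b, c]"
  shows "solid (insert v V) (E \<union> {{v, a}, {v, b}, {v, c}})"
proof -
  have s': "solid V (insert {a, b} E)"
    using s d by (intro solid_mono[OF s]) (auto simp: solid_def graph_def)
  have v': "v \<notin> \<Union>(insert {a, b} E)" using v d by auto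
  have "solid (insert v V) (insert {a, b} E - {{a, b}} \<union> {{v, a}, {v, b}, {v, c}})"
    by (rule solid_one_ext[OF s' v(1) v' d]) simp
  moreover have "graph (insert v V) (E \<union> {{v, a}, {v, b}, {v, c}})"
    using s d by (auto simp: solid_def graph_def)
  ultimately show ?thesis by (elim solid_mono) auto
qed

text \<open>A basis of \<open>2 * card D\<close> edges spans at most \<open>D\<close> and its
  neighbours, and the pure bound leaves room for it only if there are at least \<open>3/2\<close>
  neighbours.\<close>

lemma rigid_card_nb:
  assumes "rigid D E" "D \<noteq> {}" "finite D" "finite (nb E D)"
  shows "2 \<le> card (nb E D)"
proof -
  obtain I where I: "I \<subseteq> E" "ind D I" "card I = 2 * card D" using assms(1) unfolding rigid_def by blast
  have cD: "0 < card D" using assms by (simp add: card_gt_0_iff)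
  have "\<Union>I \<subseteq> D \<union> nb E D"
    using I ind_meets[OF I(2)] by (intro edges_subset_nb) (auto simp: ind_def)
  then have "card (\<Union>I) \<le> card (D \<union> nb E D)" using assms by (intro card_mono) auto
  also have "\<dots> \<le> card D + card (nb E D)" by (rule card_Un_le)
  finally have "card (\<Union>I) \<le> card D + card (nb E D)" .
  moreover have "I \<noteq> {}" using I(3) cD by auto
  then have "card I + 3 \<le> 2 * card (\<Union>I)" using ind_pure[OF I(2) order_refl] by blast
  ultimately show ?thesis using I(3) by linarith
qed

text \<open>If \<open>x\<close> were attached by one edge only, deleting that edge would leave a
  rigid \<open>D\<close> with a single neighbour.\<close>

lemma RR_nb_two_edges:
  assumes "RR D E" "D \<noteq> {}" "graph D E" "card (nb E D) \<le> 2" "x \<in> nb E D"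
  shows "\<exists>u\<in>D. \<exists>w\<in>D. u \<noteq> w \<and> {u, x} \<in> E \<and> {w, x} \<in> E"
proof (rule ccontr)
  assume no: "\<not> ?thesis"
  obtain u where u: "u \<in> D" "{u, x} \<in> E" "x \<notin> D" using assms(5) by (auto simp: nb_def)
  have sub: "nb (E - {{u, x}}) D \<subseteq> nb E D - {x}" using no u by (auto simp: nb_def)
  have fin: "finite (nb E D)" using finite_nb[OF assms(3)] .
  have "2 \<le> card (nb (E - {{u, x}}) D)"
    using rigid_card_nb[OF RR_delete[OF assms(1)] assms(2)] finite_subset[OF sub] fin graphD(1)[OF assms(3)]
    by simp
  also have "\<dots> \<le> card (nb E D - {x})" using sub fin by (intro card_mono) auto
  also have "\<dots> < card (nb E D)" using assms(5) fin by (intro psubset_card_mono) auto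
  finally show False using assms(4) by simp
qed

lemma RR_card_nb: "RR D E \<Longrightarrow> D \<noteq> {} \<Longrightarrow> graph D E \<Longrightarrow> 2 \<le> card (nb E D)"
  by (rule rigid_card_nb[OF RR_rigid _ graphD(1) finite_nb])

subsection \<open>Splitting along two vertices\<close>

lemma ind_vertex_cong: "ind V F \<Longrightarrow> \<Union>F \<inter> V = \<Union>F \<inter> W \<Longrightarrow> ind W F"
proof -
  assume i: "ind V F" and eq: "\<Union>F \<inter> V = \<Union>F \<inter> W"
  have "card T + 3 \<le> 2 * card (\<Union>T) \<and> card T \<le> 2 * card (\<Union>T \<inter> W)" if T: "T \<subseteq> F" "T \<noteq> {}" for T
  proof -
    have "\<Union>T \<inter> V = \<Union>T \<inter> W" using eq T(1) by blast
    then show ?thesis using ind_pure[OF i T] ind_ground[OF i T(1)] by simp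
  qed
  then show "ind W F" using i by (simp add: ind_def)
qed

text \<open>Here \<open>2 * card D + 1\<close> is \<open>2 * (card D + 2) - 3\<close>, the pure
  bound on \<open>D\<close> with two more vertices.\<close>

lemma card_pure_le:
  assumes "ind V I" "\<Union>I \<subseteq> D \<union> {x, y}" "finite D"
  shows "card I \<le> 2 * card D + 1"
proof (cases "I = {}")
  case False
  have "card (\<Union>I) \<le> card (D \<union> {x, y})" using assms by (intro card_mono) auto
  also have "\<dots> \<le> card D + card {x, y}" by (rule card_Un_le)
  also have "card {x, y} \<le> 2" by (simp add: card_insert_if)
  finally show ?thesis using ind_pure[OF assms(1) order_refl False] by linarith
qed simp

lemma inc_Union_subset:
  assumes "graph W F"
  shows "\<Union>(inc D F) \<subseteq> D \<union> nb F D"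
  using assms by (intro edges_subset_nb) (auto simp: inc_def graph_def)

text \<open>By the pure bound on \<open>D\<close> and its two neighbours, at most
  \<open>2 * card D + 1\<close> edges of \<open>I\<close> meet \<open>D\<close>. If there are fewer,
  the rest of \<open>I\<close> is already complete outside \<open>D\<close>; otherwise it lacks one
  edge, and \<open>xy\<close> does the job of \<open>D\<close>.\<close>

lemma split_rigid:
  assumes W: "graph W F" and D: "D \<subseteq> W" and nb: "nb F D = {x, y}" "x \<noteq> y"
    and I: "ind W I" "I \<subseteq> F" "card I = 2 * card W"
  shows "rigid (W - D) (insert {x, y} (I - inc D F))"
proof -
  have fW: "finite W" "finite F" using W by (auto simp: graph_def)
  have fD: "finite D" using D fW finite_subset by auto
  define I1 I2 where "I1 = I \<inter> inc D F" and "I2 = I - inc D F"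
  have I12: "I = I1 \<union> I2" "I1 \<inter> I2 = {}" by (auto simp: I1_def I2_def)
  have fin: "finite I" "finite I1" "finite I2" using I fW finite_subset I12 by auto
  have cI: "card I = card I1 + card I2" using I12 fin by (simp add: card_Un_disjoint)
  have ind1: "ind W I1" and ind2: "ind W I2" using M.ind_mono[OF I(1)] I12 by auto
  have U1: "\<Union>I1 \<subseteq> D \<union> {x, y}" using inc_Union_subset[OF W, of D] nb by (auto simp: I1_def)
  have c1: "card I1 \<le> 2 * card D + 1" using card_pure_le[OF ind1 U1 fD] .
  have dI2: "\<Union>I2 \<inter> D = {}" using I(2) by (auto simp: I2_def inc_def)
  have c2: "card I2 \<le> 2 * card (W - D)" using dI2 fW by (intro ind_le_card[OF ind2]) auto
  have ind2': "ind (W - D) I2" using ind2 dI2 by (rule_tac ind_vertex_cong[of W]) auto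
  have cW: "card W = card D + card (W - D)" using D fD fW by (simp add: card_Diff_subset card_mono)
  show ?thesis
  proof (cases "card I2 = 2 * card (W - D)")
    case True
    then show ?thesis unfolding rigid_def using ind2' by (intro exI[of _ I2]) (auto simp: I2_def)
  next
    case False
    then have e1: "card I1 = 2 * card D + 1" and e2: "card I2 + 1 = 2 * card (W - D)"
      using c1 c2 cI I(3) cW by linarith+
    have ne1: "I1 \<noteq> {}" using e1 by auto
    have xyD: "x \<notin> D" "y \<notin> D" using nb by (auto simp: nb_def)
    have meets: "{x, y} \<inter> (W - D) \<noteq> {}"
    proof
      assume "{x, y} \<inter> (W - D) = {}"
      then have "\<Union>I1 \<inter> W \<subseteq> D" using U1 xyD by auto
      then show False using ind_le_card[OF ind1 fW(1) _ fD] e1 by simp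
    qed
    \<comment> \<open>The counts for \<open>T\<close> with \<open>xy\<close> come from those for
      \<open>T\<close> with the edges of \<open>I\<close> at \<open>D\<close>, which number
      \<open>2 * card D + 1\<close> and use no vertices besides \<open>D\<close>, \<open>x\<close>
      and \<open>y\<close>.\<close>
    have key: "card T + 4 \<le> 2 * card (\<Union>T \<union> {x, y}) \<and> card T + 1 \<le> 2 * card ((\<Union>T \<union> {x, y}) \<inter> (W - D))"
      if T: "T \<subseteq> I2" for T
    proof -
      have TI: "T \<union> I1 \<subseteq> I" "T \<union> I1 \<noteq> {}" using T I12 ne1 by auto
      have fT: "finite T" "finite (\<Union>T)" using T fin finite_subset ind_finite_Union[OF ind2] by auto
      have cT: "card (T \<union> I1) = card T + card I1" using T I12 fin fT by (intro card_Un_disjoint) auto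
      have U: "\<Union>(T \<union> I1) \<subseteq> (\<Union>T \<union> {x, y}) \<union> D" using U1 by auto
      have "card (\<Union>(T \<union> I1)) \<le> card ((\<Union>T \<union> {x, y}) \<union> D)" using U fT fD by (intro card_mono) auto
      also have "\<dots> \<le> card (\<Union>T \<union> {x, y}) + card D" by (rule card_Un_le)
      finally have p: "card T + 4 \<le> 2 * card (\<Union>T \<union> {x, y})"
        using ind_pure[OF I(1) TI] cT e1 by linarith
      have "card (\<Union>(T \<union> I1) \<inter> W) \<le> card (((\<Union>T \<union> {x, y}) \<inter> (W - D)) \<union> D)"
        using U fT fD by (intro card_mono) auto
      also have "\<dots> \<le> card ((\<Union>T \<union> {x, y}) \<inter> (W - D)) + card D" by (rule card_Un_le)
      finally show ?thesis using p ind_ground[OF I(1) TI(1)] cT e1 by linarith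
    qed
    have new: "{x, y} \<notin> I2"
    proof
      assume "{x, y} \<in> I2"
      then have "{{x, y}} \<subseteq> I2" by simp
      then show False using key[of "{{x, y}}"] nb(2) by simp
    qed
    have "ind (W - D) (insert {x, y} I2)" unfolding ind_def
    proof (intro conjI ballI allI impI)
      show "finite (insert {x, y} I2)" using fin by simp
      show "card e = 2" if "e \<in> insert {x, y} I2" for e using that nb(2) ind2 by (auto simp: ind_def)
      fix T assume T: "T \<subseteq> insert {x, y} I2" "T \<noteq> {}"
      have "card T + 3 \<le> 2 * card (\<Union>T) \<and> card T \<le> 2 * card (\<Union>T \<inter> (W - D))"
      proof (cases "{x, y} \<in> T")
        case False
        then have "T \<subseteq> I2" using T by auto
        then show ?thesis using ind_pure[OF ind2' _ T(2)] ind_ground[OF ind2'] by blast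
      next
        case True
        define T0 where "T0 = T - {{x, y}}"
        have T0: "T0 \<subseteq> I2" "T = insert {x, y} T0" "{x, y} \<notin> T0" using T True by (auto simp: T0_def)
        have "finite T0" using T0 fin finite_subset by auto
        then have "card T = card T0 + 1" using T0 by simp
        moreover have "\<Union>T = \<Union>T0 \<union> {x, y}" using T0(2) by auto
        ultimately show ?thesis using key[OF T0(1)] by simp
      qed
      then show "card T + 3 \<le> 2 * card (\<Union>T)" "card T \<le> 2 * card (\<Union>T \<inter> (W - D))" by simp_all
    qed
    moreover have "card (insert {x, y} I2) = 2 * card (W - D)" using new fin e2 by simp
    ultimately show ?thesis unfolding rigid_def by (intro exI[of _ "insert {x, y} I2"]) (auto simp: I2_def)
  qed
qed

text \<open>Deleting an edge other than \<open>xy\<close> is covered by \<open>split_rigid\<close>.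
  That \<open>xy\<close> itself may be omitted is where inseparability enters: the edges at
  \<open>D\<close> have rank at most \<open>2 * card D + 1\<close>, and since ranks may not add up
  exactly, the others have rank \<open>2 * card (W - D)\<close>.\<close>

lemma split_RR:
  assumes W: "graph W F" and r: "RR W F" and s: "M.insep W F" and D: "D \<subseteq> W" "D \<noteq> {}"
    and meets: "\<And>e. e \<in> F \<Longrightarrow> e \<inter> W \<noteq> {}" and nb: "nb F D = {x, y}" "x \<noteq> y"
  shows "RR (W - D) (insert {x, y} (F - inc D F))"
proof -
  have fW: "finite W" "finite F" using W by (auto simp: graph_def)
  have fD: "finite D" using D fW finite_subset by auto
  have cW: "card W = card D + card (W - D)" using D fD fW by (simp add: card_Diff_subset card_mono)
  let ?R = "insert {x, y} (F - inc D F)"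
  have del: "rigid (W - D) (?R - {g})" if g: "g \<noteq> {x, y}" for g
  proof -
    obtain I where I: "I \<subseteq> F - {g}" "ind W I" "card I = 2 * card W"
      using RR_delete[OF r, of g] unfolding rigid_def by blast
    have "I \<subseteq> F" using I by auto
    then have "rigid (W - D) (insert {x, y} (I - inc D F))" using split_rigid[OF W D(1) nb I(2) _ I(3)] by simp
    then show ?thesis by (rule rigid_mono) (use I g in auto)
  qed
  have full: "rigid (W - D) (?R - {{x, y}})"
  proof -
    \<comment> \<open>An edge \<open>xy\<close> of \<open>F\<close> is put on the side of
      \<open>D\<close>, whose rank bound it does not affect, so that \<open>T\<close> avoids
      it.\<close>
    define S T where "S = F \<inter> insert {x, y} (inc D F)" and "T = F - insert {x, y} (inc D F)"
    have ST: "S \<union> T = F" "S \<inter> T = {}" by (auto simp: S_def T_def)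
    have fST: "finite S" "finite T" using fW by (auto simp: S_def T_def)
    obtain u where "u \<in> D" "{u, x} \<in> F" using nb by (auto simp: nb_def)
    then have Sne: "S \<noteq> {}" by (auto simp: S_def inc_def)
    have US: "\<Union>S \<subseteq> D \<union> {x, y}" using inc_Union_subset[OF W, of D] nb by (auto simp: S_def)
    obtain B where B: "B \<subseteq> S" "ind W B" "card B = M.rk W S" using M.basis_exists[OF fST(1)] .
    have "\<Union>B \<subseteq> D \<union> {x, y}" using US B by blast
    then have rS: "M.rk W S \<le> 2 * card D + 1" using card_pure_le[OF B(2) _ fD] B(3) by simp
    have rF: "M.rk W F = 2 * card W" using rigid_rk[OF fW(2,1)] RR_rigid[OF r] by simp
    obtain C where C: "C \<subseteq> T" "ind W C" "card C = M.rk W T" using M.basis_exists[OF fST(2)] .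
    have dC: "\<Union>C \<inter> D = {}" using C(1) by (auto simp: T_def inc_def)
    have iC: "ind (W - D) C" using C(2) dC by (rule_tac ind_vertex_cong[of W]) auto
    have "2 * card (W - D) \<le> card C"
    proof (cases "T = {}")
      case True
      then have "S = F" using ST by auto
      \<comment> \<open>Parity: the rank \<open>2 * card W\<close> is even and at most
        \<open>2 * card D + 1\<close>, so nothing is left outside \<open>D\<close>.\<close>
      then have "2 * card (W - D) \<le> 1" using rS rF cW by simp
      then have "card (W - D) = 0" by presburger
      then show ?thesis by simp
    next
      case False
      then have "M.rk W F < M.rk W S + M.rk W T" using s ST Sne unfolding M.insep_def by blast
      then show ?thesis using rS rF cW C(3) by linarith
    qed
    then obtain C' where C': "C' \<subseteq> C" "card C' = 2 * card (W - D)"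
      using obtain_subset_with_card_n by metis
    then have "ind (W - D) C'" using M.ind_mono[OF iC] by blast
    then show ?thesis unfolding rigid_def using C C' by (intro exI[of _ C']) (auto simp: T_def)
  qed
  then have "rigid (W - D) (?R - {g})" for g using del by (cases "g = {x, y}") auto
  then show ?thesis using rigid_mono[OF full] unfolding RR_def by blast
qed

text \<open>Independence in the generic rigidity matroid of the plane, with no vertex fixed. For
  \<open>D\<close> with two neighbours, \<open>2 * card D + 1\<close> pure edges at \<open>D\<close>
  make \<open>D\<close> and its neighbours a rigid body.\<close>

definition pure :: "'a set set \<Rightarrow> bool" where
  "pure F \<longleftrightarrow> finite F \<and> (\<forall>e\<in>F. card e = 2) \<and> (\<forall>T\<subseteq>F. T \<noteq> {} \<longrightarrow> card T + 3 \<le> 2 * card (\<Union>T))"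

lemma ind_imp_pure: "ind V F \<Longrightarrow> pure F"
  by (simp add: ind_def pure_def)

lemma pure_subset: "pure F \<Longrightarrow> F' \<subseteq> F \<Longrightarrow> pure F'"
  unfolding pure_def using finite_subset[of F' F] by auto

text \<open>If vertices of \<open>W\<close> remain outside \<open>D\<close>, inseparability gives
  the edges at \<open>D\<close> a rank beyond \<open>2 * card D\<close>. If none remain, the ground
  bound of \<open>W\<close> forbids this, and \<open>x\<close> and \<open>y\<close> are first
  counted as inner vertices.\<close>

lemma split_braced:
  assumes W: "graph W F" and r: "rigid W F" and s: "M.insep W F" and D: "D \<subseteq> W" "D \<noteq> {}"
    and meets: "\<And>e. e \<in> F \<Longrightarrow> e \<inter> W \<noteq> {}" and nb: "nb F D = {x, y}" "x \<noteq> y"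
  obtains I where "I \<subseteq> inc D F" "pure I" "card I = 2 * card D + 1"
proof -
  have fW: "finite W" "finite F" using W by (auto simp: graph_def)
  have fD: "finite D" using D fW finite_subset by auto
  have cW: "card W = card D + card (W - D)" using D fD fW by (simp add: card_Diff_subset card_mono)
  have rF: "M.rk W F = 2 * card W" using rigid_rk[OF fW(2,1)] r by simp
  have "\<exists>I\<subseteq>inc D F. pure I \<and> 2 * card D + 1 \<le> card I"
  proof (cases "D = W")
    case False
    define T where "T = F - inc D F"
    have fS: "finite (inc D F)" "finite T" using fW finite_inc by (auto simp: T_def)
    have ST: "inc D F \<union> T = F" "inc D F \<inter> T = {}" using inc_subset[of D F] by (auto simp: T_def)
    obtain B where B: "B \<subseteq> inc D F" "ind W B" "card B = M.rk W (inc D F)" using M.basis_exists[OF fS(1)] .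
    obtain C where C: "C \<subseteq> T" "ind W C" "card C = M.rk W T" using M.basis_exists[OF fS(2)] .
    have "\<Union>C \<inter> W \<subseteq> W - D" using C(1) by (auto simp: T_def inc_def)
    then have rT: "M.rk W T \<le> 2 * card (W - D)" using ind_le_card[OF C(2) fW(1)] C(3) fW by simp
    obtain u where "u \<in> D" "{u, x} \<in> F" using nb by (auto simp: nb_def)
    then have Sne: "inc D F \<noteq> {}" by (auto simp: inc_def)
    have "2 * card D + 1 \<le> M.rk W (inc D F)"
    proof (cases "T = {}")
      case True
      have "0 < card (W - D)" using False D fW by (auto simp: card_gt_0_iff)
      then show ?thesis using True ST rF cW by simp
    next
      case False
      then have "M.rk W F < M.rk W (inc D F) + M.rk W T" using s ST Sne unfolding M.insep_def by blast
      then show ?thesis using rT rF cW by linarith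
    qed
    then show ?thesis using B ind_imp_pure by metis
  next
    case True
    define V where "V = W \<union> {x, y}"
    have FD: "inc D F = F" using meets True by (auto simp: inc_def)
    have UF: "\<Union>F \<subseteq> V" using inc_Union_subset[OF W, of D] nb FD True by (auto simp: V_def)
    have fV: "finite V" using fW by (simp add: V_def)
    obtain J where J: "J \<subseteq> F" "ind V J" "card J = M.rk V F" using M.basis_exists[OF fW(2)] .
    have ne: "0 < card W" using D True fW by (auto simp: card_gt_0_iff)
    have lift: "ind V B" if "ind W B" for B unfolding ind_def
    proof (intro conjI ballI allI impI)
      fix T assume T: "T \<subseteq> B" "T \<noteq> {}"
      show "card T + 3 \<le> 2 * card (\<Union>T)" using ind_pure[OF that T] .
      have "card (\<Union>T \<inter> W) \<le> card (\<Union>T \<inter> V)"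
        using ind_finite_Union[OF that T(1)] by (intro card_mono) (auto simp: V_def)
      then show "card T \<le> 2 * card (\<Union>T \<inter> V)" using ind_ground[OF that T(1)] by linarith
    qed (use that in \<open>auto simp: ind_def\<close>)
    have "2 * card W + 1 \<le> card J"
    proof (rule ccontr)
      assume neg: "\<not> 2 * card W + 1 \<le> card J"
      obtain B where B: "B \<subseteq> F" "ind W B" "card B = 2 * card W" using r unfolding rigid_def by blast
      have "card B \<le> M.rk V F" using M.ind_card_le_rk[OF fW(2) B(1) lift[OF B(2)]] .
      then have cJ: "card J = 2 * card W" using B neg J by simp
      have eV: "e \<inter> V \<noteq> {}" if "e \<in> F" for e using meets[OF that] by (auto simp: V_def)
      obtain P where P: "finite P" "\<Union>P = F" "disjoint P" "{} \<notin> P"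
        "\<And>Q. Q \<in> P \<Longrightarrow> cnt V Q = int (card (Q \<inter> J))" "card J = (\<Sum>Q\<in>P. card (Q \<inter> J))"
        by (rule rank_blocks[OF fW(2) _ eV fV J(2,1,3)]) (use W in \<open>auto simp: graph_def\<close>)
      have cQ: "cnt V Q = 2 * int (card (\<Union>Q)) - 3" if "Q \<in> P" for Q
      proof -
        have "\<Union>Q \<inter> V = \<Union>Q" using UF P(2) that by blast
        then show ?thesis by (simp add: cnt_def)
      qed
      have le: "card (Q \<inter> C) \<le> card (Q \<inter> J)" if "Q \<in> P" "ind V C" for Q C
      proof (cases "Q \<inter> C = {}")
        case False
        have "finite (\<Union>Q)" using UF P(2) that(1) fV by (meson Union_mono Sup_upper finite_subset)
        then have "card (\<Union>(Q \<inter> C)) \<le> card (\<Union>Q)" by (intro card_mono) auto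
        then show ?thesis using ind_pure[OF that(2) _ False] cQ[OF that(1)] P(5)[OF that(1)] by simp
      qed simp
      have "F \<noteq> {}" using B ne by auto
      then obtain Q where Q: "Q \<in> P" using P(2) by auto
      \<comment> \<open>In \<open>V\<close> every block counts by the pure bound, which is odd; so a
        single block cannot have \<open>2 * card W\<close> basis edges, and several blocks would
        separate the matroid of \<open>W\<close>.\<close>
      show False
      proof (cases "P = {Q}")
        case True
        then have "int (card J) = 2 * int (card (\<Union>Q)) - 3" using P(5,6) cQ by simp
        then show False using cJ by presburger
      next
        case False
        define T where "T = \<Union>(P - {Q})"
        have QT: "Q \<union> T = F" "Q \<inter> T = {}" using Q P(2,3) by (auto simp: T_def disjoint_def)
        obtain R where R: "R \<in> P" "R \<noteq> Q" using False Q by auto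
        then have "R \<noteq> {}" using P(4) by auto
        then have "T \<noteq> {}" using R by (auto simp: T_def)
        moreover have "Q \<noteq> {}" using Q P(4) by auto
        ultimately have lt: "M.rk W F < M.rk W Q + M.rk W T" using s QT unfolding M.insep_def by blast
        have fQT: "finite Q" "finite T" using QT fW by auto
        obtain B1 where B1: "B1 \<subseteq> Q" "ind W B1" "card B1 = M.rk W Q" using M.basis_exists[OF fQT(1)] .
        obtain B2 where B2: "B2 \<subseteq> T" "ind W B2" "card B2 = M.rk W T" using M.basis_exists[OF fQT(2)] .
        have "Q \<inter> B1 = B1" using B1 by auto
        then have l1: "card B1 \<le> card (Q \<inter> J)" using le[OF Q lift[OF B1(2)]] by simp
        have dis: "disjoint (P - {Q})" using P(3) by (auto simp: disjoint_def)
        have "card B2 = (\<Sum>R\<in>P - {Q}. card (R \<inter> B2))"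
          using counting.sum_block_card[OF counting_cnt, of "P - {Q}" T B2] P(1) dis B2
            M.ind_finite[OF B2(2)] by (simp add: T_def)
        also have "\<dots> \<le> (\<Sum>R\<in>P - {Q}. card (R \<inter> J))" by (intro sum_mono le lift B2(2)) auto
        finally have "card B1 + card B2 \<le> card (Q \<inter> J) + (\<Sum>R\<in>P - {Q}. card (R \<inter> J))" using l1 by simp
        also have "\<dots> = card J" using P(1,6) Q by (simp add: sum.remove)
        finally show False using lt B1 B2 cJ rF by simp
      qed
    qed
    then show ?thesis using J ind_imp_pure FD True by metis
  qed
  then obtain I where I: "I \<subseteq> inc D F" "pure I" "2 * card D + 1 \<le> card I" by blast
  then obtain I' where "I' \<subseteq> I" "card I' = 2 * card D + 1" using obtain_subset_with_card_n by metis
  then show ?thesis using that I pure_subset by (meson subset_trans)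
qed

text \<open>A double count. A vertex of \<open>V\<close> is counted once for every block it lies in
  and once more if it lies in only one, hence at least twice. Redundancy and the third neighbour
  make every block pay for its share, so a total of \<open>2 * card V\<close> leaves no slack
  anywhere, and then a block with an outer vertex shares no vertex of \<open>V\<close> with another
  block.\<close>

lemma block_count:
  assumes s: "solid V E" and V: "V \<noteq> {}"
    and P: "finite P" "\<Union>P = inc V E" "disjoint P" "{} \<notin> P"
    and le: "(\<Sum>Q\<in>P. cnt V Q) \<le> 2 * int (card V)"
  obtains Q where "Q \<in> P" "\<Union>Q \<inter> V \<noteq> {}" "\<And>e. e \<in> E \<Longrightarrow> e \<inter> (\<Union>Q \<inter> V) \<noteq> {} \<Longrightarrow> e \<in> Q"
proof -
  interpret C: counting "cnt V" "{e. card e = 2}" by (rule counting_cnt)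
  have g: "graph V E" and r: "RR V E" and b: "bal V E" using s by (auto simp: solid_def)
  have fV: "finite V" and fE: "finite E" and c2: "\<And>e. e \<in> E \<Longrightarrow> card e = 2" using g by (auto simp: graph_def)
  have fF: "finite (inc V E)" using fE by (rule finite_inc)
  have QE: "Q \<subseteq> E" "finite Q" "Q \<subseteq> {e. card e = 2}" "finite (\<Union>Q)" if "Q \<in> P" for Q
  proof -
    show "Q \<subseteq> E" using that P(2) inc_subset[of V E] by auto
    then show "finite Q" using fE finite_subset by auto
    then show "Q \<subseteq> {e. card e = 2}" "finite (\<Union>Q)" using \<open>Q \<subseteq> E\<close> c2 finite_Union_pairs[of Q] by auto
  qed
  have QV: "e \<inter> V \<noteq> {}" if "Q \<in> P" "e \<in> Q" for Q e using that P(2) by (auto simp: inc_def)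
  have single: "1 \<le> cnt V {e}" if "e \<in> E" "e \<inter> V \<noteq> {}" for e
  proof -
    have "0 < card (e \<inter> V)" using that fV by (simp add: card_gt_0_iff)
    then show ?thesis using c2[OF that(1)] by (simp add: cnt_def)
  qed
  have pos: "1 \<le> cnt V Q" if Q: "Q \<in> P" for Q
  proof -
    have "Q \<noteq> {}" using Q P(4) by metis
    then obtain e where e: "e \<in> Q" by auto
    have "cnt V {e} \<le> cnt V Q" using C.f_mono[OF QE(2,3)[OF Q], of "{e}"] e by auto
    then show ?thesis using single[of e] QE(1)[OF Q] QV[OF Q e] e by auto
  qed
  have indle: "int (card (Q \<inter> B)) \<le> cnt V Q" if Q: "Q \<in> P" and B: "ind V B" for Q B
  proof (cases "Q \<inter> B = {}")
    case True
    then show ?thesis using pos[OF Q] by simp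
  next
    case False
    have "int (card (Q \<inter> B)) \<le> cnt V (Q \<inter> B)" using C.cind_card[of B "Q \<inter> B"] B False by (simp add: ind_cind)
    also have "\<dots> \<le> cnt V Q" using C.f_mono[OF QE(2,3)[OF Q] _ False] by simp
    finally show ?thesis .
  qed
  have two: "2 \<le> card Q" if Q: "Q \<in> P" for Q
  proof (rule ccontr)
    assume "\<not> 2 \<le> card Q"
    moreover have "0 < card Q" using Q P(4) QE(2)[OF Q] unfolding card_gt_0_iff by metis
    ultimately have "card Q = 1" by simp
    then obtain h where h: "Q = {h}" using card_1_singletonE by blast
    obtain B where B: "B \<subseteq> E - {h}" "ind V B" "card B = 2 * card V"
      using RR_delete[OF r, of h] unfolding rigid_def by blast
    have BF: "B \<subseteq> inc V E" using B ind_meets[OF B(2)] by (auto simp: inc_def)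
    have "int (card B) = (\<Sum>R\<in>P. int (card (R \<inter> B)))"
      using C.sum_block_card[OF P(1-3) BF] M.ind_finite[OF B(2)] by simp
    also have "\<dots> = int (card (Q \<inter> B)) + (\<Sum>R\<in>P - {Q}. int (card (R \<inter> B)))"
      using P(1) Q by (simp add: sum.remove)
    also have "Q \<inter> B = {}" using B(1) h by auto
    also have "(\<Sum>R\<in>P - {Q}. int (card (R \<inter> B))) \<le> (\<Sum>R\<in>P - {Q}. cnt V R)"
      using indle[OF _ B(2)] by (intro sum_mono) auto
    also have "(\<Sum>R\<in>P - {Q}. cnt V R) = (\<Sum>R\<in>P. cnt V R) - cnt V Q"
      using P(1) Q by (simp add: sum.remove)
    finally show False using le pos[OF Q] B(3) by simp
  qed
  have three: "3 \<le> card (\<Union>Q)" if Q: "Q \<in> P" for Q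
  proof -
    obtain e e' where e: "e \<in> Q" "e' \<in> Q" "e \<noteq> e'"
      using two[OF Q] card_le_Suc0_iff_eq[OF QE(2)[OF Q]] by auto
    have ce: "card e = 2" "card e' = 2" using e QE(3)[OF Q] by auto
    show ?thesis
    proof (rule ccontr)
      assume "\<not> 3 \<le> card (\<Union>Q)"
      then have "card (\<Union>Q) \<le> 2" by simp
      moreover have "e \<subseteq> \<Union>Q" "e' \<subseteq> \<Union>Q" using e by auto
      ultimately have "e = \<Union>Q" "e' = \<Union>Q"
        using ce card_seteq[OF QE(4)[OF Q]] by auto
      then show False using e by simp
    qed
  qed
  \<comment> \<open>\<open>X Q\<close> are the vertices private to the block, \<open>Y Q\<close> the
    shared ones and \<open>L Q\<close> the outer ones. All neighbours of \<open>X Q\<close> lie in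
    \<open>Y Q\<close> and \<open>L Q\<close>.\<close>
  define X where "X Q = {v \<in> \<Union>Q \<inter> V. \<forall>R\<in>P. v \<in> \<Union>R \<longrightarrow> R = Q}" for Q
  define Y where "Y Q = \<Union>Q \<inter> V - X Q" for Q
  define L where "L Q = \<Union>Q - V" for Q
  have XV: "X Q \<subseteq> V" for Q by (auto simp: X_def)
  have Xuniq: "R = Q" if "x \<in> X Q" "x \<in> e" "e \<in> R" "R \<in> P" for x e Q R
    using that unfolding X_def by blast
  have finXYL: "finite (X Q)" "finite (Y Q)" "finite (L Q)" if "Q \<in> P" for Q
  proof -
    have "X Q \<subseteq> \<Union>Q" by (auto simp: X_def)
    then show "finite (X Q)" "finite (Y Q)" "finite (L Q)"
      using QE(4)[OF that] finite_subset by (auto simp: Y_def L_def)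
  qed
  have cV: "card (\<Union>Q \<inter> V) = card (X Q) + card (Y Q)" if "Q \<in> P" for Q
  proof -
    have "\<Union>Q \<inter> V = X Q \<union> Y Q" "X Q \<inter> Y Q = {}" by (auto simp: X_def Y_def)
    then show ?thesis using finXYL[OF that] by (simp add: card_Un_disjoint)
  qed
  have cU: "card (\<Union>Q) = card (X Q) + card (Y Q) + card (L Q)" if "Q \<in> P" for Q
    using card_Int_Diff[OF QE(4)[OF that], of V] cV[OF that] by (simp add: L_def)
  have YL: "3 \<le> card (Y Q) + card (L Q)" if Q: "Q \<in> P" for Q
  proof (cases "X Q = {}")
    case True
    then show ?thesis using three[OF Q] cU[OF Q] by simp
  next
    case False
    have "nb E (X Q) \<subseteq> Y Q \<union> L Q"
    proof
      fix y assume "y \<in> nb E (X Q)"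
      then obtain x where x: "x \<in> X Q" "{x, y} \<in> E" "y \<notin> X Q" by (auto simp: nb_def)
      have "{x, y} \<in> inc V E" using x XV by (auto simp: inc_def)
      then obtain R where R: "R \<in> P" "{x, y} \<in> R" using P(2) by auto
      then have "R = Q" using Xuniq[OF x(1)] by blast
      then show "y \<in> Y Q \<union> L Q" using R x by (auto simp: Y_def L_def)
    qed
    then have "card (nb E (X Q)) \<le> card (Y Q \<union> L Q)" using finXYL[OF Q] by (intro card_mono) auto
    also have "\<dots> \<le> card (Y Q) + card (L Q)" by (rule card_Un_le)
    finally show ?thesis using b[unfolded bal_def, rule_format, OF XV False] by linarith
  qed
  \<comment> \<open>This slack is the minimum of \<open>card (Y Q) + 2 * card (L Q) - 3\<close> and
    \<open>card (Y Q)\<close>. As \<open>Y Q\<close> and \<open>L Q\<close> have at least three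
    elements together, the first term is at least \<open>card (L Q)\<close>.\<close>
  define sl where "sl Q = cnt V Q - (int (card (\<Union>Q \<inter> V)) + int (card (X Q)))" for Q
  have sl: "0 \<le> sl Q" "L Q \<noteq> {} \<Longrightarrow> sl Q = 0 \<Longrightarrow> Y Q = {}" if Q: "Q \<in> P" for Q
  proof -
    have "cnt V Q = min (2 * int (card (X Q) + card (Y Q) + card (L Q)) - 3) (2 * int (card (X Q) + card (Y Q)))"
      by (simp add: cnt_def cU[OF Q] cV[OF Q])
    then have eq: "sl Q = min (int (card (Y Q)) + 2 * int (card (L Q)) - 3) (int (card (Y Q)))"
      by (simp add: sl_def cV[OF Q] min_def)
    then show "0 \<le> sl Q" using YL[OF Q] by linarith
    assume "L Q \<noteq> {}" "sl Q = 0"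
    then have "0 < card (L Q)" using finXYL[OF Q] by (simp add: card_gt_0_iff)
    then have "card (Y Q) = 0" using eq \<open>sl Q = 0\<close> YL[OF Q] by linarith
    then show "Y Q = {}" using finXYL[OF Q] by simp
  qed
  have cover: "\<exists>Q\<in>P. v \<in> \<Union>Q" if v: "v \<in> V" for v
  proof -
    have "3 \<le> card (nb E {v})" using b v unfolding bal_def by blast
    then have "nb E {v} \<noteq> {}" by auto
    then obtain y where "{v, y} \<in> E" by (auto simp: nb_def)
    then have "{v, y} \<in> \<Union>P" using v P(2) by (auto simp: inc_def)
    then obtain Q where "Q \<in> P" "{v, y} \<in> Q" by (rule UnionE)
    then show ?thesis by blast
  qed
  have "2 * int (card V) = (\<Sum>v\<in>V. 2)" by simp
  also have "\<dots> \<le> (\<Sum>v\<in>V. \<Sum>Q\<in>P. of_bool (v \<in> \<Union>Q) + of_bool (v \<in> X Q))"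
  proof (rule sum_mono)
    fix v assume v: "v \<in> V"
    obtain Q where Q: "Q \<in> P" "v \<in> \<Union>Q" using cover[OF v] by blast
    have nn: "(0::int) \<le> of_bool (v \<in> \<Union>R) + of_bool (v \<in> X R)" for R by simp
    show "(2::int) \<le> (\<Sum>Q\<in>P. of_bool (v \<in> \<Union>Q) + of_bool (v \<in> X Q))"
    proof (cases "v \<in> X Q")
      case True
      have "(\<Sum>Q\<in>{Q}. of_bool (v \<in> \<Union>Q) + of_bool (v \<in> X Q)) \<le> (\<Sum>Q\<in>P. (of_bool (v \<in> \<Union>Q) + of_bool (v \<in> X Q))::int)"
        using Q P(1) by (intro sum_mono2) auto
      then show ?thesis using True Q by simp
    next
      case False
      then obtain R where R: "R \<in> P" "v \<in> \<Union>R" "R \<noteq> Q" using Q v by (auto simp: X_def)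
      have "(\<Sum>Q\<in>{Q, R}. of_bool (v \<in> \<Union>Q) + of_bool (v \<in> X Q)) \<le> (\<Sum>Q\<in>P. (of_bool (v \<in> \<Union>Q) + of_bool (v \<in> X Q))::int)"
        using Q R P(1) by (intro sum_mono2) auto
      moreover have "(\<Sum>Q\<in>{Q, R}. of_bool (v \<in> \<Union>Q) + of_bool (v \<in> X Q)) =
          (of_bool (v \<in> \<Union>Q) + of_bool (v \<in> X Q)) + (of_bool (v \<in> \<Union>R) + (of_bool (v \<in> X R)::int))"
        using R(3) by simp
      moreover have "(of_bool (v \<in> \<Union>Q) :: int) = 1" "(of_bool (v \<in> \<Union>R) :: int) = 1" using Q R by auto
      moreover have "(0::int) \<le> of_bool (v \<in> X Q)" "(0::int) \<le> of_bool (v \<in> X R)" by simp_all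
      ultimately show ?thesis by linarith
    qed
  qed
  also have "\<dots> = (\<Sum>Q\<in>P. \<Sum>v\<in>V. of_bool (v \<in> \<Union>Q) + of_bool (v \<in> X Q))" by (rule sum.swap)
  also have "\<dots> = (\<Sum>Q\<in>P. int (card (\<Union>Q \<inter> V)) + int (card (X Q)))"
  proof (rule sum.cong[OF refl])
    fix Q assume "Q \<in> P"
    have "V \<inter> {v. v \<in> \<Union>Q} = \<Union>Q \<inter> V" "V \<inter> {v. v \<in> X Q} = X Q" using XV[of Q] by auto
    then show "(\<Sum>v\<in>V. of_bool (v \<in> \<Union>Q) + of_bool (v \<in> X Q)) = int (card (\<Union>Q \<inter> V)) + int (card (X Q))"
      using fV by (simp add: sum.distrib of_bool_def sum.If_cases)
  qed
  finally have "(\<Sum>Q\<in>P. sl Q) \<le> 0" using le by (simp add: sl_def sum_subtractf)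
  moreover have "0 \<le> (\<Sum>Q\<in>P. sl Q)" by (intro sum_nonneg sl(1))
  ultimately have "(\<Sum>Q\<in>P. sl Q) = 0" by linarith
  then have zero: "sl Q = 0" if "Q \<in> P" for Q
    using sum_nonneg_eq_0_iff[OF P(1), of sl] sl(1) that by auto
  have "3 \<le> card (nb E V)" using b V unfolding bal_def by blast
  then have "nb E V \<noteq> {}" by auto
  then obtain x y where xy: "x \<in> V" "y \<notin> V" "{x, y} \<in> E" by (auto simp: nb_def)
  then have "{x, y} \<in> inc V E" by (auto simp: inc_def)
  then obtain Q where Q: "Q \<in> P" "{x, y} \<in> Q" using P(2) by auto
  then have "L Q \<noteq> {}" using xy by (auto simp: L_def)
  then have "Y Q = {}" using sl(2)[OF Q(1)] zero[OF Q(1)] by simp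
  then have XQ: "\<Union>Q \<inter> V = X Q" by (auto simp: Y_def X_def)
  show ?thesis
  proof (rule that[OF Q(1)])
    show "\<Union>Q \<inter> V \<noteq> {}" using Q(2) xy by auto
    fix e assume e: "e \<in> E" "e \<inter> (\<Union>Q \<inter> V) \<noteq> {}"
    then obtain v where v: "v \<in> e" "v \<in> X Q" using XQ by auto
    then have "e \<in> inc V E" using e XV by (auto simp: inc_def)
    then obtain R where R: "R \<in> P" "e \<in> R" using P(2) by auto
    then have "R = Q" using Xuniq[OF v(2,1)] by blast
    then show "e \<in> Q" using R by simp
  qed
qed

text \<open>A separation of the matroid, refined into rank blocks on both sides, is a partition of
  total count at most \<open>2 * card V\<close>, so \<open>block_count\<close> finds vertices whose
  edges stay in one block. They are not all of \<open>V\<close>, because that block lies on one side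
  of the separation.\<close>

lemma solid_insep_or_closed:
  assumes s: "solid V E" and V: "V \<noteq> {}"
  obtains (insep) "M.insep V (inc V E)"
  | (closed) W where "W \<subset> V" "W \<noteq> {}" "\<And>e. e \<in> E \<Longrightarrow> e \<inter> W \<noteq> {} \<Longrightarrow> e \<inter> (V - W) = {}"
proof (cases "M.insep V (inc V E)")
  case True
  then show ?thesis using insep by simp
next
  case False
  have g: "graph V E" and r: "RR V E" using s by (auto simp: solid_def)
  have fV: "finite V" and fE: "finite E" and c2: "\<And>e. e \<in> E \<Longrightarrow> card e = 2" using g by (auto simp: graph_def)
  have fF: "finite (inc V E)" using fE by (rule finite_inc)
  obtain S T where ST: "S \<union> T = inc V E" "S \<inter> T = {}" "S \<noteq> {}" "T \<noteq> {}"
    "M.rk V S + M.rk V T \<le> M.rk V (inc V E)" using False unfolding M.insep_def by (auto simp: not_less)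
  have fST: "finite S" "finite T" using ST fF by (metis finite_Un)+
  have cm: "card e = 2 \<and> e \<inter> V \<noteq> {}" if "e \<in> S \<union> T" for e
    using that c2 ST(1) by (auto simp: inc_def)
  obtain I where I: "I \<subseteq> S" "ind V I" "card I = M.rk V S" using M.basis_exists[OF fST(1)] .
  obtain J where J: "J \<subseteq> T" "ind V J" "card J = M.rk V T" using M.basis_exists[OF fST(2)] .
  obtain P where P: "finite P" "\<Union>P = S" "disjoint P" "{} \<notin> P"
    "\<And>Q. Q \<in> P \<Longrightarrow> cnt V Q = int (card (Q \<inter> I))" "card I = (\<Sum>Q\<in>P. card (Q \<inter> I))"
    by (rule rank_blocks[OF fST(1) _ _ fV I(2,1,3)]) (use cm in auto)
  obtain R where R: "finite R" "\<Union>R = T" "disjoint R" "{} \<notin> R"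
    "\<And>Q. Q \<in> R \<Longrightarrow> cnt V Q = int (card (Q \<inter> J))" "card J = (\<Sum>Q\<in>R. card (Q \<inter> J))"
    by (rule rank_blocks[OF fST(2) _ _ fV J(2,1,3)]) (use cm in auto)
  have cross: "p \<inter> q = {}" if "p \<in> P" "q \<in> R" for p q using that P(2) R(2) ST(2) by blast
  have PR: "P \<inter> R = {}"
  proof (rule ccontr)
    assume "P \<inter> R \<noteq> {}"
    then obtain q where "q \<in> P" "q \<in> R" by auto
    then show False using cross[of q q] P(4) by auto
  qed
  have "(\<Sum>Q\<in>P \<union> R. cnt V Q) = (\<Sum>Q\<in>P. cnt V Q) + (\<Sum>Q\<in>R. cnt V Q)"
    using P(1) R(1) PR by (intro sum.union_disjoint)
  also have "\<dots> = int (card I) + int (card J)" using P(5,6) R(5,6) by simp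
  also have "\<dots> \<le> int (M.rk V (inc V E))" using ST(5) I(3) J(3) by simp
  also have "\<dots> \<le> 2 * int (card V)" using rk_le[OF fF fV] by simp
  finally have le: "(\<Sum>Q\<in>P \<union> R. cnt V Q) \<le> 2 * int (card V)" .
  have un: "\<Union>(P \<union> R) = inc V E" using P(2) R(2) ST(1) by auto
  have dis: "disjoint (P \<union> R)" using P(2,3) R(2,3) ST(2) by (intro disjoint_union) auto
  obtain Q where Q: "Q \<in> P \<union> R" "\<Union>Q \<inter> V \<noteq> {}"
    "\<And>e. e \<in> E \<Longrightarrow> e \<inter> (\<Union>Q \<inter> V) \<noteq> {} \<Longrightarrow> e \<in> Q"
    by (rule block_count[OF s V _ un dis _ le]) (use P(1,4) R(1,4) in auto)
  have "\<Union>Q \<inter> V \<noteq> V"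
  proof
    assume eq: "\<Union>Q \<inter> V = V"
    have "inc V E \<subseteq> Q" using Q(3) eq by (auto simp: inc_def)
    then have "S \<subseteq> Q" "T \<subseteq> Q" using ST(1) by auto
    then show False using Q(1) cross P(2) R(2) ST by blast
  qed
  then show ?thesis using Q by (intro closed[of "\<Union>Q \<inter> V"]) auto
qed

subsection \<open>Reducible vertices of a circuit\<close>

text \<open>Meant for a circuit that violates only the ground bound, and only with all of its edges:
  proper subsets of \<open>V\<close> obey this bound, and the pure bound holds without
  exception.\<close>

locale tight_graph =
  fixes V :: "'a set" and E :: "'a set set"
  assumes graph: "graph V E"
    and meets: "e \<in> E \<Longrightarrow> e \<inter> V \<noteq> {}"
    and card_E: "card E = 2 * card V + 1"
    and ground_le: "X \<subset> V \<Longrightarrow> card {e \<in> E. e \<inter> V \<subseteq> X} \<le> 2 * card X"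
    and pure_le: "finite P \<Longrightarrow> 2 \<le> card P \<Longrightarrow> card {e \<in> E. e \<subseteq> P} + 3 \<le> 2 * card P"
    and bal: "bal V E"
    and card_V: "2 \<le> card V"
begin

text \<open>\<open>gt\<close> and \<open>pt\<close> are the tight sets of the two counts. A star at \<open>v\<close> with ends \<open>a\<close>, \<open>b\<close>, \<open>c\<close> cannot be
  replaced by the edge \<open>ab\<close> iff \<open>gcert v a b\<close> or \<open>pcert v a b\<close>. The complements of the certificates
  of a bad vertex \<open>v\<close> are its sides, which are linked to \<open>v\<close> by one edge each.\<close>

definition ie :: "'a set \<Rightarrow> 'a set set" where "ie X = {e \<in> E. e \<inter> V \<subseteq> X}"
definition ip :: "'a set \<Rightarrow> 'a set set" where "ip P = {e \<in> E. e \<subseteq> P}"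
definition touch :: "'a set \<Rightarrow> 'a set set" where "touch A = {e \<in> E. e \<inter> A \<noteq> {}}"
definition gt :: "'a set \<Rightarrow> bool" where "gt X \<longleftrightarrow> X \<subseteq> V \<and> card (ie X) = 2 * card X"
definition pt :: "'a set \<Rightarrow> bool" where "pt P \<longleftrightarrow> finite P \<and> 2 \<le> card P \<and> card (ip P) + 3 = 2 * card P"
definition node :: "'a \<Rightarrow> bool" where "node v \<longleftrightarrow> v \<in> V \<and> card {e \<in> E. v \<in> e} = 3"
definition star :: "'a \<Rightarrow> 'a \<Rightarrow> 'a \<Rightarrow> 'a \<Rightarrow> bool" where
  "star v a b c \<longleftrightarrow> v \<in> V \<and> distinct [v, a, b, c] \<and> {e \<in> E. v \<in> e} = {{v, a}, {v, b}, {v, c}}"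
definition side :: "'a \<Rightarrow> 'a \<Rightarrow> 'a set \<Rightarrow> bool" where
  "side v a A \<longleftrightarrow> A \<subseteq> V - {v} \<and> a \<in> A \<and> {v, a} \<in> E \<and> gt (V - {v} - A) \<and> (\<forall>x\<in>A. {v, x} \<in> E \<longrightarrow> x = a)"
definition gcert :: "'a \<Rightarrow> 'a \<Rightarrow> 'a \<Rightarrow> bool" where
  "gcert v a b \<longleftrightarrow> (\<exists>X. gt X \<and> X \<subset> V - {v} \<and> {a, b} \<inter> V \<subseteq> X)"
definition pcert :: "'a \<Rightarrow> 'a \<Rightarrow> 'a \<Rightarrow> bool" where
  "pcert v a b \<longleftrightarrow> (\<exists>P. pt P \<and> v \<notin> P \<and> a \<in> P \<and> b \<in> P)"

lemma fin: "finite V" "finite E" and card2: "e \<in> E \<Longrightarrow> card e = 2" and finite_edge: "e \<in> E \<Longrightarrow> finite e"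
  using graph by (auto simp: graph_def) (metis card.infinite zero_neq_numeral)

lemma finite_sets [simp]: "finite (ie X)" "finite (ip P)" "finite (touch A)" "finite {e \<in> E. v \<in> e}"
  using fin by (auto simp: ie_def ip_def touch_def)

lemma ie_le: "X \<subset> V \<Longrightarrow> card (ie X) \<le> 2 * card X"
  using ground_le by (simp add: ie_def)

lemma ip_le: "finite P \<Longrightarrow> 2 \<le> card P \<Longrightarrow> card (ip P) + 3 \<le> 2 * card P"
  using pure_le by (simp add: ip_def)

lemma gtD: "gt X \<Longrightarrow> X \<subseteq> V" "gt X \<Longrightarrow> card (ie X) = 2 * card X" "gt X \<Longrightarrow> finite X"
  using fin finite_subset by (auto simp: gt_def)

lemma edge_pair: "e \<in> E \<Longrightarrow> v \<in> e \<Longrightarrow> \<exists>x. x \<noteq> v \<and> e = {v, x}"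
proof -
  assume e: "e \<in> E" "v \<in> e"
  then obtain x where "x \<in> e" "x \<noteq> v" using card2[OF e(1)] by (auto simp: card_2_iff)
  then show ?thesis using pair_other[OF card2[OF e(1)] e(2), of x] by auto
qed

text \<open>Equality in the count gives more than tightness: every edge of the union already belongs
  to one of the two sets. This is what later confines edges to certificates.\<close>

lemma gt_Un:
  assumes X: "gt X" and Y: "gt Y" and ne: "X \<union> Y \<noteq> V"
  shows "gt (X \<union> Y)" "ie (X \<union> Y) = ie X \<union> ie Y"
proof -
  note dX = gtD[OF X] and dY = gtD[OF Y]
  have sub: "X \<union> Y \<subset> V" "X \<inter> Y \<subset> V" using dX dY ne by auto
  have int: "ie X \<inter> ie Y = ie (X \<inter> Y)" by (auto simp: ie_def)
  have c: "card X + card Y = card (X \<union> Y) + card (X \<inter> Y)" using card_Un_Int dX dY by blast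
  have "card (ie X) + card (ie Y) = card (ie X \<union> ie Y) + card (ie (X \<inter> Y))"
    using card_Un_Int[of "ie X" "ie Y"] by (simp add: int)
  then have ge: "2 * card (X \<union> Y) \<le> card (ie X \<union> ie Y)" using dX dY c ie_le[OF sub(2)] by linarith
  have s: "ie X \<union> ie Y \<subseteq> ie (X \<union> Y)" by (auto simp: ie_def)
  then have le: "card (ie X \<union> ie Y) \<le> card (ie (X \<union> Y))" by (intro card_mono) simp_all
  have "card (ie (X \<union> Y)) \<le> 2 * card (X \<union> Y)" using ie_le[OF sub(1)] .
  then show "gt (X \<union> Y)" using ge le sub by (auto simp: gt_def)
  show "ie (X \<union> Y) = ie X \<union> ie Y"
    using card_subset_eq[OF _ s] ge le ie_le[OF sub(1)] by simp
qed

lemma pt_Un_Int: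
  assumes P: "pt P" and Q: "pt Q" and two: "2 \<le> card (P \<inter> Q)"
  shows "pt (P \<union> Q)" "pt (P \<inter> Q)"
proof -
  have f: "finite P" "finite Q" using P Q by (auto simp: pt_def)
  have int: "ip P \<inter> ip Q = ip (P \<inter> Q)" by (auto simp: ip_def)
  have c: "card P + card Q = card (P \<union> Q) + card (P \<inter> Q)" using card_Un_Int f by blast
  have c2: "card (ip P) + card (ip Q) = card (ip P \<union> ip Q) + card (ip (P \<inter> Q))"
    using card_Un_Int[of "ip P" "ip Q"] by (simp add: int)
  have "ip P \<union> ip Q \<subseteq> ip (P \<union> Q)" by (auto simp: ip_def)
  then have le: "card (ip P \<union> ip Q) \<le> card (ip (P \<union> Q))" by (intro card_mono) simp_all
  have "card (P \<inter> Q) \<le> card (P \<union> Q)" using f by (intro card_mono) auto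
  then have u: "2 \<le> card (P \<union> Q)" using two by simp
  have "card (ip (P \<union> Q)) + 3 \<le> 2 * card (P \<union> Q)" "card (ip (P \<inter> Q)) + 3 \<le> 2 * card (P \<inter> Q)"
    using ip_le u two f by auto
  then have "card (ip (P \<union> Q)) + 3 = 2 * card (P \<union> Q)" "card (ip (P \<inter> Q)) + 3 = 2 * card (P \<inter> Q)"
    using P Q c c2 le unfolding pt_def by linarith+
  then show "pt (P \<union> Q)" "pt (P \<inter> Q)" using f u two by (auto simp: pt_def)
qed

text \<open>Uncrossing a ground set with a pure set, as in the submodularity of \<open>cnt\<close>:
  the union is taken within \<open>V\<close> for the ground bound, and the intersection keeps the
  outer vertices of \<open>P\<close> for the pure bound.\<close>

lemma mixed_card:
  assumes X: "X \<subseteq> V" and P: "finite P"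
  shows "card X + card P = card (X \<union> (P \<inter> V)) + card (P - (V - X))"
    "card (ie X) + card (ip P) = card (ie X \<union> ip P) + card (ip (P - (V - X)))"
proof -
  have fX: "finite X" using X fin finite_subset by auto
  have "card P = card (P - (V - X)) + card (P \<inter> (V - X))" using card_Int_Diff[OF P, of "V - X"] by simp
  moreover have "X \<union> (P \<inter> V) = X \<union> (P \<inter> (V - X))" by auto
  moreover have "card (X \<union> (P \<inter> (V - X))) = card X + card (P \<inter> (V - X))"
    using fX P by (intro card_Un_disjoint) auto
  ultimately show "card X + card P = card (X \<union> (P \<inter> V)) + card (P - (V - X))" by simp
  have "ie X \<inter> ip P = ip (P - (V - X))" by (auto simp: ie_def ip_def)
  then show "card (ie X) + card (ip P) = card (ie X \<union> ip P) + card (ip (P - (V - X)))"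
    using card_Un_Int[of "ie X" "ip P"] by simp
qed

lemma gt_pt:
  assumes X: "gt X" and P: "pt P" and two: "2 \<le> card (P - (V - X))" and ne: "X \<union> (P \<inter> V) \<noteq> V"
  shows "gt (X \<union> (P \<inter> V))" "pt (P - (V - X))" "ie (X \<union> (P \<inter> V)) = ie X \<union> ip P"
proof -
  note dX = gtD[OF X]
  have f: "finite P" using P by (auto simp: pt_def)
  have sub: "X \<union> (P \<inter> V) \<subset> V" using dX ne by auto
  note c = mixed_card[OF dX(1) f]
  have s: "ie X \<union> ip P \<subseteq> ie (X \<union> (P \<inter> V))" by (auto simp: ie_def ip_def)
  then have le: "card (ie X \<union> ip P) \<le> card (ie (X \<union> (P \<inter> V)))" by (intro card_mono) simp_all
  have le2: "card (ie (X \<union> (P \<inter> V))) \<le> 2 * card (X \<union> (P \<inter> V))" using ie_le[OF sub] .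
  have le3: "card (ip (P - (V - X))) + 3 \<le> 2 * card (P - (V - X))" using ip_le two f by simp
  have eq: "card (ie X) = 2 * card X" "card (ip P) + 3 = 2 * card P" using dX P by (auto simp: pt_def)
  show "gt (X \<union> (P \<inter> V))" using c le le2 le3 eq sub by (auto simp: gt_def)
  show "pt (P - (V - X))" using c le le2 le3 eq two f by (auto simp: pt_def)
  show "ie (X \<union> (P \<inter> V)) = ie X \<union> ip P"
    using card_subset_eq[OF _ s] c le le2 le3 eq by simp
qed

lemma starD:
  assumes "star v a b c"
  shows "v \<in> V" "distinct [v, a, b, c]" "{v, a} \<in> E" "{v, b} \<in> E" "{v, c} \<in> E"
    "{e \<in> E. v \<in> e} = {{v, a}, {v, b}, {v, c}}"
  using assms unfolding star_def by blast+

lemma star_other: "star v a b c \<Longrightarrow> {v, x} \<in> E \<Longrightarrow> x = a \<or> x = b \<or> x = c"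
proof -
  assume s: "star v a b c" "{v, x} \<in> E"
  then have "{v, x} \<in> {e \<in> E. v \<in> e}" by simp
  then have "{v, x} \<in> {{v, a}, {v, b}, {v, c}}" unfolding starD(6)[OF s(1)] .
  moreover have "x \<noteq> v" using card2[OF s(2)] by auto
  ultimately show ?thesis by (auto simp: doubleton_eq_iff)
qed

lemma star_rot: "star v a b c \<Longrightarrow> star v b c a"
  unfolding star_def by (auto simp: insert_commute)

lemma star_swap: "star v a b c \<Longrightarrow> star v b a c"
  unfolding star_def by (auto simp: insert_commute)

lemma star_node: "star v a b c \<Longrightarrow> node v"
proof -
  assume s: "star v a b c"
  have "card {{v, a}, {v, b}, {v, c}} = 3"
    using starD(2)[OF s] by (auto simp: doubleton_eq_iff card_insert_if)
  then show ?thesis using starD(1,6)[OF s] by (simp add: node_def)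
qed

lemma node_star: "node v \<Longrightarrow> \<exists>a b c. star v a b c"
proof -
  assume n: "node v"
  then obtain x y z where xyz: "{e \<in> E. v \<in> e} = {x, y, z}" "x \<noteq> y" "y \<noteq> z" "x \<noteq> z"
    by (auto simp: node_def card_3_iff)
  have "x \<in> E \<and> v \<in> x" "y \<in> E \<and> v \<in> y" "z \<in> E \<and> v \<in> z" using xyz(1) by blast+
  then obtain a b c where abc: "x = {v, a}" "y = {v, b}" "z = {v, c}" "a \<noteq> v" "b \<noteq> v" "c \<noteq> v"
    using edge_pair by metis
  have "distinct [v, a, b, c]" using abc xyz(2-4) by auto
  then have "star v a b c" unfolding star_def using n xyz(1) abc by (simp add: node_def)
  then show "\<exists>a b c. star v a b c" by blast
qed

lemma star_with_two:
  assumes "node v" "{v, a} \<in> E" "{v, b} \<in> E" "a \<noteq> b"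
  shows "\<exists>c. star v a b c"
proof -
  obtain x y z where s: "star v x y z" using node_star[OF assms(1)] by blast
  note ss = s star_rot[OF s] star_rot[OF star_rot[OF s]]
  note ss' = ss ss[THEN star_swap]
  show ?thesis using star_other[OF s assms(2)] star_other[OF s assms(3)] assms(4) ss' by blast
qed

text \<open>Adding \<open>v\<close> would bring three edges where the bound grows by two
  only.\<close>

lemma ip_insert_star:
  assumes s: "star v a b c" and P: "pt P" "v \<notin> P" "a \<in> P" "b \<in> P" "c \<in> P"
  shows False
proof -
  have f: "finite P" using P by (simp add: pt_def)
  have sub: "ip P \<union> {{v, a}, {v, b}, {v, c}} \<subseteq> ip (insert v P)"
    using starD(3,4,5)[OF s] P by (auto simp: ip_def)
  have nv: "v \<notin> e" if "e \<in> ip P" for e using that P(2) by (auto simp: ip_def)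
  have "ip P \<inter> {{v, a}, {v, b}, {v, c}} = {}" using nv by blast
  then have "card (ip P \<union> {{v, a}, {v, b}, {v, c}}) = card (ip P) + card {{v, a}, {v, b}, {v, c}}"
    by (intro card_Un_disjoint) simp_all
  also have "card {{v, a}, {v, b}, {v, c}} = 3"
    using star_node[OF s] starD(6)[OF s] by (simp add: node_def)
  finally have "card (ip P) + 3 \<le> card (ip (insert v P))" using card_mono[OF _ sub] by simp
  moreover have "card (ip (insert v P)) + 3 \<le> 2 * card (insert v P)" using f P by (intro ip_le) (auto simp: pt_def)
  ultimately show False using P f by (simp add: pt_def)
qed

text \<open>Again \<open>v\<close> brings one edge too many, unless the enlarged set is
  \<open>V\<close>, where the bound is exceeded by one.\<close>

lemma ie_insert_star:
  assumes s: "star v a b c" and X: "gt X" "v \<notin> X" "{a, b, c} \<inter> V \<subseteq> X"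
  shows "X = V - {v}"
proof (rule ccontr)
  assume "X \<noteq> V - {v}"
  then have sub: "insert v X \<subset> V" using gtD[OF X(1)] starD(1)[OF s] X(2) by auto
  have sub2: "ie X \<union> {{v, a}, {v, b}, {v, c}} \<subseteq> ie (insert v X)"
    using starD(1,3,4,5)[OF s] X(3) by (auto simp: ie_def)
  have nv: "v \<notin> e" if "e \<in> ie X" for e using that X(2) starD(1)[OF s] by (auto simp: ie_def)
  have "ie X \<inter> {{v, a}, {v, b}, {v, c}} = {}" using nv by blast
  then have "card (ie X \<union> {{v, a}, {v, b}, {v, c}}) = card (ie X) + card {{v, a}, {v, b}, {v, c}}"
    by (intro card_Un_disjoint) simp_all
  also have "card {{v, a}, {v, b}, {v, c}} = 3"
    using star_node[OF s] starD(6)[OF s] by (simp add: node_def)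
  finally have "card (ie X) + 3 \<le> card (ie (insert v X))" using card_mono[OF _ sub2] by simp
  then show False using ie_le[OF sub] gtD[OF X(1)] X(2) by simp
qed

lemma gcert_side:
  assumes s: "star v a b c" and g: "gcert v b c"
  obtains A where "side v a A"
proof -
  obtain X where X: "gt X" "X \<subset> V - {v}" "{b, c} \<inter> V \<subseteq> X" using g unfolding gcert_def by blast
  have "a \<in> V - X"
  proof (rule ccontr)
    assume "a \<notin> V - X"
    then have "{a, b, c} \<inter> V \<subseteq> X" using X by auto
    then show False using ie_insert_star[OF s X(1)] X(2) by auto
  qed
  moreover have "V - {v} - (V - {v} - X) = X" using X by auto
  moreover have "a \<noteq> v" using starD(2)[OF s] by auto
  moreover have "x = a" if "x \<in> V - {v} - X" "{v, x} \<in> E" for x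
    using star_other[OF s that(2)] that(1) X(3) by auto
  ultimately have "side v a (V - {v} - X)"
    using X(1) starD(3)[OF s] by (auto simp: side_def)
  then show ?thesis using that by blast
qed

lemma nb_ge: "D \<subseteq> V \<Longrightarrow> D \<noteq> {} \<Longrightarrow> 3 \<le> card (nb E D)"
  using bal by (simp add: bal_def)

lemma card_le_2: "X \<subseteq> {a, b} \<Longrightarrow> card X \<le> 2"
  using card_mono[of "{a, b}" X] by (auto simp: card_insert_if split: if_splits)

lemma degree_ge:
  assumes v: "v \<in> V"
  shows "3 \<le> card {e \<in> E. v \<in> e}"
proof -
  have "nb E {v} \<subseteq> (\<lambda>e. the_elem (e - {v})) ` {e \<in> E. v \<in> e}"
  proof
    fix y assume "y \<in> nb E {v}"
    then have y: "{v, y} \<in> E" "y \<noteq> v" by (auto simp: nb_def)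
    then have "{v, y} - {v} = {y}" by auto
    then show "y \<in> (\<lambda>e. the_elem (e - {v})) ` {e \<in> E. v \<in> e}" using y by (force intro: image_eqI[of _ _ "{v, y}"])
  qed
  then have "card (nb E {v}) \<le> card {e \<in> E. v \<in> e}" by (rule surj_card_le[rotated]) simp
  then show ?thesis using nb_ge[of "{v}"] v by auto
qed

lemma single_inter:
  assumes "finite S" "\<not> 2 \<le> card S" "x \<in> S" "y \<in> S"
  shows "x = y"
  using assms card_le_Suc0_iff_eq[of S] by (auto simp: not_le)

lemma single_eq: "finite S \<Longrightarrow> \<not> 2 \<le> card S \<Longrightarrow> x \<in> S \<Longrightarrow> S = {x}"
proof -
  assume a: "finite S" "\<not> 2 \<le> card S" "x \<in> S"
  have "y = x" if "y \<in> S" for y by (rule single_inter[OF a(1,2) that a(3)])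
  then show "S = {x}" using a(3) by blast
qed

lemma ie_delete: "v \<in> V \<Longrightarrow> e \<in> E \<Longrightarrow> v \<notin> e \<Longrightarrow> e \<in> ie (V - {v})"
  by (auto simp: ie_def)

text \<open>Uncrossing the ground certificate with one or both pure ones yields all of
  \<open>V\<close> except \<open>v\<close>, with every edge off \<open>v\<close> inside one of the
  sets used. Then either some edge at \<open>b\<close> has no place, or the complement of the ground
  certificate has only the neighbours \<open>a\<close> and \<open>c\<close>, against
  balance.\<close>

lemma no_two_pcert:
  assumes s: "star v a b c" and g: "gcert v c a" and p: "pcert v a b" "pcert v b c"
  shows False
proof -
  obtain X where X: "gt X" "X \<subset> V - {v}" "{c, a} \<inter> V \<subseteq> X" using g unfolding gcert_def by blast
  obtain P where P: "pt P" "v \<notin> P" "a \<in> P" "b \<in> P" using p(1) unfolding pcert_def by blast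
  obtain Q where Q: "pt Q" "v \<notin> Q" "b \<in> Q" "c \<in> Q" using p(2) unfolding pcert_def by blast
  note d = starD[OF s]
  have fP: "finite P" "finite Q" using P Q by (auto simp: pt_def)
  have cP: "c \<notin> P" using ip_insert_star[OF s P] by blast
  have aQ: "a \<notin> Q" using ip_insert_star[OF s Q(1,2) _ Q(3,4)] by blast
  have PQ: "P \<inter> Q = {b}"
  proof -
    have "\<not> 2 \<le> card (P \<inter> Q)"
    proof
      assume "2 \<le> card (P \<inter> Q)"
      then have "pt (P \<union> Q)" using pt_Un_Int[OF P(1) Q(1)] by blast
      then show False using ip_insert_star[OF s] P Q by blast
    qed
    then show ?thesis by (rule single_eq[rotated]) (use fP P Q in auto)
  qed
  have bX: "b \<in> V - X"
  proof (rule ccontr)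
    assume "b \<notin> V - X"
    then have "{a, b, c} \<inter> V \<subseteq> X" using X by auto
    then show False using ie_insert_star[OF s X(1)] X(2) by auto
  qed
  have full: "X \<union> (S \<inter> V) = V - {v}" "ie (V - {v}) = ie X \<union> ip S"
    if S: "pt S" "v \<notin> S" "{a, b, c} \<inter> V \<subseteq> X \<union> S" "2 \<le> card (S - (V - X))" for S
  proof -
    have ne: "X \<union> (S \<inter> V) \<noteq> V" using d(1) X S by auto
    note g = gt_pt[OF X(1) S(1,4) ne]
    show "X \<union> (S \<inter> V) = V - {v}" using ie_insert_star[OF s g(1)] X S by auto
    then show "ie (V - {v}) = ie X \<union> ip S" using g(3) by simp
  qed
  have aX: "a \<in> P - (V - X)" and cX: "c \<in> Q - (V - X)" using P Q X by auto
  have bdeg: "\<exists>e\<in>E. b \<in> e \<and> v \<notin> e"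
  proof (rule ccontr)
    assume "\<not> (\<exists>e\<in>E. b \<in> e \<and> v \<notin> e)"
    then have all: "v \<in> e" if "e \<in> E" "b \<in> e" for e using that by auto
    have "e = {v, b}" if "e \<in> E" "b \<in> e" for e
      using pair_other[OF card2[OF that(1)] all[OF that] that(2)] d(2) by auto
    then have "{e \<in> E. b \<in> e} \<subseteq> {{v, b}}" by auto
    then have "card {e \<in> E. b \<in> e} \<le> card {{v, b}}" by (intro card_mono) auto
    then show False using degree_ge[of b] bX by simp
  qed
  then obtain e where e: "e \<in> E" "b \<in> e" "v \<notin> e" by blast
  have eV: "e \<in> ie (V - {v})" using ie_delete d(1) e by blast
  have eX: "e \<notin> ie X" using e bX by (auto simp: ie_def)
  show False
  proof (cases "2 \<le> card (P - (V - X))")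
    case P2: True
    note fu = full[OF P(1,2) _ P2]
    have abc: "{a, b, c} \<inter> V \<subseteq> X \<union> P" using X P by auto
    have eP: "e \<subseteq> P" using fu(2)[OF abc] eV eX by (auto simp: ip_def)
    show False
    proof (cases "2 \<le> card (Q - (V - X))")
      case True
      have "{a, b, c} \<inter> V \<subseteq> X \<union> Q" using X Q by auto
      then have "e \<subseteq> Q" using full(2)[OF Q(1,2) _ True] eV eX by (auto simp: ip_def)
      then have "e \<subseteq> {b}" using eP PQ by auto
      then show False using card2[OF e(1)] card_mono[of "{b}" e] by simp
    next
      case False
      have "Q - (V - X) = {c}" by (rule single_eq[OF _ False cX]) (use fP in simp)
      moreover have "Q \<inter> (V - X) \<subseteq> P" using fu(1)[OF abc] Q by auto
      ultimately have Qbc: "Q = {b, c}" using PQ Q by auto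
      have "ip Q \<noteq> {}" using Q(1) d(2) by (auto simp: pt_def Qbc)
      then obtain h where h: "h \<in> E" "h \<subseteq> {b, c}" by (auto simp: ip_def Qbc)
      then have hbc: "h = {b, c}" using card2[OF h(1)] card_subset_eq[of "{b, c}" h] d(2) by simp
      have "h \<in> ie (V - {v})" using h hbc d by (intro ie_delete) auto
      moreover have "h \<notin> ie X" using hbc bX by (auto simp: ie_def)
      ultimately have "h \<subseteq> P" using fu(2)[OF abc] by (auto simp: ip_def)
      then show False using hbc cP by auto
    qed
  next
    case P1: False
    have Pa: "P - (V - X) = {a}" by (rule single_eq[OF _ P1 aX]) (use fP in simp)
    show False
    proof (cases "2 \<le> card (Q - (V - X))")
      case True
      have abc: "{a, b, c} \<inter> V \<subseteq> X \<union> Q" using X Q by auto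
      note fu = full[OF Q(1,2) abc True]
      have "P \<inter> (V - X) \<subseteq> Q" using fu(1) P by auto
      then have Pab: "P = {a, b}" using PQ P Pa by auto
      have "ip P \<noteq> {}" using P(1) d(2) by (auto simp: pt_def Pab)
      then obtain h where h: "h \<in> E" "h \<subseteq> {a, b}" by (auto simp: ip_def Pab)
      then have hab: "h = {a, b}" using card2[OF h(1)] card_subset_eq[of "{a, b}" h] d(2) by simp
      have "h \<in> ie (V - {v})" using h hab d by (intro ie_delete) auto
      moreover have "h \<notin> ie X" using hab bX by (auto simp: ie_def)
      ultimately have "h \<subseteq> Q" using fu(2) by (auto simp: ip_def)
      then show False using hab aQ by auto
    next
      case False
      have Qc: "Q - (V - X) = {c}" by (rule single_eq[OF _ False cX]) (use fP in simp)
      \<comment> \<open>Now \<open>P\<close> and \<open>Q\<close> leave \<open>V - X\<close> only at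
        \<open>a\<close> and \<open>c\<close>, which rules out uncrossing them with \<open>X\<close>
        one at a time. They meet in \<open>b\<close>, so \<open>card S\<close> is the sum of the
        three sizes minus three, and the two defects of \<open>3\<close> in the pure counts match
        \<open>2 * card S\<close> exactly.\<close>
      define S where "S = X \<union> (P \<inter> V) \<union> (Q \<inter> V)"
      have SV: "S \<subseteq> V" "v \<notin> S" using gtD[OF X(1)] X P Q by (auto simp: S_def)
      have fX: "finite X" using gtD[OF X(1)] by simp
      have S_eq: "S = X \<union> ((P - {a}) \<union> (Q - {c}))"
      proof
        show "S \<subseteq> X \<union> ((P - {a}) \<union> (Q - {c}))" using X by (auto simp: S_def)
        have "P - {a} \<subseteq> V" "Q - {c} \<subseteq> V" using Pa Qc by auto
        then show "X \<union> ((P - {a}) \<union> (Q - {c})) \<subseteq> S" by (auto simp: S_def)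
      qed
      have dX: "X \<inter> ((P - {a}) \<union> (Q - {c})) = {}" using Pa Qc by auto
      have "card ((P - {a}) \<union> (Q - {c})) + card ((P - {a}) \<inter> (Q - {c})) = card (P - {a}) + card (Q - {c})"
        using card_Un_Int[of "P - {a}" "Q - {c}"] fP by simp
      moreover have "(P - {a}) \<inter> (Q - {c}) = {b}" using PQ d(2) by auto
      moreover have "card (P - {a}) + 1 = card P" "card (Q - {c}) + 1 = card Q"
        using card.remove[OF fP(1) P(3)] card.remove[OF fP(2) Q(4)] by simp_all
      ultimately have cS: "card S + 3 = card X + card P + card Q"
        unfolding S_eq using dX fX fP by (simp add: card_Un_disjoint)
      have dis1: "ie X \<inter> ip P = {}"
      proof (rule ccontr)
        assume "ie X \<inter> ip P \<noteq> {}"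
        then obtain h where "h \<in> E" "h \<inter> V \<subseteq> X" "h \<subseteq> P" by (auto simp: ie_def ip_def)
        then have "h \<in> E" "h \<subseteq> {a}" using Pa by auto
        then show False using card2[of h] card_mono[of "{a}" h] by simp
      qed
      have dis2: "ie X \<inter> ip Q = {}"
      proof (rule ccontr)
        assume "ie X \<inter> ip Q \<noteq> {}"
        then obtain h where "h \<in> E" "h \<inter> V \<subseteq> X" "h \<subseteq> Q" by (auto simp: ie_def ip_def)
        then have "h \<in> E" "h \<subseteq> {c}" using Qc by auto
        then show False using card2[of h] card_mono[of "{c}" h] by simp
      qed
      have dis3: "ip P \<inter> ip Q = {}"
      proof (rule ccontr)
        assume "ip P \<inter> ip Q \<noteq> {}"
        then obtain h where "h \<in> E" "h \<subseteq> {b}" using PQ by (auto simp: ip_def)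
        then show False using card2[of h] card_mono[of "{b}" h] by simp
      qed
      let ?U = "ie X \<union> ip P \<union> ip Q"
      have "card ?U = card (ie X) + card (ip P) + card (ip Q)"
        using dis1 dis2 dis3 by (simp add: card_Un_disjoint Int_Un_distrib2)
      then have cU: "card ?U = 2 * card S" using cS gtD(2)[OF X(1)] P(1) Q(1) by (simp add: pt_def)
      have Usub: "?U \<subseteq> ie S" by (auto simp: S_def ie_def ip_def)
      have "S \<subset> V" using SV d(1) by auto
      then have cS2: "card (ie S) = 2 * card S" using ie_le[of S] cU card_mono[OF _ Usub] by simp
      then have gS: "gt S" using SV by (simp add: gt_def)
      have SV': "S = V - {v}" using ie_insert_star[OF s gS SV(2)] X P by (auto simp: S_def)
      have U_eq: "?U = ie S" using card_subset_eq[OF _ Usub] cU cS2 by simp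
      have "nb E (V - X) \<subseteq> {a, c}"
      proof
        fix y assume "y \<in> nb E (V - X)"
        then obtain u where u: "u \<in> V - X" "{u, y} \<in> E" "y \<notin> V - X" by (auto simp: nb_def)
        show "y \<in> {a, c}"
        proof (cases "v \<in> {u, y}")
          case True
          have "y \<noteq> v" using u(3) X d(1) by auto
          then have "u = v" using True by auto
          then show ?thesis using star_other[OF s, of y] u bX by auto
        next
          case False
          then have "{u, y} \<in> ?U" using ie_delete[OF d(1) u(2)] U_eq SV' by simp
          moreover have "{u, y} \<notin> ie X" using u by (auto simp: ie_def)
          ultimately have "y \<in> P \<or> y \<in> Q" by (auto simp: ip_def)
          then show ?thesis using u(3) Pa Qc by auto
        qed
      qed
      then have "card (nb E (V - X)) \<le> 2" by (rule card_le_2)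
      moreover have "V - X \<noteq> {}" using bX by auto
      ultimately show False using nb_ge[of "V - X"] by auto
    qed
  qed
qed

end

context tight_graph
begin

text \<open>The sets meet pairwise in one vertex, and a triangle of tight sets is tight again:
  \<open>2 * (p + q + r - 3) - 3\<close> is the sum of \<open>2 * p - 3\<close>,
  \<open>2 * q - 3\<close> and \<open>2 * r - 3\<close>. The union contains all neighbours of
  \<open>v\<close>.\<close>

lemma no_three_pcert:
  assumes s: "star v a b c" and p: "pcert v a b" "pcert v b c" "pcert v c a"
  shows False
proof -
  obtain P where P: "pt P" "v \<notin> P" "a \<in> P" "b \<in> P" using p(1) unfolding pcert_def by blast
  obtain Q where Q: "pt Q" "v \<notin> Q" "b \<in> Q" "c \<in> Q" using p(2) unfolding pcert_def by blast
  obtain R where R: "pt R" "v \<notin> R" "c \<in> R" "a \<in> R" using p(3) unfolding pcert_def by blast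
  note d = starD[OF s]
  have f: "finite P" "finite Q" "finite R" using P Q R by (auto simp: pt_def)
  have one: "S \<inter> T = {x}" if "pt S" "pt T" "v \<notin> S \<union> T" "{a, b, c} \<subseteq> S \<union> T" "x \<in> S \<inter> T" for S T x
  proof (rule single_eq[OF _ _ that(5)])
    show "finite (S \<inter> T)" using that by (simp add: pt_def)
    show "\<not> 2 \<le> card (S \<inter> T)"
    proof
      assume "2 \<le> card (S \<inter> T)"
      then have "pt (S \<union> T)" using pt_Un_Int[OF that(1,2)] by blast
      then show False using ip_insert_star[OF s, of "S \<union> T"] that by auto
    qed
  qed
  have PQ: "P \<inter> Q = {b}" and QR: "Q \<inter> R = {c}" and RP: "P \<inter> R = {a}"
    by (rule one; use P Q R in simp)+
  let ?U = "P \<union> Q \<union> R"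
  have PQR: "(P \<union> Q) \<inter> R = {a, c}" using QR RP by (auto simp: Int_Un_distrib2)
  have "card (P \<union> Q) + 1 = card P + card Q" using card_Un_Int[OF f(1,2)] PQ by simp
  moreover have "card ?U + card ((P \<union> Q) \<inter> R) = card (P \<union> Q) + card R"
    using card_Un_Int[of "P \<union> Q" R] f by simp
  moreover have "card {a, c} = 2" using d(2) by simp
  ultimately have cU: "card ?U + 3 = card P + card Q + card R" using PQR by simp
  have small: "ip S \<inter> ip T = {}" if "S \<inter> T = {x}" for S T x
  proof (rule ccontr)
    assume "ip S \<inter> ip T \<noteq> {}"
    then obtain h where h: "h \<in> E" "h \<subseteq> S \<inter> T" by (auto simp: ip_def)
    then show False using that card2[of h] card_mono[of "{x}" h] by simp
  qed
  have dis: "ip P \<inter> ip Q = {}" "(ip P \<union> ip Q) \<inter> ip R = {}"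
    using small[OF PQ] small[OF QR] small[OF RP] by auto
  have "card (ip P \<union> ip Q \<union> ip R) = card (ip P) + card (ip Q) + card (ip R)"
    using dis by (simp add: card_Un_disjoint)
  moreover have "ip P \<union> ip Q \<union> ip R \<subseteq> ip ?U" by (auto simp: ip_def)
  then have "card (ip P \<union> ip Q \<union> ip R) \<le> card (ip ?U)" by (intro card_mono) simp_all
  moreover have "card P \<le> card ?U" using f by (intro card_mono) auto
  then have U2: "2 \<le> card ?U" using P(1) by (simp add: pt_def)
  moreover have "card (ip ?U) + 3 \<le> 2 * card ?U" using f U2 by (intro ip_le) auto
  ultimately have "pt ?U" using cU P(1) Q(1) R(1) f unfolding pt_def by simp
  then show False using ip_insert_star[OF s, of ?U] P Q R by auto
qed

definition inadmissible :: "'a \<Rightarrow> bool" where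
  "inadmissible v \<longleftrightarrow> (\<forall>a b c. star v a b c \<longrightarrow> gcert v a b \<or> pcert v a b)"

lemma pcert_gcert:
  assumes s: "star v a b c" and i: "inadmissible v" and p: "pcert v a b"
  shows "gcert v b c" "gcert v c a"
proof -
  note ss = s star_rot[OF s] star_rot[OF star_rot[OF s]]
  have c: "gcert v b c \<or> pcert v b c" "gcert v c a \<or> pcert v c a" using i ss unfolding inadmissible_def by blast+
  show "gcert v b c"
    using c no_two_pcert[OF s _ p] no_three_pcert[OF s p] by blast
  show "gcert v c a"
    using c no_two_pcert[OF ss(3) _ _ p] no_three_pcert[OF s p] by blast
qed

section \<open>Sides of vertices with ground certificates\<close>

lemma three_sides:
  assumes s: "star v a b c" and i: "inadmissible v" and np: "\<not> pcert v a b" "\<not> pcert v b c" "\<not> pcert v c a"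
  obtains A B C where "side v a A" "side v b B" "side v c C"
proof -
  note ss = s star_rot[OF s] star_rot[OF star_rot[OF s]]
  have g: "gcert v a b" "gcert v b c" "gcert v c a" using i ss np unfolding inadmissible_def by blast+
  show ?thesis using gcert_side[OF ss(1) g(2)] gcert_side[OF ss(2) g(3)] gcert_side[OF ss(3) g(1)] that by metis
qed

lemma side_notin: "side v b B \<Longrightarrow> {v, a} \<in> E \<Longrightarrow> a \<noteq> b \<Longrightarrow> a \<notin> B"
  by (auto simp: side_def)

text \<open>The two ground certificates together contain all neighbours of \<open>v\<close>, so
  their union is everything but \<open>v\<close>, and every edge off \<open>v\<close> lies in one of
  them.\<close>

lemma side_disjoint:
  assumes s: "star v a b c" and A: "side v a A" and B: "side v b B"
  shows "A \<inter> B = {}" "ie (V - {v}) = ie (V - {v} - A) \<union> ie (V - {v} - B)"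
proof -
  let ?X = "V - {v} - A" and ?Y = "V - {v} - B"
  have g: "gt ?X" "gt ?Y" using A B by (auto simp: side_def)
  have ab: "a \<notin> B" "b \<notin> A" "c \<notin> A" "c \<notin> B"
    using side_notin[OF B starD(3)[OF s]] side_notin[OF A starD(4)[OF s]] side_notin[OF A starD(5)[OF s]]
      side_notin[OF B starD(5)[OF s]] starD(2)[OF s] by auto
  have v: "v \<in> V" using starD(1)[OF s] .
  have ne: "?X \<union> ?Y \<noteq> V" using v by auto
  have nv: "a \<noteq> v" "b \<noteq> v" "c \<noteq> v" using starD(2)[OF s] by auto
  have "{a, b, c} \<inter> V \<subseteq> ?X \<union> ?Y" using ab nv by auto
  then have eq: "?X \<union> ?Y = V - {v}" using ie_insert_star[OF s gt_Un(1)[OF g ne]] by auto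
  have "A \<subseteq> V - {v}" using A by (simp add: side_def)
  then show "A \<inter> B = {}" using eq by blast
  show "ie (V - {v}) = ie ?X \<union> ie ?Y" using gt_Un(2)[OF g ne] eq by simp
qed

lemma card_touch: "A \<subseteq> V \<Longrightarrow> card (touch A) + card (ie (V - A)) = 2 * card V + 1"
proof -
  assume A: "A \<subseteq> V"
  have "touch A \<union> ie (V - A) = E" "touch A \<inter> ie (V - A) = {}" using A by (auto simp: touch_def ie_def)
  then show ?thesis using card_Un_disjoint[of "touch A" "ie (V - A)"] card_E by simp
qed

lemma card_diff: "A \<subseteq> V \<Longrightarrow> card (V - A) + card A = card V"
  using fin(1) by (metis card_Diff_subset card_mono finite_subset le_add_diff_inverse2)

lemma touch_ge: "A \<subseteq> V \<Longrightarrow> A \<noteq> {} \<Longrightarrow> 2 * card A + 1 \<le> card (touch A)"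
proof -
  assume A: "A \<subseteq> V" "A \<noteq> {}"
  then have "V - A \<subset> V" by auto
  then show ?thesis using ie_le[of "V - A"] card_touch[OF A(1)] card_diff[OF A(1)] by linarith
qed

text \<open>By \<open>touch_ge\<close> no set of vertices can meet fewer edges. A side attains this
  minimum, because the two edges from \<open>v\<close> to the other neighbours keep the complement
  ground tight when \<open>v\<close> joins it.\<close>

lemma side_touch:
  assumes s: "star v a b c" and A: "side v a A"
  shows "gt (V - A)" "card (touch A) = 2 * card A + 1"
proof -
  let ?R = "V - {v} - A"
  have gR: "gt ?R" and AV: "A \<subseteq> V - {v}" using A by (auto simp: side_def)
  note d = starD[OF s]
  have nA: "b \<notin> A" "c \<notin> A" using side_notin[OF A d(4)] side_notin[OF A d(5)] d(2) by auto
  have ieq: "ie (V - A) = ie ?R \<union> {{v, b}, {v, c}}"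
  proof
    show "ie ?R \<union> {{v, b}, {v, c}} \<subseteq> ie (V - A)" using d(1,4,5) AV nA by (auto simp: ie_def)
    show "ie (V - A) \<subseteq> ie ?R \<union> {{v, b}, {v, c}}"
    proof
      fix e assume e: "e \<in> ie (V - A)"
      then have eE: "e \<in> E" and eA: "e \<inter> V \<subseteq> V - A" by (auto simp: ie_def)
      show "e \<in> ie ?R \<union> {{v, b}, {v, c}}"
      proof (cases "v \<in> e")
        case True
        then have "e \<in> {e \<in> E. v \<in> e}" using eE by simp
        then have "e \<in> {{v, a}, {v, b}, {v, c}}" unfolding d(6) .
        moreover have "a \<in> A" "a \<in> V" using A by (auto simp: side_def)
        then have "e \<noteq> {v, a}" using eA by auto
        ultimately show ?thesis by blast
      next
        case False
        then show ?thesis using eE eA by (auto simp: ie_def)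
      qed
    qed
  qed
  have nv: "v \<notin> e" if "e \<in> ie ?R" for e using that d(1) by (auto simp: ie_def)
  have "ie ?R \<inter> {{v, b}, {v, c}} = {}" using nv by blast
  then have "card (ie (V - A)) = card (ie ?R) + card {{v, b}, {v, c}}"
    unfolding ieq by (intro card_Un_disjoint) simp_all
  moreover have "{v, b} \<noteq> {v, c}" using d(2) by (auto simp: doubleton_eq_iff)
  then have "card {{v, b}, {v, c}} = 2" by simp
  moreover have "V - A = insert v ?R" using d(1) AV by auto
  then have "card (V - A) = card ?R + 1" using fin(1) by simp
  ultimately have c: "card (ie (V - A)) = 2 * card (V - A)" using gtD(2)[OF gR] by simp
  then show "gt (V - A)" by (simp add: gt_def)
  have "A \<subseteq> V" using AV by auto
  then show "card (touch A) = 2 * card A + 1" using card_touch[of A] card_diff[of A] c by linarith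
qed

lemma sum_degrees:
  assumes F: "finite A" "F \<subseteq> E"
  shows "(\<Sum>x\<in>A. card {e \<in> F. x \<in> e}) = card {e \<in> F. e \<inter> A \<noteq> {}} + card {e \<in> F. e \<subseteq> A}"
proof -
  have fF: "finite F" using F fin finite_subset by auto
  have "(\<Sum>x\<in>A. card {e \<in> F. x \<in> e}) = (\<Sum>x\<in>A. \<Sum>e\<in>F. of_bool (x \<in> e))"
  proof (rule sum.cong[OF refl])
    fix x
    have "{e \<in> F. x \<in> e} = F \<inter> {e. x \<in> e}" by auto
    then show "card {e \<in> F. x \<in> e} = (\<Sum>e\<in>F. of_bool (x \<in> e))" using fF by simp
  qed
  also have "\<dots> = (\<Sum>e\<in>F. \<Sum>x\<in>A. of_bool (x \<in> e))" by (rule sum.swap)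
  also have "\<dots> = (\<Sum>e\<in>F. of_bool (e \<inter> A \<noteq> {}) + of_bool (e \<subseteq> A))"
  proof (rule sum.cong[OF refl])
    fix e assume "e \<in> F"
    then obtain x y where xy: "e = {x, y}" "x \<noteq> y" using card2[of e] F by (auto simp: card_2_iff)
    have "(\<Sum>z\<in>A. of_bool (z \<in> e)) = card (A \<inter> e)" using F(1) by simp
    also have "A \<inter> e = (if x \<in> A then {x} else {}) \<union> (if y \<in> A then {y} else {})" using xy by auto
    also have "card \<dots> = of_bool (e \<inter> A \<noteq> {}) + of_bool (e \<subseteq> A)" using xy by auto
    finally show "(\<Sum>z\<in>A. of_bool (z \<in> e)) = of_bool (e \<inter> A \<noteq> {}) + (of_bool (e \<subseteq> A) :: nat)" .
  qed
  also have "\<dots> = card (F \<inter> {e. e \<inter> A \<noteq> {}}) + card (F \<inter> {e. e \<subseteq> A})"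
    using fF by (simp add: sum.distrib)
  also have "F \<inter> {e. e \<inter> A \<noteq> {}} = {e \<in> F. e \<inter> A \<noteq> {}}" by auto
  also have "F \<inter> {e. e \<subseteq> A} = {e \<in> F. e \<subseteq> A}" by auto
  finally show ?thesis .
qed

text \<open>The degrees in \<open>A\<close> sum to at most
  \<open>(2 * card A + 1) + (2 * card A - 3)\<close>, two less than four times the size, and no
  degree is below three.\<close>

lemma two_nodes:
  assumes A: "A \<subseteq> V" "2 \<le> card A" "card (touch A) = 2 * card A + 1"
  shows "2 \<le> card {x \<in> A. node x}"
proof -
  have fA: "finite A" using A fin finite_subset by auto
  have "(\<Sum>x\<in>A. card {e \<in> E. x \<in> e}) = card (touch A) + card (ip A)"
    using sum_degrees[OF fA order_refl] by (simp add: touch_def ip_def)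
  moreover have "card (ip A) + 3 \<le> 2 * card A" using ip_le fA A by simp
  ultimately have "(\<Sum>x\<in>A. card {e \<in> E. x \<in> e}) + 2 \<le> 4 * card A" using A by linarith
  moreover have "(\<Sum>x\<in>A. 4 - of_bool (node x)) \<le> (\<Sum>x\<in>A. int (card {e \<in> E. x \<in> e}))"
  proof (rule sum_mono)
    fix x assume "x \<in> A"
    then have "x \<in> V" using A by auto
    then show "4 - of_bool (node x) \<le> int (card {e \<in> E. x \<in> e})"
      using degree_ge[of x] by (auto simp: node_def of_bool_def)
  qed
  moreover have "A \<inter> {x. node x} = {x \<in> A. node x}" by auto
  then have "(\<Sum>x\<in>A. 4 - of_bool (node x)) = 4 * int (card A) - int (card {x \<in> A. node x})"
    using fA by (simp add: sum_subtractf)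
  ultimately show ?thesis by (simp flip: of_nat_sum)
qed

text \<open>Two parts without an edge between them would meet at least \<open>2 * card A + 2\<close>
  edges.\<close>

lemma touch_connected:
  assumes A: "A \<subseteq> V" "card (touch A) = 2 * card A + 1" and B: "B \<subseteq> A" "B \<noteq> {}" "B \<noteq> A"
    and no: "\<And>x y. x \<in> B \<Longrightarrow> y \<in> A - B \<Longrightarrow> {x, y} \<notin> E"
  shows False
proof -
  have fA: "finite A" using A fin finite_subset by auto
  have t: "touch A = touch B \<union> touch (A - B)" using B by (auto simp: touch_def)
  have dis: "touch B \<inter> touch (A - B) = {}"
  proof (rule ccontr)
    assume "touch B \<inter> touch (A - B) \<noteq> {}"
    then obtain e x y where e: "e \<in> E" "x \<in> e" "x \<in> B" "y \<in> e" "y \<in> A - B" by (auto simp: touch_def)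
    then have "e = {x, y}" using pair_other[OF card2[OF e(1)]] by auto
    then show False using no e by auto
  qed
  have "card (touch A) = card (touch B) + card (touch (A - B))"
    unfolding t using dis by (intro card_Un_disjoint) simp_all
  moreover have "2 * card B + 1 \<le> card (touch B)" using A B by (intro touch_ge) auto
  moreover have "2 * card (A - B) + 1 \<le> card (touch (A - B))" using A B by (intro touch_ge) auto
  moreover have "card A = card B + card (A - B)" using B fA
    by (metis card_Diff_subset card_mono finite_subset le_add_diff_inverse)
  ultimately show False using A(2) by linarith
qed

text \<open>The ground tight sets belonging to the two sides both avoid \<open>v\<close>, so their
  union is tight; it is the complement of \<open>v\<close> and the common part.\<close>

lemma side_Int:
  assumes s: "star w p q t" and W: "side w p W" and v: "v \<in> W" and A: "side v a A" "a \<in> W"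
  shows "side v a (W \<inter> A)"
proof -
  have g1: "gt (V - W)" using side_touch[OF s W] by simp
  have g2: "gt (V - {v} - A)" using A by (simp add: side_def)
  have WV: "W \<subseteq> V" using W by (auto simp: side_def)
  have "(V - W) \<union> (V - {v} - A) \<noteq> V" using v WV A by (auto simp: side_def)
  then have "gt ((V - W) \<union> (V - {v} - A))" using gt_Un[OF g1 g2] by blast
  moreover have "(V - W) \<union> (V - {v} - A) = V - {v} - (W \<inter> A)" using v by auto
  ultimately show ?thesis using A by (auto simp: side_def)
qed

text \<open>The predicate \<open>g\<close> marks a region in which every vertex of degree three has
  three sides, two of them inside the region. A smallest side in the region that is attached at a
  vertex of larger degree would contain a smaller one. So all attaching vertices have degree three,
  and the marked vertices of degree three span too many edges.\<close>

lemma minimal_side: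
  assumes three: "\<And>y. node y \<Longrightarrow> g y \<Longrightarrow> \<exists>a b c A B C. star y a b c \<and> side y a A \<and> side y b B \<and> side y c C \<and>
      (\<forall>x\<in>A. g x) \<and> (\<forall>x\<in>B. g x)"
    and ex: "node y0" "g y0"
  shows False
proof -
  define N where "N = {y \<in> V. node y \<and> g y}"
  have fN: "finite N" using fin by (simp add: N_def)
  have nV: "node y \<Longrightarrow> y \<in> V" for y by (simp add: node_def)
  have y0: "y0 \<in> N" using ex nV by (simp add: N_def)
  define Bad where "Bad = (\<lambda>(y, p, A). node y \<and> g y \<and> side y p A \<and> (\<forall>x\<in>A. g x) \<and> \<not> node p)"
  show False
  proof (cases "\<exists>t. Bad t")
    case True
    then obtain t where t: "Bad t" "\<And>t'. Bad t' \<Longrightarrow> card (snd (snd t)) \<le> card (snd (snd t'))"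
      using ex_has_least_nat[of Bad _ "\<lambda>t. card (snd (snd t))"] by blast
    obtain y p W where tt: "t = (y, p, W)" by (cases t)
    have y: "node y" "g y" "side y p W" "\<And>x. x \<in> W \<Longrightarrow> g x" "\<not> node p" using t(1) by (auto simp: Bad_def tt)
    have WV: "W \<subseteq> V" "p \<in> W" "{y, p} \<in> E" "y \<notin> W" using y(3) by (auto simp: side_def)
    have fW: "finite W" using WV fin finite_subset by auto
    obtain q r where s: "star y p q r"
    proof -
      obtain a b c where abc: "star y a b c" using node_star[OF y(1)] by blast
      note ss = abc star_rot[OF abc] star_rot[OF star_rot[OF abc]]
      show ?thesis using star_other[OF abc WV(3)] ss that by blast
    qed
    note tW = side_touch(2)[OF s y(3)]
    have cW: "2 \<le> card W"
    proof (rule ccontr)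
      assume "\<not> 2 \<le> card W"
      then have "W = {p}" using single_eq[OF fW _ WV(2)] by simp
      then have "card {e \<in> E. p \<in> e} = 3" using tW by (simp add: touch_def)
      then show False using y(5) WV by (auto simp: node_def)
    qed
    \<comment> \<open>The side \<open>W\<close> is connected, so an edge joins one of its vertices
      of degree three to some other vertex \<open>z\<close>. The side of that vertex towards
      \<open>z\<close>, cut down to \<open>W\<close>, is smaller.\<close>
    define B where "B = {x \<in> W. node x}"
    have "card B \<noteq> 0" using two_nodes[OF WV(1) cW tW] by (simp add: B_def)
    then have "B \<noteq> {}" by auto
    moreover have "B \<subseteq> W" "B \<noteq> W" using WV(2) y(5) by (auto simp: B_def)
    moreover have "{x, z} \<notin> E" if x: "x \<in> B" and z: "z \<in> W - B" for x z
    proof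
      assume xz: "{x, z} \<in> E"
      have xW: "x \<in> W" "node x" using x by (auto simp: B_def)
      have zW: "z \<in> W" "\<not> node z" using z by (auto simp: B_def)
      obtain a b c A1 A2 A3 where h: "star x a b c" "side x a A1" "side x b A2" "side x c A3"
        using three[OF xW(2) y(4)[OF xW(1)]] by blast
      then obtain A where A: "side x z A" using star_other[OF h(1) xz] by blast
      have sA: "side x z (W \<inter> A)" using side_Int[OF s y(3) xW(1) A zW(1)] .
      then have "Bad (x, z, W \<inter> A)" using xW y(4) zW by (auto simp: Bad_def)
      from t(2)[OF this] have "card W \<le> card (W \<inter> A)" by (simp add: tt)
      moreover have "W \<inter> A \<subset> W" using A xW by (auto simp: side_def)
      then have "card (W \<inter> A) < card W" using fW psubset_card_mono by blast
      ultimately show False by simp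
    qed
    ultimately show False using touch_connected[OF WV(1) tW] by blast
  next
    case False
    have "2 \<le> card {e \<in> ip N. y \<in> e}" if y: "y \<in> N" for y
    proof -
      have ny: "node y" "g y" using y by (auto simp: N_def)
      obtain a b c A B C where h: "star y a b c" "side y a A" "side y b B" "\<And>x. x \<in> A \<Longrightarrow> g x" "\<And>x. x \<in> B \<Longrightarrow> g x"
        using three[OF ny] by blast
      have ab: "a \<in> A" "b \<in> B" using h by (auto simp: side_def)
      have "node a" using False ny h unfolding Bad_def by blast
      moreover have "node b" using False ny h unfolding Bad_def by blast
      ultimately have "a \<in> N" "b \<in> N" using h ab nV by (auto simp: N_def)
      then have sub: "{{y, a}, {y, b}} \<subseteq> {e \<in> ip N. y \<in> e}" using starD(3,4)[OF h(1)] y by (auto simp: ip_def)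
      have "{y, a} \<noteq> {y, b}" using starD(2)[OF h(1)] by (auto simp: doubleton_eq_iff)
      then have "card {{y, a}, {y, b}} = 2" by simp
      moreover have "finite {e \<in> ip N. y \<in> e}" by simp
      ultimately show ?thesis using card_mono[OF _ sub] by simp
    qed
    \<comment> \<open>Every vertex of \<open>N\<close> has two neighbours in \<open>N\<close>, so
      \<open>N\<close> spans at least \<open>card N\<close> edges; with degree three throughout it
      meets at most \<open>2 * card N\<close> edges, one too few.\<close>
    then have "(\<Sum>y\<in>N. 2) \<le> (\<Sum>y\<in>N. card {e \<in> ip N. y \<in> e})" by (intro sum_mono)
    also have "\<dots> = card {e \<in> ip N. e \<inter> N \<noteq> {}} + card {e \<in> ip N. e \<subseteq> N}"
      by (rule sum_degrees[OF fN]) (auto simp: ip_def)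
    also have "{e \<in> ip N. e \<subseteq> N} = ip N" by (auto simp: ip_def)
    also have "card {e \<in> ip N. e \<inter> N \<noteq> {}} \<le> card (ip N)" by (intro card_mono) auto
    finally have ge: "card N \<le> card (ip N)" by simp
    have "(\<Sum>x\<in>N. card {e \<in> E. x \<in> e}) = card (touch N) + card (ip N)"
      using sum_degrees[OF fN order_refl] by (simp add: touch_def ip_def)
    moreover have "(\<Sum>x\<in>N. card {e \<in> E. x \<in> e}) = (\<Sum>x\<in>N. 3)"
      by (rule sum.cong) (auto simp: N_def node_def)
    ultimately have "card (touch N) + card (ip N) = 3 * card N" by simp
    moreover have "2 * card N + 1 \<le> card (touch N)" using y0 by (intro touch_ge) (auto simp: N_def)
    ultimately show False using ge by linarith
  qed
qed

section \<open>Vertices with a pure certificate\<close>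

lemma pt_degree:
  assumes P: "pt P" "3 \<le> card P" "z \<in> P"
  shows "2 \<le> card {e \<in> ip P. z \<in> e}"
proof -
  have f: "finite P" using P by (simp add: pt_def)
  have c: "card (P - {z}) + 1 = card P" using card.remove[OF f P(3)] by simp
  have "ip P = ip (P - {z}) \<union> {e \<in> ip P. z \<in> e}" by (auto simp: ip_def)
  then have "card (ip P) \<le> card (ip (P - {z})) + card {e \<in> ip P. z \<in> e}" by (metis card_Un_le)
  moreover have "card (ip (P - {z})) + 3 \<le> 2 * card (P - {z})" using f c P by (intro ip_le) auto
  ultimately show ?thesis using c P(1) by (simp add: pt_def)
qed

lemma pt_edge:
  assumes P: "pt P" "z \<in> P"
  shows "\<exists>e\<in>ip P. z \<in> e"
proof (cases "3 \<le> card P")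
  case True
  then have "{e \<in> ip P. z \<in> e} \<noteq> {}" using pt_degree[OF P(1) True P(2)] by (metis card.empty not_numeral_le_zero)
  then show ?thesis by auto
next
  case False
  then have c2: "card P = 2" using P(1) by (simp add: pt_def)
  then have "ip P \<noteq> {}" using P(1) by (auto simp: pt_def)
  then obtain e where e: "e \<in> E" "e \<subseteq> P" by (auto simp: ip_def)
  then have "e = P" using c2 card2[OF e(1)] P(1) by (intro card_subset_eq) (auto simp: pt_def)
  then show ?thesis using e P by (auto simp: ip_def)
qed

text \<open>\<open>P\<close> is uncrossed with the ground certificate that leaves out
  \<open>B\<close>. They share \<open>a\<close> and a further vertex, because an edge of
  \<open>P\<close> at \<open>a\<close> lies in one of the ground certificates, and not in the one
  that avoids \<open>a\<close>. The union is everything but \<open>v\<close>, so whatever touches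
  \<open>B\<close> lies in \<open>P\<close>.\<close>

lemma pure_side_subset:
  assumes s: "star v a b c" and A: "side v a A" and B: "side v b B"
    and P: "pt P" "v \<notin> P" "a \<in> P" "b \<in> P"
  shows "B \<subseteq> P" "\<And>e. e \<in> E \<Longrightarrow> e \<inter> B \<noteq> {} \<Longrightarrow> v \<notin> e \<Longrightarrow> e \<subseteq> P"
proof -
  let ?R = "V - {v} - B"
  note d = starD[OF s]
  have gR: "gt ?R" and BV: "B \<subseteq> V - {v}" using B by (auto simp: side_def)
  have aV: "a \<in> V" using A by (auto simp: side_def)
  have aB: "a \<notin> B" "c \<notin> B" using side_notin[OF B d(3)] side_notin[OF B d(5)] d(2) by auto
  have fP: "finite P" using P by (simp add: pt_def)
  have aR: "a \<in> P - (V - ?R)" using P aV aB d(2) by auto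
  have two: "2 \<le> card (P - (V - ?R))"
  proof (rule ccontr)
    assume n2: "\<not> 2 \<le> card (P - (V - ?R))"
    have Pa: "P - (V - ?R) = {a}" by (rule single_eq[OF _ n2 aR]) (use fP in simp)
    obtain e where e: "e \<in> E" "e \<subseteq> P" "a \<in> e" using pt_edge[OF P(1,3)] by (auto simp: ip_def)
    obtain q where q: "q \<noteq> a" "e = {a, q}" using edge_pair[OF e(1,3)] by blast
    have "q \<in> P" using q e by auto
    then have qR: "q \<in> V - ?R" using Pa q by auto
    have "e \<in> ie (V - {v})" using ie_delete[OF d(1) e(1)] e(2) P(2) by auto
    then have "e \<in> ie (V - {v} - A) \<or> e \<in> ie ?R" using side_disjoint(2)[OF s A B] by auto
    moreover have "a \<in> A" using A by (simp add: side_def)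
    ultimately show False using q qR aV by (auto simp: ie_def)
  qed
  have ne: "?R \<union> (P \<inter> V) \<noteq> V" using d(1) P(2) by auto
  note g = gt_pt[OF gR P(1) two ne]
  have "{a, b, c} \<inter> V \<subseteq> ?R \<union> (P \<inter> V)" using P aB d(2) by auto
  then have eq: "?R \<union> (P \<inter> V) = V - {v}" using ie_insert_star[OF s g(1)] P(2) by auto
  show "B \<subseteq> P" using eq BV by auto
  fix e assume e: "e \<in> E" "e \<inter> B \<noteq> {}" "v \<notin> e"
  then have "e \<in> ie ?R \<union> ip P" using ie_delete[OF d(1) e(1,3)] g(3) eq by simp
  moreover have "e \<notin> ie ?R" using e(2) BV by (auto simp: ie_def)
  ultimately show "e \<subseteq> P" by (auto simp: ip_def)
qed

text \<open>Descent on the certificate. A vertex of degree three with all its edges in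
  \<open>P\<close> would turn a pure certificate of its own into a smaller one by intersecting it
  with \<open>P\<close>; so it has three sides. At most one of them contains \<open>v\<close>, and
  the others again have all their edges in \<open>P\<close>, which is the situation excluded by
  \<open>minimal_side\<close>.\<close>

lemma no_pure_node:
  assumes R: "\<And>r. r \<in> R \<Longrightarrow> \<exists>z. z \<notin> V \<and> {r, z} \<in> E \<and> (\<forall>u\<in>V. {u, z} \<in> E \<longrightarrow> u = r)"
    and all: "\<And>v. node v \<Longrightarrow> v \<notin> R \<Longrightarrow> inadmissible v"
    and v: "node v" "v \<notin> R" "pt P" "v \<notin> P" "{v, a} \<in> E" "{v, b} \<in> E" "a \<noteq> b" "a \<in> P" "b \<in> P"
  shows False
  using v
proof (induction "card P" arbitrary: P v a b rule: less_induct)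
  case (less P v a b)
  note IH = less(1) and v = less(2,3) and P = less(4,5,9,10) and ab = less(6,7,8)
  have fP: "finite P" using P(1) by (simp add: pt_def)
  obtain c where s: "star v a b c" using star_with_two[OF v(1) ab] by blast
  note d = starD[OF s]
  have iv: "inadmissible v" using all v by blast
  have "pcert v a b" using P by (auto simp: pcert_def)
  note gc = pcert_gcert[OF s iv this]
  obtain A where A: "side v a A" using gcert_side[OF s gc(1)] .
  obtain B where B: "side v b B" using gcert_side[OF star_rot[OF s] gc(2)] .
  have AB: "A \<inter> B = {}" using side_disjoint(1)[OF s A B] .
  have abV: "a \<in> V" "b \<in> V" "a \<in> A" "b \<in> B" using A B by (auto simp: side_def)
  have AV: "A \<subseteq> V - {v}" and gA: "gt (V - {v} - A)" using A by (auto simp: side_def)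
  note subA = pure_side_subset[OF star_swap[OF s] B A P(1,2,4,3)]
  note tA = side_touch[OF s A]
  have fA: "finite A" using AV fin finite_subset by auto
  have cP: "c \<notin> P" using ip_insert_star[OF s P] by blast
  \<comment> \<open>The private outer neighbour of a root would lie in \<open>P\<close> with a
    single edge, but a pure tight set of three or more vertices has two edges at each of
    them.\<close>
  have notR: "y \<notin> R" if y: "y \<in> P" "\<And>e. e \<in> E \<Longrightarrow> y \<in> e \<Longrightarrow> v \<notin> e \<Longrightarrow> e \<subseteq> P" for y
  proof
    assume yR: "y \<in> R"
    obtain z where z: "z \<notin> V" "{y, z} \<in> E" "\<And>u. u \<in> V \<Longrightarrow> {u, z} \<in> E \<Longrightarrow> u = y" using R[OF yR] by blast
    have "y \<noteq> v" using yR v by auto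
    then have zP: "z \<in> P" using y(2)[OF z(2)] z(1) d(1) by auto
    have "{a, b, z} \<subseteq> P" using zP P by auto
    then have "card {a, b, z} \<le> card P" using fP card_mono by blast
    moreover have "z \<noteq> a" "z \<noteq> b" using abV(1,2) z(1) by metis+
    then have "card {a, b, z} = 3" using ab(3) by simp
    ultimately have "2 \<le> card {e \<in> ip P. z \<in> e}" using pt_degree[OF P(1) _ zP] by simp
    moreover have "e = {y, z}" if e: "e \<in> E" "z \<in> e" for e
    proof -
      obtain u where u: "u \<noteq> z" "e = {z, u}" using edge_pair[OF e] by blast
      then have "u \<in> V" using meets[OF e(1)] z(1) by auto
      then show ?thesis using z(3)[of u] e u by (simp add: insert_commute)
    qed
    then have "{e \<in> ip P. z \<in> e} \<subseteq> {{y, z}}" by (auto simp: ip_def)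
    then have "card {e \<in> ip P. z \<in> e} \<le> card {{y, z}}" by (intro card_mono) auto
    ultimately show False by simp
  qed
  have notRA: "x \<notin> R" if "x \<in> A" for x using notR[of x] subA that by blast
  show False
  proof (cases "2 \<le> card A")
    case False
    \<comment> \<open>When the side consists of \<open>a\<close> alone, \<open>a\<close> has degree
      three, and \<open>P - {a}\<close> is a pure certificate for its other two neighbours.\<close>
    then have Aa: "A = {a}" using single_eq[OF fA _ abV(3)] by simp
    have na: "node a" using tA(2) Aa abV by (simp add: node_def touch_def)
    obtain s1 s2 where sa: "star a v s1 s2"
    proof -
      obtain x y z where xyz: "star a x y z" using node_star[OF na] by blast
      have "{a, v} \<in> E" using ab(1) by (simp add: insert_commute)
      note ss = xyz star_rot[OF xyz] star_rot[OF star_rot[OF xyz]]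
      show ?thesis using star_other[OF xyz \<open>{a, v} \<in> E\<close>] ss that by blast
    qed
    note da = starD[OF sa]
    have sP: "{a, s1} \<subseteq> P" "{a, s2} \<subseteq> P" using subA(2)[OF da(4)] subA(2)[OF da(5)] da(2) Aa by auto
    have eqP: "P - (V - (V - {v} - A)) = P - {a}" using P(2) AV Aa by auto
    have "{s1, s2} \<subseteq> P - {a}" using sP da(2) by auto
    then have "card {s1, s2} \<le> card (P - {a})" using fP by (intro card_mono) auto
    then have two: "2 \<le> card (P - (V - (V - {v} - A)))" using da(2) eqP by simp
    have "(V - {v} - A) \<union> (P \<inter> V) \<noteq> V" using d(1) P(2) by auto
    then have "pt (P - {a})" using gt_pt(2)[OF gA P(1) two] eqP by simp
    moreover have "card (P - {a}) < card P" using fP P(3) by (metis card_Diff1_less)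
    ultimately show False
      using IH[of "P - {a}" a s1 s2] na notRA[OF abV(3)] da(2,4,5) sP by auto
  next
    case True
    define g where "g y \<longleftrightarrow> y \<in> P \<and> y \<noteq> a \<and> y \<noteq> b \<and> (\<forall>e\<in>E. y \<in> e \<longrightarrow> e \<subseteq> P)" for y
    have gnotR: "y \<notin> R" if "g y" for y using notR[of y] that unfolding g_def by blast
    have smaller: False if y: "node y" "g y" and Q: "pt Q" "y \<notin> Q" "p \<in> Q" "q \<in> Q"
      and pq: "p \<noteq> q" "{y, p} \<in> E" "{y, q} \<in> E" for y p q Q
    proof -
      have pP: "p \<in> P" "q \<in> P" using y(2) pq unfolding g_def by blast+
      have "{p, q} \<subseteq> P \<inter> Q" using pP Q by auto
      then have "card {p, q} \<le> card (P \<inter> Q)" using fP by (intro card_mono) auto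
      then have "pt (P \<inter> Q)" using pt_Un_Int(2)[OF P(1) Q(1)] pq(1) by simp
      moreover have "P \<inter> Q \<subset> P" using y(2) Q(2) by (auto simp: g_def)
      then have "card (P \<inter> Q) < card P" using fP psubset_card_mono by blast
      ultimately show False using IH[of "P \<inter> Q" y p q] y(1) gnotR[OF y(2)] Q pP pq by auto
    qed
    have good: "\<forall>x\<in>W. g x" if y: "node y" "g y" and st: "star y p q t" and W: "side y p W" and vW: "v \<notin> W" for y p q t W
    proof -
      let ?X = "V - {y} - W"
      note dy = starD[OF st]
      have gX: "gt ?X" and WV: "W \<subseteq> V - {y}" using W by (auto simp: side_def)
      have yP: "y \<in> P" "y \<noteq> v" using y(2) P(2) by (auto simp: g_def)
      have qt: "q \<in> P" "t \<in> P" using y(2) dy(4,5) unfolding g_def by blast+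
      have "q \<notin> W" "t \<notin> W" using side_notin[OF W dy(4)] side_notin[OF W dy(5)] dy(2) by auto
      then have qt': "q \<in> P - (V - ?X)" "t \<in> P - (V - ?X)" using qt dy(2) by auto
      have "card {q, t} \<le> card (P - (V - ?X))" using qt' fP by (intro card_mono) auto
      then have two: "2 \<le> card (P - (V - ?X))" using dy(2) by simp
      have yn: "y \<notin> P - (V - ?X)" using dy(1) by auto
      have npt: "\<not> pt (P - (V - ?X))"
        using smaller[OF y _ yn qt'] dy by auto
      \<comment> \<open>The uncrossing may not produce a smaller pure tight set, so the union is all
        of \<open>V\<close>. Not being tight, the intersection gives up one more edge, which is just
        enough to place every edge of the graph in \<open>?X\<close> or in \<open>P\<close>.\<close>
      have cov: "?X \<union> (P \<inter> V) = V" using gt_pt(2)[OF gX P(1) two] npt by blast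
      note mc = mixed_card[OF gtD(1)[OF gX] fP]
      have "card (ip (P - (V - ?X))) + 3 \<le> 2 * card (P - (V - ?X))" using fP two by (intro ip_le) auto
      moreover have "card (ip (P - (V - ?X))) + 3 \<noteq> 2 * card (P - (V - ?X))" using npt fP two by (auto simp: pt_def)
      moreover have "card (ip P) + 3 = 2 * card P" using P(1) by (simp add: pt_def)
      ultimately have "2 * card V + 1 \<le> card (ie ?X \<union> ip P)"
        using mc gtD(2)[OF gX] cov by simp
      moreover have sub: "ie ?X \<union> ip P \<subseteq> E" by (auto simp: ie_def ip_def)
      ultimately have "ie ?X \<union> ip P = E" using card_seteq[OF fin(2) sub] card_E by simp
      then have dich: "e \<in> ie ?X \<or> e \<subseteq> P" if "e \<in> E" for e using that by (auto simp: ip_def)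
      have "a \<notin> W" using dich[OF ab(1)] P(2) abV by (auto simp: ie_def)
      moreover have "b \<notin> W" using dich[OF ab(2)] P(2) abV by (auto simp: ie_def)
      moreover have "e \<subseteq> P" if "x \<in> W" "e \<in> E" "x \<in> e" for x e
        using dich[OF that(2)] that WV by (auto simp: ie_def)
      moreover have "W \<subseteq> P" using cov WV by auto
      ultimately show ?thesis unfolding g_def by blast
    qed
    have three: "\<exists>a b c A B C. star y a b c \<and> side y a A \<and> side y b B \<and> side y c C \<and> (\<forall>x\<in>A. g x) \<and> (\<forall>x\<in>B. g x)"
      if y: "node y" "g y" for y
    proof -
      obtain p q t where st: "star y p q t" using node_star[OF y(1)] by blast
      note dy = starD[OF st]
      have iy: "inadmissible y" using all[OF y(1) gnotR[OF y(2)]] .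
      have "\<not> pcert y p q" "\<not> pcert y q t" "\<not> pcert y t p"
        using smaller[OF y] dy unfolding pcert_def by auto
      then obtain A1 A2 A3 where A: "side y p A1" "side y q A2" "side y t A3" using three_sides[OF st iy] by metis
      note s2 = star_rot[OF st] and s3 = star_rot[OF star_rot[OF st]]
      have dis: "A1 \<inter> A2 = {}" "A2 \<inter> A3 = {}" "A3 \<inter> A1 = {}"
        using side_disjoint(1)[OF st A(1,2)] side_disjoint(1)[OF s2 A(2,3)] side_disjoint(1)[OF s3 A(3,1)] .
      have gd: "v \<notin> A1 \<Longrightarrow> \<forall>x\<in>A1. g x" "v \<notin> A2 \<Longrightarrow> \<forall>x\<in>A2. g x" "v \<notin> A3 \<Longrightarrow> \<forall>x\<in>A3. g x"
        using good[OF y st A(1)] good[OF y s2 A(2)] good[OF y s3 A(3)] by blast+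
      show ?thesis
      proof (cases "v \<in> A1")
        case True
        then have "v \<notin> A2" "v \<notin> A3" using dis by auto
        then show ?thesis using s2 A gd by blast
      next
        case False
        show ?thesis
        proof (cases "v \<in> A2")
          case True
          then have "v \<notin> A3" using dis by auto
          then show ?thesis using s3 A gd False by blast
        next
          case f2: False
          show ?thesis using st A gd False f2 by blast
        qed
      qed
    qed
    \<comment> \<open>The side \<open>A\<close> lies in \<open>P\<close> and has two vertices of
      degree three; one of them is not \<open>a\<close> and serves as the start.\<close>
    have "\<exists>x\<in>{x \<in> A. node x}. x \<noteq> a"
    proof (rule ccontr)
      assume "\<not> ?thesis"
      then have "{x \<in> A. node x} \<subseteq> {a}" by auto
      then have "card {x \<in> A. node x} \<le> card {a}" by (intro card_mono) auto
      moreover have "A \<subseteq> V" using AV by auto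
      ultimately show False using two_nodes[OF _ True tA(2)] by simp
    qed
    then obtain x where x: "x \<in> A" "node x" "x \<noteq> a" by blast
    have "g x" unfolding g_def
    proof (intro conjI ballI impI)
      show "x \<in> P" using subA(1) x by auto
      show "x \<noteq> a" "x \<noteq> b" using x AB abV by auto
      fix e assume e: "e \<in> E" "x \<in> e"
      have "v \<notin> e"
      proof
        assume "v \<in> e"
        moreover have "v \<noteq> x" using AV x by auto
        ultimately have "e = {v, x}" using pair_other[OF card2[OF e(1)]] e(2) by auto
        then show False using A x e(1) by (auto simp: side_def)
      qed
      then show "e \<subseteq> P" using subA(2)[OF e(1)] x e(2) by auto
    qed
    then show False using minimal_side[of g x] three x(2) by blast
  qed
qed

text \<open>Pure certificates are out by \<open>no_pure_node\<close>, so every bad vertex has three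
  sides. They are disjoint, so at most one contains the only root, and \<open>minimal_side\<close>
  applies to the vertices that are no root.\<close>

theorem admissible_node:
  assumes R: "\<And>r. r \<in> R \<Longrightarrow> \<exists>z. z \<notin> V \<and> {r, z} \<in> E \<and> (\<forall>u\<in>V. {u, z} \<in> E \<longrightarrow> u = r)"
    and one: "\<And>r r'. r \<in> R \<Longrightarrow> r' \<in> R \<Longrightarrow> r = r'"
  shows "\<exists>v a b c. v \<notin> R \<and> star v a b c \<and> \<not> gcert v a b \<and> \<not> pcert v a b"
proof (rule ccontr)
  assume no: "\<not> ?thesis"
  then have all: "inadmissible v" if "node v" "v \<notin> R" for v using that unfolding inadmissible_def by blast
  have np: "\<not> pcert v a b" if "star v a b c" "v \<notin> R" for v a b c
  proof
    assume "pcert v a b"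
    then obtain P where P: "pt P" "v \<notin> P" "a \<in> P" "b \<in> P" unfolding pcert_def by blast
    note d = starD[OF that(1)]
    show False
      by (rule no_pure_node[OF R all star_node[OF that(1)] that(2) P(1,2) d(3,4) _ P(3,4)]) (use d(2) in auto)
  qed
  have three: "\<exists>a b c A B C. star y a b c \<and> side y a A \<and> side y b B \<and> side y c C \<and> (\<forall>x\<in>A. x \<notin> R) \<and> (\<forall>x\<in>B. x \<notin> R)"
    if y: "node y" "y \<notin> R" for y
  proof -
    obtain p q t where st: "star y p q t" using node_star[OF y(1)] by blast
    note s2 = star_rot[OF st] and s3 = star_rot[OF star_rot[OF st]]
    obtain A1 A2 A3 where A: "side y p A1" "side y q A2" "side y t A3"
      using three_sides[OF st all[OF y] np[OF st y(2)] np[OF s2 y(2)] np[OF s3 y(2)]] by metis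
    have dis: "A1 \<inter> A2 = {}" "A2 \<inter> A3 = {}" "A3 \<inter> A1 = {}"
      using side_disjoint(1)[OF st A(1,2)] side_disjoint(1)[OF s2 A(2,3)] side_disjoint(1)[OF s3 A(3,1)] .
    show ?thesis
    proof (cases "\<exists>r\<in>R. r \<in> A1")
      case True
      then obtain r where "r \<in> R" "r \<in> A1" by blast
      then have "\<forall>x\<in>A2. x \<notin> R" "\<forall>x\<in>A3. x \<notin> R" using dis one by blast+
      then show ?thesis using s2 A by blast
    next
      case False
      show ?thesis
      proof (cases "\<exists>r\<in>R. r \<in> A2")
        case True
        then obtain r where "r \<in> R" "r \<in> A2" by blast
        then have "\<forall>x\<in>A3. x \<notin> R" using dis one by blast
        then show ?thesis using s3 A False by blast
      next
        case f2: False
        show ?thesis using st A False f2 by blast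
      qed
    qed
  qed
  \<comment> \<open>All of \<open>V\<close> meets \<open>2 * card V + 1\<close> edges, so it has two
    vertices of degree three, one of which is no root.\<close>
  have "touch V = E" using meets by (auto simp: touch_def)
  then have "2 \<le> card {x \<in> V. node x}" using two_nodes[of V] card_V card_E by simp
  moreover have "finite {x \<in> V. node x}" using fin by simp
  ultimately obtain x y where "x \<in> V" "y \<in> V" "node x" "node y" "x \<noteq> y"
    using card_le_Suc0_iff_eq[of "{x \<in> V. node x}"] by auto
  then obtain z where "node z" "z \<notin> R" using one by blast
  then show False using minimal_side[of "\<lambda>y. y \<notin> R" z] three by blast
qed

end

subsection \<open>Reductions that keep a root\<close>

text \<open>Besides the two operations, a new vertex of degree three may be added without deleting an edge;
  this is a one-extension combined with an addition.\<close>

definition step :: "'a set \<Rightarrow> 'a set set \<Rightarrow> 'a set \<Rightarrow> 'a set set \<Rightarrow> bool" where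
  "step V' E' V E \<longleftrightarrow>
     V' = V \<and> (\<exists>e. e \<notin> E' \<and> E = insert e E' \<and> card e = 2 \<and> e \<inter> V \<noteq> {}) \<or>
     (\<exists>v a b c. v \<notin> V' \<and> v \<notin> \<Union>E' \<and> V = insert v V' \<and> distinct [v, a, b, c] \<and>
       (E = E' \<union> {{v, a}, {v, b}, {v, c}} \<or>
        {a, b} \<in> E' \<and> {a, b} \<inter> V' \<noteq> {} \<and> E = E' - {{a, b}} \<union> {{v, a}, {v, b}, {v, c}}))"

lemma stepE [consumes 1, case_names edge vertex ext]:
  assumes "step V' E' V E"
  obtains e where "V' = V" "e \<notin> E'" "E = insert e E'" "card e = 2" "e \<inter> V \<noteq> {}"
  | v a b c where "v \<notin> V'" "v \<notin> \<Union>E'" "V = insert v V'" "distinct [v, a, b, c]"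
      "E = E' \<union> {{v, a}, {v, b}, {v, c}}"
  | v a b c where "v \<notin> V'" "v \<notin> \<Union>E'" "V = insert v V'" "distinct [v, a, b, c]" "{a, b} \<in> E'"
      "{a, b} \<inter> V' \<noteq> {}" "E = E' - {{a, b}} \<union> {{v, a}, {v, b}, {v, c}}"
  using assms unfolding step_def by metis

lemma step_edge: "e \<notin> E' \<Longrightarrow> E = insert e E' \<Longrightarrow> card e = 2 \<Longrightarrow> e \<inter> V \<noteq> {} \<Longrightarrow> step V E' V E"
  unfolding step_def by (intro disjI1 conjI exI[of _ e]) auto

lemma step_vertex: "v \<notin> V' \<Longrightarrow> v \<notin> \<Union>E' \<Longrightarrow> V = insert v V' \<Longrightarrow> distinct [v, a, b, c] \<Longrightarrow>
    E = E' \<union> {{v, a}, {v, b}, {v, c}} \<Longrightarrow> step V' E' V E"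
  unfolding step_def by (intro disjI2 exI[of _ v] exI[of _ a] exI[of _ b] exI[of _ c]) simp

lemma step_ext: "v \<notin> V' \<Longrightarrow> v \<notin> \<Union>E' \<Longrightarrow> V = insert v V' \<Longrightarrow> distinct [v, a, b, c] \<Longrightarrow> {a, b} \<in> E' \<Longrightarrow>
    {a, b} \<inter> V' \<noteq> {} \<Longrightarrow> E = E' - {{a, b}} \<union> {{v, a}, {v, b}, {v, c}} \<Longrightarrow> step V' E' V E"
  unfolding step_def by (intro disjI2 exI[of _ v] exI[of _ a] exI[of _ b] exI[of _ c]) simp

lemma step_solid: "step V' E' V E \<Longrightarrow> solid V' E' \<Longrightarrow> solid V E"
proof (induction rule: stepE)
  case (edge e)
  have s: "solid V E'" using edge(1,6) by simp
  have "graph V E" using s edge(4) unfolding edge(3) by (simp add: solid_def graph_def)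
  then show ?case using solid_mono[OF s] edge(3) by blast
next
  case (vertex v a b c)
  show ?case unfolding vertex(3,5) using solid_vertex_add[OF vertex(6,1,2,4)] .
next
  case (ext v a b c)
  show ?case unfolding ext(3,7) using solid_one_ext[OF ext(8,1,2,4)] ext(5) by simp
qed

lemma step_subset: "step V' E' V E \<Longrightarrow> V' \<subseteq> V"
  by (induction rule: stepE) auto

text \<open>Used to trace neighbours upwards: an edge is kept or subdivided by the new vertex, so an
  outer neighbour of the smaller part was a neighbour before.\<close>

lemma step_edge_cases:
  "step V' E' V E \<Longrightarrow> {x, y} \<in> E' \<Longrightarrow> {x, y} \<in> E \<or> (\<exists>v\<in>V - V'. {v, x} \<in> E \<and> {v, y} \<in> E)"
proof (induction rule: stepE)
  case (ext v a b c)
  show ?case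
  proof (cases "{x, y} = {a, b}")
    case True
    have "x \<in> {x, y}" "y \<in> {x, y}" by simp_all
    then have "x \<in> {a, b}" "y \<in> {a, b}" unfolding True .
    then have "{v, x} \<in> E" "{v, y} \<in> E" unfolding ext(7) by blast+
    moreover have "v \<in> V - V'" using ext(1,3) by simp
    ultimately show ?thesis by blast
  next
    case False
    then show ?thesis using ext(8) unfolding ext(7) by simp
  qed
qed simp_all

lemma step_new_notin: "step V' E' V E \<Longrightarrow> v \<in> V - V' \<Longrightarrow> v \<notin> \<Union>E'"
  by (induction rule: stepE) auto

lemma step_outside: "step V' E' V E \<Longrightarrow> {e \<in> E'. e \<inter> V' = {}} = {e \<in> E. e \<inter> V = {}}"
proof (induction rule: stepE)
  case (vertex v a b c)
  then have "e \<inter> V = e \<inter> V'" if "e \<in> E'" for e using that by auto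
  then show ?case using vertex(3,5) by blast
next
  case (ext v a b c)
  then have "e \<inter> V = e \<inter> V'" if "e \<in> E'" for e using that by auto
  then show ?case using ext(3,6,7) by blast
qed auto

lemma step_graph: "step V' E' V E \<Longrightarrow> graph V E \<Longrightarrow> graph V' E'"
proof (induction rule: stepE)
  case (ext v a b c)
  have "E' \<subseteq> insert {a, b} E" using ext(7) by auto
  moreover have "card {a, b} = 2" using ext(4) by simp
  ultimately show ?case using ext(3,8) finite_subset[of E' "insert {a, b} E"] by (auto simp: graph_def)
qed (auto simp: graph_def)

text \<open>Only the notion of a step is insensitive to moving outer vertices into \<open>V\<close>;
  whether the smaller graph is then still solid has to be proved anew.\<close>

lemma step_lift: "step V' E' V E \<Longrightarrow> U \<inter> V = {} \<Longrightarrow> step (U \<union> V') E' (U \<union> V) E"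
proof (induction rule: stepE)
  case (edge e)
  show ?case unfolding edge(1) by (rule step_edge[OF edge(2,3,4)]) (use edge(5) in auto)
next
  case (vertex v a b c)
  then show ?case by (intro step_vertex[of v _ _ _ a b c]) auto
next
  case (ext v a b c)
  then show ?case by (intro step_ext[of v _ _ _ a b c]) auto
qed

text \<open>Steps never touch the edges among outer vertices, so these are not counted.\<close>

definition graph_size :: "'a set \<Rightarrow> 'a set set \<Rightarrow> nat" where
  "graph_size V E = card V + card (inc V E)"

lemma card_star3:
  assumes "distinct [v, a, b, c]"
  shows "card {{v, a}, {v, b}, {v, c}} = 3"
  using assms by (auto simp: doubleton_eq_iff card_insert_if)

lemma step_size: "step V' E' V E \<Longrightarrow> graph V E \<Longrightarrow> graph_size V' E' < graph_size V E"
proof (induction rule: stepE)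
  case (edge e)
  then have "inc V E = insert e (inc V E')" "e \<notin> inc V E'" "finite (inc V E')"
    by (auto simp: inc_def graph_def)
  then show ?case using edge(1) by (simp add: graph_size_def)
next
  case (vertex v a b c)
  have "inc V' E' \<subseteq> inc V E" using vertex by (auto simp: inc_def)
  then have "card (inc V' E') \<le> card (inc V E)" using vertex(6) by (intro card_mono finite_inc) (auto simp: graph_def)
  moreover have "card V = Suc (card V')" using vertex by (auto simp: graph_def)
  ultimately show ?case by (simp add: graph_size_def)
next
  case (ext v a b c)
  let ?S = "{{v, a}, {v, b}, {v, c}}"
  have fE: "finite (inc V E)" using ext(8) by (intro finite_inc) (auto simp: graph_def)
  have S: "?S \<subseteq> inc V E" using ext(3,7) by (auto simp: inc_def)
  have dis: "inc V' E' \<inter> ?S = {}" using ext(2) by (auto simp: inc_def)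
  have "inc V' E' - {{a, b}} \<subseteq> inc V E - ?S" using ext(3,7) dis by (auto simp: inc_def)
  then have "card (inc V' E' - {{a, b}}) \<le> card (inc V E - ?S)" using fE by (intro card_mono) auto
  also have "\<dots> = card (inc V E) - 3" using S fE card_star3[OF ext(4)] by (simp add: card_Diff_subset)
  finally have "card (inc V' E') - 1 \<le> card (inc V E) - 3" using diff_card_le_card_Diff[of "{{a, b}}" "inc V' E'"] by simp
  moreover have "3 \<le> card (inc V E)" using card_mono[OF fE S] card_star3[OF ext(4)] by simp
  moreover have "card V = Suc (card V')" using ext by (auto simp: graph_def)
  ultimately show ?case by (simp add: graph_size_def)
qed

lemma inc_card_mono: "graph V E \<Longrightarrow> D \<subseteq> V \<Longrightarrow> card (inc D E) \<le> card (inc V E)"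
  by (intro card_mono finite_inc) (auto simp: inc_def graph_def)

lemma graph_size_subset: "graph V E \<Longrightarrow> D \<subset> V \<Longrightarrow> graph_size D E < graph_size V E"
  using inc_card_mono[of V E D] psubset_card_mono[of V D] by (simp add: graph_size_def graph_def psubset_imp_subset)

text \<open>A root is an edge to an outer vertex that has no other neighbour in \<open>V\<close>.\<close>

definition rooted :: "'a set \<Rightarrow> 'a set set \<Rightarrow> 'a \<Rightarrow> 'a \<Rightarrow> bool" where
  "rooted V E r z \<longleftrightarrow> r \<in> V \<and> z \<notin> V \<and> {r, z} \<in> E \<and> (\<forall>u\<in>V. {u, z} \<in> E \<longrightarrow> u = r)"

lemma step_rooted:
  assumes "step V' E' V E" "rooted V E r z" "r \<in> V'" "{r, z} \<in> E'"
  shows "rooted V' E' r z"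
  unfolding rooted_def
proof (intro conjI ballI impI)
  have sub: "V' \<subseteq> V" using step_subset[OF assms(1)] .
  show "r \<in> V'" "{r, z} \<in> E'" by fact+
  show "z \<notin> V'" using assms(2) sub by (auto simp: rooted_def)
  fix u assume u: "u \<in> V'" "{u, z} \<in> E'"
  show "u = r"
    using step_edge_cases[OF assms(1) u(2)] assms(2,3) u(1) sub unfolding rooted_def by blast
qed

definition reduces :: "'a set \<Rightarrow> 'a set set \<Rightarrow> ('a \<times> 'a) set \<Rightarrow> bool" where
  "reduces V E R \<longleftrightarrow> (\<exists>V' E'. step V' E' V E \<and> solid V' E' \<and> (\<forall>(r, z)\<in>R. r \<in> V' \<and> {r, z} \<in> E'))"

lemma reducesI:
  "step V' E' V E \<Longrightarrow> solid V' E' \<Longrightarrow> (\<And>r z. (r, z) \<in> R \<Longrightarrow> r \<in> V' \<and> {r, z} \<in> E') \<Longrightarrow> reduces V E R"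
  unfolding reduces_def by auto

text \<open>A set \<open>R\<close> with at most one element treats the rooted and the unrooted case
  together. A single rooted vertex is excluded, for if it has degree three, its only reduction
  removes the root.\<close>

definition claim :: "'a set \<Rightarrow> 'a set set \<Rightarrow> ('a \<times> 'a) set \<Rightarrow> bool" where
  "claim V E R \<longleftrightarrow> (solid V E \<and> V \<noteq> {} \<and> (\<forall>p\<in>R. \<forall>q\<in>R. p = q) \<and> (\<forall>(r, z)\<in>R. rooted V E r z) \<and>
     (R \<noteq> {} \<longrightarrow> 2 \<le> card V) \<longrightarrow> reduces V E R)"

text \<open>The induction hypothesis as a predicate that can be handed to lemmas; the type argument
  fixes the type of the vertices.\<close>

definition below :: "nat \<Rightarrow> 'a itself \<Rightarrow> bool" where
  "below n _ \<longleftrightarrow> (\<forall>V E. \<forall>R :: ('a \<times> 'a) set. graph_size V E < n \<longrightarrow> claim V E R)"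

lemma below_rooted:
  assumes "below n TYPE('a)" "graph_size V E < n" "solid V E" "rooted V E r z" "2 \<le> card V"
  obtains V' E' where "step V' E' V E" "solid V' E'" "r \<in> V'" "{r, z :: 'a} \<in> E'" "rooted V' E' r z"
proof -
  have "claim V E {(r, z)}" using assms(1,2) unfolding below_def by blast
  moreover have "V \<noteq> {}" using assms(5) by auto
  ultimately have "reduces V E {(r, z)}" using assms(3-5) by (simp add: claim_def)
  then obtain V' E' where "step V' E' V E" "solid V' E'" "r \<in> V'" "{r, z} \<in> E'" by (auto simp: reduces_def)
  then show ?thesis using that step_rooted[OF _ assms(4)] by blast
qed

lemma below_free:
  assumes "below n TYPE('a)" "graph_size V E < n" "solid V E" "V \<noteq> ({} :: 'a set)"
  obtains V' E' where "step V' E' V E" "solid V' E'"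
proof -
  have "claim V E {}" using assms(1,2) unfolding below_def by blast
  then have "reduces V E {}" using assms(3,4) by (simp add: claim_def)
  then show ?thesis using that by (auto simp: reduces_def)
qed

text \<open>\<open>D\<close> is replaced by one vertex \<open>d\<close> with the same three
  neighbours. A set \<open>A\<close> is compared with a set of the old graph: \<open>d\<close> is
  exchanged for \<open>D\<close>; \<open>D\<close> is added if \<open>A\<close> contains two of the
  three neighbours; nothing changes if it contains none. If \<open>A\<close> contains just one,
  \<open>k\<close>, then \<open>k\<close> is dropped and may become a neighbour in place of
  \<open>d\<close>.\<close>

lemma bal_contract_set:
  assumes g: "graph V E" and b: "bal V E" and D: "D \<subseteq> V" and nb: "nb E D = {x, y, w}" and d: "d \<in> D"
    and E3: "{e \<in> E. e \<inter> D = {}} \<union> {{d, x}, {d, y}, {d, w}} \<subseteq> E3"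
    and g3: "graph (insert d (V - D)) E3" and r3: "RR (insert d (V - D)) E3"
  shows "bal (insert d (V - D)) E3"
  unfolding bal_def
proof (intro allI impI)
  fix A assume A: "A \<subseteq> insert d (V - D)" "A \<noteq> {}"
  let ?N = "nb E3 A"
  have fN: "finite ?N" using finite_nb[OF g3] .
  have xyw: "x \<notin> D" "y \<notin> D" "w \<notin> D" using nb by (auto simp: nb_def)
  have dE: "{d, t} \<in> E3" if "t \<in> {x, y, w}" for t using that E3 by auto
  have big: "3 \<le> card (nb E B)" if "B \<subseteq> V" "B \<noteq> {}" for B using b that by (simp add: bal_def)
  show "3 \<le> card ?N"
  proof (cases "d \<in> A")
    case True
    let ?B = "(A - {d}) \<union> D"
    have "nb E ?B \<subseteq> ?N"
    proof
      fix t assume "t \<in> nb E ?B"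
      then obtain u where u: "u \<in> ?B" "{u, t} \<in> E" "t \<notin> ?B" by (auto simp: nb_def)
      have tA: "t \<notin> A" using u(3) d by auto
      show "t \<in> ?N"
      proof (cases "u \<in> D")
        case True
        then have "t \<in> nb E D" using u by (auto simp: nb_def)
        then show ?thesis using dE[of t] nb tA \<open>d \<in> A\<close> by (auto simp: nb_iff)
      next
        case False
        then have "{u, t} \<in> E3" using u E3 by auto
        then show ?thesis using u False tA by (auto simp: nb_iff)
      qed
    qed
    then have "card (nb E ?B) \<le> card ?N" using fN by (intro card_mono)
    moreover have "?B \<subseteq> V" "?B \<noteq> {}" using A D d by auto
    ultimately show ?thesis using big[of ?B] by simp
  next
    case False
    then have AV: "A \<subseteq> V - D" using A by auto
    have toD: "u \<in> {x, y, w}" if "u \<in> A" "{u, t} \<in> E" "t \<in> D" for u t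
    proof -
      have "u \<in> nb E D" unfolding nb_iff using that AV by (auto simp: insert_commute)
      then show ?thesis using nb by simp
    qed
    have keep: "t \<in> nb E3 B" if "t \<in> nb E B" "B \<subseteq> A" "t \<notin> D" for t B
    proof -
      from that(1) obtain u where u: "u \<in> B" "{u, t} \<in> E" "t \<notin> B" by (auto simp: nb_def)
      have "{u, t} \<in> E3" using u that AV E3 by auto
      then show ?thesis using u by (auto simp: nb_iff)
    qed
    have dN: "d \<in> ?N" if "t \<in> A" "t \<in> {x, y, w}" for t
      unfolding nb_iff using dE[OF that(2)] that(1) False by (auto simp: insert_commute)
    show ?thesis
    proof (cases "\<exists>k. A \<inter> {x, y, w} \<subseteq> {k}")
      case False
      then obtain k l where kl: "k \<in> A" "l \<in> A" "k \<in> {x, y, w}" "l \<in> {x, y, w}" "k \<noteq> l" by blast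
      have "nb E (A \<union> D) \<subseteq> (?N - {d}) \<union> ({x, y, w} - {k, l})"
      proof
        fix t assume "t \<in> nb E (A \<union> D)"
        then obtain u where u: "u \<in> A \<union> D" "{u, t} \<in> E" "t \<notin> A \<union> D" by (auto simp: nb_def)
        show "t \<in> (?N - {d}) \<union> ({x, y, w} - {k, l})"
        proof (cases "u \<in> A")
          case True
          then have "t \<in> nb E A" using u by (auto simp: nb_iff)
          then show ?thesis using keep[of t A] u d by auto
        next
          case False
          then have "t \<in> nb E D" using u by (auto simp: nb_iff)
          then show ?thesis using nb u kl by auto
        qed
      qed
      then have "card (nb E (A \<union> D)) \<le> card ((?N - {d}) \<union> ({x, y, w} - {k, l}))" using fN by (intro card_mono) auto
      also have "\<dots> \<le> card (?N - {d}) + card ({x, y, w} - {k, l})" by (rule card_Un_le)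
      also have "card ({x, y, w} - {k, l}) \<le> 1"
      proof -
        have "card ({x, y, w} - {k, l}) = card {x, y, w} - card {k, l}" using kl by (intro card_Diff_subset) auto
        moreover have "card {x, y, w} \<le> 3" by (simp add: card_insert_if)
        ultimately show ?thesis using kl(5) by simp
      qed
      also have "card (?N - {d}) + 1 = card ?N" using card.remove[OF fN dN[OF kl(1,3)]] by simp
      finally have "card (nb E (A \<union> D)) \<le> card ?N" by simp
      moreover have "A \<union> D \<subseteq> V" "A \<union> D \<noteq> {}" using AV D A by auto
      ultimately show ?thesis using big[of "A \<union> D"] by simp
    next
      case True
      then obtain k where k: "A \<inter> {x, y, w} \<subseteq> {k}" by blast
      show ?thesis
      proof (cases "k \<in> A \<and> k \<in> {x, y, w}")
        case False
        then have none: "A \<inter> {x, y, w} = {}" using k by auto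
        have "nb E A \<subseteq> ?N"
        proof
          fix t assume t: "t \<in> nb E A"
          then have "t \<notin> D" using toD none by (auto simp: nb_def)
          then show "t \<in> ?N" using keep t by auto
        qed
        then have "card (nb E A) \<le> card ?N" using fN by (intro card_mono)
        moreover have "A \<subseteq> V" using AV by auto
        ultimately show ?thesis using big[OF _ A(2)] by simp
      next
        case kA: True
        show ?thesis
        proof (cases "A = {k}")
          case True
          \<comment> \<open>Nothing would remain without \<open>k\<close>. But if \<open>k\<close>
            had only two neighbours, redundancy would require two edges from \<open>d\<close> to
            \<open>{k}\<close>.\<close>
          have "RR {k} E3" using RR_contract[OF g3 r3, of "{k}"] A True by auto
          moreover have "graph {k} E3" using g3 by (auto simp: graph_def)
          ultimately show ?thesis
            using RR_nb_two_edges[of "{k}" E3 d] dN[of k] kA True by fastforce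
        next
          case False
          let ?B = "A - {k}"
          have "nb E ?B \<subseteq> (?N - {d}) \<union> {k}"
          proof
            fix t assume t: "t \<in> nb E ?B"
            then obtain u where u: "u \<in> A" "u \<noteq> k" "{u, t} \<in> E" "t \<notin> ?B" by (auto simp: nb_def)
            have tD: "t \<notin> D" using toD[OF u(1,3)] u k by auto
            show "t \<in> (?N - {d}) \<union> {k}"
            proof (cases "t = k")
              case False
              then have "t \<in> nb E A" using u by (auto simp: nb_iff)
              then show ?thesis using keep[of t A] tD d by auto
            qed simp
          qed
          then have "card (nb E ?B) \<le> card ((?N - {d}) \<union> {k})" using fN by (intro card_mono) auto
          also have "\<dots> \<le> card (?N - {d}) + card {k}" by (rule card_Un_le)
          also have "\<dots> = card ?N" using card.remove[OF fN, of d] dN[of k] kA by simp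
          finally have "card (nb E ?B) \<le> card ?N" .
          moreover have "?B \<subseteq> V" "?B \<noteq> {}" using AV False kA by blast+
          ultimately show ?thesis using big[of ?B] by simp
        qed
      qed
    qed
  qed
qed

text \<open>Solidity of the whole does not follow from that of \<open>D\<close> alone. So
  \<open>D\<close> is reduced, with \<open>u\<close> kept attached to \<open>w\<close>, until
  \<open>u\<close> is left alone with neighbours \<open>x\<close>, \<open>y\<close> and
  \<open>w\<close>. That graph is solid by assumption, and the way back up consists of
  steps.\<close>

lemma solid_lift_rooted:
  assumes bl: "below n TYPE('a)"
    and "graph_size D E < n" "solid D E" "rooted D E u w" "nb E D \<subseteq> {x, y, w}" "U \<inter> D = {}"
    and base: "solid (insert u U) ({e \<in> E. e \<inter> D = {}} \<union> {{u, x}, {u, y}, {u, w :: 'a}})"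
  shows "solid (U \<union> D) E"
  using assms(2-)
proof (induction "graph_size D E" arbitrary: D E rule: less_induct)
  case (less D E)
  have g: "graph D E" using less(3) by (simp add: solid_def)
  have u: "u \<in> D" using less(4) by (simp add: rooted_def)
  have fU: "finite U" using less(7) by (auto simp: solid_def graph_def)
  show ?case
  proof (cases "2 \<le> card D")
    case False
    then have D: "D = {u}" using u g card_le_Suc0_iff_eq[of D] by (auto simp: graph_def not_le)
    have "3 \<le> card (nb E {u})" using less(3) u D by (simp add: solid_def bal_def)
    moreover have sub: "nb E {u} \<subseteq> {x, y, w}" using less(5) D by simp
    moreover have "card {x, y, w} \<le> 3" by (simp add: card_insert_if)
    ultimately have "nb E {u} = {x, y, w}" using card_seteq[of "{x, y, w}" "nb E {u}"] by simp
    then have "{{u, x}, {u, y}, {u, w}} \<subseteq> E" by (auto simp: nb_def)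
    moreover have "graph (insert u U) E" using g fU by (auto simp: graph_def)
    ultimately have "solid (insert u U) E" using solid_mono[OF less(7), of E] by auto
    then show ?thesis using D by simp
  next
    case True
    obtain D' E' where s: "step D' E' D E" "solid D' E'" "u \<in> D'" "{u, w} \<in> E'" "rooted D' E' u w"
      using below_rooted[OF bl less(2,3,4) True] .
    have lt: "graph_size D' E' < graph_size D E" using step_size[OF s(1) g] .
    have sub: "D' \<subseteq> D" using step_subset[OF s(1)] .
    have "nb E' D' \<subseteq> {x, y, w}"
    proof
      fix t assume "t \<in> nb E' D'"
      then obtain p where p: "p \<in> D'" "{p, t} \<in> E'" "t \<notin> D'" by (auto simp: nb_def)
      have tD: "t \<notin> D" using step_new_notin[OF s(1), of t] p by auto
      obtain q where "q \<in> D" "{q, t} \<in> E" using step_edge_cases[OF s(1) p(2)] p(1) sub by blast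
      then have "t \<in> nb E D" using tD by (auto simp: nb_def)
      then show "t \<in> {x, y, w}" using less(5) by auto
    qed
    then have "solid (U \<union> D') E'"
      using less(1)[OF lt _ s(2,5)] less(2,6,7) lt sub step_outside[OF s(1)] by auto
    then show ?thesis using step_solid[OF step_lift[OF s(1) less(6)]] by blast
  qed
qed

text \<open>Iterating reductions rooted at \<open>(u, w)\<close> contracts \<open>D\<close> to the single vertex \<open>u\<close>, and then the graph is
  a one-extension of the graph outside \<open>D\<close> at the edge \<open>xy\<close>.\<close>

lemma reduces_inside_rooted:
  assumes bl: "below (graph_size V E) TYPE('a)" and s: "solid V E" and D: "D \<subset> V" "2 \<le> card D"
    and nb: "nb E D = {x, y, w}" and xyw: "distinct [x, y, w]" and root: "rooted D E u (w :: 'a)"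
    and r: "RR (V - D) (insert {x, y} {e \<in> E. e \<inter> D = {}})"
    and R: "\<And>r z. (r, z) \<in> R \<Longrightarrow> r \<in> V - D \<and> z \<notin> V \<and> {r, z} \<in> E"
  shows "reduces V E R"
proof -
  let ?U = "V - D" and ?E0 = "{e \<in> E. e \<inter> D = {}}"
  let ?S = "{{u, x}, {u, y}, {u, w}}"
  have g: "graph V E" using s by (simp add: solid_def)
  have sD: "solid D E" using solid_contract[OF s] D by auto
  have u: "u \<in> D" using root by (simp add: rooted_def)
  have xywD: "x \<notin> D" "y \<notin> D" "w \<notin> D" using nb by (auto simp: nb_def)
  have lt: "graph_size D E < graph_size V E" using graph_size_subset[OF g D(1)] .
  obtain D' E' where st: "step D' E' D E" "solid D' E'" "u \<in> D'" "{u, w} \<in> E'" "rooted D' E' u w"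
    using below_rooted[OF bl lt sD root D(2)] .
  have gD: "graph D E" using sD by (simp add: solid_def)
  have lt': "graph_size D' E' < graph_size V E" using step_size[OF st(1) gD] lt by simp
  have sub: "D' \<subseteq> D" using step_subset[OF st(1)] .
  have "nb E' D' \<subseteq> {x, y, w}"
  proof
    fix t assume "t \<in> nb E' D'"
    then obtain p where p: "p \<in> D'" "{p, t} \<in> E'" "t \<notin> D'" by (auto simp: nb_def)
    have tD: "t \<notin> D" using step_new_notin[OF st(1), of t] p by auto
    obtain q where "q \<in> D" "{q, t} \<in> E" using step_edge_cases[OF st(1) p(2)] p(1) sub by blast
    then have "t \<in> nb E D" using tD by (auto simp: nb_def)
    then show "t \<in> {x, y, w}" using nb by auto
  qed
  moreover have "solid (insert u ?U) (?E0 \<union> ?S)"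
  proof -
    have "u \<noteq> x" "u \<noteq> y" "u \<noteq> w" using u xywD by metis+
    then have g3: "graph (insert u ?U) (?E0 \<union> ?S)" using g by (auto simp: graph_def)
    \<comment> \<open>The edge \<open>xy\<close> need not be in the graph: in the assumption on the
      outside it stands for \<open>D\<close>, and the extension consumes it.\<close>
    have "RR (insert u ?U) (insert {x, y} ?E0 - {{x, y}} \<union> ?S)"
      using g u xywD xyw by (intro RR_one_ext r) (auto simp: graph_def)
    then have r3: "RR (insert u ?U) (?E0 \<union> ?S)" by (rule RR_mono) auto
    have "D \<subseteq> V" using D by auto
    then show ?thesis
      using bal_contract_set[OF g _ _ nb u order_refl g3 r3] g3 r3 s by (simp add: solid_def)
  qed
  ultimately have "solid (?U \<union> D') E'"
    using solid_lift_rooted[OF bl lt' st(2,5), of x y ?U] sub step_outside[OF st(1)] by auto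
  moreover have "step (?U \<union> D') E' V E"
  proof -
    have "?U \<union> D = V" "?U \<inter> D = {}" using D by auto
    then show ?thesis using step_lift[OF st(1), of ?U] by simp
  qed
  moreover have "r \<in> ?U \<union> D' \<and> {r, z} \<in> E'" if rz: "(r, z) \<in> R" for r z
  proof -
    have "{r, z} \<in> {e \<in> E. e \<inter> D = {}}" using R[OF rz] D by auto
    then have "{r, z} \<in> E'" using step_outside[OF st(1)] by blast
    then show ?thesis using R[OF rz] by auto
  qed
  ultimately show ?thesis unfolding reduces_def by blast
qed

text \<open>A pendant edge brings a new vertex, so the pure bound takes care of itself; the ground
  bound is left as an assumption, since the new vertex may be outer.\<close>

lemma ind_insert_pendant:
  assumes I: "ind W I" and e: "p \<noteq> q" "q \<notin> \<Union>I"
    and g: "\<And>T. T \<subseteq> I \<Longrightarrow> card T + 1 \<le> 2 * card ((\<Union>T \<union> {p, q}) \<inter> W)"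
  shows "ind W (insert {p, q} I)" "card (insert {p, q} I) = card I + 1"
proof -
  have fI: "finite I" using M.ind_finite[OF I] .
  have new: "{p, q} \<notin> I" using e by auto
  then show "card (insert {p, q} I) = card I + 1" using fI by simp
  show "ind W (insert {p, q} I)" unfolding ind_def
  proof (intro conjI ballI allI impI)
    show "finite (insert {p, q} I)" using fI by simp
    show "card h = 2" if "h \<in> insert {p, q} I" for h using that e(1) I by (auto simp: ind_def)
    fix T assume T: "T \<subseteq> insert {p, q} I" "T \<noteq> {}"
    have "card T + 3 \<le> 2 * card (\<Union>T) \<and> card T \<le> 2 * card (\<Union>T \<inter> W)"
    proof (cases "{p, q} \<in> T")
      case False
      then have "T \<subseteq> I" using T by auto
      then show ?thesis using ind_pure[OF I _ T(2)] ind_ground[OF I] by blast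
    next
      case True
      define T0 where "T0 = T - {{p, q}}"
      have T0: "T0 \<subseteq> I" "T = insert {p, q} T0" "{p, q} \<notin> T0" using T True by (auto simp: T0_def)
      have fT: "finite T0" "finite (\<Union>T0)" using finite_subset[OF T0(1) fI] ind_finite_Union[OF I T0(1)] by auto
      have cT: "card T = card T0 + 1" using T0 fT by simp
      have UT: "\<Union>T = \<Union>T0 \<union> {p, q}" using T0(2) by auto
      have "card T + 3 \<le> 2 * card (\<Union>T)"
      proof (cases "T0 = {}")
        case True
        then show ?thesis using T0(2) e(1) by simp
      next
        case False
        have "card (insert q (\<Union>T0)) \<le> card (\<Union>T)" using UT fT by (intro card_mono) auto
        moreover have "q \<notin> \<Union>T0" using e(2) T0(1) by auto
        ultimately have "card (\<Union>T0) + 1 \<le> card (\<Union>T)" using fT by simp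
        then show ?thesis using ind_pure[OF I T0(1) False] cT by linarith
      qed
      then show ?thesis using g[OF T0(1)] cT UT by simp
    qed
    then show "card T + 3 \<le> 2 * card (\<Union>T)" "card T \<le> 2 * card (\<Union>T \<inter> W)" by auto
  qed
qed

lemma ind_vertex_mono: "ind V I \<Longrightarrow> V \<subseteq> W \<Longrightarrow> ind W I"
proof -
  assume i: "ind V I" and VW: "V \<subseteq> W"
  have "card T \<le> 2 * card (\<Union>T \<inter> W)" if T: "T \<subseteq> I" for T
  proof -
    have "card (\<Union>T \<inter> V) \<le> card (\<Union>T \<inter> W)"
      using ind_finite_Union[OF i T] VW by (intro card_mono) auto
    then show ?thesis using ind_ground[OF i T] by linarith
  qed
  then show "ind W I" using i by (auto simp: ind_def)
qed

text \<open>With \<open>y\<close> made an inner vertex, \<open>D\<close> and its two neighbours form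
  a rigid body that can only rotate about \<open>x\<close>. Either of the pendant edges
  \<open>yz\<close> and \<open>uv\<close> stops the rotation, and if another edge is deleted, a
  basis for \<open>D\<close> together with both of them has full rank.\<close>

lemma RR_pinned:
  assumes g: "graph D F" and r: "RR D F" and nb: "nb F D = {x, y}" "x \<noteq> y"
    and I: "I \<subseteq> inc D F" "pure I" "card I = 2 * card D + 1"
    and u: "u \<in> D" and v: "v \<notin> D \<union> {x, y}" and z: "z \<notin> D \<union> {x, y}" "z \<noteq> v"
  shows "RR (insert y D) (insert {y, z} (insert {u, v} (inc D F)))" (is "RR ?W ?E")
proof -
  have fD: "finite D" using g by (simp add: graph_def)
  have xyD: "x \<notin> D" "y \<notin> D" using nb by (auto simp: nb_def)
  have cW: "card ?W = card D + 1" using fD xyD by simp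
  have UF: "\<Union>(inc D F) \<subseteq> D \<union> {x, y}" using inc_Union_subset[OF g, of D] nb by simp
  have uv: "u \<noteq> v" "y \<noteq> z" using u v z by auto
  have UI: "\<Union>I \<subseteq> D \<union> {x, y}" using UF I(1) by blast
  have fI: "finite I" "finite (\<Union>I)" using I(2) by (auto simp: pure_def intro: finite_Union_pairs)
  \<comment> \<open>Only \<open>x\<close> lies outside the enlarged vertex set, so the pure bound
    implies the ground bound with one to spare.\<close>
  have pI: "card T + 1 \<le> 2 * card (\<Union>T \<inter> ?W)" if T: "T \<subseteq> I" "T \<noteq> {}" for T
  proof -
    have fT: "finite (\<Union>T)" using fI T by (meson Union_mono finite_subset)
    have "\<Union>T \<subseteq> insert x (\<Union>T \<inter> ?W)" using UI T by blast
    then have "card (\<Union>T) \<le> card (insert x (\<Union>T \<inter> ?W))" using fT by (intro card_mono) auto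
    also have "\<dots> \<le> card (\<Union>T \<inter> ?W) + 1" using fT by (simp add: card_insert_if)
    finally have "card (\<Union>T) \<le> card (\<Union>T \<inter> ?W) + 1" .
    moreover have "card T + 3 \<le> 2 * card (\<Union>T)" using I(2) T by (simp add: pure_def)
    ultimately show ?thesis by linarith
  qed
  have iI: "ind ?W I" unfolding ind_def
  proof (intro conjI ballI allI impI)
    show "card e = 2" if "e \<in> I" for e using I(2) that by (auto simp: pure_def)
    fix T assume T: "T \<subseteq> I" "T \<noteq> {}"
    show "card T + 3 \<le> 2 * card (\<Union>T)" using I(2) T by (simp add: pure_def)
    show "card T \<le> 2 * card (\<Union>T \<inter> ?W)" using pI[OF T] by simp
  qed (use fI in simp)
  have ground: "card T + 1 \<le> 2 * card ((\<Union>T \<union> e) \<inter> ?W)" if T: "T \<subseteq> I" and e: "finite e" "e \<inter> ?W \<noteq> {}" for T e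
  proof -
    have fT: "finite (\<Union>T)" using fI T by (meson Union_mono finite_subset)
    show ?thesis
    proof (cases "T = {}")
      case True
      have "0 < card (e \<inter> ?W)" using e by (simp add: card_gt_0_iff)
      then show ?thesis using True by simp
    next
      case False
      have "card (\<Union>T \<inter> ?W) \<le> card ((\<Union>T \<union> e) \<inter> ?W)" using fT e by (intro card_mono) auto
      then show ?thesis using pI[OF T False] by linarith
    qed
  qed
  have "rigid ?W (?E - {h})" for h
  proof -
    consider "h = {y, z}" | "h \<noteq> {y, z}" "h = {u, v}" | "h \<noteq> {y, z}" "h \<noteq> {u, v}" by blast
    then show ?thesis
    proof cases
      case 1
      have "v \<notin> \<Union>I" using UI v by blast
      note p = ind_insert_pendant[OF iI uv(1) this ground]
      have "ind ?W (insert {u, v} I)" "card (insert {u, v} I) = 2 * card ?W"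
        using p u I(3) cW by auto
      moreover have "{y, z} \<notin> inc D F" "{y, z} \<noteq> {u, v}" using UF z u xyD by (auto simp: doubleton_eq_iff)
      then have "insert {u, v} I \<subseteq> ?E - {h}" using I(1) 1 by auto
      ultimately show ?thesis unfolding rigid_def by blast
    next
      case 2
      have "z \<notin> \<Union>I" using UI z by blast
      note p = ind_insert_pendant[OF iI uv(2) this ground]
      have "ind ?W (insert {y, z} I)" "card (insert {y, z} I) = 2 * card ?W"
        using p I(3) cW by auto
      moreover have "{u, v} \<notin> inc D F" using UF v by auto
      then have "insert {y, z} I \<subseteq> ?E - {h}" using I(1) 2 by auto
      ultimately show ?thesis unfolding rigid_def by blast
    next
      case 3
      obtain J where J: "J \<subseteq> F - {h}" "ind D J" "card J = 2 * card D"
        using RR_delete[OF r, of h] unfolding rigid_def by blast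
      have JF: "J \<subseteq> inc D F - {h}" using J ind_meets[OF J(2)] by (auto simp: inc_def)
      have UJ: "\<Union>J \<subseteq> D \<union> {x, y}" using UF JF by blast
      have iJ: "ind ?W J" using ind_vertex_mono[OF J(2)] by blast
      have vJ: "v \<notin> \<Union>J" using UJ v by blast
      have g1: "card T + 1 \<le> 2 * card ((\<Union>T \<union> {u, v}) \<inter> ?W)" if T: "T \<subseteq> J" for T
      proof -
        have fT: "finite (\<Union>T)" using ind_finite_Union[OF J(2) T] .
        show ?thesis
        proof (cases "y \<in> \<Union>T")
          case True
          have "card (insert y (\<Union>T \<inter> D)) \<le> card ((\<Union>T \<union> {u, v}) \<inter> ?W)"
            using fT True by (intro card_mono) auto
          then have "card (\<Union>T \<inter> D) + 1 \<le> card ((\<Union>T \<union> {u, v}) \<inter> ?W)" using fT xyD by simp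
          then show ?thesis using ind_ground[OF J(2) T] by linarith
        next
          case False
          show ?thesis
          proof (cases "T = {}")
            case True
            have "u \<in> (\<Union>T \<union> {u, v}) \<inter> ?W" using u by simp
            then have "0 < card ((\<Union>T \<union> {u, v}) \<inter> ?W)" using fT by (auto simp: card_gt_0_iff)
            then show ?thesis using True by simp
          next
            case ne: False
            have "\<Union>T \<subseteq> insert x ((\<Union>T \<union> {u, v}) \<inter> ?W)" using UJ T False by blast
            then have "card (\<Union>T) \<le> card (insert x ((\<Union>T \<union> {u, v}) \<inter> ?W))" using fT by (intro card_mono) auto
            also have "\<dots> \<le> card ((\<Union>T \<union> {u, v}) \<inter> ?W) + 1" using fT by (simp add: card_insert_if)
            finally show ?thesis using ind_pure[OF J(2) T ne] by linarith
          qed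
        qed
      qed
      note p1 = ind_insert_pendant[OF iJ uv(1) vJ g1]
      have zJ: "z \<notin> \<Union>(insert {u, v} J)" using UJ z u by auto
      have g2: "card T + 1 \<le> 2 * card ((\<Union>T \<union> {y, z}) \<inter> ?W)" if T: "T \<subseteq> insert {u, v} J" for T
      proof -
        define T0 where "T0 = T - {{u, v}}"
        have T0: "T0 \<subseteq> J" using T by (auto simp: T0_def)
        have fT0: "finite (\<Union>T0)" using ind_finite_Union[OF J(2) T0] .
        have fT: "finite (\<Union>T)" using ind_finite_Union[OF p1(1) T] .
        have "card T - 1 \<le> card T0" unfolding T0_def using diff_card_le_card_Diff[of "{{u, v}}" T] by simp
        moreover have "card (insert y (\<Union>T0 \<inter> D)) \<le> card ((\<Union>T \<union> {y, z}) \<inter> ?W)"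
          using fT by (intro card_mono) (auto simp: T0_def)
        then have "card (\<Union>T0 \<inter> D) + 1 \<le> card ((\<Union>T \<union> {y, z}) \<inter> ?W)" using fT0 xyD by simp
        ultimately show ?thesis using ind_ground[OF J(2) T0] by linarith
      qed
      note p2 = ind_insert_pendant[OF p1(1) uv(2) zJ g2]
      have "card (insert {y, z} (insert {u, v} J)) = 2 * card ?W" using p1(2) p2(2) J(3) cW by simp
      moreover have "insert {y, z} (insert {u, v} J) \<subseteq> ?E - {h}" using JF 3 by auto
      ultimately show ?thesis unfolding rigid_def using p2(1) by blast
    qed
  qed
  then show ?thesis unfolding RR_def using rigid_mono[of ?W "?E - {{}}" ?E] by blast
qed

text \<open>The pin gives \<open>y\<close> a neighbour \<open>z\<close> that no vertex of
  \<open>D\<close> has. A set with \<open>y\<close> may lose \<open>y\<close> as a neighbour of its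
  other vertices, but gains \<open>z\<close>; and \<open>y\<close> alone has \<open>z\<close> and
  two neighbours in \<open>D\<close>.\<close>

lemma bal_pinned:
  assumes g: "graph V E" and b: "bal V E" and D: "D \<subseteq> V" and y: "y \<notin> D"
    and two: "u1 \<in> D" "u2 \<in> D" "u1 \<noteq> u2" "{u1, y} \<in> E" "{u2, y} \<in> E"
    and z: "z \<notin> D" "z \<notin> nb E D" "z \<noteq> y"
  shows "bal (insert y D) (insert {y, z} (inc D E))" (is "bal _ ?E")
  unfolding bal_def
proof (intro allI impI)
  fix A assume A: "A \<subseteq> insert y D" "A \<noteq> {}"
  have gE: "graph (insert y D) ?E" using g D z(3) finite_subset by (auto simp: graph_def inc_def)
  have fN: "finite (nb ?E A)" using finite_nb[OF gE] .
  show "3 \<le> card (nb ?E A)"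
  proof (cases "y \<in> A")
    case False
    then have AD: "A \<subseteq> D" using A by auto
    have "nb E A \<subseteq> nb ?E A" using AD nb_inc[of A D E] nb_mono[of "inc D E" ?E A] by auto
    then have "card (nb E A) \<le> card (nb ?E A)" using fN by (intro card_mono)
    moreover have "3 \<le> card (nb E A)" using b AD D A by (auto simp: bal_def)
    ultimately show ?thesis by simp
  next
    case True
    have zA: "z \<notin> A" using A z by auto
    then have zN: "z \<in> nb ?E A" using True by (auto simp: nb_def)
    show ?thesis
    proof (cases "A = {y}")
      case True
      have "{u1, u2, z} \<subseteq> nb ?E A"
        using True two y zN by (auto simp: nb_def inc_def insert_commute)
      then have "card {u1, u2, z} \<le> card (nb ?E A)" using fN by (intro card_mono)
      moreover have "u1 \<noteq> z" "u2 \<noteq> z" using two z by auto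
      then have "card {u1, u2, z} = 3" using two(3) by simp
      ultimately show ?thesis by simp
    next
      case False
      let ?B = "A - {y}"
      have B: "?B \<subseteq> D" "?B \<noteq> {}" using A False True by auto
      have "insert z (nb E ?B - {y}) \<subseteq> nb ?E A"
      proof
        fix t assume t: "t \<in> insert z (nb E ?B - {y})"
        show "t \<in> nb ?E A"
        proof (cases "t = z")
          case False
          then obtain p where p: "p \<in> ?B" "{p, t} \<in> E" "t \<notin> ?B" "t \<noteq> y" using t by (auto simp: nb_def)
          then have "{p, t} \<in> ?E" using B by (auto simp: inc_def)
          then show ?thesis unfolding nb_iff using p by auto
        qed (use zN in simp)
      qed
      then have le: "card (insert z (nb E ?B - {y})) \<le> card (nb ?E A)" using fN by (intro card_mono)
      have "z \<notin> nb E ?B" using z B by (auto simp: nb_def)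
      then have "card (insert z (nb E ?B - {y})) = card (nb E ?B - {y}) + 1"
        using finite_nb[OF g] by simp
      moreover have "card (nb E ?B) \<le> card (nb E ?B - {y}) + 1"
        using diff_card_le_card_Diff[of "{y}" "nb E ?B"] by simp
      moreover have "3 \<le> card (nb E ?B)" using b B D by (auto simp: bal_def)
      ultimately show ?thesis using le by linarith
    qed
  qed
qed

text \<open>A step of the pinned part is read in the graph where \<open>y\<close> is outer again and
  the pin is gone. As the pin survives the step, it is not the subdivided edge, so the smaller graph
  still has the edge needed for the extension.\<close>

lemma solid_lift_pinned_step:
  assumes st: "step W' F' W F" and y: "y \<in> W'" "{y, z} \<in> F'" "{y, z} \<in> F" and W: "W - {y} \<subseteq> D" and z: "z \<notin> D"
    and U: "U \<inter> D = {}" and E0: "\<And>e. e \<in> E0 \<Longrightarrow> e \<inter> D = {}"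
    and g: "graph (U \<union> (W - {y})) (E0 \<union> (F - {{y, z}}))"
    and s: "solid (U \<union> (W' - {y})) (E0 \<union> (F' - {{y, z}}))"
  shows "solid (U \<union> (W - {y})) (E0 \<union> (F - {{y, z}}))"
  using st
proof (cases rule: stepE)
  case (edge e)
  then show ?thesis using solid_mono[OF s, of "E0 \<union> (F - {{y, z}})"] g by auto
next
  case (vertex v a b c)
  have vy: "v \<noteq> y" using vertex y by auto
  have vD: "v \<in> D" using vertex(3) W vy by auto
  have v: "v \<notin> U \<union> (W' - {y})" "v \<notin> \<Union>(E0 \<union> (F' - {{y, z}}))" using vertex(1,2) vD U E0 by auto
  have eq: "insert v (U \<union> (W' - {y})) = U \<union> (W - {y})" using vertex(3) vy by auto
  have "v \<noteq> z" using vD z by auto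
  then have sub: "E0 \<union> (F' - {{y, z}}) \<union> {{v, a}, {v, b}, {v, c}} \<subseteq> E0 \<union> (F - {{y, z}})"
    unfolding vertex(5) using vy by (auto simp: doubleton_eq_iff)
  show ?thesis
    using solid_mono[OF solid_vertex_add[OF s v vertex(4), unfolded eq] sub g] .
next
  case (ext v a b c)
  have vy: "v \<noteq> y" using ext y by auto
  have vD: "v \<in> D" using ext(3) W vy by auto
  have v: "v \<notin> U \<union> (W' - {y})" "v \<notin> \<Union>(E0 \<union> (F' - {{y, z}}))" using ext(1,2) vD U E0 by auto
  have eq: "insert v (U \<union> (W' - {y})) = U \<union> (W - {y})" using ext(3) vy by auto
  have "v \<noteq> z" using vD z by auto
  then have sub: "E0 \<union> (F' - {{y, z}}) - {{a, b}} \<union> {{v, a}, {v, b}, {v, c}} \<subseteq> E0 \<union> (F - {{y, z}})"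
    unfolding ext(7) using vy by (auto simp: doubleton_eq_iff)
  have "{a, b} \<noteq> {y, z}" using y(3) \<open>v \<noteq> z\<close> vy unfolding ext(7) by (auto simp: doubleton_eq_iff)
  then have "{a, b} \<in> E0 \<union> (F' - {{y, z}})" using ext(5) by simp
  then show ?thesis
    using solid_mono[OF solid_one_ext[OF s v ext(4), unfolded eq] sub g] by blast
qed

text \<open>Besides the outer neighbours, it has to be kept that \<open>v\<close> has at most one
  neighbour in the part; at the end of the reduction this prevents \<open>v\<close> from being
  joined to \<open>y\<close>.\<close>

lemma nb_step_pinned:
  assumes st: "step W' F' W F" and g: "graph W F" and nbW: "nb F W \<subseteq> {x, v, z}"
    and vu: "\<And>p q. p \<in> W \<Longrightarrow> q \<in> W \<Longrightarrow> {p, v} \<in> F \<Longrightarrow> {q, v} \<in> F \<Longrightarrow> p = q"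
    and c3: "3 \<le> card W"
  shows "nb F' W' \<subseteq> {x, v, z}"
    "\<And>p q. p \<in> W' \<Longrightarrow> q \<in> W' \<Longrightarrow> {p, v} \<in> F' \<Longrightarrow> {q, v} \<in> F' \<Longrightarrow> p = q"
    "2 \<le> card W'"
proof -
  have sub: "W' \<subseteq> W" using step_subset[OF st] .
  show "nb F' W' \<subseteq> {x, v, z}"
  proof
    fix t assume "t \<in> nb F' W'"
    then obtain p where p: "p \<in> W'" "{p, t} \<in> F'" "t \<notin> W'" by (auto simp: nb_def)
    have tD: "t \<notin> W" using step_new_notin[OF st, of t] p by auto
    obtain q where "q \<in> W" "{q, t} \<in> F" using step_edge_cases[OF st p(2)] p(1) sub by blast
    then have "t \<in> nb F W" using tD by (auto simp: nb_def)
    then show "t \<in> {x, v, z}" using nbW by auto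
  qed
  have "card W \<le> card W' + 1"
    using st g by (cases rule: stepE) (auto simp: graph_def card_insert_if)
  then show "2 \<le> card W'" using c3 by simp
  fix p q assume pq: "p \<in> W'" "q \<in> W'" "{p, v} \<in> F'" "{q, v} \<in> F'"
  show "p = q"
    using st
  proof (cases rule: stepE)
    case (ext w a b c)
    have w: "w \<in> W" "w \<noteq> p" "w \<noteq> q" "p \<in> W" "q \<in> W" using ext(1,3) pq sub by auto
    have new: "{w, v} \<in> F" if "{t, v} = {a, b}" for t
    proof -
      have "v \<in> {t, v}" by simp
      then have "v \<in> {a, b}" unfolding that .
      then show ?thesis unfolding ext(7) by blast
    qed
    have old: "{t, v} \<in> F" if "{t, v} \<in> F'" "{t, v} \<noteq> {a, b}" for t
      using that unfolding ext(7) by simp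
    show ?thesis
    proof (cases "{p, v} = {a, b} \<or> {q, v} = {a, b}")
      case True
      then have wv: "{w, v} \<in> F" using new by auto
      have "{p, v} = {a, b}"
      proof (rule ccontr)
        assume "{p, v} \<noteq> {a, b}"
        then show False using vu[OF w(1,4) wv old[OF pq(3)]] w(2) by simp
      qed
      moreover have "{q, v} = {a, b}"
      proof (rule ccontr)
        assume "{q, v} \<noteq> {a, b}"
        then show False using vu[OF w(1,5) wv old[OF pq(4)]] w(3) by simp
      qed
      ultimately have "{p, v} = {q, v}" by simp
      then show ?thesis by (auto simp: doubleton_eq_iff)
    next
      case False
      then show ?thesis using vu[OF w(4,5) old[OF pq(3)] old[OF pq(4)]] by simp
    qed
  next
    case (edge e)
    then show ?thesis using vu[of p q] pq by simp
  next
    case (vertex w a b c)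
    then show ?thesis using vu[of p q] pq by simp
  qed
qed

text \<open>As in \<open>solid_lift_rooted\<close>, but the reduction stops at two vertices,
  \<open>y\<close> and some \<open>d\<close>. Their neighbours are then forced: \<open>x\<close>,
  \<open>y\<close> and \<open>v\<close> for \<open>d\<close>, and \<open>x\<close>, \<open>d\<close>
  and \<open>z\<close> for \<open>y\<close>. This is why the graph assumed to be solid contains the
  edge \<open>xy\<close>.\<close>

lemma solid_lift_pinned:
  assumes bl: "below n TYPE('a)"
    and "graph_size W F < n" "solid W F" "rooted W F y z" "nb F W \<subseteq> {x, v, z}"
      "\<And>p q. p \<in> W \<Longrightarrow> q \<in> W \<Longrightarrow> {p, v} \<in> F \<Longrightarrow> {q, v} \<in> F \<Longrightarrow> p = q"
      "W - {y} \<subseteq> D" "2 \<le> card W"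
    and z: "z \<notin> D" and U: "finite U" "U \<inter> D = {}" and E0: "graph U E0" "\<And>e. e \<in> E0 \<Longrightarrow> e \<inter> D = {}"
    and base: "\<And>d. d \<in> D \<Longrightarrow> solid (insert d U) (E0 \<union> {{d, x}, {d, y}, {d, v}, {x, y :: 'a}})"
  shows "solid (U \<union> (W - {y})) (E0 \<union> (F - {{y, z}}))"
  using assms(2-8)
proof (induction "graph_size W F" arbitrary: W F rule: less_induct)
  case (less W F)
  have g: "graph W F" using less(3) by (simp add: solid_def)
  have y: "y \<in> W" "z \<notin> W" "{y, z} \<in> F" using less(4) by (auto simp: rooted_def)
  have gU: "graph (U \<union> (W - {y})) (E0 \<union> (F - {{y, z}}))" using g E0 U by (auto simp: graph_def)
  show ?case
  proof (cases "3 \<le> card W")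
    case False
    then have "card W = 2" using less(8) by simp
    then obtain d where d: "W = {y, d}" "d \<noteq> y" using y(1) by (auto simp: card_2_iff)
    have zonly: "p = y" if "p \<in> W" "{p, z} \<in> F" for p using less(4) that by (auto simp: rooted_def)
    have nbW: "t \<in> {x, v, z}" if "p \<in> W" "{p, t} \<in> F" "t \<notin> W" for p t
      using less(5) that by (auto simp: nb_def)
    have three: "nb F {p} = T" if "p \<in> W" "nb F {p} \<subseteq> T" "card T \<le> 3" "finite T" for p T
    proof -
      have "3 \<le> card (nb F {p})" using less(3) that(1) by (simp add: solid_def bal_def)
      then show ?thesis using card_seteq[OF that(4,2)] that(3) by simp
    qed
    have c3: "card {p, q, t} \<le> 3" for p q t :: 'a by (simp add: card_insert_if)
    have "nb F {d} \<subseteq> {y, x, v}"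
    proof
      fix t assume "t \<in> nb F {d}"
      then have t: "{d, t} \<in> F" "t \<noteq> d" by (auto simp: nb_def)
      have "t \<noteq> z" using zonly[of d] t d by auto
      then show "t \<in> {y, x, v}" using nbW[of d t] t d by auto
    qed
    then have "nb F {d} = {y, x, v}" using three[of d "{y, x, v}"] d c3 by simp
    then have dE: "{d, y} \<in> F" "{d, x} \<in> F" "{d, v} \<in> F" by (auto simp: nb_def)
    have "nb F {y} \<subseteq> {d, x, z}"
    proof
      fix t assume "t \<in> nb F {y}"
      then have t: "{y, t} \<in> F" "t \<noteq> y" by (auto simp: nb_def)
      have "t \<noteq> v" using less(6)[of d y] dE(3) t d by auto
      then show "t \<in> {d, x, z}" using nbW[of y t] t d by auto
    qed
    then have "nb F {y} = {d, x, z}" using three[of y "{d, x, z}"] d c3 by simp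
    then have xy: "{x, y} \<in> F" "x \<noteq> y" by (auto simp: nb_def insert_commute)
    have dD: "d \<in> D" using less(7) d by auto
    have dz: "d \<noteq> z" using dD z by auto
    have xz: "x \<noteq> z" using zonly[of d] dE(2) d by auto
    have "E0 \<union> {{d, x}, {d, y}, {d, v}, {x, y}} \<subseteq> E0 \<union> (F - {{y, z}})"
      using dE xy d(2) dz xz by (auto simp: insert_commute doubleton_eq_iff)
    moreover have "U \<union> (W - {y}) = insert d U" using d by auto
    ultimately show ?thesis using solid_mono[OF base[OF dD]] gU by simp
  next
    case True
    obtain W' F' where s: "step W' F' W F" "solid W' F'" "y \<in> W'" "{y, z} \<in> F'" "rooted W' F' y z"
      using below_rooted[OF bl less(2,3,4)] True by auto
    have lt: "graph_size W' F' < graph_size W F" using step_size[OF s(1) g] .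
    have sub: "W' \<subseteq> W" using step_subset[OF s(1)] .
    note inv = nb_step_pinned[OF s(1) g less(5,6) True]
    have "solid (U \<union> (W' - {y})) (E0 \<union> (F' - {{y, z}}))"
      using less(1)[OF lt _ s(2,5) inv(1,2) _ inv(3)] less(2,7) lt sub by auto
    then show ?thesis by (intro solid_lift_pinned_step[OF s(1,3,4) y(3) less(7) z U(2) E0(2) gU])
  qed
qed

text \<open>Here \<open>D\<close> together with \<open>y\<close> is reduced, pinned by an edge from \<open>y\<close> to an unused vertex \<open>z\<close>, which is the root.\<close>

lemma reduces_inside_pinned:
  assumes bl: "below (graph_size V E) TYPE('a)" and s: "solid V E" and D: "D \<subseteq> V" "D \<noteq> {}"
    and nb: "nb E D = {x, y, v}" and xyv: "distinct [x, y, v]" and vV: "v \<in> V"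
    and u: "u \<in> D" "{u, v} \<in> E" "\<And>p. p \<in> D \<Longrightarrow> {p, v} \<in> E \<Longrightarrow> p = u"
    and z: "z \<notin> D" "z \<notin> {x, y, v}"
    and r: "RR D (E - {{u, v}})" and I: "I \<subseteq> inc D E - {{u, v}}" "pure I" "card I = 2 * card D + 1"
    and base: "\<And>d. d \<in> D \<Longrightarrow> solid (insert d (V - D)) ({e \<in> E. e \<inter> D = {}} \<union> {{d, x}, {d, y}, {d, v}, {x, y :: 'a}})"
    and more: "card (inc D E) + 2 \<le> card (inc V E)"
    and R: "\<And>r z. (r, z) \<in> R \<Longrightarrow> r \<in> V - D \<and> z \<notin> V \<and> {r, z} \<in> E"
  shows "reduces V E R"
proof -
  let ?U = "V - D" and ?E0 = "{e \<in> E. e \<inter> D = {}}" and ?W = "insert y D" and ?F = "insert {y, z} (inc D E)"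
  have g: "graph V E" using s by (simp add: solid_def)
  have fV: "finite V" "finite E" using g by (auto simp: graph_def)
  have fD: "finite D" using fV D finite_subset by auto
  have xyvD: "x \<notin> D" "y \<notin> D" "v \<notin> D" using nb by (auto simp: nb_def)
  have vD: "v \<notin> D \<union> {x, y}" using xyvD xyv by auto
  have yz: "y \<noteq> z" using z by auto
  \<comment> \<open>Without its only edge to \<open>v\<close>, the set \<open>D\<close> has just the
    neighbours \<open>x\<close> and \<open>y\<close>, as \<open>RR_pinned\<close> requires;
    \<open>uv\<close> returns there as a pendant edge.\<close>
  let ?F1 = "E - {{u, v}}"
  have g1: "graph D ?F1" using g fD by (auto simp: graph_def)
  have nb1: "nb ?F1 D = {x, y}"
  proof
    show "nb ?F1 D \<subseteq> {x, y}"
    proof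
      fix t assume "t \<in> nb ?F1 D"
      then obtain p where p: "p \<in> D" "{p, t} \<in> E" "{p, t} \<noteq> {u, v}" "t \<notin> D" by (auto simp: nb_def)
      then have "t \<in> {x, y, v}" using nb by (auto simp: nb_def)
      moreover have "t \<noteq> v" using u(3)[OF p(1)] p by auto
      ultimately show "t \<in> {x, y}" by simp
    qed
    show "{x, y} \<subseteq> nb ?F1 D"
    proof
      fix t assume t: "t \<in> {x, y}"
      then have "t \<in> nb E D" using nb by auto
      then obtain p where p: "p \<in> D" "{p, t} \<in> E" "t \<notin> D" by (auto simp: nb_def)
      have "{p, t} \<noteq> {u, v}" using t xyv u(1) p(3) by (auto simp: doubleton_eq_iff)
      then show "t \<in> nb ?F1 D" using p by (auto simp: nb_iff)
    qed
  qed
  have "{u, v} \<in> inc D E" using u(1,2) by (simp add: inc_def)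
  then have inc1: "insert {u, v} (inc D ?F1) = inc D E" unfolding inc_def by blast
  have "I \<subseteq> inc D ?F1" using I(1) by (auto simp: inc_def)
  then have rW: "RR ?W ?F"
    using RR_pinned[OF g1 r nb1 _ _ I(2,3) u(1) vD, of z] z xyv inc1 by simp
  have "card (nb ?F1 D) \<le> 2" "y \<in> nb ?F1 D" using nb1 by (simp_all add: card_insert_if)
  then obtain u1 u2 where u12: "u1 \<in> D" "u2 \<in> D" "u1 \<noteq> u2" "{u1, y} \<in> E" "{u2, y} \<in> E"
    using RR_nb_two_edges[OF r D(2) g1, of y] by blast
  have znb: "z \<notin> nb E D" using nb z by simp
  have bW: "bal ?W ?F" using bal_pinned[OF g _ D(1) xyvD(2) u12 z(1) znb] s yz by (simp add: solid_def)
  have gW: "graph ?W ?F" using g fD yz by (auto simp: graph_def inc_def)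
  have sW: "solid ?W ?F" using rW bW gW by (simp add: solid_def)
  have zE: "{p, z} \<notin> E" if "p \<in> D" for p using znb z that by (auto simp: nb_def)
  have root: "rooted ?W ?F y z" unfolding rooted_def
  proof (intro conjI ballI impI)
    fix p assume p: "p \<in> ?W" "{p, z} \<in> ?F"
    show "p = y"
    proof (rule ccontr)
      assume "p \<noteq> y"
      then have "p \<in> D" "{p, z} \<in> inc D E" using p by (auto simp: doubleton_eq_iff)
      then show False using zE by (auto simp: inc_def)
    qed
  qed (use z yz in auto)
  have incW: "inc ?W ?F = ?F" by (auto simp: inc_def)
  have "card D + 1 \<le> card V"
  proof -
    have "insert v D \<subseteq> V" using D vV by auto
    then have "card (insert v D) \<le> card V" using fV card_mono by blast
    then show ?thesis using xyvD fD by simp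
  qed
  moreover have "card ?F \<le> card (inc D E) + 1" using finite_inc[OF fV(2)] by (simp add: card_insert_if)
  \<comment> \<open>The pinned part has one vertex and at most one edge more than \<open>D\<close>.
    The vertex is paid for by \<open>v\<close>, and \<open>more\<close> provides two edges.\<close>
  ultimately have lt: "graph_size ?W ?F < graph_size V E"
    using more incW xyvD fD by (simp add: graph_size_def)
  have c2: "2 \<le> card ?W" using fD xyvD D(2) by (simp add: Suc_le_eq card_gt_0_iff)
  obtain W' F' where st: "step W' F' ?W ?F" "solid W' F'" "y \<in> W'" "{y, z} \<in> F'" "rooted W' F' y z"
    using below_rooted[OF bl lt sW root c2] .
  have nbF: "nb ?F ?W \<subseteq> {x, v, z}"
  proof
    fix t assume "t \<in> nb ?F ?W"
    then obtain p where p: "p \<in> ?W" "{p, t} \<in> ?F" "t \<notin> ?W" by (auto simp: nb_def)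
    show "t \<in> {x, v, z}"
    proof (cases "{p, t} = {y, z}")
      case True
      then show ?thesis using p(3) by (auto simp: doubleton_eq_iff)
    next
      case False
      then have pt: "{p, t} \<in> E" "{p, t} \<inter> D \<noteq> {}" using p(2) by (auto simp: inc_def)
      then have "p \<in> D" using p(3) by auto
      then have "t \<in> nb E D" using pt p(3) by (auto simp: nb_def)
      then show ?thesis using nb p(3) by auto
    qed
  qed
  have vuniq: "p = q" if "p \<in> ?W" "q \<in> ?W" "{p, v} \<in> ?F" "{q, v} \<in> ?F" for p q
  proof -
    have "t = u" if t: "t \<in> ?W" "{t, v} \<in> ?F" for t
    proof -
      have "{t, v} \<noteq> {y, z}" using z xyv by (auto simp: doubleton_eq_iff)
      then have "{t, v} \<in> E" "{t, v} \<inter> D \<noteq> {}" using t by (auto simp: inc_def)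
      then show ?thesis using u(3)[of t] xyvD by auto
    qed
    then show ?thesis using that by metis
  qed
  have WD: "?W - {y} = D" using xyvD by auto
  have UD: "?U \<inter> D = {}" by auto
  have gU: "graph ?U ?E0" using g by (auto simp: graph_def)
  have yzD: "{y, z} \<notin> inc D E" using z xyvD by (auto simp: inc_def)
  have E_eq: "?E0 \<union> (?F - {{y, z}}) = E" using yzD by (auto simp: inc_def)
  have V_eq: "?U \<union> D = V" using D by auto
  define L where "L = ?E0 \<union> (F' - {{y, z}})"
  have lt': "graph_size W' F' < graph_size V E" using step_size[OF st(1) gW] lt by simp
  have sub: "W' \<subseteq> ?W" using step_subset[OF st(1)] .
  have W'D: "W' - {y} \<subseteq> D" using sub by auto
  have c3: "3 \<le> card ?W"
  proof -
    have "card {u1, u2} \<le> card D" using u12 fD by (intro card_mono) auto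
    then show ?thesis using u12(3) xyvD fD by simp
  qed
  note inv = nb_step_pinned[OF st(1) gW nbF vuniq c3]
  have sL: "solid (?U \<union> (W' - {y})) L"
    unfolding L_def
    by (rule solid_lift_pinned[OF bl lt' st(2,5) inv(1,2) W'D inv(3) z(1) _ UD gU _ base]) (use fV in auto)
  have yF: "{y, z} \<in> F'" using st(4) .
  have roots: "r \<in> ?U \<union> (W' - {y}) \<and> {r, t} \<in> ?E0" if rt: "(r, t) \<in> R" for r t
    using R[OF rt] D(1) by auto
  show ?thesis
    using st(1)
  proof (cases rule: stepE)
    case (edge e)
    have "e \<noteq> {y, z}" using edge(2) yF by auto
    moreover have "e \<in> ?F" unfolding edge(3) by simp
    ultimately have eE: "e \<in> E" "e \<inter> D \<noteq> {}" by (auto simp: inc_def)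
    have "insert e L = ?E0 \<union> (insert e F' - {{y, z}})" using \<open>e \<noteq> {y, z}\<close> unfolding L_def by blast
    then have E2: "E = insert e L" unfolding edge(3)[symmetric] E_eq by simp
    have eL: "e \<notin> L" using edge(2) eE by (auto simp: L_def)
    have V2: "?U \<union> (W' - {y}) = V" using edge(1) WD V_eq by simp
    have "step V L V E" by (rule step_edge[OF eL E2 edge(4)]) (use eE D in auto)
    moreover have "solid V L" using sL V2 by simp
    moreover have "r \<in> V \<and> {r, t} \<in> L" if "(r, t) \<in> R" for r t using roots[OF that] V2 by (auto simp: L_def)
    ultimately show ?thesis by (rule reducesI)
  next
    case (vertex p a b c)
    have py: "p \<noteq> y" using vertex(1) st(3) by auto
    have pD: "p \<in> D" using vertex(3) py by auto
    have pz: "p \<noteq> z" using pD z by auto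
    have V2: "V = insert p (?U \<union> (W' - {y}))" using vertex(3) WD V_eq py by auto
    have pU: "p \<notin> ?U \<union> (W' - {y})" using pD vertex(1) by auto
    have pL: "p \<notin> \<Union>L" using vertex(2) pD by (auto simp: L_def)
    have alg: "yz \<notin> T \<Longrightarrow> A \<union> (B - {yz}) \<union> T = A \<union> (B \<union> T - {yz})"
      for yz :: "'a set" and A B T by auto
    have "L \<union> {{p, a}, {p, b}, {p, c}} = ?E0 \<union> (F' \<union> {{p, a}, {p, b}, {p, c}} - {{y, z}})"
      unfolding L_def by (rule alg) (use py pz in auto)
    then have E2: "E = L \<union> {{p, a}, {p, b}, {p, c}}" unfolding vertex(5)[symmetric] E_eq by simp
    have "step (?U \<union> (W' - {y})) L V E" by (rule step_vertex[OF pU pL V2 vertex(4) E2])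
    then show ?thesis by (rule reducesI[OF _ sL]) (use roots in \<open>auto simp: L_def\<close>)
  next
    case (ext p a b c)
    have py: "p \<noteq> y" using ext(1) st(3) by auto
    have pD: "p \<in> D" using ext(3) py by auto
    have pz: "p \<noteq> z" using pD z by auto
    have V2: "V = insert p (?U \<union> (W' - {y}))" using ext(3) WD V_eq py by auto
    have pU: "p \<notin> ?U \<union> (W' - {y})" using pD ext(1) by auto
    have pL: "p \<notin> \<Union>L" using ext(2) pD by (auto simp: L_def)
    have alg: "yz \<notin> T \<Longrightarrow> A \<union> (A \<union> (B - {yz}) - {ab}) \<union> T = A \<union> (B - {ab} \<union> T - {yz})"
      for yz ab :: "'a set" and A B T by auto
    have "{y, z} \<in> F' - {{a, b}} \<union> {{p, a}, {p, b}, {p, c}}" unfolding ext(7)[symmetric] by simp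
    then have abyz: "{a, b} \<noteq> {y, z}" using py pz by auto
    then have abL: "{a, b} \<in> L" using ext(5) by (simp add: L_def)
    have "?E0 \<union> (L - {{a, b}}) \<union> {{p, a}, {p, b}, {p, c}} =
        ?E0 \<union> (F' - {{a, b}} \<union> {{p, a}, {p, b}, {p, c}} - {{y, z}})"
      unfolding L_def by (rule alg) (use py pz in auto)
    then have E1: "E = ?E0 \<union> (L - {{a, b}}) \<union> {{p, a}, {p, b}, {p, c}}"
      unfolding ext(7)[symmetric] E_eq by simp
    \<comment> \<open>The subdivided edge \<open>ab\<close> may be an edge outside \<open>D\<close>
      that the whole graph still has, or may have no inner end once \<open>y\<close> is outer. In
      both cases the step turns into the addition of a vertex.\<close>
    show ?thesis
    proof (cases "{a, b} \<in> ?E0")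
      case True
      then have "?E0 \<union> (L - {{a, b}}) = L" unfolding L_def by blast
      then have E2: "E = L \<union> {{p, a}, {p, b}, {p, c}}" using E1 by simp
      have "step (?U \<union> (W' - {y})) L V E" by (rule step_vertex[OF pU pL V2 ext(4) E2])
      then show ?thesis by (rule reducesI[OF _ sL]) (use roots in \<open>auto simp: L_def\<close>)
    next
      case False
      then have "?E0 \<union> (L - {{a, b}}) = L - {{a, b}}" unfolding L_def by blast
      then have E2: "E = L - {{a, b}} \<union> {{p, a}, {p, b}, {p, c}}" using E1 by simp
      have roots': "{r, t} \<in> L - {{a, b}}" if "(r, t) \<in> R" for r t
        using roots[OF that] False by (auto simp: L_def)
      show ?thesis
      proof (cases "{a, b} \<inter> (?U \<union> (W' - {y})) = {}")
        case False
        have "step (?U \<union> (W' - {y})) L V E" by (rule step_ext[OF pU pL V2 ext(4) abL False E2])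
        then show ?thesis by (rule reducesI[OF _ sL]) (use roots in \<open>auto simp: L_def\<close>)
      next
        case True
        have sL': "solid (?U \<union> (W' - {y})) (L - {{a, b}})"
        proof (rule solid_cong[OF sL])
          show "inc (?U \<union> (W' - {y})) L \<subseteq> L - {{a, b}}" using True unfolding inc_def by blast
          show "graph (?U \<union> (W' - {y})) (L - {{a, b}})" using sL by (auto simp: solid_def graph_def)
        qed
        have "step (?U \<union> (W' - {y})) (L - {{a, b}}) V E"
          by (rule step_vertex[OF pU _ V2 ext(4) E2]) (use pL in auto)
        then show ?thesis by (rule reducesI[OF _ sL']) (use roots roots' in auto)
      qed
    qed
  qed
qed

subsection \<open>Reducing a redundantly rigid graph\<close>

text \<open>The pure set becomes independent when all its vertices are taken as inner ones, and then
  \<open>ind_compose\<close> applies.\<close>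

lemma pure_compose:
  assumes I: "pure I" "\<Union>I \<inter> Y = {}" and J: "ind Y J" and Y: "finite Y"
  shows "pure (I \<union> J)" "card (I \<union> J) = card I + card J"
proof -
  have fI: "finite (\<Union>I)" using I(1) by (auto simp: pure_def intro: finite_Union_pairs)
  have "ind (\<Union>I) I" unfolding ind_def
  proof (intro conjI ballI allI impI)
    fix T assume T: "T \<subseteq> I" "T \<noteq> {}"
    then have "card T + 3 \<le> 2 * card (\<Union>T)" using I(1) by (simp add: pure_def)
    moreover have "\<Union>T \<inter> \<Union>I = \<Union>T" using T by auto
    ultimately show "card T + 3 \<le> 2 * card (\<Union>T)" "card T \<le> 2 * card (\<Union>T \<inter> \<Union>I)" by auto
  qed (use I(1) in \<open>auto simp: pure_def\<close>)
  note i = ind_compose[OF this J I(2,2) fI Y] ind_compose_card[OF this J I(2)]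
  show "pure (I \<union> J)" using ind_imp_pure[OF i(1)] .
  show "card (I \<union> J) = card I + card J" using i(2) .
qed

lemma RR_inc_mono:
  assumes "RR D E1" "inc D E1 \<subseteq> E2"
  shows "RR D E2"
  using RR_mono[of D "inc D E1" E2] RR_inc assms by blast

lemma card_le_3_eq: "A \<subseteq> {x, y, z} \<Longrightarrow> 3 \<le> card A \<Longrightarrow> A = {x, y, z}"
proof (rule card_seteq)
  assume "3 \<le> card A"
  moreover have "card {x, y, z} \<le> 3" by (simp add: card_insert_if)
  ultimately show "card {x, y, z} \<le> card A" by simp
qed simp_all

text \<open>\<open>v\<close> has been removed, and \<open>M\<close> holds the edge that repaired
  this, if any. In the reduced graph \<open>D\<close> is hinged at \<open>x\<close> and
  \<open>y\<close>; the edge \<open>vp\<close> is what joined it to more. If \<open>q\<close> is in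
  \<open>D\<close> or the repairing edge is \<open>pq\<close>, then \<open>v\<close> joins
  \<open>D\<close> and \<open>vt\<close> is the root; otherwise \<open>v\<close> is the third
  neighbour of \<open>D\<close>, which is reduced with a pin.\<close>

lemma reduces_of_removed_node:
  assumes bl: "below (graph_size V E) TYPE('a)" and s: "solid V (E :: 'a set set)"
    and v: "v \<notin> V1" "v \<notin> \<Union>E1" "V = insert v V1" and dis: "distinct [v, p, q, t]"
    and E: "E = E1 - M \<union> {{v, p}, {v, q}, {v, t}}" and M: "M = {} \<or> M = {{p, q}} \<or> M = {{q, t}}"
    and D: "D \<subseteq> V1" "2 \<le> card D" and nb1: "nb E1 D = {x, y}" "x \<noteq> y"
    and p: "p \<in> D" and t: "t \<notin> D" "t \<notin> {x, y}" and ME: "M \<subseteq> E1"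
    and rD: "RR D E1" and I: "I \<subseteq> inc D E1" "pure I" "card I = 2 * card D + 1"
    and RRout: "RR (V1 - D) (insert {x, y} {e \<in> E1. e \<inter> D = {}})"
    and notall: "\<And>D' u w. rooted D' E u w \<Longrightarrow> (\<And>r z. (r, z) \<in> R \<Longrightarrow> r \<notin> D') \<Longrightarrow> D' \<noteq> V"
    and R: "\<And>r z. (r, z) \<in> R \<Longrightarrow> r \<in> V1 - D \<and> z \<notin> V \<and> {r, z} \<in> E"
  shows "reduces V E R"
proof -
  have g: "graph V E" using s by (simp add: solid_def)
  have fV: "finite V" "finite E" using g by (auto simp: graph_def)
  have bV: "3 \<le> card (nb E A)" if "A \<subseteq> V" "A \<noteq> {}" for A using s that by (simp add: solid_def bal_def)
  have DV: "D \<subseteq> V" "D \<noteq> {}" "v \<notin> D" using D v by auto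
  have xyD: "x \<notin> D" "y \<notin> D" using nb1 by (auto simp: nb_def)
  have "x \<in> nb E1 D" "y \<in> nb E1 D" using nb1 by simp_all
  then have xyv: "x \<noteq> v" "y \<noteq> v" using v(2) by (auto simp: nb_def)
  have pqt: "v \<noteq> p" "v \<noteq> q" "v \<noteq> t" "p \<noteq> q" "p \<noteq> t" "q \<noteq> t" using dis by auto
  have E1: "{u, w} \<in> E1" if "{u, w} \<in> E" "u \<noteq> v" "w \<noteq> v" for u w
    using that E by (auto simp: doubleton_eq_iff)
  have out1: "w \<in> {x, y}" if "u \<in> D" "{u, w} \<in> E1" "w \<notin> D" for u w
    using nb1 that by (auto simp: nb_def)
  have vT: "w \<in> {p, q, t}" if "{v, w} \<in> E" for w
    using that E v(2) by (auto simp: doubleton_eq_iff)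
  show ?thesis
  proof (cases "q \<in> D \<or> {p, q} \<in> M")
    case True
    let ?D = "insert v D"
    have q: "q \<in> D \<union> {x, y}" using True out1[OF p, of q] ME by auto
    have M1: "e \<inter> D \<noteq> {}" if "e \<in> M" for e
    proof (cases "q \<in> D")
      case False
      then have "M = {{p, q}}" using True M by auto
      then show ?thesis using that p by auto
    qed (use that M p in auto)
    have nbE: "nb E ?D = {x, y, t}"
    proof (rule card_le_3_eq)
      show "3 \<le> card (nb E ?D)" using bV[of ?D] v D by auto
      show "nb E ?D \<subseteq> {x, y, t}"
      proof
        fix w assume "w \<in> nb E ?D"
        then obtain u where u: "u \<in> ?D" "{u, w} \<in> E" "w \<notin> ?D" by (auto simp: nb_def)
        show "w \<in> {x, y, t}"
        proof (cases "u = v")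
          case True
          then show ?thesis using vT[of w] u q p by auto
        next
          case False
          then show ?thesis using E1[OF u(2)] out1[of u w] u by auto
        qed
      qed
    qed
    have root: "rooted ?D E v t" unfolding rooted_def
    proof (intro conjI ballI impI)
      fix u assume u: "u \<in> ?D" "{u, t} \<in> E"
      show "u = v"
      proof (rule ccontr)
        assume "u \<noteq> v"
        then have "{u, t} \<in> E1" "u \<in> D" using E1[OF u(2)] u(1) pqt by auto
        then show False using out1 t by blast
      qed
    qed (use t pqt E in auto)
    have "?D \<noteq> V" using notall[OF root] R v by blast
    then have DV': "?D \<subset> V" using DV v by auto
    have "card D \<le> card ?D" using fV DV by (intro card_mono) (auto intro: finite_subset)
    then have c: "2 \<le> card ?D" using D by simp
    have "V - ?D = V1 - D" using v by auto
    moreover have "{e \<in> E1. e \<inter> D = {}} \<subseteq> {e \<in> E. e \<inter> ?D = {}}"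
      using M1 v(2) E by auto
    ultimately have rr: "RR (V - ?D) (insert {x, y} {e \<in> E. e \<inter> ?D = {}})"
      using RR_mono[OF RRout, of "insert {x, y} {e \<in> E. e \<inter> ?D = {}}"] by auto
    show ?thesis
      by (rule reduces_inside_rooted[OF bl s DV' c nbE _ root rr]) (use nb1 t R v in auto)
  next
    case False
    then have q: "q \<notin> D" and M': "M \<subseteq> {{q, t}}" using M by auto
    have nbE: "nb E D = {x, y, v}"
    proof (rule card_le_3_eq)
      show "3 \<le> card (nb E D)" using bV[of D] DV by auto
      show "nb E D \<subseteq> {x, y, v}"
      proof
        fix w assume "w \<in> nb E D"
        then obtain u where u: "u \<in> D" "{u, w} \<in> E" "w \<notin> D" by (auto simp: nb_def)
        then show "w \<in> {x, y, v}" using E1[OF u(2)] out1[of u w] u DV by auto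
      qed
    qed
    have incE: "inc D E1 \<subseteq> inc D E - {{p, v}}"
      using M' q t(1) v(2) E by (auto simp: inc_def)
    have r: "RR D (E - {{p, v}})" using RR_inc_mono[OF rD, of "E - {{p, v}}"] incE inc_subset by blast
    have uni: "u = p" if "u \<in> D" "{u, v} \<in> E" for u
      using vT[of u] that q t by (auto simp: insert_commute)
    have base: "solid (insert d (V - D)) ({e \<in> E. e \<inter> D = {}} \<union> {{d, x}, {d, y}, {d, v}, {x, y}})"
      (is "solid ?V3 ?E3") if d: "d \<in> D" for d
    proof -
      have dn: "d \<noteq> x" "d \<noteq> y" "d \<noteq> v" "d \<noteq> q" "d \<noteq> t" using d xyD DV q t by auto
      \<comment> \<open>The required graph arises from the outside of \<open>D\<close>, with
        \<open>xy\<close> in place of \<open>D\<close>, by two extensions: \<open>v\<close> at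
        \<open>qt\<close> with third neighbour \<open>x'\<close>, then \<open>d\<close> at the new
        edge \<open>vx'\<close> with third neighbour \<open>y'\<close>. For the first,
        \<open>x'\<close> must differ from \<open>q\<close>; the edge \<open>xy\<close> survives
        both.\<close>
      obtain x' y' where xy': "{x', y'} = {x, y}" "x' \<noteq> y'" "x' \<noteq> q"
        using nb1(2) by (cases "x = q") auto
      have xs: "x' \<in> {x, y}" "y' \<in> {x, y}" using xy'(1) by auto
      let ?E10 = "{e \<in> E1. e \<inter> D = {}}"
      let ?A = "insert {q, t} (insert {x, y} ?E10)"
      let ?B = "?A - {{q, t}} \<union> {{v, q}, {v, t}, {v, x'}}"
      let ?C = "?B - {{v, x'}} \<union> {{d, v}, {d, x'}, {d, y'}}"
      have fV1: "finite V1" using fV v by simp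
      have "RR (V1 - D) ?A" using RRout by (rule RR_mono) auto
      then have "RR (insert v (V1 - D)) ?B"
      proof (rule RR_one_ext[rotated])
        show "v \<notin> V1 - D" "v \<notin> \<Union>?A" using v(1,2) pqt xyv by auto
        show "distinct [v, q, t, x']" using pqt xyv xs xy'(3) t by auto
      qed (use fV1 in auto)
      then have C: "RR (insert d (insert v (V1 - D))) ?C"
      proof (rule RR_one_ext[rotated])
        show "d \<notin> insert v (V1 - D)" using d dn by auto
        show "d \<notin> \<Union>?B" using d dn xs by auto
        have "v \<noteq> x'" "v \<noteq> y'" "d \<noteq> x'" "d \<noteq> y'" using dn xs xyv by auto
        then show "distinct [d, v, x', y']" using xy'(2) dn(3) by simp
      qed (use fV1 in auto)
      have VD: "insert v (V1 - D) = V - D" using v DV by auto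
      have "?C \<subseteq> ?E3"
      proof
        fix e assume "e \<in> ?C"
        then have "e = {x, y} \<or> e \<in> ?E10 \<and> e \<noteq> {q, t} \<or> e = {v, q} \<or> e = {v, t} \<or> e = {d, v} \<or>
            e = {d, x'} \<or> e = {d, y'}"
          unfolding Un_iff Diff_iff insert_iff empty_iff by argo
        then consider "e = {x, y}" | "e \<in> ?E10" "e \<noteq> {q, t}" | "e = {v, q}" | "e = {v, t}" | "e = {d, v}"
          | "e = {d, x'}" | "e = {d, y'}" by argo
        then show "e \<in> ?E3"
        proof cases
          case 2
          then have "e \<notin> M" using M' by auto
          then show ?thesis using 2 E by auto
        qed (use xs q t DV E in auto)
      qed
      from RR_mono[OF C[unfolded VD] this] have r3: "RR ?V3 ?E3" .
      have g3: "graph ?V3 ?E3" using g dn nb1(2) by (auto simp: graph_def)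
      have "bal ?V3 ?E3"
        by (rule bal_contract_set[OF g _ DV(1) nbE d _ g3 r3]) (use s in \<open>auto simp: solid_def\<close>)
      then show ?thesis using g3 r3 by (simp add: solid_def)
    qed
    have more: "card (inc D E) + 2 \<le> card (inc V E)"
    proof -
      have "card (inc D E \<union> {{v, q}, {v, t}}) \<le> card (inc V E)"
        using fV DV v(3) E by (intro card_mono finite_inc) (auto simp: inc_def)
      moreover have "card (inc D E \<union> {{v, q}, {v, t}}) = card (inc D E) + card {{v, q}, {v, t}}"
        using fV DV q t by (intro card_Un_disjoint finite_inc) (auto simp: inc_def)
      moreover have "{v, q} \<noteq> {v, t}" using pqt by (auto simp: doubleton_eq_iff)
      ultimately show ?thesis by simp
    qed
    have dxy: "distinct [x, y, v]" using nb1 xyv by auto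
    have pv: "{p, v} \<in> E" using E by (auto simp: insert_commute)
    have It: "I \<subseteq> inc D E - {{p, v}}" using I(1) incE by (rule order_trans)
    have vV: "v \<in> V" using v by simp
    have tt: "t \<notin> {x, y, v}" using t pqt by auto
    show ?thesis
      by (rule reduces_inside_pinned[OF bl s DV(1,2) nbE dxy vV p pv uni t(1) tt r It I(2,3) base more])
        (use R v in auto)
  qed
qed

text \<open>If \<open>(V1, E1)\<close> fails only because some \<open>D\<close> has two neighbours, the step is exchanged for one inside \<open>D\<close>,
  possibly enlarged by the removed vertex.\<close>

lemma reduces_of_insep_part:
  assumes bl: "below (graph_size V E) TYPE('a)" and s: "solid V (E :: 'a set set)"
    and R1: "\<And>r z. (r, z) \<in> R \<Longrightarrow> rooted V E r z" and nolab: "R = {} \<Longrightarrow> \<not> (\<exists>r z. rooted V E r z)"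
    and st: "step V1 E1 V E" and R2: "\<And>r z. (r, z) \<in> R \<Longrightarrow> r \<in> V1 \<and> {r, z} \<in> E1"
    and W: "W \<subseteq> V1" and F: "F = {e \<in> E1. e \<inter> W \<noteq> {} \<and> e \<inter> (V1 - W) = {}}"
    and rF: "RR W F" and sF: "M.insep W F" and rY: "RR (V1 - W) E1" and bY: "bal (V1 - W) E1"
  shows "reduces V E R"
proof (cases "bal V1 E1")
  case True
  have g: "graph V E" using s by (simp add: solid_def)
  have g1: "graph V1 E1" using step_graph[OF st g] .
  have "RR V1 E1"
  proof -
    have "RR (W \<union> (V1 - W)) E1"
      by (rule RR_compose[OF rF rY]) (use F W g1 finite_subset[OF W] in \<open>auto simp: graph_def\<close>)
    then show ?thesis using W by (simp add: Un_absorb1)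
  qed
  then have "solid V1 E1" using g1 True by (simp add: solid_def)
  then show ?thesis by (rule reducesI[OF st]) (use R2 in auto)
next
  case False
  have g: "graph V E" using s by (simp add: solid_def)
  have fV: "finite V" "finite E" and c2: "\<And>e. e \<in> E \<Longrightarrow> card e = 2" using g by (auto simp: graph_def)
  have g1: "graph V1 E1" using step_graph[OF st g] .
  have fV1: "finite V1" "finite E1" and c21: "\<And>e. e \<in> E1 \<Longrightarrow> card e = 2" using g1 by (auto simp: graph_def)
  have V1V: "V1 \<subseteq> V" using step_subset[OF st] .
  have fW: "finite W" using finite_subset[OF W fV1(1)] .
  have r1: "RR V1 E1"
  proof -
    have "RR (W \<union> (V1 - W)) E1" by (rule RR_compose[OF rF rY]) (use F fW fV1 in auto)
    then show ?thesis using W by (simp add: Un_absorb1)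
  qed
  have bV: "3 \<le> card (nb E A)" if "A \<subseteq> V" "A \<noteq> {}" for A using s that by (simp add: solid_def bal_def)
  obtain D where D: "D \<subseteq> V1" "D \<noteq> {}" "card (nb E1 D) \<le> 2"
    using False unfolding bal_def by (metis not_less_eq_eq numeral_2_eq_2 numeral_3_eq_3)
  have DV: "D \<subseteq> V" using D V1V by auto
  have fD: "finite D" using finite_subset[OF D(1) fV1(1)] .
  have gD: "graph D E1" using g1 fD by (simp add: graph_def)
  have rD: "RR D E1" using RR_contract[OF g1 r1 D(1)] .
  have "card (nb E1 D) = 2" using RR_card_nb[OF rD D(2) gD] D(3) by simp
  then obtain x y where nb1: "nb E1 D = {x, y}" "x \<noteq> y" by (auto simp: card_2_iff)
  have xyD: "x \<notin> D" "y \<notin> D" using nb1 by (auto simp: nb_def)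
  have two: "\<exists>p\<in>D. \<exists>q\<in>D. p \<noteq> q \<and> {p, t} \<in> E1 \<and> {q, t} \<in> E1" if "t \<in> {x, y}" for t
    using RR_nb_two_edges[OF rD D(2) gD D(3), of t] nb1 that by auto
  have cD: "2 \<le> card D"
  proof -
    obtain p q where "p \<in> D" "q \<in> D" "p \<noteq> q" using two[of x] by blast
    then have "{p, q} \<subseteq> D" "card {p, q} = 2" by auto
    then show ?thesis using card_mono[OF fD, of "{p, q}"] by simp
  qed
  define DW where "DW = D \<inter> W"
  have DWne: "DW \<noteq> {}"
  proof
    assume "DW = {}"
    then have "D \<subseteq> V1 - W" using D by (auto simp: DW_def)
    then have "3 \<le> card (nb E1 D)" using bY D(2) by (simp add: bal_def)
    then show False using D(3) by simp
  qed
  have gF: "graph W F" using g1 fW by (auto simp: F graph_def)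
  have mF: "e \<inter> W \<noteq> {}" if "e \<in> F" for e using that by (simp add: F)
  have DW: "DW \<subseteq> W" by (simp add: DW_def)
  \<comment> \<open>The trace of \<open>D\<close> on \<open>W\<close> needs two neighbours by
    rigidity of \<open>W\<close>, so these are \<open>x\<close> and \<open>y\<close>, and neither is
    a vertex outside \<open>W\<close>.\<close>
  have subnb: "nb F DW \<subseteq> {x, y} - (V1 - W)"
  proof
    fix t assume "t \<in> nb F DW"
    then obtain p where p: "p \<in> DW" "{p, t} \<in> F" "t \<notin> DW" by (auto simp: nb_def)
    have t: "t \<notin> V1 - W" using p(2) by (auto simp: F)
    then have "t \<notin> D" using p(3) D(1) by (auto simp: DW_def)
    then have "t \<in> nb E1 D" using p by (auto simp: nb_def F DW_def)
    then show "t \<in> {x, y} - (V1 - W)" using nb1 t by auto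
  qed
  have "2 \<le> card (nb F DW)"
    using RR_card_nb[OF RR_contract[OF gF rF DW] DWne graph_subset[OF gF DW order_refl]] .
  moreover have "nb F DW \<subseteq> {x, y}" using subnb by auto
  ultimately have nbF: "nb F DW = {x, y}" using card_seteq[of "{x, y}" "nb F DW"] nb1(2) by simp
  have xyY: "x \<notin> V1 - W" "y \<notin> V1 - W" using subnb nbF by auto
  let ?E10 = "{e \<in> E1. e \<inter> D = {}}"
  \<comment> \<open>Within \<open>W\<close> the edge \<open>xy\<close> replaces \<open>D\<close> by
    \<open>split_RR\<close>. The vertices outside both \<open>W\<close> and \<open>D\<close> have no
    edges to \<open>D\<close>, because \<open>x\<close> and \<open>y\<close> are not among them, so
    they keep all their edges.\<close>
  have RRout: "RR (V1 - D) (insert {x, y} ?E10)"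
  proof -
    let ?X = "W - DW" and ?Y = "V1 - W - D"
    have "RR ?X (insert {x, y} (F - inc DW F))"
      by (rule split_RR[OF gF rF sF DW DWne mF nbF nb1(2)])
    note X = this
    have Y: "RR ?Y (insert {x, y} ?E10)"
    proof (rule RR_inc_mono)
      show "RR ?Y E1"
        using RR_contract[of "V1 - W" E1 ?Y] g1 rY by (auto simp: graph_def)
      show "inc ?Y E1 \<subseteq> insert {x, y} ?E10"
      proof
        fix e assume e: "e \<in> inc ?Y E1"
        then obtain q where q: "q \<in> e" "q \<in> ?Y" "e \<in> E1" by (auto simp: inc_def)
        have "e \<inter> D = {}"
        proof (rule ccontr)
          assume "e \<inter> D \<noteq> {}"
          then have "q \<in> nb E1 D" using nbI[OF c21[OF q(3)] q(3) _ q(1)] q(2) by auto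
          then show False using nb1 xyY q(2) by auto
        qed
        then show "e \<in> insert {x, y} ?E10" using q by simp
      qed
    qed
    have "RR (?X \<union> ?Y) (insert {x, y} ?E10)"
    proof (rule RR_compose[OF X Y])
      show "?X \<inter> ?Y = {}" by auto
      show "insert {x, y} (F - inc DW F) \<subseteq> insert {x, y} ?E10"
        using D(1) by (auto simp: F inc_def DW_def)
      show "\<Union>(insert {x, y} (F - inc DW F)) \<inter> ?Y = {}" using xyY by (auto simp: F)
    qed (use fW fV1 in auto)
    moreover have "?X \<union> ?Y = V1 - D" using W by (auto simp: DW_def)
    ultimately show ?thesis by simp
  qed
  \<comment> \<open>The private outer vertex of a root in \<open>D\<close> would be one of the
    hinges, but a hinge has two neighbours in \<open>D\<close>.\<close>
  have rnotD: "r \<notin> D" if rz: "(r, z) \<in> R" for r z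
  proof
    assume rD: "r \<in> D"
    have root1: "rooted V1 E1 r z" using step_rooted[OF st R1[OF rz]] R2[OF rz] by auto
    then have "z \<in> nb E1 D" using rD D(1) by (auto simp: nb_def rooted_def)
    then obtain p q where pq: "p \<in> D" "q \<in> D" "p \<noteq> q" "{p, z} \<in> E1" "{q, z} \<in> E1"
      using two nb1 by blast
    then show False using root1 D(1) unfolding rooted_def by blast
  qed
  \<comment> \<open>A part that avoids the given root is not all of \<open>V\<close>; if no root is
    given, the whole graph has none, whereas the part has one.\<close>
  have notall: "D' \<noteq> V" if "rooted D' E u w" "\<And>r z. (r, z) \<in> R \<Longrightarrow> r \<notin> D'" for D' u w
  proof
    assume eq: "D' = V"
    show False
    proof (cases "R = {}")
      case True
      then show False using nolab that(1) eq by blast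
    next
      case False
      then obtain r z where rz: "(r, z) \<in> R" by auto
      then have "r \<in> V" using R1 by (auto simp: rooted_def)
      then show False using that(2)[OF rz] eq by simp
    qed
  qed
  have Rz: "z \<notin> V" "{r, z} \<in> E" "r \<in> V" if "(r, z) \<in> R" for r z using R1[OF that] by (auto simp: rooted_def)
  have Dne: "\<not> nb E A \<subseteq> {x, y}" if "A \<subseteq> V" "A \<noteq> {}" for A
  proof
    assume "nb E A \<subseteq> {x, y}"
    then have "card (nb E A) \<le> card {x, y}" by (intro card_mono) auto
    then show False using bV[OF that] nb1(2) by simp
  qed
  have out1: "w \<in> {x, y}" if "u \<in> D" "{u, w} \<in> E1" "w \<notin> D" for u w
    using nb1 that by (auto simp: nb_def)
  \<comment> \<open>\<open>split_braced\<close> makes the trace of \<open>D\<close> on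
    \<open>W\<close> a rigid body, to which the vertices of \<open>D\<close> outside
    \<open>W\<close> are attached by a basis of their own.\<close>
  obtain I where I: "I \<subseteq> inc D E1" "pure I" "card I = 2 * card D + 1"
  proof -
    let ?Q = "D - W"
    obtain I1 where I1: "I1 \<subseteq> inc DW F" "pure I1" "card I1 = 2 * card DW + 1"
      using split_braced[OF gF RR_rigid[OF rF] sF DW DWne mF nbF nb1(2)] .
    have "?Q \<subseteq> V1 - W" using D(1) by auto
    moreover have "graph (V1 - W) E1" using g1 by (simp add: graph_def)
    ultimately have "rigid ?Q (inc ?Q E1)" using RR_contract[OF _ rY] by (simp add: rigid_inc RR_rigid)
    then obtain I2 where I2: "I2 \<subseteq> inc ?Q E1" "ind ?Q I2" "card I2 = 2 * card ?Q"
      unfolding rigid_def by blast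
    have disj: "\<Union>I1 \<inter> ?Q = {}" using I1(1) D(1) by (auto simp: inc_def F)
    have fQ: "finite ?Q" using fD by simp
    note i = pure_compose[OF I1(2) disj I2(2) fQ]
    have "D = DW \<union> ?Q" "DW \<inter> ?Q = {}" by (auto simp: DW_def)
    then have "card D = card DW + card ?Q" using fD card_Un_disjoint[of DW ?Q] by (simp add: DW_def)
    then have "card (I1 \<union> I2) = 2 * card D + 1" using i(2) I1(3) I2(3) by simp
    moreover have "I1 \<union> I2 \<subseteq> inc D E1" using I1(1) I2(1) by (auto simp: inc_def F DW_def)
    ultimately show ?thesis using that i(1) by blast
  qed
  have node: "reduces V E R"
    if v: "v \<notin> V1" "v \<notin> \<Union>E1" "V = insert v V1" and dis: "distinct [v, a, b, c]"
      and E: "E = E1 - M \<union> {{v, a}, {v, b}, {v, c}}" and M: "M = {} \<or> M = {{a, b}}" "M \<subseteq> E1" for v a b c M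
  proof -
    have E1: "{u, w} \<in> E1" if "{u, w} \<in> E" "u \<noteq> v" "w \<noteq> v" for u w
      using that E by (auto simp: doubleton_eq_iff)
    have vT: "w \<in> {a, b, c}" if "{v, w} \<in> E" for w
      using that E v(2) by (auto simp: doubleton_eq_iff)
    have vD: "v \<notin> D" using v(1) D(1) by blast
    \<comment> \<open>In the old graph neither \<open>D\<close> nor \<open>D\<close> with
      \<open>v\<close> has all its neighbours among \<open>x\<close> and \<open>y\<close>. The
      second fact gives a neighbour \<open>t\<close> of \<open>v\<close> away from \<open>D\<close>
      and the hinge, the first a neighbour \<open>p\<close> in \<open>D\<close>.\<close>
    obtain t where t: "t \<in> {a, b, c}" "t \<notin> D" "t \<notin> {x, y}"
    proof -
      obtain t where t: "t \<in> nb E (insert v D)" "t \<notin> {x, y}" using Dne[of "insert v D"] DV v by auto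
      then obtain u where u: "u \<in> insert v D" "{u, t} \<in> E" "t \<notin> insert v D" by (auto simp: nb_def)
      then have "u = v" using E1[OF u(2)] out1[of u t] t by auto
      then show ?thesis using that vT[of t] u t by auto
    qed
    obtain p where p: "p \<in> {a, b, c}" "p \<in> D"
    proof -
      obtain w where w: "w \<in> nb E D" "w \<notin> {x, y}" using Dne[OF DV D(2)] by auto
      then obtain u where u: "u \<in> D" "{u, w} \<in> E" "w \<notin> D" by (auto simp: nb_def)
      then have "w = v" using E1[OF u(2)] out1[of u w] w vD by auto
      then show ?thesis using that vT[of u] u by (auto simp: insert_commute)
    qed
    \<comment> \<open>So the repairing edge, if there is one, has the third neighbour
      \<open>q\<close> as an end.\<close>
    have pt: "{p, t} \<notin> E1" using out1[OF p(2)] t by blast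
    have "p \<noteq> t" using p t by auto
    obtain q where q: "distinct [v, p, q, t]" "{{v, a}, {v, b}, {v, c}} = {{v, p}, {v, q}, {v, t}}"
      "{a, b} \<in> {{p, q}, {q, t}, {p, t}}"
    proof -
      consider "p = a" "t = b" | "p = a" "t = c" | "p = b" "t = a" | "p = b" "t = c" | "p = c" "t = a" | "p = c" "t = b"
        using p(1) t(1) \<open>p \<noteq> t\<close> by auto
      then show ?thesis
      proof cases
        case 1 show ?thesis by (rule that[of c]) (use 1 dis in auto)
      next
        case 2 show ?thesis by (rule that[of b]) (use 2 dis in auto)
      next
        case 3 show ?thesis by (rule that[of c]) (use 3 dis in auto)
      next
        case 4 show ?thesis by (rule that[of a]) (use 4 dis in auto)
      next
        case 5 show ?thesis by (rule that[of b]) (use 5 dis in auto)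
      next
        case 6 show ?thesis by (rule that[of a]) (use 6 dis in auto)
      qed
    qed
    have M': "M = {} \<or> M = {{p, q}} \<or> M = {{q, t}}"
    proof (cases "M = {}")
      case False
      then have "M = {{a, b}}" "{a, b} \<in> E1" using M by simp_all
      moreover have "{a, b} = {p, q} \<or> {a, b} = {q, t} \<or> {a, b} = {p, t}"
        using q(3) unfolding insert_iff empty_iff by argo
      ultimately show ?thesis using pt by (elim disjE) simp_all
    qed simp
    show ?thesis
      by (rule reduces_of_removed_node[OF bl s v q(1) E[unfolded q(2)] M' D(1) cD nb1 p(2) t(2,3) M(2) rD I RRout notall])
        (use R2 Rz rnotD in blast)+
  qed
  show ?thesis
    using st
  proof (cases rule: stepE)
    case (edge f)
    have sub: "nb E1 D \<subseteq> nb E D" by (rule nb_mono) (simp add: edge(3) subset_insertI)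
    obtain w where w: "w \<in> nb E D" "w \<noteq> x" "w \<noteq> y" using Dne[OF DV D(2)] by auto
    then obtain u where u: "u \<in> D" "{u, w} \<in> E" "w \<notin> D" by (auto simp: nb_def)
    have uw1: "{p, w} \<notin> E1" if "p \<in> D" for p using nb1 w u(3) that by (auto simp: nb_def)
    then have f: "f = {u, w}" using u edge(3) by auto
    have nbE: "nb E D = {x, y, w}"
    proof
      show "{x, y, w} \<subseteq> nb E D" using sub nb1 w by auto
      show "nb E D \<subseteq> {x, y, w}"
      proof
        fix t assume "t \<in> nb E D"
        then obtain p where p: "p \<in> D" "{p, t} \<in> E" "t \<notin> D" by (auto simp: nb_def)
        show "t \<in> {x, y, w}"
        proof (cases "{p, t} = {u, w}")
          case True
          then have "t \<in> {u, w}" by auto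
          then show ?thesis using p u by auto
        next
          case False
          then have "{p, t} \<in> E1" using p edge(3) f by simp
          then show ?thesis using p nb1 by (auto simp: nb_def)
        qed
      qed
    qed
    have root: "rooted D E u w" unfolding rooted_def
    proof (intro conjI ballI impI)
      fix p assume p: "p \<in> D" "{p, w} \<in> E"
      then have "{p, w} = {u, w}" using uw1[OF p(1)] edge(3) f by auto
      then show "p = u" using p(1) u(3) by (auto simp: doubleton_eq_iff)
    qed (use u in auto)
    have "D \<noteq> V" using notall[OF root] rnotD by blast
    then have DV': "D \<subset> V" using DV by auto
    have "RR (V - D) (insert {x, y} {e \<in> E. e \<inter> D = {}})"
      using RR_mono[OF RRout, of "insert {x, y} {e \<in> E. e \<inter> D = {}}"] edge(1,3) by auto
    then show ?thesis
      by (intro reduces_inside_rooted[OF bl s DV' cD nbE _ root]) (use nb1 w rnotD Rz in auto)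
  next
    case (vertex v a b c)
    show ?thesis by (rule node[OF vertex(1-4), of "{}"]) (use vertex(5) in simp_all)
  next
    case (ext v a b c)
    show ?thesis by (rule node[OF ext(1-4,7)]) (use ext(5) in simp_all)
  qed
qed

text \<open>The certificates are exactly the tight sets that the new edge would overload. Without
  them every proper subset of the new edge set is independent, while the whole is one above the
  ground bound.\<close>

lemma (in tight_graph) one_reduction:
  assumes st: "star v a b c" and ng: "\<not> gcert v a b" and np: "\<not> pcert v a b"
  shows "{a, b} \<inter> V \<noteq> {}" "{a, b} \<notin> E"
    and "M.circuit (V - {v}) (insert {a, b} (E - {{v, a}, {v, b}, {v, c}}))" (is "M.circuit ?V1 ?C")
    and "card (insert {a, b} (E - {{v, a}, {v, b}, {v, c}})) = 2 * card (V - {v}) + 1"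
proof -
  let ?S = "{{v, a}, {v, b}, {v, c}}"
  have v: "v \<in> V" and dis: "distinct [v, a, b, c]" and S: "{e \<in> E. v \<in> e} = ?S"
    using st unfolding star_def by blast+
  have ab: "a \<noteq> b" "v \<noteq> a" "v \<noteq> b" using dis by auto
  have cV: "card V = card ?V1 + 1" using v fin card_V by simp
  have V1ne: "?V1 \<noteq> {}"
  proof
    assume "?V1 = {}"
    then have "card ?V1 = 0" by (simp only: card.empty)
    then show False using cV card_V by simp
  qed
  have gt_no: "\<not> gt X" if "X \<subset> ?V1" "{a, b} \<inter> V \<subseteq> X" for X
    using ng that unfolding gcert_def by blast
  have pt_no: "\<not> pt P" if "v \<notin> P" "a \<in> P" "b \<in> P" for P
    using np that unfolding pcert_def by blast
  show abV: "{a, b} \<inter> V \<noteq> {}"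
  proof
    assume 0: "{a, b} \<inter> V = {}"
    have "ie {} = {}" using meets by (auto simp: ie_def)
    then have "gt {}" by (simp add: gt_def)
    moreover have "{} \<subset> ?V1" using V1ne by (simp add: psubset_eq)
    ultimately show False using gt_no[of "{}"] 0 by simp
  qed
  show abE: "{a, b} \<notin> E"
  proof
    assume "{a, b} \<in> E"
    then have "{{a, b}} \<subseteq> ip {a, b}" by (simp add: ip_def)
    then have "1 \<le> card (ip {a, b})" using card_mono[of "ip {a, b}" "{{a, b}}"] by simp
    moreover have "card (ip {a, b}) + 3 \<le> 2 * card {a, b}" using ab by (intro ip_le) auto
    ultimately have "pt {a, b}" using ab by (simp add: pt_def)
    then show False using pt_no[of "{a, b}"] ab by simp
  qed
  have SE: "?S \<subseteq> E" using S by blast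
  have vE: "v \<notin> e" if "e \<in> E - ?S" for e using that S by blast
  have "card ?C = card (E - ?S) + 1" using abE fin by simp
  also have "card (E - ?S) = card E - 3" using SE card_star3[OF dis] by (subst card_Diff_subset) auto
  finally show cC: "card ?C = 2 * card ?V1 + 1" using card_E cV card_V by simp
  define C where "C = ?C"
  have fC: "finite C" using fin by (simp add: C_def)
  have memC: "e \<in> E \<and> v \<notin> e" if "e \<in> C" "e \<noteq> {a, b}" for e using that vE[of e] by (simp add: C_def)
  have c2: "card e = 2" if "e \<in> C" for e
    using that memC[OF that] card2[of e] ab by (cases "e = {a, b}") simp_all
  have vC: "v \<notin> e" if "e \<in> C" for e using that memC[OF that] ab by (cases "e = {a, b}") simp_all
  note cC' = cC[folded C_def]
  have ground: "card T \<le> 2 * card (\<Union>T \<inter> ?V1)" if T: "T \<subset> C" for T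
  proof -
    let ?X = "\<Union>T \<inter> ?V1"
    have fT: "finite T" using T fC finite_subset psubset_imp_subset by metis
    show ?thesis
    proof (cases "?X = ?V1")
      case True
      then show ?thesis using psubset_card_mono[OF fC T] cC' by simp
    next
      case False
      then have X: "?X \<subset> ?V1" by blast
      then have XV: "?X \<subset> V" by blast
      have "T - {{a, b}} \<subseteq> ie ?X"
      proof
        fix e assume e: "e \<in> T - {{a, b}}"
        then have "e \<in> E" "v \<notin> e" using T memC[of e] by blast+
        then show "e \<in> ie ?X" using e by (auto simp: ie_def)
      qed
      then have c: "card (T - {{a, b}}) \<le> card (ie ?X)" by (intro card_mono) simp_all
      note le = ie_le[OF XV]
      show ?thesis
      proof (cases "{a, b} \<in> T")
        case True
        then have "{a, b} \<inter> V \<subseteq> ?X" using ab by auto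
        then have "card (ie ?X) \<noteq> 2 * card ?X" using gt_no[OF X] XV by (auto simp: gt_def)
        moreover have "card T = card (T - {{a, b}}) + 1" using card.remove[OF fT True] by simp
        ultimately show ?thesis using c le by linarith
      next
        case False
        then show ?thesis using c le by simp
      qed
    qed
  qed
  have pure: "card T + 3 \<le> 2 * card (\<Union>T)" if T: "T \<subset> C" "T \<noteq> {}" for T
  proof -
    let ?P = "\<Union>T"
    have fT: "finite T" using T fC finite_subset psubset_imp_subset by metis
    have fP: "finite ?P" using T by (intro finite_Union_pairs[OF fT] c2) blast
    have vP: "v \<notin> ?P" using vC T by blast
    have P2: "2 \<le> card ?P"
    proof -
      obtain e where e: "e \<in> T" using T(2) by (auto simp only: ex_in_conv[symmetric])
      then have "e \<subseteq> ?P" by (rule Union_upper)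
      then show ?thesis using card_mono[OF fP, of e] c2[of e] e T by auto
    qed
    have "T - {{a, b}} \<subseteq> ip ?P"
    proof
      fix e assume e: "e \<in> T - {{a, b}}"
      then have "e \<in> E" using T memC[of e] by blast
      then show "e \<in> ip ?P" using e by (auto simp: ip_def)
    qed

    then have c: "card (T - {{a, b}}) \<le> card (ip ?P)" by (intro card_mono) simp_all
    note le = ip_le[OF fP P2]
    show ?thesis
    proof (cases "{a, b} \<in> T")
      case True
      then have "\<not> pt ?P" using pt_no[OF vP] by blast
      then have "card (ip ?P) + 3 \<noteq> 2 * card ?P" using fP P2 by (simp add: pt_def)
      moreover have "card T = card (T - {{a, b}}) + 1" using card.remove[OF fT True] by simp
      ultimately show ?thesis using c le by linarith
    next
      case False
      then show ?thesis using c le by simp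
    qed
  qed
  have "ind ?V1 (C - {x})" if x: "x \<in> C" for x
    unfolding ind_def
  proof (intro conjI ballI allI impI)
    fix T assume T: "T \<subseteq> C - {x}" "T \<noteq> {}"
    then have "T \<subset> C" using x by blast
    then show "card T + 3 \<le> 2 * card (\<Union>T)" "card T \<le> 2 * card (\<Union>T \<inter> ?V1)"
      using pure ground T(2) by blast+
  qed (use fC c2 in auto)
  moreover have "\<not> ind ?V1 C"
  proof
    assume "ind ?V1 C"
    then have "card C \<le> 2 * card ?V1" by (rule ind_le_card) (use fin in auto)
    then show False using cC' by simp
  qed
  ultimately have "M.circuit ?V1 C" using fC unfolding M.circuit_def by blast
  then show "M.circuit ?V1 ?C" by (simp only: C_def)
qed

section \<open>Reductions found through a circuit\<close>

lemma circuit_RR: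
  assumes C: "M.circuit W C" "card C = 2 * card W + 1"
  shows "RR W C"
proof -
  have del: "rigid W (C - {g})" if "g \<in> C" for g
    using that C unfolding rigid_def M.circuit_def by (intro exI[of _ "C - {g}"]) simp
  moreover obtain g where "g \<in> C" using M.circuit_nonempty[OF C(1)] by blast
  ultimately show ?thesis unfolding RR_def using rigid_mono[OF del, of g C] by blast
qed

text \<open>A circuit of size \<open>2 * card W + 1\<close> has full rank for \<open>W\<close>, so
  all edges of the graph that belong to \<open>W\<close> are redundantly rigid and inseparable along
  with it.\<close>

lemma reduces_of_circuit_part:
  assumes bl: "below (graph_size V E) TYPE('a)" and s: "solid V (E :: 'a set set)"
    and R1: "\<And>r z. (r, z) \<in> R \<Longrightarrow> rooted V E r z" and nolab: "R = {} \<Longrightarrow> \<not> (\<exists>r z. rooted V E r z)"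
    and st: "step V1 E1 V E" and R2: "\<And>r z. (r, z) \<in> R \<Longrightarrow> r \<in> V1 \<and> {r, z} \<in> E1"
    and W: "W \<subseteq> V1" and C: "M.circuit W C" "card C = 2 * card W + 1" "C \<subseteq> E1"
    and CW: "\<And>e. e \<in> C \<Longrightarrow> e \<inter> W \<noteq> {} \<and> e \<inter> (V1 - W) = {}"
    and rY: "RR (V1 - W) E1" and bY: "bal (V1 - W) E1"
  shows "reduces V E R"
proof -
  define F where "F = {e \<in> E1. e \<inter> W \<noteq> {} \<and> e \<inter> (V1 - W) = {}}"
  have CF: "C \<subseteq> F" using C(3) CW unfolding F_def by blast
  have g: "graph V E" using s by (simp add: solid_def)
  have g1: "graph V1 E1" using step_graph[OF st g] .
  have fF: "finite F" using g1 by (simp add: F_def graph_def)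
  have fW: "finite W" using W g1 finite_subset by (auto simp: graph_def)
  have rC: "RR W C" using circuit_RR[OF C(1,2)] .
  have rF: "RR W F" using RR_mono[OF rC CF] .
  have fC: "finite C" using finite_subset[OF CF fF] .
  have "M.rk W C = M.rk W F"
    using rigid_rk[OF fC fW] rigid_rk[OF fF fW] RR_rigid[OF rC] RR_rigid[OF rF] by simp
  moreover have "ind W {x}" if "x \<in> F" for x
    using that g1 fW by (intro ind_single) (auto simp: F_def graph_def)
  ultimately have "M.insep W F" using M.insep_superset[OF M.insep_circuit[OF C(1)] CF fF] by blast
  then show ?thesis using reduces_of_insep_part[OF bl s R1 nolab st R2 W F_def rF _ rY bY] by blast
qed

lemma bal_empty: "bal {} E"
  by (simp add: bal_def)

text \<open>No edge joins the two sides, before or after the step, so every set of vertices has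
  three neighbours through its part on one side.\<close>

lemma reduce_closed:
  assumes bl: "below (graph_size V E) TYPE('a)" and s: "solid V (E :: 'a set set)"
    and Y: "Y \<subset> V" "Y \<noteq> {}" and cl: "\<And>e. e \<in> E \<Longrightarrow> e \<inter> Y \<noteq> {} \<Longrightarrow> e \<inter> (V - Y) = {}"
    and R: "\<And>r z. (r, z) \<in> R \<Longrightarrow> rooted V E r z \<and> r \<notin> Y"
  shows "reduces V E R"
proof -
  have g: "graph V E" using s by (simp add: solid_def)
  have YV: "Y \<subseteq> V" using Y by blast
  obtain Y' E' where st: "step Y' E' Y E" "solid Y' E'"
    using below_free[OF bl graph_size_subset[OF g Y(1)] solid_contract[OF s YV] Y(2)] .
  let ?U = "V - Y"
  let ?V1 = "?U \<union> Y'"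
  have Y'Y: "Y' \<subseteq> Y" using step_subset[OF st(1)] .
  have "?U \<inter> Y = {}" "?U \<union> Y = V" using YV by auto
  then have st1: "step ?V1 E' V E" using step_lift[OF st(1), of ?U] by simp
  note g1 = step_graph[OF st1 g]
  have out: "{e \<in> E'. e \<inter> Y' = {}} = {e \<in> E. e \<inter> Y = {}}" using step_outside[OF st(1)] .
  have keep: "e \<in> E'" if "e \<in> E" "e \<inter> ?U \<noteq> {}" for e
  proof -
    have "e \<inter> Y = {}" using cl[OF that(1)] that(2) by blast
    then show ?thesis using out that(1) by blast
  qed
  have cl': "t \<notin> ?U" if pt: "p \<in> Y'" "{p, t} \<in> E'" for p t
  proof
    assume t: "t \<in> ?U"
    obtain q where "q \<in> Y" "{q, t} \<in> E" using step_edge_cases[OF st(1) pt(2)] pt(1) Y'Y by blast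
    then show False using cl[of "{q, t}"] t by auto
  qed
  have "RR ?U {e \<in> E'. e \<inter> Y' = {}}"
  proof (rule RR_inc_mono)
    show "RR ?U E" using RR_contract[OF g, of ?U] s by (auto simp: solid_def)
    show "inc ?U E \<subseteq> {e \<in> E'. e \<inter> Y' = {}}" using cl unfolding out inc_def by blast
  qed
  then have "RR ?V1 E'"
    by (rule RR_compose) (use st(2) Y'Y g1 in \<open>auto simp: solid_def graph_def\<close>)
  moreover have "bal ?V1 E'" unfolding bal_def
  proof (intro allI impI)
    fix A assume A: "A \<subseteq> ?V1" "A \<noteq> {}"
    have fin: "finite (nb E' A)" using finite_nb[OF g1] .
    show "3 \<le> card (nb E' A)"
    proof (cases "A \<inter> Y' = {}")
      case True
      then have "A \<subseteq> ?U" using A by blast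
      then have "nb E A \<subseteq> nb E' A" unfolding nb_def using keep by blast
      then have "card (nb E A) \<le> card (nb E' A)" using fin by (intro card_mono)
      moreover have "3 \<le> card (nb E A)" using s A(2) \<open>A \<subseteq> ?U\<close> unfolding solid_def bal_def by blast
      ultimately show ?thesis by simp
    next
      case False
      have "nb E' (A \<inter> Y') \<subseteq> nb E' A"
      proof
        fix t assume "t \<in> nb E' (A \<inter> Y')"
        then obtain p where p: "p \<in> A" "p \<in> Y'" "{p, t} \<in> E'" "t \<notin> A \<inter> Y'" by (auto simp: nb_def)
        then have "t \<notin> A" using cl'[OF p(2,3)] A(1) by blast
        then show "t \<in> nb E' A" using p by (auto simp: nb_def)
      qed
      then have "card (nb E' (A \<inter> Y')) \<le> card (nb E' A)" using fin by (intro card_mono)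
      moreover have "3 \<le> card (nb E' (A \<inter> Y'))" using st(2) False by (simp add: solid_def bal_def)
      ultimately show ?thesis by simp
    qed
  qed
  ultimately have "solid ?V1 E'" using g1 by (simp add: solid_def)
  then show ?thesis
  proof (rule reducesI[OF st1])
    fix r z assume "(r, z) \<in> R"
    then have "rooted V E r z" "r \<notin> Y" using R by auto
    then show "r \<in> ?V1 \<and> {r, z} \<in> E'" using keep[of "{r, z}"] by (auto simp: rooted_def)
  qed
qed

lemma inc_delete: "inc V (E - F) = inc V E - F"
  by (auto simp: inc_def)

lemma RR_circuit:
  assumes "graph V E" "RR V E" "g \<in> inc V E"
  obtains C where "M.circuit V C" "C \<subseteq> inc V E" "g \<in> C"
proof -
  have fin: "finite V" "finite (inc V E)" using assms(1) finite_inc by (auto simp: graph_def)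
  have "rigid V (inc V E - {g})" using RR_delete[OF assms(2), of g] rigid_inc[of V "E - {g}"] by (simp add: inc_delete)
  moreover have "rigid V (inc V E)" using RR_rigid[OF assms(2)] by (simp add: rigid_inc)
  ultimately have "M.rk V (inc V E - {g}) = M.rk V (inc V E)"
    using rigid_rk[OF fin(2,1)] rigid_rk[of "inc V E - {g}" V] fin by simp
  then show ?thesis using M.circuit_of_rk_delete[OF fin(2) _ assms(3)] that by blast
qed

text \<open>The circuit must exceed the ground bound, \<open>card C = 2 * card W + 1\<close>; one
  that violates only the pure bound would have too small a rank. It must also contain the root, so
  that no reduction away from it can touch the root.\<close>

lemma reduce_insep:
  assumes bl: "below (graph_size V E) TYPE('a)" and s: "solid V (E :: 'a set set)"
    and one: "\<And>p q. p \<in> R \<Longrightarrow> q \<in> R \<Longrightarrow> p = q"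
    and R1: "\<And>r z. (r, z) \<in> R \<Longrightarrow> rooted V E r z" and nolab: "R = {} \<Longrightarrow> \<not> (\<exists>r z. rooted V E r z)"
    and cV: "2 \<le> card V" and ins: "M.insep V (inc V E)"
  shows "reduces V E R"
proof -
  let ?H = "inc V E"
  have g: "graph V E" using s by (simp add: solid_def)
  have fV: "finite V" "finite E" using g by (auto simp: graph_def)
  have fH: "finite ?H" using finite_inc[OF fV(2)] .
  have rr: "RR V E" using s by (simp add: solid_def)
  have Vne: "V \<noteq> {}" using cV by auto
  have Hc2: "card e = 2" "e \<inter> V \<noteq> {}" "e \<in> E" if "e \<in> ?H" for e
    using that g by (auto simp: inc_def graph_def)
  have Rz: "r \<in> V" "z \<notin> V" "{r, z} \<in> ?H" "\<And>u. u \<in> V \<Longrightarrow> {u, z} \<in> E \<Longrightarrow> u = r" if "(r, z) \<in> R" for r z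
    using R1[OF that] by (auto simp: rooted_def inc_def)
  \<comment> \<open>Given a root, its outer end lies on no other edge of \<open>C\<close>, so the
    pure bound for the other edges is good enough for all of \<open>C\<close>. Without a root,
    \<open>C\<close> is taken through edges to two different outer vertices, which enter the pure
    bound in addition to the vertices of \<open>V\<close>.\<close>
  obtain C where C: "M.circuit V C" "C \<subseteq> ?H" "\<And>r z. (r, z) \<in> R \<Longrightarrow> {r, z} \<in> C"
    and lo: "card C + 3 \<le> 2 * card (\<Union>C)"
  proof (cases "R = {}")
    case False
    then obtain r z where rz: "(r, z) \<in> R" by auto
    let ?g = "{r, z}"
    obtain C where C: "M.circuit V C" "C \<subseteq> ?H" "?g \<in> C" using RR_circuit[OF g rr Rz(3)[OF rz]] .
    have RC: "{r', z'} \<in> C" if "(r', z') \<in> R" for r' z' using one[OF that rz] C(3) by simp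
    have fC: "finite C" using finite_subset[OF C(2) fH] .
    let ?D = "C - {?g}"
    have iD: "ind V ?D" using C by (simp add: M.circuit_def)
    have "?D \<noteq> {}"
    proof
      assume "?D = {}"
      then have "C = {?g}" using C(3) by blast
      moreover have "ind V {?g}" using Hc2[OF Rz(3)[OF rz]] fV by (intro ind_single)
      ultimately show False using C(1) by (simp add: M.circuit_def)
    qed
    then have "card ?D + 3 \<le> 2 * card (\<Union>?D)" using ind_pure[OF iD order_refl] by simp
    moreover have "card (\<Union>?D) + 1 \<le> card (\<Union>C)"
    proof -
      have zD: "z \<notin> \<Union>?D"
      proof
        assume "z \<in> \<Union>?D"
        then obtain e where e: "e \<in> C" "e \<noteq> ?g" "z \<in> e" by blast
        then have eH: "e \<in> ?H" using C(2) by blast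
        then obtain u where u: "u \<in> e" "u \<in> V" using Hc2(2) by blast
        then have "e = {u, z}" using pair_other[OF Hc2(1)[OF eH]] e(3) Rz(2)[OF rz] by blast
        then show False using Rz(4)[OF rz u(2)] Hc2(3)[OF eH] e(2) by simp
      qed
      have fU: "finite (\<Union>C)" using fC Hc2(1) C(2) by (intro finite_Union_pairs) blast+
      have "insert z (\<Union>?D) \<subseteq> \<Union>C" using C(3) by blast
      then have "card (insert z (\<Union>?D)) \<le> card (\<Union>C)" using fU by (intro card_mono)
      moreover have "finite (\<Union>?D)" by (rule finite_subset[OF _ fU]) blast
      ultimately show ?thesis using zD by simp
    qed
    moreover have "card C = card ?D + 1" using card.remove[OF fC C(3)] by simp
    ultimately have "card C + 3 \<le> 2 * card (\<Union>C)" by simp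
    then show ?thesis using that C(1,2) RC by blast
  next
    case True
    have "3 \<le> card (nb E V)" using s Vne by (simp add: solid_def bal_def)
    then have "\<not> card (nb E V) \<le> Suc 0" by simp
    then obtain t1 t2 where t: "t1 \<in> nb E V" "t2 \<in> nb E V" "t1 \<noteq> t2"
      using card_le_Suc0_iff_eq[OF finite_nb[OF g]] by blast
    obtain u1 u2 where u: "u1 \<in> V" "{u1, t1} \<in> ?H" "t1 \<notin> V" "u2 \<in> V" "{u2, t2} \<in> ?H" "t2 \<notin> V"
      using t by (auto simp: nb_def inc_def)
    then have "{u1, t1} \<noteq> {u2, t2}" using t(3) by (auto simp: doubleton_eq_iff)
    then obtain C where C: "M.circuit V C" "C \<subseteq> ?H" "{u1, t1} \<in> C" "{u2, t2} \<in> C"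
      using M.insep_common_circuit[OF ins fH u(2,5)] by blast
    have fC: "finite C" using finite_subset[OF C(2) fH] .
    have "ind V (C - {{u1, t1}})" using C by (simp add: M.circuit_def)
    then have "card (C - {{u1, t1}}) \<le> 2 * card (\<Union>(C - {{u1, t1}}) \<inter> V)" using ind_ground by blast
    also have "card (\<Union>(C - {{u1, t1}}) \<inter> V) \<le> card (\<Union>C \<inter> V)" using fV by (intro card_mono) auto
    finally have "card C \<le> 2 * card (\<Union>C \<inter> V) + 1" using card.remove[OF fC C(3)] by simp
    moreover have "card (\<Union>C \<inter> V \<union> {t1, t2}) \<le> card (\<Union>C)"
    proof (rule card_mono)
      show "finite (\<Union>C)" using fC Hc2(1) C(2) by (intro finite_Union_pairs) blast+
      show "\<Union>C \<inter> V \<union> {t1, t2} \<subseteq> \<Union>C" using C(3,4) by blast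
    qed
    moreover have "card (\<Union>C \<inter> V \<union> {t1, t2}) = card (\<Union>C \<inter> V) + card {t1, t2}"
      using fV u by (intro card_Un_disjoint) auto
    ultimately have "card C + 3 \<le> 2 * card (\<Union>C)" using t(3) by simp
    then show ?thesis using that C(1,2) True by blast
  qed
  define W where "W = \<Union>C \<inter> V"
  have WV: "W \<subseteq> V" by (simp add: W_def)
  have fC: "finite C" using finite_subset[OF C(2) fH] .
  have fW: "finite W" using finite_subset[OF WV fV(1)] .
  have subC: "\<Union>T \<inter> V = \<Union>T \<inter> W" if "T \<subseteq> C" for T using that unfolding W_def by blast
  have indW: "ind W T \<longleftrightarrow> ind V T" if "T \<subseteq> C" for T
    using ind_vertex_cong[of V T W] ind_vertex_cong[of W T V] subC[OF that] by auto
  have cW: "M.circuit W C" using C(1) indW[of C] indW[of "C - {x}" for x] unfolding M.circuit_def by blast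
  obtain g0 where g0: "g0 \<in> C" using M.circuit_nonempty[OF C(1)] by blast
  have Wne: "W \<noteq> {}" using g0 C(2) Hc2(2) unfolding W_def by blast
  have cC: "card C = 2 * card W + 1"
  proof (rule antisym)
    have "ind W (C - {g0})" using cW g0 by (simp add: M.circuit_def)
    then have "card (C - {g0}) \<le> 2 * card W" by (rule ind_le_card) (use fW in auto)
    then show "card C \<le> 2 * card W + 1" using card.remove[OF fC g0] by simp
    \<comment> \<open>A smaller circuit would obey both bounds and hence be independent.\<close>
    show "2 * card W + 1 \<le> card C"
    proof (rule ccontr)
      assume small: "\<not> ?thesis"
      have "ind V C" unfolding ind_def
      proof (intro conjI ballI allI impI)
        fix T assume T: "T \<subseteq> C" "T \<noteq> {}"
        have "card T + 3 \<le> 2 * card (\<Union>T) \<and> card T \<le> 2 * card (\<Union>T \<inter> V)"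
        proof (cases "T = C")
          case True
          then show ?thesis using lo small by (simp add: W_def)
        next
          case False
          then have "ind V T" using M.circuit_psubset_ind[OF C(1)] T(1) by blast
          then show ?thesis using ind_pure[OF _ order_refl T(2)] ind_ground[OF _ order_refl] by blast
        qed
        then show "card T + 3 \<le> 2 * card (\<Union>T)" "card T \<le> 2 * card (\<Union>T \<inter> V)" by simp_all
      qed (use fC Hc2(1) C(2) in auto)
      then show False using C(1) by (simp add: M.circuit_def)
    qed
  qed
  have eW: "e \<inter> W \<noteq> {} \<and> e \<inter> (V - W) = {}" if "e \<in> C" for e
    using that Hc2(2)[of e] C(2) unfolding W_def by blast
  show ?thesis
  proof (cases "W = V")
    case False
    \<comment> \<open>The circuit stays, and the induction hypothesis is applied to the remaining
      vertices. No root is asked for there, since the prescribed one belongs to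
      \<open>C\<close>.\<close>
    let ?Y = "V - W"
    have Y: "?Y \<subset> V" "?Y \<noteq> {}" using WV Wne False by auto
    obtain Y' E' where st: "step Y' E' ?Y E" "solid Y' E'"
      using below_free[OF bl graph_size_subset[OF g Y(1)] solid_contract[OF s] Y(2)] Y(1) by blast
    have Y'Y: "Y' \<subseteq> ?Y" using step_subset[OF st(1)] .
    have "W \<inter> ?Y = {}" "W \<union> ?Y = V" using WV by auto
    then have st1: "step (W \<union> Y') E' V E" using step_lift[OF st(1), of W] by simp
    have CE': "C \<subseteq> E'"
    proof
      fix e assume e: "e \<in> C"
      then have "e \<in> {e \<in> E. e \<inter> ?Y = {}}" using eW C(2) Hc2(3) by blast
      then show "e \<in> E'" using step_outside[OF st(1)] by blast
    qed
    have VW: "W \<union> Y' - W = Y'" using Y'Y by blast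
    show ?thesis
    proof (rule reduces_of_circuit_part[OF bl s R1 nolab st1 _ _ cW cC CE'])
      show "r \<in> W \<union> Y' \<and> {r, z} \<in> E'" if "(r, z) \<in> R" for r z
        using C(3)[OF that] Rz(1)[OF that] CE' unfolding W_def by blast
      show "e \<inter> W \<noteq> {} \<and> e \<inter> (W \<union> Y' - W) = {}" if "e \<in> C" for e
        using eW[OF that] Y'Y unfolding VW by blast
    qed (use st(2) VW in \<open>auto simp: solid_def\<close>)
  next
    case WV': True
    show ?thesis
    proof (cases "C = ?H")
      case False
      \<comment> \<open>An edge off the circuit can be deleted, because rank and redundancy come
        from \<open>C\<close> alone.\<close>
      then obtain f where f: "f \<in> ?H" "f \<notin> C" using C(2) by blast
      have st: "step V (E - {f}) V E"
        by (rule step_edge[of f]) (use f Hc2[OF f(1)] in auto)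
      show ?thesis
      proof (rule reduces_of_circuit_part[OF bl s R1 nolab st _ order_refl cW[unfolded WV'] cC[unfolded WV']])
        show "r \<in> V \<and> {r, z} \<in> E - {f}" if "(r, z) \<in> R" for r z
          using C(3)[OF that] Rz(1)[OF that] f(2) C(2) Hc2(3) by blast
        show "C \<subseteq> E - {f}" using C(2) f(2) Hc2(3) by blast
        show "e \<inter> V \<noteq> {} \<and> e \<inter> (V - V) = {}" if "e \<in> C" for e using eW[OF that] WV' by simp
      qed (simp_all add: RR_empty bal_empty)
    next
      case CH: True
      have UV: "\<Union>?H \<inter> V = V" using WV' CH unfolding W_def by simp
      have sub: "ind V T" if "T \<subset> ?H" for T using M.circuit_psubset_ind[OF C(1)] that CH by simp
      interpret T: tight_graph V ?H
      proof
        show "graph V ?H" using g fH Hc2 by (auto simp: graph_def)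
        show "card ?H = 2 * card V + 1" using cC CH WV' by simp
        show "card {e \<in> ?H. e \<inter> V \<subseteq> X} \<le> 2 * card X" if X: "X \<subset> V" for X
        proof -
          let ?T = "{e \<in> ?H. e \<inter> V \<subseteq> X}"
          have "?T \<noteq> ?H"
          proof
            assume "?T = ?H"
            then have "e \<inter> V \<subseteq> X" if "e \<in> ?H" for e using that by blast
            then show False using UV X by blast
          qed
          then have "?T \<subset> ?H" by (intro psubsetI) auto
          moreover have "finite X" using X fV finite_subset by blast
          ultimately show ?thesis by (intro ind_le_card[OF sub fV(1)]) auto
        qed
        show "card {e \<in> ?H. e \<subseteq> P} + 3 \<le> 2 * card P" if P: "finite P" "2 \<le> card P" for P
        proof -
          let ?T = "{e \<in> ?H. e \<subseteq> P}"
          have le: "card (\<Union>?T) \<le> card P" using P by (intro card_mono) auto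
          show ?thesis
          proof (cases "?T = ?H")
            case True
            have "card ?H + 3 \<le> 2 * card (\<Union>?H)" using lo unfolding CH .
            then show ?thesis using le unfolding True by linarith
          next
            case False
            then have "ind V ?T" by (intro sub psubsetI) auto
            then have "?T \<noteq> {} \<Longrightarrow> card ?T + 3 \<le> 2 * card (\<Union>?T)" using ind_pure by blast
            moreover have "?T = {} \<Longrightarrow> card ?T = 0" by (simp only: card.empty)
            ultimately show ?thesis using le P(2) by (cases "?T = {}") linarith+
          qed
        qed
        show "bal V ?H" using s nb_inc[of _ V E] by (simp add: solid_def bal_def)
      qed (use cV Hc2 in auto)
      have "\<exists>z. z \<notin> V \<and> {r, z} \<in> ?H \<and> (\<forall>u\<in>V. {u, z} \<in> ?H \<longrightarrow> u = r)" if "r \<in> fst ` R" for r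
      proof -
        obtain z where "(r, z) \<in> R" using \<open>r \<in> fst ` R\<close> by auto
        then show ?thesis using Rz[of r z] Hc2(3) by blast
      qed
      moreover have "r = r'" if "r \<in> fst ` R" "r' \<in> fst ` R" for r r' using that one by fastforce
      ultimately obtain v a b c where vabc: "v \<notin> fst ` R" "T.star v a b c" "\<not> T.gcert v a b" "\<not> T.pcert v a b"
        using T.admissible_node[of "fst ` R"] by blast
      note red = T.one_reduction[OF vabc(2-4)]
      let ?S = "{{v, a}, {v, b}, {v, c}}" and ?V1 = "V - {v}"
      let ?E1 = "insert {a, b} (E - ?S)" and ?C1 = "insert {a, b} (?H - ?S)"
      have v: "v \<in> V" and dis: "distinct [v, a, b, c]" and S: "{e \<in> ?H. v \<in> e} = ?S"
        using vabc(2) unfolding T.star_def by blast+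
      have vE: "v \<notin> e" if "e \<in> E - ?S" for e using that S v unfolding inc_def by blast
      have ab1: "{a, b} \<inter> ?V1 \<noteq> {}" using red(1) dis by auto
      have abE: "{a, b} \<notin> E" using red(1,2) unfolding inc_def by blast
      have st: "step ?V1 ?E1 V E"
      proof (rule step_ext[OF _ _ _ dis _ ab1])
        show "v \<notin> \<Union>?E1" using vE dis by auto
        have SE: "?S \<subseteq> E" using S unfolding inc_def by blast
        have set: "A = insert x (A - B) - {x} \<union> B" if "x \<notin> A" "B \<subseteq> A" for A B and x :: "'a set" using that by blast
        show "E = ?E1 - {{a, b}} \<union> ?S" by (rule set[OF abE SE])
      qed (use v in auto)
      show ?thesis
      proof (rule reduces_of_circuit_part[OF bl s R1 nolab st _ order_refl red(3,4)])
        show "r \<in> ?V1 \<and> {r, z} \<in> ?E1" if rz: "(r, z) \<in> R" for r z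
        proof -
          have "v \<noteq> r" using vabc(1) rz by force
          moreover have "v \<noteq> z" using v Rz(2)[OF rz] by blast
          ultimately have "v \<notin> {r, z}" by simp
          then have "{r, z} \<notin> ?S" by blast
          then show ?thesis using Rz(1,3)[OF rz] \<open>v \<noteq> r\<close> unfolding inc_def by blast
        qed
        show "?C1 \<subseteq> ?E1" unfolding inc_def by blast
        show "e \<inter> ?V1 \<noteq> {} \<and> e \<inter> (?V1 - ?V1) = {}" if e: "e \<in> ?C1" for e
        proof (cases "e = {a, b}")
          case False
          then have "e \<in> ?H - ?S" using e by blast
          then have "e \<inter> V \<noteq> {}" "v \<notin> e" using vE[of e] Hc2 by blast+
          then show ?thesis by blast
        qed (use ab1 in blast)
      qed (simp_all add: RR_empty bal_empty)
    qed
  qed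
qed

text \<open>In the separable case the closed set or its complement, whichever avoids the root, is
  reduced.\<close>

lemma reduce_core:
  assumes bl: "below (graph_size V E) TYPE('a)" and s: "solid V (E :: 'a set set)"
    and one: "\<And>p q. p \<in> R \<Longrightarrow> q \<in> R \<Longrightarrow> p = q"
    and R1: "\<And>r z. (r, z) \<in> R \<Longrightarrow> rooted V E r z" and nolab: "R = {} \<Longrightarrow> \<not> (\<exists>r z. rooted V E r z)"
    and cV: "2 \<le> card V"
  shows "reduces V E R"
proof -
  have Vne: "V \<noteq> {}" using cV by auto
  show ?thesis
  proof (rule solid_insep_or_closed[OF s Vne])
    assume "M.insep V (inc V E)"
    then show ?thesis using reduce_insep[OF bl s one R1 nolab cV] by blast
  next
    fix W assume W: "W \<subset> V" "W \<noteq> {}" "\<And>e. e \<in> E \<Longrightarrow> e \<inter> W \<noteq> {} \<Longrightarrow> e \<inter> (V - W) = {}"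
    show ?thesis
    proof (cases "\<exists>r z. (r, z) \<in> R \<and> r \<in> W")
      case True
      then obtain r0 z0 where r0: "(r0, z0) \<in> R" "r0 \<in> W" by blast
      show ?thesis
      proof (rule reduce_closed[OF bl s])
        show "V - W \<subset> V" "V - W \<noteq> {}" using W by auto
        show "e \<inter> (V - (V - W)) = {}" if "e \<in> E" "e \<inter> (V - W) \<noteq> {}" for e
          using W(3)[OF that(1)] that(2) W(1) by blast
        show "rooted V E r z \<and> r \<notin> V - W" if "(r, z) \<in> R" for r z
          using R1[OF that] one[OF that r0(1)] r0(2) by simp
      qed
    next
      case False
      then show ?thesis using reduce_closed[OF bl s W(1,2,3)] R1 by blast
    qed
  qed
qed

text \<open>Three neighbours give a star, and a star arises from the empty graph by adding a
  vertex.\<close>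

lemma solid_star:
  assumes g: "graph {w} E" and n: "3 \<le> card (nb E {w})"
  shows "solid {w} E"
proof -
  obtain N where "N \<subseteq> nb E {w}" "card N = 3" using n obtain_subset_with_card_n by metis
  then obtain a b c where abc: "{a, b, c} \<subseteq> nb E {w}" "a \<noteq> b" "b \<noteq> c" "a \<noteq> c" by (auto simp: card_3_iff)
  then have dis: "distinct [w, a, b, c]" and e: "{w, a} \<in> E" "{w, b} \<in> E" "{w, c} \<in> E" by (auto simp: nb_def)
  let ?S = "{{w, a}, {w, b}, {w, c}}"
  have "step {} (E - inc {w} E) {w} ((E - inc {w} E) \<union> ?S)"
    by (rule step_vertex[OF _ _ _ dis]) (auto simp: inc_def)
  moreover have "solid {} (E - inc {w} E)" using g by (intro solid_empty) (auto simp: graph_def)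
  ultimately have "solid {w} ((E - inc {w} E) \<union> ?S)" by (rule step_solid)
  then show ?thesis by (rule solid_mono) (use e g in auto)
qed

lemma reduce_single:
  assumes s: "solid {v} E"
  shows "reduces {v} E {}"
proof -
  have g: "graph {v} E" using s by (simp add: solid_def)
  have fn: "finite (nb E {v})" using finite_nb[OF g] .
  have n: "3 \<le> card (nb E {v})" using s by (simp add: solid_def bal_def)
  show ?thesis
  proof (cases "4 \<le> card (nb E {v})")
    case True
    then obtain t where t: "t \<in> nb E {v}" by fastforce
    then have tE: "{v, t} \<in> E" "t \<noteq> v" by (auto simp: nb_def)
    let ?E = "E - {{v, t}}"
    have st: "step {v} ?E {v} E" by (rule step_edge[of "{v, t}"]) (use tE in auto)
    have g': "graph {v} ?E" using step_graph[OF st g] .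
    have "nb E {v} - {t} \<subseteq> nb ?E {v}" by (auto simp: nb_def doubleton_eq_iff)
    then have "card (nb E {v} - {t}) \<le> card (nb ?E {v})" using finite_nb[OF g'] by (intro card_mono)
    then have "3 \<le> card (nb ?E {v})" using True t fn by simp
    then have "solid {v} ?E" by (rule solid_star[OF g'])
    with st show ?thesis by (rule reducesI) simp
  next
    case False
    then have "card (nb E {v}) = 3" using n by simp
    then obtain a b c where abc: "nb E {v} = {a, b, c}" "a \<noteq> b" "b \<noteq> c" "a \<noteq> c" by (auto simp: card_3_iff)
    have nE: "{v, t} \<in> E" "t \<noteq> v" if "t \<in> {a, b, c}" for t using that unfolding abc(1)[symmetric] by (auto simp: nb_def)
    have dis: "distinct [v, a, b, c]" using abc nE(2) by auto
    let ?S = "{{v, a}, {v, b}, {v, c}}"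
    have "step {} (E - ?S) {v} E"
    proof (rule step_vertex[OF _ _ _ dis])
      show "v \<notin> \<Union>(E - ?S)"
      proof
        assume "v \<in> \<Union>(E - ?S)"
        then obtain e where e: "e \<in> E" "e \<notin> ?S" "v \<in> e" by blast
        then have "card e = 2" using g by (simp add: graph_def)
        then obtain t where t: "t \<in> e" "t \<noteq> v" using e(3) by (auto simp: card_2_iff)
        then have "e = {v, t}" using pair_other[OF \<open>card e = 2\<close> e(3)] by simp
        moreover have "t \<in> nb E {v}" using e(1) t(2) \<open>e = {v, t}\<close> by (simp add: nb_def)
        ultimately show False using e(2) abc(1) by auto
      qed
      have "?S \<subseteq> E" using nE(1) by simp
      then show "E = E - ?S \<union> ?S" by (simp only: Un_Diff_cancel2 Un_absorb2)
    qed simp_all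
    moreover have "solid {} (E - ?S)" using g by (intro solid_empty) (auto simp: graph_def)
    ultimately show ?thesis by (rule reducesI) simp
  qed
qed

theorem reduction:
  fixes E :: "'a set set"
  shows "claim V E R"
proof (induction "graph_size V E" arbitrary: V E R rule: less_induct)
  case (less V E R)
  then have bl: "below (graph_size V E) TYPE('a)" by (simp add: below_def)
  have "reduces V E R" if s: "solid V E" and V: "V \<noteq> {}" and one: "\<forall>p\<in>R. \<forall>q\<in>R. p = q"
      and R: "\<forall>(r, z)\<in>R. rooted V E r z" and c: "R \<noteq> {} \<longrightarrow> 2 \<le> card V"
  proof -
    have fV: "finite V" using s by (simp add: solid_def graph_def)
    show "reduces V E R"
    proof (cases "2 \<le> card V")
      case True
      \<comment> \<open>A graph without a prescribed root that does have some root is treated with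
        this one, so that \<open>R = {}\<close> may be taken to mean that no root exists.\<close>
      show ?thesis
      proof (cases "R = {} \<and> (\<exists>r z. rooted V E r z)")
        case True
        then obtain r z where "rooted V E r z" by blast
        then have "reduces V E {(r, z)}" by (intro reduce_core[OF bl s _ _ _ \<open>2 \<le> card V\<close>]) auto
        then show ?thesis using True by (auto simp: reduces_def)
      next
        case False
        then show ?thesis using one R by (intro reduce_core[OF bl s _ _ _ True]) blast+
      qed
    next
      case False
      then obtain v where "V = {v}" using V fV card_le_Suc0_iff_eq[OF fV] by auto
      moreover have "R = {}" using False c by blast
      ultimately show ?thesis using reduce_single s by simp
    qed
  qed
  then show ?case by (simp add: claim_def)
qed

lemma reduction_free:
  assumes "solid V E" "V \<noteq> {}"
  obtains V' E' where "step V' E' V E" "solid V' E'"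
  using reduction[of V E "{}"] assms by (auto simp: claim_def reduces_def)

lemma reduction_rooted:
  assumes "solid V E" "rooted V E r z" "2 \<le> card V"
  obtains V' E' where "step V' E' V E" "solid V' E'" "rooted V' E' r z"
proof -
  have "V \<noteq> {}" using assms(3) by auto
  then have "reduces V E {(r, z)}" using reduction[of V E "{(r, z)}"] assms by (simp add: claim_def)
  then obtain V' E' where "step V' E' V E" "solid V' E'" "r \<in> V'" "{r, z} \<in> E'" by (auto simp: reduces_def)
  then show ?thesis using that step_rooted[OF _ assms(2)] by blast
qed

subsection \<open>Loops as edges to outer vertices\<close>

context matroid
begin

text \<open>A basis that contains \<open>C\<close> except for \<open>x\<close> and that splits
  without loss over \<open>S\<close> and \<open>T\<close> spans \<open>x\<close> within
  \<open>S\<close>. The circuit \<open>C'\<close> arising there misses \<open>y\<close>, and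
  eliminating \<open>x\<close> from \<open>C\<close> and \<open>C'\<close> leaves a circuit inside
  the basis.\<close>

lemma insep_if_common_circuits:
  assumes "finite A" "\<And>x y. x \<in> A \<Longrightarrow> y \<in> A \<Longrightarrow> \<exists>C. circuit C \<and> C \<subseteq> A \<and> x \<in> C \<and> y \<in> C"
  shows "insep A"
  unfolding insep_def
proof (intro allI impI, elim conjE, rule ccontr)
  fix S T assume ST: "S \<union> T = A" "S \<inter> T = {}" "S \<noteq> {}" "T \<noteq> {}" and le: "\<not> rk A < rk S + rk T"
  obtain x y where x: "x \<in> S" and y: "y \<in> T" using ST(3,4) by blast
  obtain C where C: "circuit C" "C \<subseteq> A" "x \<in> C" "y \<in> C" using assms(2)[of x y] x y ST(1) by blast
  have fS: "finite S" and fT: "finite T" using assms(1) ST(1) by auto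
  have "ind (C - {x})" using C by (simp add: circuit_def)
  then obtain I where I: "C - {x} \<subseteq> I" "I \<subseteq> A" "ind I" "card I = rk A"
    using basis_extend[OF assms(1), of "C - {x}"] C(2) by blast
  have xI: "x \<notin> I"
  proof
    assume "x \<in> I"
    then have "C \<subseteq> I" using I(1) by blast
    then show False using ind_mono[OF I(3)] C(1) by (auto simp: circuit_def)
  qed
  have "I = (I \<inter> S) \<union> (I \<inter> T)" "(I \<inter> S) \<inter> (I \<inter> T) = {}" using I(2) ST by auto
  then have "card I = card (I \<inter> S) + card (I \<inter> T)"
    using ind_finite[OF I(3)] card_Un_disjoint[of "I \<inter> S" "I \<inter> T"] by simp
  moreover have "card (I \<inter> T) \<le> rk T" using ind_card_le_rk[OF fT] ind_mono[OF I(3)] by simp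
  ultimately have cS: "rk S \<le> card (I \<inter> S)" using I(4) le by simp
  have "\<not> ind (insert x (I \<inter> S))"
  proof
    assume "ind (insert x (I \<inter> S))"
    then have "card (insert x (I \<inter> S)) \<le> rk S" using ind_card_le_rk[OF fS] x by simp
    then show False using cS xI fS by simp
  qed
  then obtain C' where C': "circuit C'" "x \<in> C'" "C' \<subseteq> insert x (I \<inter> S)"
    using circuit_through[OF ind_mono[OF I(3)]] by (metis Int_lower1)
  have "y \<notin> C'" using C'(3) x y ST(2) by blast
  then have "x \<in> C \<inter> C'" "y \<in> C - C'" using C C'(2) by simp_all
  then obtain C3 where "circuit C3" "C3 \<subseteq> C \<union> C' - {x}" by (rule strong_elimination[OF C(1) C'(1)])
  then have "circuit C3" "C3 \<subseteq> I" using I(1) C'(3) by blast+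
  then show False using ind_mono[OF I(3)] by (auto simp: circuit_def)
qed

lemma rk_Union_le:
  "finite P \<Longrightarrow> (\<And>F. F \<in> P \<Longrightarrow> finite F) \<Longrightarrow> rk (\<Union>P) \<le> (\<Sum>F\<in>P. rk F)"
proof (induction rule: finite_induct)
  case (insert F P)
  have "rk (F \<union> \<Union>P) \<le> rk F + rk (\<Union>P)" using insert by (intro rk_Un_le) auto
  then show ?case using insert by simp
qed (simp add: rk_ind ind_empty)

end

lemma rk_le_cnt:
  assumes F: "finite F" "\<And>e. e \<in> F \<Longrightarrow> card e = 2" and V: "finite V" and e: "e \<in> F" "e \<inter> V \<noteq> {}"
  shows "int (M.rk V F) \<le> cnt V F"
proof -
  obtain B where B: "B \<subseteq> F" "ind V B" "card B = M.rk V F" using M.basis_exists[OF F(1)] .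
  have fU: "finite (\<Union>F)" using finite_Union_pairs[OF F] .
  have "ind V {e}" using ind_single[OF F(2)[OF e(1)] V e(2)] .
  then have "card {e} \<le> M.rk V F" using M.ind_card_le_rk[OF F(1), of "{e}"] e(1) by simp
  then have Bne: "B \<noteq> {}" using B(3) by auto
  have "card (\<Union>B) \<le> card (\<Union>F)" using fU B(1) by (intro card_mono) auto
  moreover have "card (\<Union>B \<inter> V) \<le> card (\<Union>F \<inter> V)" using fU B(1) by (intro card_mono) auto
  moreover note ind_pure[OF B(2) order_refl Bne] ind_ground[OF B(2) order_refl]
  ultimately show ?thesis unfolding cnt_def B(3)[symmetric] by simp
qed

text \<open>The ranks of the blocks in the rank formula add up, so there is only one block. With two
  outer vertices the ground bound is the smaller one for it, as \<open>2 * (n + 2) - 3\<close>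
  exceeds \<open>2 * n\<close>.\<close>

lemma insep_rigid:
  assumes E: "finite E" "\<And>e. e \<in> E \<Longrightarrow> card e = 2" "\<And>e. e \<in> E \<Longrightarrow> e \<inter> V \<noteq> {}" and V: "finite V"
    and ne: "E \<noteq> {}" and ins: "M.insep V E" and UV: "V \<subseteq> \<Union>E" and lab: "card V + 2 \<le> card (\<Union>E)"
  shows "rigid V E"
proof -
  obtain I where I: "I \<subseteq> E" "ind V I" "card I = M.rk V E" using M.basis_exists[OF E(1)] .
  obtain P where P: "finite P" "\<Union>P = E" "disjoint P" "{} \<notin> P"
    "\<And>F. F \<in> P \<Longrightarrow> cnt V F = int (card (F \<inter> I))" "card I = (\<Sum>F\<in>P. card (F \<inter> I))"
  proof (rule rank_blocks[OF E V I(2,1,3)])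
  qed (assumption | rule that)+
  have fF: "finite F" if "F \<in> P" for F using finite_subset[OF Union_upper[OF that]] P(2) E(1) by simp
  have rkF: "M.rk V F \<le> card (F \<inter> I)" if F: "F \<in> P" for F
  proof -
    have sub: "F \<subseteq> E" using F P(2) by blast
    have "F \<noteq> {}" using F P(4) by blast
    then obtain e where "e \<in> F" by blast
    moreover have "card e = 2" if "e \<in> F" for e using E(2)[OF subsetD[OF sub that]] .
    moreover have "e \<inter> V \<noteq> {}" using E(3)[OF subsetD[OF sub \<open>e \<in> F\<close>]] .
    ultimately have "int (M.rk V F) \<le> cnt V F" by (intro rk_le_cnt[OF fF[OF F] _ V])
    then show ?thesis using P(5)[OF F] by simp
  qed
  obtain F where F: "F \<in> P" using ne P(2) by blast
  have "F = E"
  proof (rule ccontr)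
    assume "F \<noteq> E"
    let ?T = "\<Union>(P - {F})"
    have "F \<inter> G = {}" if "G \<in> P - {F}" for G using that P(3) F by (auto simp: disjoint_def)
    then have dis: "F \<inter> ?T = {}" by blast
    have U: "F \<union> ?T = E" using F P(2) by blast
    then have "?T \<noteq> {}" using \<open>F \<noteq> E\<close> by blast
    moreover have "F \<noteq> {}" using F P(4) by blast
    ultimately have "M.rk V E < M.rk V F + M.rk V ?T" using ins U dis unfolding M.insep_def by blast
    also have "M.rk V ?T \<le> (\<Sum>G\<in>P - {F}. M.rk V G)" using P(1) fF by (intro M.rk_Union_le) auto
    also have "\<dots> \<le> (\<Sum>G\<in>P - {F}. card (G \<inter> I))" using rkF by (intro sum_mono) auto
    also have "M.rk V F \<le> card (F \<inter> I)" using rkF[OF F] .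
    also have "card (F \<inter> I) + (\<Sum>G\<in>P - {F}. card (G \<inter> I)) = card I"
      using P(1,6) F by (simp add: sum.remove)
    finally show False using I(3) by simp
  qed
  then have "cnt V E = int (card I)" using P(5)[OF F] I(1) by (simp add: Int_absorb1)
  moreover have "\<Union>E \<inter> V = V" using UV by blast
  ultimately have "card I = 2 * card V" using lab by (simp add: cnt_def)
  then show ?thesis using I(1,2) unfolding rigid_def by blast
qed

fun code :: "('v element \<Rightarrow> 'v + nat) \<Rightarrow> 'v element \<Rightarrow> ('v + nat) set" where
  "code l (Edge e) = Inl ` e"
| "code l (Loop u i) = {Inl u, l (Loop u i)}"

text \<open>The labels of loops become pairwise distinct vertices outside \<open>V\<close>. A label may be \<open>Inl w\<close> for a vertex
  \<open>w\<close> that is not in the graph: when a pendant vertex \<open>w\<close> is removed, its edge then serves as a loop.\<close>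

locale coded =
  fixes l :: "'v element \<Rightarrow> 'v + nat" and G :: "'v lgraph" and V :: "('v + nat) set" and E :: "('v + nat) set set"
  assumes G: "looped_simple_graph G"
    and inj: "inj_on l (loops G)"
    and outside: "x \<in> loops G \<Longrightarrow> l x \<notin> Inl ` verts G"
    and V: "V = Inl ` verts G"
    and E: "E = code l ` elements G"
begin

lemma edge_cases:
  assumes "x \<in> edges G"
  obtains u w where "x = Edge {u, w}" "u \<in> verts G" "w \<in> verts G" "u \<noteq> w"
proof -
  have "x \<in> {Edge {u, w} | u w. u \<in> verts G \<and> w \<in> verts G \<and> u \<noteq> w}"
    using G assms unfolding looped_simple_graph_def by (elim conjE) (rule subsetD)
  then show ?thesis using that by (elim CollectE exE conjE)
qed

lemma loop_cases:
  assumes "x \<in> loops G"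
  obtains u i where "x = Loop u i" "u \<in> verts G"
  using G assms unfolding looped_simple_graph_def by blast

lemma fin_verts: "finite (verts G)" and verts_ne: "verts G \<noteq> {}" and fin_loops: "finite (loops G)"
  using G by (auto simp: looped_simple_graph_def)

lemma fin_edges: "finite (edges G)"
proof (rule finite_subset)
  show "edges G \<subseteq> Edge ` Pow (verts G)"
  proof
    fix x assume "x \<in> edges G"
    then obtain u w where "x = Edge {u, w}" "u \<in> verts G" "w \<in> verts G" by (rule edge_cases)
    then show "x \<in> Edge ` Pow (verts G)" by simp
  qed
qed (simp add: fin_verts)

lemma code_edge:
  assumes "x \<in> edges G"
  shows "code l x = Inl ` ends x" "x = Edge (ends x)" "ends x \<subseteq> verts G" "card (ends x) = 2"
proof -
  obtain u w where "x = Edge {u, w}" "u \<in> verts G" "w \<in> verts G" "u \<noteq> w" using edge_cases[OF assms] .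
  then show "code l x = Inl ` ends x" "x = Edge (ends x)" "ends x \<subseteq> verts G" "card (ends x) = 2" by simp_all
qed

lemma code_loop:
  assumes "x \<in> loops G"
  shows "code l x = insert (l x) (Inl ` ends x)" "ends x \<subseteq> verts G" "card (ends x) = 1" "l x \<notin> V"
proof -
  obtain u i where "x = Loop u i" "u \<in> verts G" using loop_cases[OF assms] .
  then show "code l x = insert (l x) (Inl ` ends x)" "ends x \<subseteq> verts G" "card (ends x) = 1" by auto
  show "l x \<notin> V" using outside[OF assms] V by simp
qed

lemma ends_verts: "x \<in> elements G \<Longrightarrow> ends x \<subseteq> verts G" "x \<in> elements G \<Longrightarrow> ends x \<noteq> {}"
  "x \<in> elements G \<Longrightarrow> finite (ends x)"
proof -
  assume x: "x \<in> elements G"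
  show sub: "ends x \<subseteq> verts G" using x code_edge(3) code_loop(2) by blast
  show "finite (ends x)" using finite_subset[OF sub fin_verts] .
  have "card (ends x) \<noteq> 0" using x code_edge(4) code_loop(3) by fastforce
  then show "ends x \<noteq> {}" by auto
qed

lemma disj: "edges G \<inter> loops G = {}"
proof -
  have False if x: "x \<in> edges G" "x \<in> loops G" for x
    using code_edge(4)[OF x(1)] code_loop(3)[OF x(2)] by simp
  then show ?thesis by blast
qed

lemma code_Int_V: "x \<in> elements G \<Longrightarrow> code l x \<inter> V = Inl ` ends x"
proof -
  assume x: "x \<in> elements G"
  then have "Inl ` ends x \<subseteq> V" using ends_verts(1) V by blast
  then show ?thesis using x code_edge(1)[of x] code_loop(1,4)[of x] by auto
qed

lemma inj_code: "inj_on (code l) (elements G)"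
proof (rule inj_onI)
  fix x y assume x: "x \<in> elements G" and y: "y \<in> elements G" and eq: "code l x = code l y"
  have "Inl ` ends x = (Inl ` ends y :: ('v + nat) set)" using code_Int_V[OF x] code_Int_V[OF y] eq by simp
  then have ends: "ends x = ends y" by (simp add: inj_image_eq_iff)
  show "x = y"
  proof (cases "x \<in> edges G")
    case True
    then have "y \<in> edges G" using y ends code_edge(4)[of x] code_loop(3)[of y] by fastforce
    then show ?thesis using code_edge(2) True ends by metis
  next
    case False
    then have xl: "x \<in> loops G" using x by blast
    then have yl: "y \<in> loops G" using y ends code_edge(4)[of y] code_loop(3)[of x] by fastforce
    have "l x \<in> code l y" using code_loop(1)[OF xl] eq by blast
    then have "l x = l y" using code_loop(1)[OF yl] code_loop(4)[OF xl] ends_verts(1)[OF y] V by auto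
    then show ?thesis using inj xl yl by (auto dest: inj_onD)
  qed
qed

lemma card_code: "x \<in> elements G \<Longrightarrow> card (code l x) = 2"
proof -
  assume x: "x \<in> elements G"
  have inl: "card (Inl ` ends x :: ('v + nat) set) = card (ends x)" by (simp add: card_image)
  show ?thesis
  proof (cases "x \<in> edges G")
    case True
    then show ?thesis using code_edge(1,4) inl by simp
  next
    case False
    then have l: "x \<in> loops G" using x by blast
    then have "l x \<notin> Inl ` ends x" using code_loop(2,4)[OF l] V by auto
    then show ?thesis using code_loop(1,3)[OF l] inl ends_verts(3)[OF x] by simp
  qed
qed

lemma graph: "graph V E"
  using fin_verts fin_edges fin_loops card_code by (auto simp: graph_def V E)

lemma meets: "e \<in> E \<Longrightarrow> e \<inter> V \<noteq> {}"
  using code_Int_V ends_verts(2) by (auto simp: E)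

lemma inc_E: "inc V E = E"
  using meets by (auto simp: inc_def)

lemma V_ne: "V \<noteq> {}" using verts_ne V by simp

lemma outer_edge:
  assumes "e \<in> E" "t \<in> e" "t \<notin> V"
  obtains x where "x \<in> loops G" "e = code l x" "l x = t"
proof -
  obtain x where x: "x \<in> elements G" "e = code l x" using assms(1) E by blast
  have "Inl ` ends x \<subseteq> V" using ends_verts(1)[OF x(1)] V by blast
  then have t: "t \<notin> Inl ` ends x" using assms(3) by (rule contra_subsetD)
  then have "x \<notin> edges G" using code_edge(1)[of x] x(2) assms(2) by auto
  then have xl: "x \<in> loops G" using x by simp
  moreover have "l x = t" using code_loop(1)[OF xl] x(2) assms(2) t by simp
  ultimately show ?thesis using that x(2) by blast
qed

lemma unique_outer: "e \<in> E \<Longrightarrow> f \<in> E \<Longrightarrow> t \<in> e \<Longrightarrow> t \<in> f \<Longrightarrow> t \<notin> V \<Longrightarrow> e = f"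
  using outer_edge inj by (metis inj_onD)

lemma Union_code_Int: "F \<subseteq> elements G \<Longrightarrow> \<Union>(code l ` F) \<inter> V = Inl ` span_verts F"
proof -
  assume F: "F \<subseteq> elements G"
  have "\<Union>(code l ` F) \<inter> V = (\<Union>x\<in>F. code l x \<inter> V)" by simp
  also have "\<dots> = (\<Union>x\<in>F. Inl ` ends x)" using F code_Int_V by (intro SUP_cong) auto
  finally show ?thesis by (simp add: span_verts_def image_UN)
qed

lemma span_card: "F \<subseteq> elements G \<Longrightarrow> card (\<Union>(code l ` F) \<inter> V) = card (span_verts F)"
  by (simp add: Union_code_Int card_image)

lemma fin_span: "F \<subseteq> elements G \<Longrightarrow> finite (span_verts F)"
  using ends_verts(1) fin_verts unfolding span_verts_def by (meson UN_least finite_subset subsetD)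

lemma Union_card:
  assumes F: "F \<subseteq> elements G"
  shows "card (\<Union>(code l ` F)) = card (span_verts F) + card (F \<inter> loops G)"
proof -
  let ?U = "\<Union>(code l ` F)"
  have "?U - V = l ` (F \<inter> loops G)"
  proof
    show "?U - V \<subseteq> l ` (F \<inter> loops G)"
    proof
      fix t assume "t \<in> ?U - V"
      then obtain x where x: "x \<in> F" "t \<in> code l x" "t \<notin> V" by blast
      then have xe: "x \<in> elements G" using F by blast
      obtain y where y: "y \<in> loops G" "code l x = code l y" "l y = t"
        using outer_edge[of "code l x" t] x xe E by blast
      then have "x = y" using inj_code xe by (auto dest: inj_onD)
      then show "t \<in> l ` (F \<inter> loops G)" using x y by blast
    qed
    show "l ` (F \<inter> loops G) \<subseteq> ?U - V" using code_loop(1,4) by blast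
  qed
  then have "card (?U - V) = card (F \<inter> loops G)" using inj by (simp add: card_image inj_on_subset)
  moreover have "?U \<inter> V = Inl ` span_verts F" by (rule Union_code_Int[OF F])
  then have "finite (?U \<inter> V)" "card (?U \<inter> V) = card (span_verts F)" using fin_span[OF F] by (simp_all add: card_image)
  moreover have "finite (?U - V)" using \<open>?U - V = l ` (F \<inter> loops G)\<close> fin_loops by simp
  moreover have "?U = (?U \<inter> V) \<union> (?U - V)" "(?U \<inter> V) \<inter> (?U - V) = {}" by blast+
  ultimately show ?thesis by (metis card_Un_disjoint)
qed

lemma card_code_image: "F \<subseteq> elements G \<Longrightarrow> card (code l ` F) = card F"
  by (simp add: card_image inj_on_subset[OF inj_code])

text \<open>Each loop adds one to the size of a set but a private vertex, hence two, to its pure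
  bound, so with non-loop edges present this bound matters for them only. The ground bound is the
  same on both sides.\<close>

lemma indep_iff: "lc_indep G F \<longleftrightarrow> F \<subseteq> elements G \<and> ind V (code l ` F)"
proof (cases "F \<subseteq> elements G")
  case F: True
  have fF: "finite F" using F fin_edges fin_loops finite_subset by blast
  show ?thesis
  proof
    assume lc: "lc_indep G F"
    have "card (code l ` T) + 3 \<le> 2 * card (\<Union>(code l ` T)) \<and>
        card (code l ` T) \<le> 2 * card (\<Union>(code l ` T) \<inter> V)" if T: "T \<subseteq> F" "T \<noteq> {}" for T
    proof -
      have Te: "T \<subseteq> elements G" using T F by blast
      have fT: "finite T" using T fF finite_subset by blast
      have cT: "card T = card (T \<inter> edges G) + card (T \<inter> loops G)"
      proof -
        have "T = (T \<inter> edges G) \<union> (T \<inter> loops G)" "(T \<inter> edges G) \<inter> (T \<inter> loops G) = {}" using Te disj by blast+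
        then show ?thesis using fT card_Un_disjoint[of "T \<inter> edges G" "T \<inter> loops G"] by simp
      qed
      have g: "card T \<le> 2 * card (span_verts T)" using lc T by (simp add: lc_indep_def)
      have sp: "card (span_verts (T \<inter> edges G)) \<le> card (span_verts T)"
        using fin_span[OF Te] by (intro card_mono) (auto simp: span_verts_def)
      have p: "card (T \<inter> edges G) + 3 \<le> 2 * card (span_verts T)" if "T \<inter> edges G \<noteq> {}"
      proof -
        have "int (card (T \<inter> edges G)) \<le> 2 * int (card (span_verts (T \<inter> edges G))) - 3"
          using lc that T unfolding lc_indep_def by (meson Int_mono order_refl)
        then show ?thesis using sp by linarith
      qed
      have "card T + 3 \<le> 2 * (card (span_verts T) + card (T \<inter> loops G))"
      proof (cases "T \<inter> edges G = {}")
        case True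
        \<comment> \<open>Loops alone meet the pure bound as soon as there is one, since
          \<open>n + 3 \<le> 2 * (1 + n)\<close> for positive \<open>n\<close>.\<close>
        have "card T \<noteq> 0" "card T = card (T \<inter> loops G)"
        proof -
          show "card T \<noteq> 0" using T(2) fT by simp
          show "card T = card (T \<inter> loops G)" using cT True by simp
        qed
        then show ?thesis using g by presburger
      next
        case False
        then show ?thesis using p cT g by simp
      qed
      then show ?thesis using Union_card[OF Te] span_card[OF Te] card_code_image[OF Te] g by simp
    qed
    then have "card T + 3 \<le> 2 * card (\<Union>T) \<and> card T \<le> 2 * card (\<Union>T \<inter> V)" if "T \<subseteq> code l ` F" "T \<noteq> {}" for T
      using that by (metis image_is_empty subset_imageE)
    then show "F \<subseteq> elements G \<and> ind V (code l ` F)" using F fF card_code unfolding ind_def by auto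
  next
    assume "F \<subseteq> elements G \<and> ind V (code l ` F)"
    then have i: "ind V (code l ` F)" by simp
    have a: "card T \<le> 2 * card (span_verts T)" if "T \<subseteq> F" for T
      using ind_ground[OF i image_mono[OF that]] that F span_card[of T] card_code_image[of T] by auto
    have b: "int (card T) \<le> 2 * int (card (span_verts T)) - 3" if T: "T \<subseteq> F \<inter> edges G" "T \<noteq> {}" for T
    proof -
      have Te: "T \<subseteq> elements G" "T \<subseteq> F" "T \<inter> loops G = {}" using T disj by blast+
      have "card (code l ` T) + 3 \<le> 2 * card (\<Union>(code l ` T))"
        using T(2) ind_pure[OF i image_mono[OF Te(2)]] by simp
      then show ?thesis using Union_card[OF Te(1)] card_code_image[OF Te(1)] Te(3) by simp
    qed
    show "lc_indep G F" using a b F unfolding lc_indep_def by simp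
  qed
qed (auto simp: lc_indep_def)

lemma circuit_iff: "lc_circuit G C \<longleftrightarrow> C \<subseteq> elements G \<and> M.circuit V (code l ` C)"
proof (cases "C \<subseteq> elements G")
  case C: True
  have fC: "finite C" using C fin_edges fin_loops finite_subset by blast
  have diff: "code l ` C - {code l x} = code l ` (C - {x})" if "x \<in> C" for x
    using inj_on_image_set_diff[OF inj_code, of C "{x}"] C that by auto
  show ?thesis
  proof
    assume lc: "lc_circuit G C"
    have "ind V (code l ` C - {y})" if y: "y \<in> code l ` C" for y
    proof -
      obtain x where x: "x \<in> C" "y = code l x" using y by blast
      then have "C - {x} \<subset> C" by blast
      then have "lc_indep G (C - {x})" using lc unfolding lc_circuit_def by blast
      then show ?thesis using indep_iff diff[OF x(1)] x(2) by simp
    qed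
    moreover have "\<not> ind V (code l ` C)" using lc C indep_iff unfolding lc_circuit_def by blast
    ultimately show "C \<subseteq> elements G \<and> M.circuit V (code l ` C)" using C fC by (simp add: M.circuit_def)
  next
    assume a: "C \<subseteq> elements G \<and> M.circuit V (code l ` C)"
    have "lc_indep G D" if D: "D \<subset> C" for D
    proof -
      have "code l ` D \<subset> code l ` C" using D inj_on_image_eq_iff[OF inj_code, of D C] C by blast
      then have "ind V (code l ` D)" by (rule M.circuit_psubset_ind[OF conjunct2[OF a]])
      then show ?thesis using indep_iff D C by blast
    qed
    moreover have "\<not> lc_indep G C" using a indep_iff by (simp add: M.circuit_def)
    ultimately show "lc_circuit G C" using C unfolding lc_circuit_def by blast
  qed
qed (simp add: lc_circuit_def)

end

text \<open>Connectedness of the graph on \<open>V\<close>; outer vertices do not serve as links,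
  and in a coded graph each has only one edge.\<close>

definition conn :: "'a set \<Rightarrow> 'a set set \<Rightarrow> bool" where
  "conn V E \<longleftrightarrow> (\<forall>S. S \<subset> V \<and> S \<noteq> {} \<longrightarrow> (\<exists>e\<in>E. e \<inter> S \<noteq> {} \<and> e \<inter> (V - S) \<noteq> {}))"

lemma ind_pair:
  assumes V: "finite V" and e: "card e = 2" "e \<inter> V \<noteq> {}" and f: "card f = 2" "f \<inter> V \<noteq> {}"
  shows "ind V {e, f}"
proof (cases "e = f")
  case True
  then show ?thesis using ind_single[OF e(1) V e(2)] by simp
next
  case False
  have fin: "finite e" "finite f" using e(1) f(1) card.infinite by fastforce+
  have "\<not> f \<subseteq> e" using card_subset_eq[OF fin(1), of f] e(1) f(1) False by auto
  then obtain t where t: "t \<in> f" "t \<notin> e" by blast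
  have "card (insert t e) \<le> card (e \<union> f)" using fin t by (intro card_mono) auto
  then have u: "3 \<le> card (e \<union> f)" using fin t e(1) by simp
  have "0 < card ((e \<union> f) \<inter> V)" using V e(2) by (simp add: card_gt_0_iff Int_Un_distrib2)
  then have "card T + 3 \<le> 2 * card (\<Union>T) \<and> card T \<le> 2 * card (\<Union>T \<inter> V)" if T: "T \<subseteq> {e, f}" "T \<noteq> {}" for T
    using subset_pair_cases[OF T]
  proof (elim disjE)
    assume "T = {e}"
    moreover have "ind V {e}" using ind_single[OF e(1) V e(2)] .
    ultimately show ?thesis unfolding ind_def by blast
  next
    assume "T = {f}"
    moreover have "ind V {f}" using ind_single[OF f(1) V f(2)] .
    ultimately show ?thesis unfolding ind_def by blast
  next
    assume "T = {e, f}"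
    then show ?thesis using False u \<open>0 < card ((e \<union> f) \<inter> V)\<close> by simp
  qed
  then show ?thesis using e f unfolding ind_def by blast
qed

section \<open>Balance and matroid connectivity of coded graphs\<close>

context coded
begin

lemma in_E_edge:
  assumes "{Inl p, Inl q} \<in> E" "p \<in> verts G" "q \<in> verts G" "p \<noteq> q"
  shows "Edge {p, q} \<in> edges G"
proof -
  obtain x where x: "x \<in> elements G" "code l x = {Inl p, Inl q}" using assms(1) E by auto
  have "code l x \<inter> V = Inl ` {p, q}" using x(2) assms(2,3) V by auto
  then have "(Inl ` ends x :: ('v + nat) set) = Inl ` {p, q}" using code_Int_V[OF x(1)] by simp
  then have ends: "ends x = {p, q}" by (simp only: inj_image_eq_iff[OF inj_Inl])
  then have "card (ends x) = 2" using assms(4) by simp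
  then have "x \<in> edges G" using x(1) code_loop(3)[of x] by auto
  then show ?thesis using code_edge(2)[of x] ends by simp
qed

lemma in_E_loop:
  assumes "{Inl p, t} \<in> E" "p \<in> verts G" "t \<notin> V"
  obtains i where "Loop p i \<in> loops G" "l (Loop p i) = t"
proof -
  obtain x where x: "x \<in> loops G" "{Inl p, t} = code l x" "l x = t"
    using outer_edge[OF assms(1) _ assms(3)] by blast
  have "code l x \<inter> V = Inl ` {p}" using x(2) assms(2,3) V by auto
  then have "(Inl ` ends x :: ('v + nat) set) = Inl ` {p}" using code_Int_V[of x] x(1) by simp
  then have "ends x = {p}" by (simp only: inj_image_eq_iff[OF inj_Inl])
  moreover obtain u i where "x = Loop u i" using loop_cases[OF x(1)] .
  ultimately show ?thesis using that x(1,3) by simp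
qed

lemma edge_in_E: "Edge {p, q} \<in> edges G \<Longrightarrow> {Inl p, Inl q} \<in> E"
  using code_edge(1)[of "Edge {p, q}"] by (force simp: E)

lemma loop_in_E: "Loop p i \<in> loops G \<Longrightarrow> {Inl p, l (Loop p i)} \<in> E"
  by (force simp: E)

lemma span_all:
  assumes "\<And>p. p \<in> V \<Longrightarrow> \<exists>e\<in>E. p \<in> e"
  shows "no_isolated_vertices G"
  unfolding no_isolated_vertices_def
proof
  show "span_verts (elements G) \<subseteq> verts G" using ends_verts(1) unfolding span_verts_def by blast
  have "V \<subseteq> \<Union>(code l ` elements G) \<inter> V" using assms E by auto
  also have "\<dots> = Inl ` span_verts (elements G)" by (rule Union_code_Int[OF order_refl])
  finally show "verts G \<subseteq> span_verts (elements G)" unfolding V by (simp add: inj_image_subset_iff)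
qed

lemma solid_imp_no_isolated:
  assumes "solid V E"
  shows "no_isolated_vertices G"
proof (rule span_all)
  fix p assume "p \<in> V"
  then have "3 \<le> card (nb E {p})" using assms by (simp add: solid_def bal_def)
  then have "nb E {p} \<noteq> {}" by auto
  then show "\<exists>e\<in>E. p \<in> e" by (auto simp: nb_def)
qed

text \<open>In a connected graph the closed sets of \<open>solid_insep_or_closed\<close> do not
  exist. Redundancy provides a circuit through a single element, which the definition also
  demands.\<close>

lemma solid_imp_connected:
  assumes s: "solid V E" and c: "conn V E"
  shows "lc_connected G"
  unfolding lc_connected_def
proof (intro ballI)
  fix e f assume e: "e \<in> elements G" and f: "f \<in> elements G"
  have fE: "finite E" using graph by (simp add: graph_def)
  have ins: "M.insep V E"
  proof (rule solid_insep_or_closed[OF s V_ne])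
    show "M.insep V E" if "M.insep V (inc V E)" using that inc_E by simp
  next
    fix W assume W: "W \<subset> V" "W \<noteq> {}" "\<And>e. e \<in> E \<Longrightarrow> e \<inter> W \<noteq> {} \<Longrightarrow> e \<inter> (V - W) = {}"
    have "\<exists>g\<in>E. g \<inter> W \<noteq> {} \<and> g \<inter> (V - W) \<noteq> {}" using c W(1,2) unfolding conn_def by simp
    then obtain g where "g \<in> E" "g \<inter> W \<noteq> {}" "g \<inter> (V - W) \<noteq> {}" by (elim bexE conjE)
    then show "M.insep V E" using W(3)[of g] by simp
  qed
  have eE: "code l e \<in> E" and fE': "code l f \<in> E" using e f E by blast+
  obtain C where C: "M.circuit V C" "C \<subseteq> E" "code l e \<in> C" "code l f \<in> C"
  proof (cases "e = f")
    case True
    have "RR V E" using s by (simp add: solid_def)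
    then obtain C where "M.circuit V C" "C \<subseteq> inc V E" "code l e \<in> C"
      using RR_circuit[OF graph] eE inc_E by blast
    then show ?thesis using that True inc_E by simp
  next
    case False
    then have "code l e \<noteq> code l f" using inj_code e f by (auto dest: inj_onD)
    then show ?thesis using M.insep_common_circuit[OF ins fE eE fE'] that by blast
  qed
  define C0 where "C0 = {x \<in> elements G. code l x \<in> C}"
  have "code l ` C0 = C" using C(2) E unfolding C0_def by blast
  moreover have "C0 \<subseteq> elements G" unfolding C0_def by blast
  ultimately have "lc_circuit G C0" using circuit_iff C(1) by simp
  moreover have "e \<in> C0" "f \<in> C0" using C(3,4) e f unfolding C0_def by simp_all
  ultimately show "\<exists>C. lc_circuit G C \<and> e \<in> C \<and> f \<in> C" by blast
qed

text \<open>A component left by two vertices has a third neighbour in the coded graph. It is no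
  vertex, since it would then belong to the component, so it is the label of a loop.\<close>

lemma solid_imp_balanced:
  assumes s: "solid V E"
  shows "balanced G"
  unfolding balanced_def
proof (intro allI impI ballI)
  fix X C assume X: "X \<subseteq> verts G" "card X = 2" and C: "C \<in> components (delete_verts G X)"
  obtain u where u: "u \<in> verts G - X" "C = {w \<in> verts G - X. (u, w) \<in> (adjacency (delete_verts G X))\<^sup>*}"
    using C unfolding components_def delete_verts_def by auto
  let ?D = "Inl ` C :: ('v + nat) set"
  have D: "?D \<subseteq> V" "?D \<noteq> {}" using u V by auto
  then have "3 \<le> card (nb E ?D)" using s by (simp add: solid_def bal_def)
  moreover have fX: "finite X" using X(2) card.infinite by fastforce
  then have "card (Inl ` X :: ('v + nat) set) = 2" using X(2) by (simp add: card_image)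
  ultimately have "\<not> nb E ?D \<subseteq> Inl ` X" using fX card_mono[of "Inl ` X" "nb E ?D"] by auto
  then obtain t where t: "t \<in> nb E ?D" "t \<notin> Inl ` X" by blast
  then obtain p where p: "p \<in> C" "{Inl p, t} \<in> E" "t \<notin> ?D" by (auto simp: nb_def)
  have pV: "p \<in> verts G" "p \<notin> X" using p(1) u(2) by auto
  have "t \<notin> V"
  proof
    assume "t \<in> V"
    then obtain q where q: "t = Inl q" "q \<in> verts G" using V by blast
    have qX: "q \<notin> X" "q \<notin> C" "p \<noteq> q" using t(2) p q(1) by auto
    then have "Edge {p, q} \<in> edges G" using in_E_edge[of p q] p(2) q pV by simp
    then have "(p, q) \<in> adjacency (delete_verts G X)"
      using qX pV by (simp add: adjacency_def delete_verts_def)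
    then have "q \<in> C" using p(1) u(2) q(2) qX(1) by (auto intro: rtrancl.rtrancl_into_rtrancl)
    then show False using qX(2) by simp
  qed
  then obtain i where "Loop p i \<in> loops G" using in_E_loop[OF p(2) pV(1)] by blast
  then show "\<exists>l\<in>loops (delete_verts G X). ends l \<subseteq> C"
    using p(1) pV by (intro bexI[of _ "Loop p i"]) (auto simp: delete_verts_def)
qed

lemma connected_imp_circuits:
  assumes c: "lc_connected G" and "e \<in> E" "f \<in> E"
  obtains C where "M.circuit V C" "C \<subseteq> E" "e \<in> C" "f \<in> C"
proof -
  obtain x y where xy: "x \<in> elements G" "e = code l x" "y \<in> elements G" "f = code l y" using assms(2,3) E by blast
  obtain C where C: "lc_circuit G C" "x \<in> C" "y \<in> C" using c xy unfolding lc_connected_def by blast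
  then have C': "C \<subseteq> elements G" "M.circuit V (code l ` C)" using circuit_iff by simp_all
  show ?thesis
    by (rule that[OF C'(2)]) (use C' C(2,3) xy E in auto)
qed

text \<open>If there is at most one loop, removing its vertex and another one leaves a component
  without loops, provided that there are three vertices. With fewer there are at most two elements,
  and these are independent.\<close>

lemma two_loops:
  assumes ni: "no_isolated_vertices G" and b: "balanced G" and c: "lc_connected G"
  shows "2 \<le> card (loops G)"
proof (rule ccontr)
  assume "\<not> ?thesis"
  then have le: "card (loops G) \<le> Suc 0" by simp
  then have one: "x = y" if "x \<in> loops G" "y \<in> loops G" for x y
    using that card_le_Suc0_iff_eq[OF fin_loops] by blast
  obtain p where p: "p \<in> verts G" "\<And>x. x \<in> loops G \<Longrightarrow> ends x = {p}"
  proof (cases "loops G = {}")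
    case True
    then show ?thesis using that verts_ne by blast
  next
    case False
    then obtain x where x: "x \<in> loops G" by blast
    then obtain u i where "x = Loop u i" "u \<in> verts G" by (rule loop_cases)
    then have "ends y = {u}" if "y \<in> loops G" for y using one[OF that x] by simp
    then show ?thesis using that \<open>u \<in> verts G\<close> by blast
  qed
  show False
  proof (cases "card (verts G) \<le> 2")
    case True
    have "edges G \<subseteq> {Edge (verts G)}"
    proof
      fix x assume x: "x \<in> edges G"
      have "ends x = verts G" using card_seteq[OF fin_verts code_edge(3)[OF x]] code_edge(4)[OF x] True by simp
      then show "x \<in> {Edge (verts G)}" using code_edge(2)[OF x] by simp
    qed
    then have "card (edges G) \<le> card {Edge (verts G)}" by (rule card_mono[rotated]) simp
    then have "card (elements G) \<le> 2" using card_Un_le[of "edges G" "loops G"] le by simp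
    then have cE: "card E \<le> 2" using card_code_image[OF order_refl] E by simp
    have "elements G \<noteq> {}" using ni verts_ne by (auto simp: no_isolated_vertices_def span_verts_def)
    then obtain e where "e \<in> E" using E by blast
    then obtain C where C: "M.circuit V C" "C \<subseteq> E" "e \<in> C" using connected_imp_circuits[OF c] by blast
    have fE: "finite E" and fV: "finite V" using graph by (auto simp: graph_def)
    have "card C \<le> 2" using card_mono[OF fE C(2)] cE by simp
    moreover have "finite C" using finite_subset[OF C(2) fE] .
    ultimately have "\<exists>f. C \<subseteq> {e, f}"
    proof -
      have "card (C - {e}) \<le> Suc 0" using card.remove[OF \<open>finite C\<close> C(3)] \<open>card C \<le> 2\<close> by simp
      then have all: "\<forall>x\<in>C - {e}. \<forall>y\<in>C - {e}. x = y" using card_le_Suc0_iff_eq[of "C - {e}"] \<open>finite C\<close> by simp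
      define f where "f = (SOME x. x \<in> C - {e})"
      have "x \<in> {e, f}" if "x \<in> C" for x
      proof (cases "x = e")
        case False
        then have x: "x \<in> C - {e}" using that by simp
        then have f: "f \<in> C - {e}" unfolding f_def by (rule someI)
        have "x = f" by (rule bspec[OF bspec[OF all x] f])
        then show ?thesis by simp
      qed simp
      then show ?thesis by (intro exI[of _ f] subsetI)
    qed
    then obtain f where f: "C \<subseteq> {e, f}" by blast
    let ?f = "if f \<in> C then f else e"
    have "C \<subseteq> {e, ?f}" using f by auto
    moreover have "?f \<in> E" using C(2,3) by auto
    then have "ind V {e, ?f}"
      using \<open>e \<in> E\<close> graph by (intro ind_pair fV meets) (auto simp: graph_def)
    ultimately have "ind V C" using M.ind_mono by blast
    then show False using C(1) by (simp add: M.circuit_def)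
  next
    case False
    have "card (verts G - {p}) = card (verts G) - 1" using p(1) fin_verts by simp
    then have "card (verts G - {p}) \<noteq> 0" using False by simp
    then have "verts G - {p} \<noteq> {}" by (metis card.empty)
    then obtain q where q: "q \<in> verts G" "q \<noteq> p" by blast
    have X: "{p, q} \<subseteq> verts G" "card {p, q} = 2" using p(1) q by auto
    have "verts G \<noteq> {p, q}" using X(2) False by (metis order_refl)
    then obtain u where u: "u \<in> verts G - {p, q}" using X(1) by blast
    have "{w \<in> verts (delete_verts G {p, q}). (u, w) \<in> (adjacency (delete_verts G {p, q}))\<^sup>*}
        \<in> components (delete_verts G {p, q})"
      using u unfolding components_def by (auto simp: delete_verts_def)
    then obtain x where "x \<in> loops (delete_verts G {p, q})"
      using b X unfolding balanced_def by blast
    then have "x \<in> loops G" "ends x \<inter> {p, q} = {}" by (simp_all add: delete_verts_def)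
    then show False using p(2) by simp
  qed
qed

text \<open>Two loops lift the rank to \<open>2 * card V\<close>, and common circuits make it
  redundant. A set \<open>D\<close> with two neighbours has them among the vertices, because a label
  has only one edge; removing them leaves a component inside \<open>D\<close>, and the label of its
  loop is a third neighbour.\<close>

lemma connected_imp_solid:
  assumes ni: "no_isolated_vertices G" and b: "balanced G" and c: "lc_connected G"
  shows "solid V E" "conn V E"
proof -
  have fE: "finite E" and fV: "finite V" and c2: "\<And>e. e \<in> E \<Longrightarrow> card e = 2" using graph by (auto simp: graph_def)
  have circ: "\<exists>C. M.circuit V C \<and> C \<subseteq> E \<and> e \<in> C \<and> f \<in> C" if "e \<in> E" "f \<in> E" for e f
    using connected_imp_circuits[OF c that] by blast
  have "\<Union>E \<inter> V = Inl ` span_verts (elements G)" using Union_code_Int[OF order_refl] E by simp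
  then have UV: "V \<subseteq> \<Union>E" using ni V unfolding no_isolated_vertices_def by blast
  have "card (\<Union>E) = card (verts G) + card (loops G)"
    using Union_card[OF order_refl] ni E by (simp add: no_isolated_vertices_def Int_absorb1)
  then have lab: "card V + 2 \<le> card (\<Union>E)" using two_loops[OF ni b c] V by (simp add: card_image)
  have ne: "E \<noteq> {}" using UV V_ne by blast
  have ins: "M.insep V E" using circ by (intro M.insep_if_common_circuits fE)
  have r: "rigid V E" using insep_rigid[OF fE c2 meets fV ne ins UV lab] .
  have "rigid V (E - {g})" if g: "g \<in> E" for g
  proof -
    obtain C where C: "M.circuit V C" "C \<subseteq> E" "g \<in> C" using circ[OF g g] by blast
    then have "M.rk V (E - {g}) = M.rk V E" using M.rk_delete_circuit[OF C(1,2) fE C(3)] by simp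
    then show ?thesis using r rigid_rk[OF fE fV] rigid_rk[of "E - {g}" V] fE fV by simp
  qed
  then have rr: "RR V E" using r by (simp add: RR_def)
  have "3 \<le> card (nb E D)" if D: "D \<subseteq> V" "D \<noteq> {}" for D
  proof (rule ccontr)
    assume "\<not> ?thesis"
    then have le: "card (nb E D) \<le> 2" by simp
    have rD: "RR D E" using RR_contract[OF graph rr D(1)] .
    have gD: "graph D E" using graph_subset[OF graph D(1) order_refl] .
    have "card (nb E D) = 2" using RR_card_nb[OF rD D(2) gD] le by simp
    then obtain x y where xy: "nb E D = {x, y}" "x \<noteq> y" by (auto simp: card_2_iff)
    have nbV: "t \<in> V" if t: "t \<in> nb E D" for t
    proof (rule ccontr)
      assume tV: "t \<notin> V"
      obtain u w where uw: "u \<in> D" "w \<in> D" "u \<noteq> w" "{u, t} \<in> E" "{w, t} \<in> E"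
        using RR_nb_two_edges[OF rD D(2) gD le t] by blast
      have "{u, t} = {w, t}" by (rule unique_outer[OF uw(4,5) _ _ tV]) simp_all
      then show False using uw(1-3) t by (auto simp: doubleton_eq_iff nb_def)
    qed
    then obtain x' y' where xy': "x = Inl x'" "x' \<in> verts G" "y = Inl y'" "y' \<in> verts G"
      using xy(1) V by blast
    let ?X = "{x', y'}"
    have X: "?X \<subseteq> verts G" "card ?X = 2" using xy' xy(2) by auto
    obtain u where u: "Inl u \<in> D" "u \<in> verts G" using D V by blast
    have xyD: "x \<notin> D" "y \<notin> D" using xy(1) by (auto simp: nb_def)
    have uX: "u \<notin> ?X" using u xyD xy' by auto
    let ?H = "delete_verts G ?X"
    define C where "C = {w \<in> verts ?H. (u, w) \<in> (adjacency ?H)\<^sup>*}"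
    have "C \<in> components ?H" using u(2) uX unfolding components_def C_def by (auto simp: delete_verts_def)
    then obtain z where z: "z \<in> loops ?H" "ends z \<subseteq> C" using b X unfolding balanced_def by blast
    have CD: "Inl w \<in> D" if "(u, w) \<in> (adjacency ?H)\<^sup>*" for w
      using that
    proof (induction rule: rtrancl_induct)
      case base
      then show ?case using u(1) .
    next
      case (step a w)
      have e: "Edge {a, w} \<in> edges G" "w \<notin> ?X"
        using step(2) by (auto simp: adjacency_def delete_verts_def)
      then have "{Inl a, Inl w} \<in> E" using edge_in_E by blast
      then have "Inl w \<in> D \<or> Inl w \<in> nb E D" using step(3) by (auto simp: nb_def)
      then show ?case using xy(1) xy' e(2) by auto
    qed
    have zl: "z \<in> loops G" using z(1) by (simp add: delete_verts_def)
    then obtain p i where pi: "z = Loop p i" "p \<in> verts G" by (rule loop_cases)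
    then have "Inl p \<in> D" using z(2) CD by (auto simp: C_def)
    moreover have "{Inl p, l z} \<in> E" using loop_in_E[of p i] zl pi(1) by simp
    moreover have "l z \<notin> V" using code_loop(4)[OF zl] .
    ultimately have "l z \<in> nb E D" using D(1) by (auto simp: nb_def)
    then show False using nbV \<open>l z \<notin> V\<close> by blast
  qed
  then show "solid V E" using graph rr by (simp add: solid_def bal_def)
  \<comment> \<open>A circuit through both sides of a disconnection would split into independent
    sets that compose to an independent set.\<close>
  show "conn V E" unfolding conn_def
  proof (intro allI impI, elim conjE, rule ccontr)
    fix S assume S: "S \<subset> V" "S \<noteq> {}" and no: "\<not> (\<exists>e\<in>E. e \<inter> S \<noteq> {} \<and> e \<inter> (V - S) \<noteq> {})"
    obtain p q where p: "p \<in> S" and q: "q \<in> V - S" using S by blast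
    obtain e f where e: "e \<in> E" "p \<in> e" and f: "f \<in> E" "q \<in> f" using UV S(1) p q by blast
    obtain C where C: "M.circuit V C" "C \<subseteq> E" "e \<in> C" "f \<in> C" using circ[OF e(1) f(1)] by blast
    define A where "A = {x \<in> C. x \<inter> S \<noteq> {}}"
    have noA: "x \<inter> (V - S) = {}" if "x \<in> A" for x using that no C(2) unfolding A_def by blast
    have noB: "x \<inter> S = {}" if "x \<in> C - A" for x using that unfolding A_def by blast
    have "e \<in> A" using C(3) e(2) p unfolding A_def by blast
    moreover have "f \<notin> A" using noA f(2) q by blast
    ultimately have "A \<subset> C" "C - A \<subset> C" using C(3,4) unfolding A_def by blast+
    then have iA: "ind V A" and iB: "ind V (C - A)" using M.circuit_psubset_ind[OF C(1)] by blast+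
    have iA': "ind S A" by (rule ind_vertex_cong[OF iA]) (use noA S(1) in blast)
    have iB': "ind (V - S) (C - A)" by (rule ind_vertex_cong[OF iB]) (use noB in blast)
    have "ind (S \<union> (V - S)) (A \<union> (C - A))"
    proof (rule ind_compose[OF iA' iB'])
      show "\<Union>A \<inter> (V - S) = {}" using noA by blast
      show "finite S" using S(1) fV finite_subset by blast
    qed (use fV in auto)
    moreover have "S \<union> (V - S) = V" "A \<union> (C - A) = C" using S(1) unfolding A_def by blast+
    ultimately show False using C(1) by (simp add: M.circuit_def)
  qed
qed

end

subsection \<open>Operations on looped simple graphs\<close>

lemma looped_simpleI:
  assumes "finite (verts G)" "verts G \<noteq> {}" "finite (loops G)"
    and "\<And>x. x \<in> edges G \<Longrightarrow> \<exists>u w. x = Edge {u, w} \<and> u \<in> verts G \<and> w \<in> verts G \<and> u \<noteq> w"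
    and "\<And>x. x \<in> loops G \<Longrightarrow> \<exists>u i. x = Loop u i \<and> u \<in> verts G"
  shows "looped_simple_graph G"
  unfolding looped_simple_graph_def using assms by (intro conjI subsetI CollectI) simp_all

lemma code_cong: "l x = l' x \<Longrightarrow> code l x = code l' x"
  by (cases x) simp_all

lemma inj_on_upd_notin: "x \<notin> A \<Longrightarrow> inj_on l A \<Longrightarrow> inj_on (l(x := y)) A"
  by (auto simp: inj_on_def)

lemma exists_coding:
  assumes "looped_simple_graph G"
  obtains l where "coded l G (Inl ` verts G) (code l ` elements G)" "l ` loops G \<subseteq> range Inr"
proof -
  have "finite (loops G)" using assms by (simp add: looped_simple_graph_def)
  then obtain f :: "'a element \<Rightarrow> nat" where f: "inj_on f (loops G)"
    using finite_imp_inj_to_nat_seg by metis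
  show ?thesis
  proof (rule that)
    show "coded (Inr \<circ> f) G (Inl ` verts G) (code (Inr \<circ> f) ` elements G)"
      using assms f by unfold_locales (auto simp: inj_on_def)
  qed auto
qed

lemma conn_mono: "conn V E \<Longrightarrow> E \<subseteq> E' \<Longrightarrow> conn V E'"
  unfolding conn_def by (meson subsetD)

text \<open>A cut that is crossed by \<open>ab\<close> is now crossed by \<open>va\<close> or
  \<open>vb\<close>, whichever side \<open>v\<close> is on.\<close>

lemma conn_ext:
  assumes c: "conn V E" and a: "a \<in> V" and v: "v \<notin> V"
    and E': "E - {{a, b}} \<union> {{v, a}, {v, b}} \<subseteq> E'"
  shows "conn (insert v V) E'"
  unfolding conn_def
proof (intro allI impI, elim conjE)
  fix S assume S: "S \<subset> insert v V" "S \<noteq> {}"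
  have va: "{v, a} \<in> E'" and vb: "{v, b} \<in> E'" and keep: "\<And>e. e \<in> E \<Longrightarrow> e \<noteq> {a, b} \<Longrightarrow> e \<in> E'"
    using E' by auto
  consider "S - {v} = {}" | "V \<subseteq> S" | "S - {v} \<noteq> {}" "S - {v} \<subset> V" using S by blast
  then show "\<exists>e\<in>E'. e \<inter> S \<noteq> {} \<and> e \<inter> (insert v V - S) \<noteq> {}"
  proof cases
    case 1
    then have "S = {v}" using S(2) by blast
    then show ?thesis using va a v by (intro bexI[of _ "{v, a}"]) auto
  next
    case 2
    then have "v \<notin> S" using S by blast
    then show ?thesis using va a v 2 by (intro bexI[of _ "{v, a}"]) auto
  next
    case 3
    then obtain e where e: "e \<in> E" "e \<inter> (S - {v}) \<noteq> {}" "e \<inter> (V - (S - {v})) \<noteq> {}"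
      using c unfolding conn_def by (metis (no_types, lifting))
    show ?thesis
    proof (cases "e = {a, b}")
      case False
      then show ?thesis using e keep[OF e(1) False] v by (intro bexI[of _ e]) auto
    next
      case True
      obtain s t where st: "s \<in> {a, b}" "t \<in> {a, b}" "s \<in> S - {v}" "t \<in> V - (S - {v})"
        using e(2,3) unfolding True by blast
      have vE: "{v, r} \<in> E'" if "r \<in> {a, b}" for r using that va vb by auto
      show ?thesis
      proof (cases "v \<in> S")
        case True
        then show ?thesis using vE[OF st(2)] st(4) v by (intro bexI[of _ "{v, t}"]) auto
      next
        case False
        then show ?thesis using vE[OF st(1)] st(3) by (intro bexI[of _ "{v, s}"]) auto
      qed
    qed
  qed
qed

context coded
begin

lemma image_modify:
  assumes g: "g \<in> elements G" and l': "\<And>x. x \<in> elements G \<Longrightarrow> x \<noteq> g \<Longrightarrow> l' x = l x"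
  shows "code l' ` ((elements G - {g}) \<union> N) = (E - {code l g}) \<union> code l' ` N"
proof -
  have "code l' ` (elements G - {g}) = code l ` (elements G - {g})"
    using l' by (intro image_cong code_cong) auto
  also have "\<dots> = E - {code l g}"
    using inj_on_image_set_diff[OF inj_code, of "elements G" "{g}"] g by (simp add: E)
  finally show ?thesis by (simp only: image_Un)
qed

lemma fresh_label: obtains n where "Inr n \<notin> l ` loops G"
proof -
  have "finite {n. Inr n \<in> l ` loops G}" using fin_loops by (intro finite_vimageI[of _ Inr, unfolded vimage_def]) auto
  then obtain n where "n \<notin> {n. Inr n \<in> l ` loops G}" using ex_new_if_finite[OF infinite_UNIV_nat] by blast
  then show ?thesis using that by simp
qed

lemma loop_notin: "v \<notin> verts G \<Longrightarrow> Loop v i \<notin> elements G"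
  using ends_verts(1)[of "Loop v i"] by auto

lemma edge_form: "x \<in> edges G \<Longrightarrow> \<exists>u w. x = Edge {u, w} \<and> u \<in> verts G \<and> w \<in> verts G \<and> u \<noteq> w"
  using edge_cases by metis

lemma loop_form: "x \<in> loops G \<Longrightarrow> \<exists>u i. x = Loop u i \<and> u \<in> verts G"
  using loop_cases by metis

text \<open>In the coded graph the four extensions are one: an edge \<open>ub\<close> is subdivided
  by \<open>v\<close>, which gets a third neighbour \<open>t\<close>, and \<open>b\<close> and
  \<open>t\<close> may be labels. Labels are kept in \<open>range Inr\<close>, since otherwise the
  new vertex might coincide with one.\<close>

lemma forward_ext:
  assumes ext: "one_extension G H" and s: "solid V E" and c: "conn V E" and r: "l ` loops G \<subseteq> range Inr"
  shows "\<exists>l' V' E'. coded l' H V' E' \<and> solid V' E' \<and> conn V' E' \<and> l' ` loops H \<subseteq> range Inr"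
proof -
  have main: ?thesis
    if v: "v \<notin> verts G" and u: "u \<in> verts G" and vH: "verts H = insert v (verts G)"
      and g: "g \<in> elements G" "code l g = {Inl u, b}"
      and eH: "elements H = (elements G - {g}) \<union> N" and N: "code l' ` N = {{Inl v, Inl u}, {Inl v, b}, {Inl v, t}}"
      and l': "\<And>x. x \<in> elements G \<Longrightarrow> x \<noteq> g \<Longrightarrow> l' x = l x"
      and dis: "distinct [Inl v, Inl u, b, t]"
      and H: "looped_simple_graph H" and inj': "inj_on l' (loops H)" and r': "l' ` loops H \<subseteq> range Inr"
    for v u g b t N l'
  proof -
    let ?V = "insert (Inl v) V" and ?E = "E - {{Inl u, b}} \<union> {{Inl v, Inl u}, {Inl v, b}, {Inl v, t}}"
    have vV: "Inl v \<notin> V" using v V by auto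
    have vE: "Inl v \<notin> \<Union>E"
    proof
      assume "Inl v \<in> \<Union>E"
      then obtain e where e: "e \<in> E" "Inl v \<in> e" by blast
      then obtain x where "x \<in> loops G" "l x = Inl v" using outer_edge[OF e vV] by blast
      then show False using r by auto
    qed
    have ab: "{Inl u, b} \<in> E" using g E by (metis imageI)
    have im: "code l' ` ((elements G - {g}) \<union> N) = (E - {code l g}) \<union> code l' ` N"
      by (rule image_modify[OF g(1)]) (rule l')
    have "coded l' H ?V ?E"
    proof
      show "l' x \<notin> Inl ` verts H" if "x \<in> loops H" for x using r' that by auto
      show "?V = Inl ` verts H" using vH V by simp
      show "?E = code l' ` elements H"
        unfolding eH im g(2) N by (rule refl)
    qed (use H inj' in auto)
    moreover have "solid ?V ?E" using solid_one_ext[OF s vV vE dis] ab by blast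
    moreover have "conn ?V ?E" by (rule conn_ext[OF c _ vV, of "Inl u" b]) (use u V in auto)
    ultimately show ?thesis using r' by blast
  qed
  have fv: "finite (verts G)" "finite (loops G)" using fin_verts fin_loops by auto
  show ?thesis
    using ext
  proof (cases rule: one_extension.cases)
    case (at_edge_add_edge u w v x)
    have uw: "u \<in> verts G" "w \<in> verts G" "u \<noteq> w"
      using code_edge(3,4)[OF at_edge_add_edge(2)] by (auto simp: card_insert_if)
    have ef: "\<exists>u' w'. z = Edge {u', w'} \<and> u' \<in> verts H \<and> w' \<in> verts H \<and> u' \<noteq> w'" if z: "z \<in> edges H" for z
    proof -
      consider "z \<in> edges G" | "z = Edge {u, v}" | "z = Edge {w, v}" | "z = Edge {v, x}"
        using z unfolding at_edge_add_edge(1) by auto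
      then show ?thesis
      proof cases
        case 1
        then show ?thesis using edge_form[OF 1] unfolding at_edge_add_edge(1) by auto
      qed (use uw at_edge_add_edge in \<open>auto 4 3\<close>)
    qed
    have H: "looped_simple_graph H"
      by (rule looped_simpleI[OF _ _ _ ef]) (use fv in \<open>auto simp: at_edge_add_edge(1) dest!: loop_form\<close>)
    show ?thesis
    proof (rule main[of v u "Edge {u, w}" "Inl w" "{Edge {u, v}, Edge {w, v}, Edge {v, x}}" l "Inl x"])
      show "elements H = elements G - {Edge {u, w}} \<union> {Edge {u, v}, Edge {w, v}, Edge {v, x}}"
        using disj at_edge_add_edge(2) unfolding at_edge_add_edge(1) by auto
      show "inj_on l (loops H)" "l ` loops H \<subseteq> range Inr" using inj r unfolding at_edge_add_edge(1) by simp_all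
      show "code l ` {Edge {u, v}, Edge {w, v}, Edge {v, x}} = {{Inl v, Inl u}, {Inl v, Inl w}, {Inl v, Inl x}}"
        by (simp add: insert_commute)
    qed (use uw H at_edge_add_edge in auto)
  next
    case (at_edge_add_loop u w v i)
    have uw: "u \<in> verts G" "w \<in> verts G" "u \<noteq> w"
      using code_edge(3,4)[OF at_edge_add_loop(2)] by (auto simp: card_insert_if)
    obtain n where n: "Inr n \<notin> l ` loops G" by (rule fresh_label)
    let ?l = "l(Loop v i := Inr n)"
    have new: "Loop v i \<notin> elements G" using loop_notin at_edge_add_loop(3) by blast
    have ef: "\<exists>u' w'. z = Edge {u', w'} \<and> u' \<in> verts H \<and> w' \<in> verts H \<and> u' \<noteq> w'" if z: "z \<in> edges H" for z
    proof -
      consider "z \<in> edges G" | "z = Edge {u, v}" | "z = Edge {w, v}" using z unfolding at_edge_add_loop(1) by auto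
      then show ?thesis
      proof cases
        case 1
        then show ?thesis using edge_form[OF 1] unfolding at_edge_add_loop(1) by auto
      qed (use uw at_edge_add_loop in \<open>auto 4 3\<close>)
    qed
    have H: "looped_simple_graph H"
      by (rule looped_simpleI[OF _ _ _ ef]) (use fv in \<open>auto simp: at_edge_add_loop(1) dest!: loop_form\<close>)
    show ?thesis
    proof (rule main[of v u "Edge {u, w}" "Inl w" "{Edge {u, v}, Edge {w, v}, Loop v i}" ?l "Inr n"])
      show "elements H = elements G - {Edge {u, w}} \<union> {Edge {u, v}, Edge {w, v}, Loop v i}"
        using disj at_edge_add_loop(2) unfolding at_edge_add_loop(1) by auto
      have "inj_on ?l (loops G)" using inj new by (intro inj_on_upd_notin) auto
      moreover have "?l ` loops G = l ` loops G" using new by (intro image_cong) auto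
      ultimately show "inj_on ?l (loops H)" "?l ` loops H \<subseteq> range Inr"
        using n new r unfolding at_edge_add_loop(1) by auto
      show "code ?l ` {Edge {u, v}, Edge {w, v}, Loop v i} = {{Inl v, Inl u}, {Inl v, Inl w}, {Inl v, Inr n}}"
        by (simp add: insert_commute)
    qed (use uw H new at_edge_add_loop in auto)
  next
    case (at_loop_add_edge u k v w i)
    have u: "u \<in> verts G" using code_loop(2)[OF at_loop_add_edge(2)] by simp
    let ?g = "Loop u k"
    \<comment> \<open>The loop at \<open>v\<close> inherits the label of the deleted loop: it is the
      outer half of the subdivided edge.\<close>
    let ?l = "l(Loop v i := l ?g)"
    have new: "Loop v i \<notin> elements G" using loop_notin at_loop_add_edge(3) by blast
    have lg: "l ?g \<in> range Inr" using r at_loop_add_edge(2) by blast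
    have ef: "\<exists>u' w'. z = Edge {u', w'} \<and> u' \<in> verts H \<and> w' \<in> verts H \<and> u' \<noteq> w'" if z: "z \<in> edges H" for z
    proof -
      consider "z \<in> edges G" | "z = Edge {u, v}" | "z = Edge {w, v}" using z unfolding at_loop_add_edge(1) by auto
      then show ?thesis
      proof cases
        case 1
        then show ?thesis using edge_form[OF 1] unfolding at_loop_add_edge(1) by auto
      qed (use u at_loop_add_edge in \<open>auto 4 3\<close>)
    qed
    have H: "looped_simple_graph H"
      by (rule looped_simpleI[OF _ _ _ ef]) (use fv in \<open>auto simp: at_loop_add_edge(1) dest!: loop_form\<close>)
    show ?thesis
    proof (rule main[of v u ?g "l ?g" "{Edge {u, v}, Edge {w, v}, Loop v i}" ?l "Inl w"])
      show "elements H = elements G - {?g} \<union> {Edge {u, v}, Edge {w, v}, Loop v i}"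
        using disj at_loop_add_edge(2) unfolding at_loop_add_edge(1) by auto
      have "inj_on ?l (loops G - {?g})"
        using inj_on_subset[OF inj, of "loops G - {?g}"] new by (intro inj_on_upd_notin) auto
      moreover have "?l ` (loops G - {?g}) = l ` (loops G - {?g})" using new by (intro image_cong) auto
      moreover have "l ?g \<notin> l ` (loops G - {?g})" using inj at_loop_add_edge(2) by (auto dest: inj_onD)
      ultimately show "inj_on ?l (loops H)" "?l ` loops H \<subseteq> range Inr"
        using new r lg unfolding at_loop_add_edge(1) by auto
      show "code ?l ` {Edge {u, v}, Edge {w, v}, Loop v i} = {{Inl v, Inl u}, {Inl v, l ?g}, {Inl v, Inl w}}"
        by (simp add: insert_commute)
      show "distinct [Inl v, Inl u, l ?g, Inl w]" using lg u at_loop_add_edge(3,4) by auto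
    qed (use u H new at_loop_add_edge in auto)
  next
    case (at_loop_add_loop u k v i j)
    have u: "u \<in> verts G" using code_loop(2)[OF at_loop_add_loop(2)] by simp
    obtain n where n: "Inr n \<notin> l ` loops G" by (rule fresh_label)
    let ?g = "Loop u k"
    let ?l = "l(Loop v i := l ?g, Loop v j := Inr n)"
    have new: "Loop v i \<notin> elements G" "Loop v j \<notin> elements G" using loop_notin at_loop_add_loop(3) by blast+
    have lg: "l ?g \<in> range Inr" using r at_loop_add_loop(2) by blast
    have ng: "Inr n \<noteq> l ?g" using n at_loop_add_loop(2) by auto
    have ef: "\<exists>u' w'. z = Edge {u', w'} \<and> u' \<in> verts H \<and> w' \<in> verts H \<and> u' \<noteq> w'" if z: "z \<in> edges H" for z
    proof -
      consider "z \<in> edges G" | "z = Edge {u, v}" using z unfolding at_loop_add_loop(1) by auto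
      then show ?thesis
      proof cases
        case 1
        then show ?thesis using edge_form[OF 1] unfolding at_loop_add_loop(1) by auto
      qed (use u at_loop_add_loop in \<open>auto 4 3\<close>)
    qed
    have H: "looped_simple_graph H"
      by (rule looped_simpleI[OF _ _ _ ef]) (use fv in \<open>auto simp: at_loop_add_loop(1) dest!: loop_form\<close>)
    show ?thesis
    proof (rule main[of v u ?g "l ?g" "{Edge {u, v}, Loop v i, Loop v j}" ?l "Inr n"])
      show "elements H = elements G - {?g} \<union> {Edge {u, v}, Loop v i, Loop v j}"
        using disj at_loop_add_loop(2) unfolding at_loop_add_loop(1) by auto
      have "inj_on ?l (loops G - {?g})"
        using inj_on_subset[OF inj, of "loops G - {?g}"] new by (intro inj_on_upd_notin) auto
      moreover have im: "?l ` (loops G - {?g}) = l ` (loops G - {?g})" using new by (intro image_cong) auto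
      moreover have "l ?g \<notin> l ` (loops G - {?g})" using inj at_loop_add_loop(2) by (auto dest: inj_onD)
      moreover have "Inr n \<notin> l ` (loops G - {?g})" using n by auto
      moreover have "?l (Loop v i) = l ?g" "?l (Loop v j) = Inr n" using at_loop_add_loop(4) by simp_all
      moreover have "loops H = insert (Loop v i) (insert (Loop v j) (loops G - {?g}))"
        unfolding at_loop_add_loop(1) by auto
      ultimately show "inj_on ?l (loops H)" "?l ` loops H \<subseteq> range Inr"
        using new r lg ng by (simp_all only: inj_on_insert image_insert) auto
      show "code ?l ` {Edge {u, v}, Loop v i, Loop v j} = {{Inl v, Inl u}, {Inl v, l ?g}, {Inl v, Inr n}}"
        using at_loop_add_loop(4) by (simp add: insert_commute)
      show "distinct [Inl v, Inl u, l ?g, Inr n]" using lg u ng at_loop_add_loop(3) by auto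
    qed (use u H new at_loop_add_loop in auto)
  qed
qed

lemma forward_add:
  assumes add: "add_element G H" and s: "solid V E" and c: "conn V E" and r: "l ` loops G \<subseteq> range Inr"
  shows "\<exists>l' V' E'. coded l' H V' E' \<and> solid V' E' \<and> conn V' E' \<and> l' ` loops H \<subseteq> range Inr"
proof -
  have main: ?thesis
    if vH: "verts H = verts G" and eH: "elements H = insert x (elements G)"
      and H: "looped_simple_graph H" and l': "\<And>y. y \<in> elements G \<Longrightarrow> l' y = l y"
      and inj': "inj_on l' (loops H)" and r': "l' ` loops H \<subseteq> range Inr" for x l'
  proof -
    let ?E = "insert (code l' x) E"
    have "code l' ` elements G = E" unfolding E using l' by (intro image_cong code_cong) auto
    then have cd: "coded l' H V ?E"
      using H inj' r' vH eH V by unfold_locales auto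
    have g: "graph V ?E" by (rule coded.graph[OF cd])
    have sub: "E \<subseteq> ?E" by blast
    show ?thesis using cd solid_mono[OF s sub g] conn_mono[OF c sub] r' by blast
  qed
  have fv: "finite (verts G)" "finite (loops G)" using fin_verts fin_loops by auto
  show ?thesis
    using add
  proof (cases rule: add_element.cases)
    case (add_edge u w)
    show ?thesis
    proof (rule main[of "Edge {u, w}" l])
      show "looped_simple_graph H" unfolding add_edge(1)
        by (rule looped_simpleI) (use fv verts_ne add_edge in \<open>auto dest!: edge_form loop_form\<close>)
    qed (use inj r add_edge in auto)
  next
    case (add_loop u i)
    obtain n where n: "Inr n \<notin> l ` loops G" by (rule fresh_label)
    let ?l = "l(Loop u i := Inr n)"
    have new: "Loop u i \<notin> edges G"
      using code_edge(4)[of "Loop u i"] by auto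
    show ?thesis
    proof (rule main[of "Loop u i" ?l])
      show "looped_simple_graph H" unfolding add_loop(1)
        by (rule looped_simpleI) (use fv verts_ne add_loop in \<open>auto dest!: edge_form loop_form\<close>)
      have "inj_on ?l (loops G)" using inj add_loop(3) by (intro inj_on_upd_notin)
      moreover have "?l ` loops G = l ` loops G" using add_loop(3) by (intro image_cong) auto
      ultimately show "inj_on ?l (loops H)" "?l ` loops H \<subseteq> range Inr"
        using n add_loop(3) r unfolding add_loop(1) by auto
    qed (use new add_loop in auto)
  qed
qed

end

lemma K1_3_solid:
  assumes "is_K1_3 G"
  shows "\<exists>l V E. coded l G V E \<and> solid V E \<and> conn V E \<and> l ` loops G \<subseteq> range Inr"
proof -
  obtain u where u: "verts G = {u}" "edges G = {}" "loops G \<subseteq> {Loop u i | i. True}" "card (loops G) = 3"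
    using assms unfolding is_K1_3_def by blast
  have fl: "finite (loops G)" using u(4) card.infinite by fastforce
  have "looped_simple_graph G" by (rule looped_simpleI) (use u fl in auto)
  then obtain l where cd: "coded l G (Inl ` verts G) (code l ` elements G)" and r: "l ` loops G \<subseteq> range Inr"
    by (rule exists_coding)
  interpret coded l G "Inl ` verts G" "code l ` elements G" by (rule cd)
  obtain x y z where xyz: "loops G = {x, y, z}" "x \<noteq> y" "y \<noteq> z" "x \<noteq> z" using u(4) by (auto simp: card_3_iff)
  have cl: "code l w = {Inl u, l w}" if "w \<in> loops G" for w using u(3) that by auto
  have ne: "l x \<noteq> l y" "l y \<noteq> l z" "l x \<noteq> l z" using inj xyz by (auto dest: inj_onD)
  have ou: "l w \<noteq> Inl u" if "w \<in> loops G" for w using outside[OF that] u(1) by auto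
  have E: "code l ` elements G = {{Inl u, l x}, {Inl u, l y}, {Inl u, l z}}"
    using u(2) xyz(1) cl[of x] cl[of y] cl[of z] by simp
  have "step {} {} {Inl u} {{Inl u, l x}, {Inl u, l y}, {Inl u, l z}}"
    by (rule step_vertex[of "Inl u" _ _ _ "l x" "l y" "l z"])
      (use ne ou[of x] ou[of y] ou[of z] xyz(1) in auto)
  moreover have "solid {} ({} :: ('a + nat) set set)" by (intro solid_empty) (simp add: graph_def)
  ultimately have "solid (Inl ` verts G) (code l ` elements G)" using step_solid u(1) E by fastforce
  moreover have "conn (Inl ` verts G) (code l ` elements G)" unfolding conn_def u(1) by auto
  ultimately show ?thesis using cd r by blast
qed

lemma obtainable_imp_solid:
  "obtainable_from_K1_3 G \<Longrightarrow> \<exists>l V E. coded l G V E \<and> solid V E \<and> conn V E \<and> l ` loops G \<subseteq> range Inr"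
proof (induction rule: obtainable_from_K1_3.induct)
  case (base G)
  then show ?case by (rule K1_3_solid)
next
  case (extend G H)
  then show ?case using coded.forward_ext by metis
next
  case (add G H)
  then show ?case using coded.forward_add by metis
qed

subsection \<open>Bridges\<close>

definition cross :: "'a set \<Rightarrow> 'a set set \<Rightarrow> 'a set \<Rightarrow> 'a set set" where
  "cross V E S = {e \<in> E. e \<inter> S \<noteq> {} \<and> e \<inter> (V - S) \<noteq> {}}"

lemma conn_cross: "conn V E \<longleftrightarrow> (\<forall>S. S \<subset> V \<and> S \<noteq> {} \<longrightarrow> cross V E S \<noteq> {})"
  unfolding conn_def cross_def by (simp add: Bex_def)

text \<open>If the smaller graph falls apart, only the removed edge or vertex held it together. Of
  the three edges of a removed vertex at least one leads into \<open>W\<close> and at least one out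
  of it, so in one direction there is exactly one, and \<open>v\<close> is put on the opposite side
  of the cut.\<close>

lemma bridge_of_disconnection:
  assumes st: "step V' E' V E" and c: "conn V E" and W: "W \<subset> V'" "W \<noteq> {}"
    and no: "\<And>e. e \<in> E' \<Longrightarrow> e \<inter> W \<noteq> {} \<Longrightarrow> e \<inter> (V' - W) = {}"
  obtains S where "W \<subseteq> S" "S \<subseteq> W \<union> (V - V')" "S \<subset> V" "card (cross V E S) = 1"
proof -
  note found = that
  have node: thesis if v: "v \<notin> V'" "v \<notin> \<Union>E'" "V = insert v V'" and E: "E \<subseteq> E' \<union> {{v, a}, {v, b}, {v, d}}" for v a b d
  proof -
    let ?T = "{a, b, d}"
    have W1: "W \<subset> V" "W \<noteq> {}" using W v(3) by blast+
    obtain q where q: "q \<in> V'" "q \<notin> W" "q \<noteq> v" using W v(1) by blast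
    have W2: "insert v W \<subset> V" "insert v W \<noteq> {}"
    proof -
      have "q \<in> V" "q \<notin> insert v W" using q v(3) by simp_all
      then have "insert v W \<noteq> V" by metis
      moreover have "insert v W \<subseteq> V" using W v(3) by blast
      ultimately show "insert v W \<subset> V" by (rule psubsetI[rotated])
    qed simp
    have form: "\<exists>t\<in>?T. e = {v, t}" if "e \<in> E" "v \<in> e \<or> (e \<inter> W \<noteq> {} \<and> e \<inter> (V' - W) \<noteq> {})" for e
    proof (cases "e \<in> E'")
      case True
      then show ?thesis using that(2) v(2) no by blast
    next
      case False
      then have "e = {v, a} \<or> e = {v, b} \<or> e = {v, d}" using that(1) E by blast
      then show ?thesis by auto
    qed
    have "cross V E W \<subseteq> (\<lambda>t. {v, t}) ` (?T \<inter> W)"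
    proof
      fix e assume e: "e \<in> cross V E W"
      then have "v \<in> e \<or> (e \<inter> W \<noteq> {} \<and> e \<inter> (V' - W) \<noteq> {})" using v(3) unfolding cross_def by blast
      then obtain t where t: "t \<in> ?T" "e = {v, t}" using form[of e] e unfolding cross_def by blast
      moreover have "t \<in> W" using e t(2) W v(1) unfolding cross_def by blast
      ultimately show "e \<in> (\<lambda>t. {v, t}) ` (?T \<inter> W)" by blast
    qed
    then have c1: "card (cross V E W) \<le> card (?T \<inter> W)" "finite (cross V E W)"
      using surj_card_le[of "?T \<inter> W"] finite_subset[of _ "(\<lambda>t. {v, t}) ` (?T \<inter> W)"] by simp_all
    have "cross V E (insert v W) \<subseteq> (\<lambda>t. {v, t}) ` (?T - W)"
    proof
      fix e assume e: "e \<in> cross V E (insert v W)"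
      then have "v \<in> e \<or> (e \<inter> W \<noteq> {} \<and> e \<inter> (V' - W) \<noteq> {})" using v(3) unfolding cross_def by blast
      then obtain t where t: "t \<in> ?T" "e = {v, t}" using form[of e] e unfolding cross_def by blast
      moreover have "t \<notin> W" using e t(2) unfolding cross_def by blast
      ultimately show "e \<in> (\<lambda>t. {v, t}) ` (?T - W)" by blast
    qed
    then have c2: "card (cross V E (insert v W)) \<le> card (?T - W)" "finite (cross V E (insert v W))"
      using surj_card_le[of "?T - W"] finite_subset[of _ "(\<lambda>t. {v, t}) ` (?T - W)"] by simp_all
    have "card ((?T \<inter> W) \<union> (?T - W)) = card (?T \<inter> W) + card (?T - W)" by (intro card_Un_disjoint) auto
    moreover have "(?T \<inter> W) \<union> (?T - W) = ?T" by blast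
    ultimately have "card (?T \<inter> W) + card (?T - W) = card ?T" by (simp only:)
    moreover have "card ?T \<le> 3" by (simp add: card_insert_if)
    moreover have "card (cross V E W) \<noteq> 0" using c W1 c1(2) unfolding conn_cross by simp
    moreover have "card (cross V E (insert v W)) \<noteq> 0" using c W2 c2(2) unfolding conn_cross by simp
    ultimately consider "card (cross V E W) = 1" | "card (cross V E (insert v W)) = 1" using c1(1) c2(1) by linarith
    then show thesis
    proof cases
      case 1
      show thesis by (rule found[of W]) (use 1 W1 in auto)
    next
      case 2
      show thesis by (rule found[of "insert v W"]) (use 2 W2 v(1,3) in auto)
    qed
  qed
  show thesis
    using st
  proof (cases rule: stepE)
    case (edge f)
    have "cross V E W \<subseteq> {f}" using no edge(1,3) unfolding cross_def by blast
    moreover have "cross V E W \<noteq> {}" using c W edge(1) unfolding conn_cross by simp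
    ultimately have "cross V E W = {f}" by blast
    then show thesis using found[of W] W edge(1) by simp
  next
    case (vertex v a b d)
    show thesis by (rule node[OF vertex(1-3), of a b d]) (use vertex(5) in blast)
  next
    case (ext v a b d)
    show thesis by (rule node[OF ext(1-3), of a b d]) (use ext(7) in blast)
  qed
qed

text \<open>By redundancy each side is rigid without the bridge, so that after any deletion the
  sides can still be composed. A set meeting both sides has three neighbours from each part, of
  which at most one is an end of the bridge; the others are distinct, which leaves at least
  four.\<close>

lemma bridge_compose:
  assumes s: "solid V E" and V: "V = V1 \<union> V2" "V1 \<inter> V2 = {}" and u: "u \<in> V1" and w: "w \<in> V2"
    and f: "{u, w} \<in> E" and only: "\<And>e. e \<in> E \<Longrightarrow> e \<inter> V1 \<noteq> {} \<Longrightarrow> e \<inter> V2 \<noteq> {} \<Longrightarrow> e = {u, w}"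
    and uniq: "\<And>p q t. p \<in> V1 \<Longrightarrow> q \<in> V2 \<Longrightarrow> {p, t} \<in> E \<Longrightarrow> {q, t} \<in> E \<Longrightarrow> t \<in> V"
    and st2: "step V2' E' V2 E" and s2: "solid V2' E'" and w2: "w \<in> V2'" and f': "{u, w} \<in> E'"
  shows "step (V1 \<union> V2') E' V E" "solid (V1 \<union> V2') E'"
proof -
  let ?V = "V1 \<union> V2'" and ?f = "{u, w}"
  have g: "graph V E" and rr: "RR V E" using s by (auto simp: solid_def)
  show st: "step ?V E' V E" using step_lift[OF st2, of V1] V by simp
  note g' = step_graph[OF st g]
  have fin: "finite V" "finite E" "finite V1" "finite V2'" using g g' by (auto simp: graph_def)
  have c2: "card e = 2" if "e \<in> E'" for e using g' that by (simp add: graph_def)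
  have sub: "V2' \<subseteq> V2" using step_subset[OF st2] .
  have dis: "V1 \<inter> V2' = {}" using V(2) sub by blast
  have V1V: "V1 \<subseteq> V" using V(1) by simp
  have kept: "e \<in> E'" if e: "e \<in> E" "e \<inter> V1 \<noteq> {}" for e
  proof (cases "e \<inter> V2 = {}")
    case True
    then show ?thesis using step_outside[OF st2] e(1) by blast
  next
    case False
    then show ?thesis using only[OF e False] f' by simp
  qed
  have cr: "p = u \<and> t = w" if pt: "{p, t} \<in> E'" "p \<in> V1" "t \<in> V2'" for p t
  proof -
    have eq: "q = u \<and> r = w" if "{q, r} \<in> E" "q \<in> V1" "r \<in> V2" for q r
    proof -
      have "{q, r} = {u, w}" using only[OF that(1)] that(2,3) by auto
      then show ?thesis using that(2,3) u w V(2) by (auto simp: doubleton_eq_iff)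
    qed
    from step_edge_cases[OF st2 pt(1)] show ?thesis
    proof
      assume "{p, t} \<in> E"
      then show ?thesis using eq pt(2,3) sub by blast
    next
      assume "\<exists>v\<in>V2 - V2'. {v, p} \<in> E \<and> {v, t} \<in> E"
      then obtain v where "v \<in> V2 - V2'" "{p, v} \<in> E" by (auto simp: insert_commute)
      then show ?thesis using eq[of p v] pt(2) w2 by blast
    qed
  qed
  have crs: "e = ?f" if e: "e \<in> E'" "e \<inter> V1 \<noteq> {}" "e \<inter> V2' \<noteq> {}" for e
  proof -
    obtain p t where pt: "p \<in> e" "p \<in> V1" "t \<in> e" "t \<in> V2'" using e by blast
    then have "p \<noteq> t" using dis by blast
    then have "e = {p, t}" using pair_other[OF c2[OF e(1)] pt(1,3)] by simp
    then show ?thesis using cr[of p t] e(1) pt by simp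
  qed
  have r1f: "rigid V1 (E - {?f})"
    by (rule rigid_contract[OF RR_delete[OF rr] V1V]) (use g in \<open>auto simp: graph_def\<close>)
  have rr1: "RR V1 E'"
    by (rule RR_inc_mono[OF RR_contract[OF g rr V1V]]) (use kept in \<open>auto simp: inc_def\<close>)
  have rr2: "RR V2' E'" using s2 by (simp add: solid_def)
  \<comment> \<open>The side composed first must avoid the other one, so it does without the bridge;
    it is chosen so that the deleted edge is none of the edges it uses.\<close>
  have del: "rigid ?V (E' - {h})" for h
  proof (cases "h \<inter> V2' \<noteq> {} \<and> h \<inter> V1 = {}")
    case True
    let ?E1 = "{e \<in> E'. e \<inter> V2' = {}}"
    have "inc V1 (E - {?f}) \<subseteq> ?E1"
    proof
      fix e assume e: "e \<in> inc V1 (E - {?f})"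
      then have "e \<in> E" "e \<inter> V1 \<noteq> {}" "e \<noteq> ?f" by (auto simp: inc_def)
      then have "e \<in> E'" "e \<inter> V2 = {}" using kept[of e] only[of e] by auto
      then show "e \<in> ?E1" using sub by blast
    qed
    moreover have "rigid V1 (inc V1 (E - {?f}))" using r1f by (simp add: rigid_inc)
    ultimately have "rigid V1 ?E1" using rigid_mono[of V1 "inc V1 (E - {?f})" ?E1] by simp
    then show ?thesis
    proof (rule rigid_compose)
      show "rigid V2' (E' - {h})" using RR_delete[OF rr2] .
      show "?E1 \<subseteq> E' - {h}" using True by auto
    qed (use dis fin in auto)
  next
    case False
    let ?E1 = "inc V2' (E' - {?f})"
    have "rigid V2' ?E1" using RR_delete[OF rr2, of ?f] by (simp add: rigid_inc)
    then have "rigid (V2' \<union> V1) (E' - {h})"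
    proof (rule rigid_compose)
      show "rigid V1 (E' - {h})" using RR_delete[OF rr1] .
      have no: "e \<inter> V1 = {}" if "e \<in> ?E1" for e using crs[of e] that by (auto simp: inc_def)
      show "\<Union>?E1 \<inter> V1 = {}" using no by blast
      show "?E1 \<subseteq> E' - {h}"
      proof
        fix e assume e: "e \<in> ?E1"
        have "e \<noteq> h" using False no[OF e] e by (auto simp: inc_def)
        then show "e \<in> E' - {h}" using e by (auto simp: inc_def)
      qed
    qed (use dis fin in auto)
    then show ?thesis by (simp add: Un_commute)
  qed
  have "RR ?V E'" unfolding RR_def using del rigid_mono[OF del[of ?f], of E'] by blast
  moreover have "bal ?V E'" unfolding bal_def
  proof (intro allI impI)
    fix A assume A: "A \<subseteq> ?V" "A \<noteq> {}"
    let ?A1 = "A \<inter> V1" and ?A2 = "A \<inter> V2'"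
    have finA: "finite (nb E' A)" using finite_nb[OF g'] .
    have b1: "3 \<le> card (nb E ?A1)" if "?A1 \<noteq> {}"
    proof -
      have "\<forall>D\<subseteq>V. D \<noteq> {} \<longrightarrow> 3 \<le> card (nb E D)" using s by (simp add: solid_def bal_def)
      moreover have "?A1 \<subseteq> V" using V1V by auto
      ultimately show ?thesis using that by simp
    qed
    have b2: "3 \<le> card (nb E' ?A2)" if "?A2 \<noteq> {}"
    proof -
      have "\<forall>D\<subseteq>V2'. D \<noteq> {} \<longrightarrow> 3 \<le> card (nb E' D)" using s2 by (simp add: solid_def bal_def)
      then show ?thesis using that by simp
    qed
    show "3 \<le> card (nb E' A)"
    proof (cases "?A1 = {} \<or> ?A2 = {}")
      case True
      show ?thesis
      proof (cases "?A1 = {}")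
        case True
        then have "A = ?A2" using A(1) by blast
        then show ?thesis using b2 A(2) by metis
      next
        case False
        then have A1: "A = ?A1" using True A(1) by blast
        have "nb E ?A1 \<subseteq> nb E' ?A1" unfolding nb_def using kept by blast
        then have "card (nb E ?A1) \<le> card (nb E' A)" using finA A1 by (metis card_mono)
        then show ?thesis using b1[OF False] by simp
      qed
    next
      case False
      then have ne: "?A1 \<noteq> {}" "?A2 \<noteq> {}" by auto
      let ?N1 = "nb E ?A1 - {w}" and ?N2 = "nb E' ?A2 - {u}"
      have n1: "t \<in> nb E' A \<and> t \<notin> V2" if t: "t \<in> ?N1" for t
      proof -
        obtain p where p: "p \<in> A" "p \<in> V1" "{p, t} \<in> E" "t \<notin> ?A1" "t \<noteq> w" using t by (auto simp: nb_def)
        have "t \<notin> V2"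
        proof
          assume "t \<in> V2"
          then have "{p, t} = {u, w}" using only[OF p(3)] p(2) by auto
          then show False using p(2,5) w V(2) by (auto simp: doubleton_eq_iff)
        qed
        moreover have "{p, t} \<in> E'" using kept[OF p(3)] p(2) by simp
        ultimately show ?thesis using p A(1) sub by (auto simp: nb_def)
      qed
      have n2: "t \<in> nb E' A \<and> t \<notin> V1 \<and> (t \<notin> V2 \<longrightarrow> (\<exists>q\<in>V2. {q, t} \<in> E))" if t: "t \<in> ?N2" for t
      proof -
        obtain p where p: "p \<in> A" "p \<in> V2'" "{p, t} \<in> E'" "t \<notin> ?A2" "t \<noteq> u" using t by (auto simp: nb_def)
        have tV1: "t \<notin> V1" using cr[of t p] p by (auto simp: insert_commute)
        moreover have "\<exists>q\<in>V2. {q, t} \<in> E" using step_edge_cases[OF st2 p(3)] p(2) sub by blast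
        moreover have "t \<notin> A" using tV1 p(4) A(1) by blast
        ultimately show ?thesis using p(1,3) by (auto simp: nb_def)
      qed
      have dj: "?N1 \<inter> ?N2 = {}"
      proof (rule equals0I)
        fix t assume t: "t \<in> ?N1 \<inter> ?N2"
        then have t12: "t \<notin> V2" "t \<notin> V1" using n1 n2 by blast+
        obtain q where q: "q \<in> V2" "{q, t} \<in> E" using n2 t t12(1) by blast
        obtain p where "p \<in> V1" "{p, t} \<in> E" using t by (auto simp: nb_def)
        then show False using uniq[OF _ q(1) _ q(2)] t12 V(1) by blast
      qed
      have fN: "finite (nb E ?A1)" "finite (nb E' ?A2)" using finite_nb[OF g] finite_nb[OF g'] by auto
      have "card ?N1 \<ge> 2" using b1[OF ne(1)] fN(1) by (cases "w \<in> nb E ?A1") simp_all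
      moreover have "card ?N2 \<ge> 2" using b2[OF ne(2)] fN(2) by (cases "u \<in> nb E' ?A2") simp_all
      moreover have "card (?N1 \<union> ?N2) = card ?N1 + card ?N2" using dj fN by (intro card_Un_disjoint) auto
      moreover have "card (?N1 \<union> ?N2) \<le> card (nb E' A)" using finA n1 n2 by (intro card_mono) blast+
      ultimately show ?thesis by linarith
    qed
  qed
  ultimately show "solid ?V E'" using g' by (simp add: solid_def)
qed

section \<open>Inverse operations on looped graphs\<close>

lemma lgraph_eta: "\<lparr>verts = verts G, edges = edges G, loops = loops G\<rparr> = (G :: 'v lgraph)"
  by (cases G) simp

context coded
begin

lemma in_code_iff: "g \<in> elements G \<Longrightarrow> x \<in> verts G \<Longrightarrow> Inl x \<in> code l g \<longleftrightarrow> x \<in> ends g"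
proof -
  assume g: "g \<in> elements G" and x: "x \<in> verts G"
  have "Inl x \<in> code l g \<longleftrightarrow> Inl x \<in> code l g \<inter> V" using x V by simp
  also have "\<dots> \<longleftrightarrow> x \<in> ends g" unfolding code_Int_V[OF g] by auto
  finally show ?thesis .
qed

lemma remove_element:
  assumes x: "x \<in> elements G"
  shows "\<exists>G'. coded l G' V (E - {code l x}) \<and> add_element G' G"
proof -
  have im: "E - {code l x} = code l ` (elements G - {x})"
    using inj_on_image_set_diff[OF inj_code, of "elements G" "{x}"] x by (simp add: E)
  show ?thesis
  proof (cases "x \<in> edges G")
    case True
    then obtain u w where uw: "x = Edge {u, w}" "u \<in> verts G" "w \<in> verts G" "u \<noteq> w" by (rule edge_cases)
    let ?G = "G\<lparr>edges := edges G - {x}\<rparr>"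
    have "add_element ?G (?G\<lparr>edges := insert (Edge {u, w}) (edges ?G)\<rparr>)"
      by (rule add_element.add_edge) (use uw in auto)
    then have "add_element ?G G" using True uw(1) by (simp add: insert_absorb)
    moreover have "coded l ?G V (E - {code l x})"
    proof
      show "looped_simple_graph ?G" using G unfolding looped_simple_graph_def by auto
      show "E - {code l x} = code l ` elements ?G" unfolding im using True disj by (intro arg_cong[of _ _ "image (code l)"]) auto
    qed (use inj outside V in auto)
    ultimately show ?thesis by blast
  next
    case False
    then have xl: "x \<in> loops G" using x by blast
    then obtain u i where ui: "x = Loop u i" "u \<in> verts G" by (rule loop_cases)
    let ?G = "G\<lparr>loops := loops G - {x}\<rparr>"
    have "add_element ?G (?G\<lparr>loops := insert (Loop u i) (loops ?G)\<rparr>)"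
      by (rule add_element.add_loop) (use ui in auto)
    then have "add_element ?G G" using xl ui(1) by (simp add: insert_absorb)
    moreover have "coded l ?G V (E - {code l x})"
    proof
      show "looped_simple_graph ?G" using G unfolding looped_simple_graph_def by auto
      show "E - {code l x} = code l ` elements ?G" unfolding im using False by (intro arg_cong[of _ _ "image (code l)"]) auto
      show "inj_on l (loops ?G)" using inj_on_subset[OF inj] by simp
    qed (use outside V in auto)
    ultimately show ?thesis by blast
  qed
qed

definition at :: "'v \<Rightarrow> 'v element set" where
  "at x = {g \<in> elements G. x \<in> ends g}"

lemma code_at: "x \<in> verts G \<Longrightarrow> code l ` at x = {e \<in> E. Inl x \<in> e}"
  unfolding at_def E using in_code_iff by blast

lemma at_eqI: "x \<in> verts G \<Longrightarrow> T \<subseteq> elements G \<Longrightarrow> {e \<in> E. Inl x \<in> e} = code l ` T \<Longrightarrow> at x = T"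
proof -
  assume a: "x \<in> verts G" "T \<subseteq> elements G" "{e \<in> E. Inl x \<in> e} = code l ` T"
  have "at x \<subseteq> elements G" by (auto simp: at_def)
  then show ?thesis using inj_on_image_eq_iff[OF inj_code _ a(2)] code_at[OF a(1)] a(3) by metis
qed

lemma code_remove: "code l ` (elements G - at x) = E - code l ` at x"
  using inj_on_image_set_diff[OF inj_code, of "elements G" "at x"] by (auto simp: E at_def)

lemma at_edges: "g \<in> edges G - at x \<Longrightarrow> \<exists>u w. g = Edge {u, w} \<and> u \<in> verts G - {x} \<and> w \<in> verts G - {x} \<and> u \<noteq> w"
proof -
  assume g: "g \<in> edges G - at x"
  then obtain u w where uw: "g = Edge {u, w}" "u \<in> verts G" "w \<in> verts G" "u \<noteq> w" using edge_form[of g] by blast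
  then have "u \<noteq> x" "w \<noteq> x" using g by (auto simp: at_def)
  then show ?thesis using uw by blast
qed

lemma at_loops: "g \<in> loops G - at x \<Longrightarrow> \<exists>u i. g = Loop u i \<and> u \<in> verts G - {x}"
  using loop_form[of g] by (auto simp: at_def)

lemma coded_remove_edge:
  assumes p: "p \<in> verts G - {x}" "q \<in> verts G - {x}" "p \<noteq> q"
  shows "coded l \<lparr>verts = verts G - {x}, edges = insert (Edge {p, q}) (edges G - at x), loops = loops G - at x\<rparr>
    (V - {Inl x}) (insert {Inl p, Inl q} (E - code l ` at x))" (is "coded l ?G _ _")
proof
  show "looped_simple_graph ?G"
  proof (rule looped_simpleI)
    show "\<exists>u w. z = Edge {u, w} \<and> u \<in> verts ?G \<and> w \<in> verts ?G \<and> u \<noteq> w" if z: "z \<in> edges ?G" for z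
    proof (cases "z = Edge {p, q}")
      case False
      then show ?thesis using at_edges[of z x] z by simp
    qed (use p in auto)
    show "\<exists>u i. z = Loop u i \<and> u \<in> verts ?G" if "z \<in> loops ?G" for z using at_loops[of z x] that by simp
  qed (use p fin_verts fin_loops in auto)
  show "inj_on l (loops ?G)" using inj_on_subset[OF inj] by simp
  have "elements ?G = insert (Edge {p, q}) (elements G - at x)" by auto
  then show "insert {Inl p, Inl q} (E - code l ` at x) = code l ` elements ?G" by (simp add: code_remove)
qed (use outside V in auto)

lemma coded_remove_loop:
  assumes p: "p \<in> verts G - {x}" and k: "Loop p k \<notin> loops G"
    and y: "y \<notin> Inl ` (verts G - {x})" "y \<notin> l ` (loops G - at x)"
  shows "coded (l(Loop p k := y)) \<lparr>verts = verts G - {x}, edges = edges G - at x, loops = insert (Loop p k) (loops G - at x)\<rparr>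
    (V - {Inl x}) (insert {Inl p, y} (E - code l ` at x))" (is "coded ?l ?G _ _")
proof
  show "looped_simple_graph ?G"
  proof (rule looped_simpleI)
    show "\<exists>u w. z = Edge {u, w} \<and> u \<in> verts ?G \<and> w \<in> verts ?G \<and> u \<noteq> w" if z: "z \<in> edges ?G" for z
      using at_edges[of z x] z by simp
    show "\<exists>u i. z = Loop u i \<and> u \<in> verts ?G" if z: "z \<in> loops ?G" for z
    proof (cases "z = Loop p k")
      case False
      then show ?thesis using at_loops[of z x] z by simp
    qed (use p in auto)
  qed (use p fin_verts fin_loops in auto)
  have same: "?l z = l z" if "z \<in> elements G" for z
  proof -
    have "Loop p k \<notin> elements G" using k code_edge(2)[of "Loop p k"] by auto
    then show ?thesis using that by auto
  qed
  have "inj_on ?l (loops G - at x)" using inj_on_subset[OF inj, of "loops G - at x"] k by (intro inj_on_upd_notin) auto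
  moreover have "?l ` (loops G - at x) = l ` (loops G - at x)" using same by (intro image_cong) auto
  ultimately show "inj_on ?l (loops ?G)" using y(2) by (auto simp: inj_on_insert)
  show "?l z \<notin> Inl ` verts ?G" if z: "z \<in> loops ?G" for z
  proof (cases "z = Loop p k")
    case False
    then show ?thesis using z outside[of z] by auto
  qed (use y(1) in auto)
  have "elements ?G = insert (Loop p k) (elements G - at x)" by auto
  moreover have "code ?l ` (elements G - at x) = code l ` (elements G - at x)"
    using same by (intro image_cong code_cong) auto
  ultimately show "insert {Inl p, y} (E - code l ` at x) = code ?l ` elements ?G" by (simp add: code_remove)
qed (use V in auto)

lemma fresh_loop: obtains k where "Loop p k \<notin> loops G"
proof -
  have "finite {k. Loop p k \<in> loops G}"
    using fin_loops by (intro finite_vimageI[of _ "Loop p", unfolded vimage_def]) (auto simp: inj_on_def)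
  then obtain k where "k \<notin> {k. Loop p k \<in> loops G}" using ex_new_if_finite[OF infinite_UNIV_nat] by blast
  then show ?thesis using that by simp
qed

lemma loop_not_edge: "Loop u i \<notin> edges G" and edge_not_loop: "Edge e \<notin> loops G"
  using code_edge(2)[of "Loop u i"] loop_cases[of "Edge e"] by auto

text \<open>The label \<open>y\<close> of the loop restored at \<open>p\<close> is left open:
  ordinarily it is that of a loop at \<open>x\<close>, but it is \<open>x\<close> itself when
  \<open>x\<close> is cut off along a bridge.\<close>

lemma one_extension_two_loops:
  assumes p: "p \<in> verts G - {x}" and x: "x \<in> verts G" and at: "at x = {Edge {x, p}, Loop x i, Loop x j}" "i \<noteq> j"
    and y: "y \<notin> Inl ` (verts G - {x})" "y \<notin> l ` (loops G - at x)"
  shows "\<exists>l' G'. coded l' G' (V - {Inl x}) (insert {Inl p, y} (E - code l ` at x)) \<and> one_extension G' G"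
proof -
  obtain k where k: "Loop p k \<notin> loops G" by (rule fresh_loop)
  have "{Edge {x, p}, Loop x i, Loop x j} \<subseteq> elements G" using at(1) by (auto simp: at_def)
  then have e: "Edge {x, p} \<in> edges G" "Loop x i \<in> loops G" "Loop x j \<in> loops G"
    using loop_not_edge edge_not_loop by auto
  let ?G = "\<lparr>verts = verts G - {x}, edges = edges G - at x, loops = insert (Loop p k) (loops G - at x)\<rparr>"
  have "one_extension ?G \<lparr>verts = insert x (verts ?G), edges = edges ?G \<union> {Edge {p, x}},
      loops = (loops ?G - {Loop p k}) \<union> {Loop x i, Loop x j}\<rparr>"
    by (rule at_loop_add_loop) (use at(2) in auto)
  moreover have "insert x (verts ?G) = verts G" using x by auto
  moreover have "edges ?G \<union> {Edge {p, x}} = edges G"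
    using e(1) loop_not_edge unfolding at by (auto simp: insert_commute)
  moreover have "(loops ?G - {Loop p k}) \<union> {Loop x i, Loop x j} = loops G"
    using e(2,3) k edge_not_loop unfolding at by auto
  ultimately have "one_extension ?G G" by (simp add: lgraph_eta)
  then show ?thesis using coded_remove_loop[OF p k y] by blast
qed

lemma neighbour_element:
  assumes "{Inl x, t} \<in> E" "x \<in> verts G" "t \<noteq> Inl x"
  shows "(\<exists>q. t = Inl q \<and> q \<in> verts G - {x} \<and> Edge {x, q} \<in> edges G) \<or>
    (t \<notin> V \<and> (\<exists>i. Loop x i \<in> loops G \<and> l (Loop x i) = t))"
proof (cases "t \<in> V")
  case True
  then obtain q where q: "t = Inl q" "q \<in> verts G" using V by blast
  then show ?thesis using in_E_edge[of x q] assms by auto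
next
  case False
  then show ?thesis using in_E_loop[OF assms(1,2) False] by metis
qed

text \<open>As \<open>a\<close> is a vertex, \<open>ab\<close> stands for an edge or for a loop at
  \<open>a\<close>, depending on whether \<open>b\<close> is a vertex or a label. The same
  distinction for \<open>c\<close> yields the four extensions.\<close>

lemma remove_node:
  assumes v: "v \<notin> V'" "v \<notin> \<Union>E'" "V = insert v V'" and dis: "distinct [v, a, b, c]"
    and ab: "{a, b} \<in> E'" "a \<in> V'" and E': "E = E' - {{a, b}} \<union> {{v, a}, {v, b}, {v, c}}"
  shows "\<exists>l' G'. coded l' G' V' E' \<and> one_extension G' G"
proof -
  let ?S = "{{v, a}, {v, b}, {v, c}}"
  obtain x where x: "v = Inl x" "x \<in> verts G" using v(3) V by blast
  have abc: "a \<noteq> Inl x" "b \<noteq> Inl x" "c \<noteq> Inl x" "a \<noteq> b" "a \<noteq> c" "b \<noteq> c" using dis x(1) by auto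
  have V': "V' = V - {Inl x}" using v(1,3) x(1) by auto
  have star: "{Inl x, a} \<in> E" "{Inl x, b} \<in> E" "{Inl x, c} \<in> E" unfolding E' x(1) by blast+
  have "{e \<in> E. Inl x \<in> e} = ?S" using v(2) unfolding E' x(1) by blast
  then have cS: "code l ` at x = ?S" using code_at[OF x(2)] by simp
  have vE': "{v, t} \<notin> E'" for t using v(2) by blast
  have set: "F = insert z ((F - {z} \<union> T) - T)" if "z \<in> F" "\<And>t. t \<in> T \<Longrightarrow> t \<notin> F" for F T and z :: "('v + nat) set"
    using that by blast
  have EE: "E' = insert {a, b} (E - code l ` at x)"
    unfolding cS E' by (rule set[OF ab(1)]) (use vE' in auto)
  obtain p where p: "a = Inl p" "p \<in> verts G - {x}" "Edge {x, p} \<in> edges G"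
    using neighbour_element[OF star(1) x(2) abc(1)] ab(2) v(3) by blast
  have pe: "{v, a} = code l (Edge {x, p})" using x(1) p(1) by simp
  have atI: "at x = {Edge {x, p}, gb, gc}"
    if g: "gb \<in> elements G" "gc \<in> elements G" "code l gb = {v, b}" "code l gc = {v, c}" for gb gc
  proof -
    have sub: "{Edge {x, p}, gb, gc} \<subseteq> elements G" using p(3) g by auto
    have "code l ` {Edge {x, p}, gb, gc} = code l ` at x" using cS pe g(3,4) by simp
    moreover have "at x \<subseteq> elements G" by (auto simp: at_def)
    ultimately show ?thesis using inj_on_image_eq_iff[OF inj_code _ sub] by metis
  qed
  have setE: "insert g (A - S) - {g} \<union> B = A" if "g \<notin> A" "A \<inter> S = B" for A S B and g :: "'v element" using that by blast
  have setL: "A - S \<union> B = A" if "A \<inter> S = B" for A S B :: "'v element set" using that by blast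
  have xv: "insert x (verts G - {x}) = verts G" using x(2) by auto
  \<comment> \<open>An edge \<open>pq\<close> present in the old graph would be deleted by the
    extension and not come back.\<close>
  have newE: "Edge {p, q} \<notin> edges G" if "b = Inl q" for q
  proof
    assume "Edge {p, q} \<in> edges G"
    then have "{a, b} \<in> E" using edge_in_E p(1) that by simp
    moreover have "{a, b} \<notin> ?S" using abc x(1) by (auto simp: doubleton_eq_iff)
    ultimately show False unfolding E' by blast
  qed
  have px: "p \<noteq> x" "p \<in> verts G" using p(2) by auto
  from neighbour_element[OF star(2) x(2) abc(2)] show ?thesis
  proof (elim disjE exE conjE)
    fix q assume q: "b = Inl q" "q \<in> verts G - {x}" "Edge {x, q} \<in> edges G"
    have pq: "p \<noteq> q" using p(1) q(1) abc by auto
    have gb: "Edge {x, q} \<in> elements G" "code l (Edge {x, q}) = {v, b}" using q x(1) by auto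
    let ?G = "\<lparr>verts = verts G - {x}, edges = insert (Edge {p, q}) (edges G - at x), loops = loops G - at x\<rparr>"
    have cd: "coded l ?G V' E'"
      using coded_remove_edge[OF p(2) q(2) pq] p(1) q(1) EE V' by simp
    from neighbour_element[OF star(3) x(2) abc(3)] show ?thesis
    proof (elim disjE exE conjE)
      fix r assume r: "c = Inl r" "r \<in> verts G - {x}" "Edge {x, r} \<in> edges G"
      have at: "at x = {Edge {x, p}, Edge {x, q}, Edge {x, r}}"
        by (rule atI[OF gb(1) _ gb(2)]) (use r x(1) in auto)
      have "one_extension ?G \<lparr>verts = insert x (verts ?G),
          edges = (edges ?G - {Edge {p, q}}) \<union> {Edge {p, x}, Edge {q, x}, Edge {x, r}}, loops = loops ?G\<rparr>"
        by (rule at_edge_add_edge) (use r p q abc in auto)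
      moreover have "(edges ?G - {Edge {p, q}}) \<union> {Edge {p, x}, Edge {q, x}, Edge {x, r}} = edges G"
        unfolding lgraph.simps
        by (rule setE[OF newE[OF q(1)]]) (use p(3) q(3) r(3) at in \<open>auto simp: insert_commute\<close>)
      moreover have "loops ?G = loops G" using edge_not_loop unfolding at by auto
      ultimately have "one_extension ?G G" using xv by (simp add: lgraph_eta)
      then show ?thesis using cd by blast
    next
      fix i assume i: "c \<notin> V" "Loop x i \<in> loops G" "l (Loop x i) = c"
      have at: "at x = {Edge {x, p}, Edge {x, q}, Loop x i}"
        by (rule atI[OF gb(1) _ gb(2)]) (use i x(1) in auto)
      have "one_extension ?G \<lparr>verts = insert x (verts ?G),
          edges = (edges ?G - {Edge {p, q}}) \<union> {Edge {p, x}, Edge {q, x}}, loops = loops ?G \<union> {Loop x i}\<rparr>"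
        by (rule at_edge_add_loop) auto
      moreover have "(edges ?G - {Edge {p, q}}) \<union> {Edge {p, x}, Edge {q, x}} = edges G"
        unfolding lgraph.simps
        by (rule setE[OF newE[OF q(1)]]) (use p(3) q(3) at loop_not_edge in \<open>auto simp: insert_commute\<close>)
      moreover have "loops ?G \<union> {Loop x i} = loops G"
        unfolding lgraph.simps by (rule setL) (use i at edge_not_loop in auto)
      ultimately have "one_extension ?G G" using xv by (simp add: lgraph_eta)
      then show ?thesis using cd by blast
    qed
  next
    fix i assume i: "b \<notin> V" "Loop x i \<in> loops G" "l (Loop x i) = b"
    have gb: "Loop x i \<in> elements G" "code l (Loop x i) = {v, b}" using i x(1) by auto
    have bV: "b \<notin> Inl ` (verts G - {x})" using i(1) V by auto
    have bl: "b \<notin> l ` (loops G - at x)"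
    proof
      assume "b \<in> l ` (loops G - at x)"
      then obtain z where z: "z \<in> loops G" "z \<notin> at x" "l z = b" by blast
      then have "z = Loop x i" using inj i(2,3) by (auto dest: inj_onD)
      then show False using z(2) i(2) by (simp add: at_def)
    qed
    from neighbour_element[OF star(3) x(2) abc(3)] show ?thesis
    proof (elim disjE exE conjE)
      fix r assume r: "c = Inl r" "r \<in> verts G - {x}" "Edge {x, r} \<in> edges G"
      obtain k where k: "Loop p k \<notin> loops G" by (rule fresh_loop)
      let ?G = "\<lparr>verts = verts G - {x}, edges = edges G - at x, loops = insert (Loop p k) (loops G - at x)\<rparr>"
      have cd: "coded (l(Loop p k := b)) ?G V' E'"
        using coded_remove_loop[OF p(2) k bV bl] p(1) EE V' by simp
      have at: "at x = {Edge {x, p}, Loop x i, Edge {x, r}}"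
        by (rule atI[OF gb(1) _ gb(2)]) (use r x(1) in auto)
      have "one_extension ?G \<lparr>verts = insert x (verts ?G),
          edges = edges ?G \<union> {Edge {p, x}, Edge {r, x}}, loops = (loops ?G - {Loop p k}) \<union> {Loop x i}\<rparr>"
        by (rule at_loop_add_edge) (use r p abc in auto)
      moreover have "edges ?G \<union> {Edge {p, x}, Edge {r, x}} = edges G"
        unfolding lgraph.simps
        by (rule setL) (use p(3) r(3) at loop_not_edge in \<open>auto simp: insert_commute\<close>)
      moreover have "(loops ?G - {Loop p k}) \<union> {Loop x i} = loops G"
        unfolding lgraph.simps by (rule setE[OF k]) (use i at edge_not_loop in auto)
      ultimately have "one_extension ?G G" using xv by (simp add: lgraph_eta)
      then show ?thesis using cd by blast
    next
      fix j assume j: "c \<notin> V" "Loop x j \<in> loops G" "l (Loop x j) = c"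
      have at: "at x = {Edge {x, p}, Loop x i, Loop x j}"
        by (rule atI[OF gb(1) _ gb(2)]) (use j x(1) in auto)
      have "i \<noteq> j" using i(3) j(3) abc(6) by auto
      then show ?thesis
        using one_extension_two_loops[OF p(2) x(2) at _ bV bl] p(1) EE V' by simp
    qed
  qed
qed

end

context coded
begin

text \<open>Only the addition of a vertex without a deletion has no counterpart among the
  operations. It is an extension preceded by the addition of an edge between two neighbours of
  \<open>v\<close>, or followed by it if that edge exists already; the graphs in between are solid
  and connected.\<close>

lemma obtainable_step:
  assumes IH: "\<And>l' (G' :: 'v lgraph) V' E'. graph_size V' E' < graph_size V E \<Longrightarrow> coded l' G' V' E' \<Longrightarrow> solid V' E' \<Longrightarrow> conn V' E' \<Longrightarrow>
      obtainable_from_K1_3 G'"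
    and c: "conn V E" and st: "step V' E' V E" and s': "solid V' E'" and c': "conn V' E'"
  shows "obtainable_from_K1_3 G"
proof -
  have del_edge: ?thesis if e: "e \<in> E" and s: "solid V (E - {e})" and c: "conn V (E - {e})" for e
  proof -
    obtain x where x: "x \<in> elements G" "e = code l x" using e E by blast
    obtain G' where G': "coded l G' V (E - {e})" "add_element G' G" using remove_element[OF x(1)] x(2) by blast
    have "step V (E - {e}) V E"
      by (rule step_edge[of e]) (use e meets[OF e] graph in \<open>auto simp: graph_def\<close>)
    then have "graph_size V (E - {e}) < graph_size V E" using graph by (rule step_size)
    then have "obtainable_from_K1_3 G'" using IH G'(1) s c by blast
    then show ?thesis using G'(2) by (rule obtainable_from_K1_3.add)
  qed
  have node: ?thesis
    if v: "v \<notin> V'" "v \<notin> \<Union>E'" "V = insert v V'" and dis: "distinct [v, a, b, d]"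
      and ab: "{a, b} \<in> E'" "a \<in> V'" and E': "E = E' - {{a, b}} \<union> {{v, a}, {v, b}, {v, d}}"
      and s: "solid V' E'" and c: "conn V' E'" for v a b d V' E'
  proof -
    obtain l' G' where G': "coded l' G' V' E'" "one_extension G' G"
      using remove_node[OF v dis ab E'] by blast
    have "step V' E' V E" by (rule step_ext[OF v dis ab(1) _ E']) (use ab(2) in blast)
    then have "graph_size V' E' < graph_size V E" using graph by (rule step_size)
    then have "obtainable_from_K1_3 G'" using IH G'(1) s c by blast
    then show ?thesis using G'(2) by (rule obtainable_from_K1_3.extend)
  qed
  show ?thesis
    using st
  proof (cases rule: stepE)
    case (edge e)
    have "E - {e} = E'" using edge(2,3) by simp
    then show ?thesis using del_edge[of e] edge(1,3) s' c' by simp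
  next
    case (vertex v a b d)
    let ?S = "{{v, a}, {v, b}, {v, d}}"
    have g': "graph V' E'" using s' by (simp add: solid_def)
    show ?thesis
    proof (cases "V' = {}")
      case True
      then have Vv: "V = {v}" using vertex(3) by simp
      have "E' = {}"
      proof (rule equals0I)
        fix e assume e: "e \<in> E'"
        then have "e \<inter> V \<noteq> {}" using meets[of e] vertex(5) by simp
        then show False using Vv vertex(2) e by blast
      qed
      then have "card E = 3" using vertex(5) card_star3[OF vertex(4)] by simp
      then have c3: "card (elements G) = 3" using card_code_image[OF order_refl] E by simp
      have "card V = 1" using Vv by simp
      then have "card (verts G) = 1" using V by (simp add: card_image)
      then obtain x where x: "verts G = {x}" by (rule card_1_singletonE)
      have "edges G = {}"
      proof (rule equals0I)
        fix z assume "z \<in> edges G"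
        then show False using edge_form[of z] x by auto
      qed
      moreover have "loops G \<subseteq> {Loop x i | i. True}" using loop_form x by auto
      ultimately have "is_K1_3 G" using x c3 unfolding is_K1_3_def by auto
      then show ?thesis by (rule obtainable_from_K1_3.base)
    next
      case False
      have "V' \<subset> V" using vertex(1,3) by blast
      then have "\<exists>e\<in>E. e \<inter> V' \<noteq> {} \<and> e \<inter> (V - V') \<noteq> {}" using c False unfolding conn_def by simp
      then obtain e where e: "e \<in> E" "e \<inter> V' \<noteq> {}" "e \<inter> (V - V') \<noteq> {}" by (elim bexE conjE)
      then have "v \<in> e" using vertex(3) by blast
      then have "e \<notin> E'" using vertex(2) by blast
      then have "e = {v, a} \<or> e = {v, b} \<or> e = {v, d}" using e(1) vertex(5) by simp
      \<comment> \<open>Connectedness puts one of the three neighbours in the graph; the inverse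
        extension needs an edge with an end there.\<close>
      then have "a \<in> V' \<or> b \<in> V' \<or> d \<in> V'" using e(2) vertex(1) by auto
      then obtain a' b' d' where p: "a' \<in> V'" "distinct [v, a', b', d']" "?S = {{v, a'}, {v, b'}, {v, d'}}"
      proof (elim disjE)
        assume "a \<in> V'"
        then show thesis using that[of a b d] vertex(4) by simp
      next
        assume "b \<in> V'"
        moreover have "distinct [v, b, a, d]" using vertex(4) by auto
        ultimately show thesis by (rule that) (rule insert_commute)
      next
        assume "d \<in> V'"
        moreover have "distinct [v, d, b, a]" using vertex(4) by auto
        ultimately show thesis by (rule that) (simp only: insert_commute)
      qed
      have vE: "v \<notin> e" if "e \<in> E'" for e using vertex(2) that by blast
      have E': "E = E' \<union> {{v, a'}, {v, b'}, {v, d'}}" using vertex(5) p(3) by simp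
      show ?thesis
      proof (cases "{a', b'} \<in> E'")
        case False
        let ?E = "insert {a', b'} E'"
        have "graph V' ?E" using g' p(2) by (auto simp: graph_def)
        then have s2: "solid V' ?E" using solid_mono[OF s', of ?E] by blast
        have c2: "conn V' ?E" by (rule conn_mono[OF c']) blast
        have v2: "v \<notin> \<Union>?E" using vertex(2) p(2) by auto
        have E2: "E = ?E - {{a', b'}} \<union> {{v, a'}, {v, b'}, {v, d'}}" using E' False by simp
        show ?thesis by (rule node[OF vertex(1) v2 vertex(3) p(2) _ p(1) E2 s2 c2]) simp
      next
        case True
        let ?T = "{{v, a'}, {v, b'}, {v, d'}}"
        have "{a', b'} \<notin> ?T" using p(2) by (auto simp: doubleton_eq_iff)
        then have E2: "E - {{a', b'}} = E' - {{a', b'}} \<union> ?T" unfolding E' by blast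
        have "solid V (E - {{a', b'}})" unfolding E2 vertex(3)
          by (rule solid_one_ext[OF s' vertex(1,2) p(2)]) (use True in blast)
        moreover have "conn V (E - {{a', b'}})" unfolding E2 vertex(3)
          by (rule conn_ext[OF c' p(1) vertex(1)]) blast
        moreover have "{a', b'} \<in> E" unfolding E' using True by blast
        ultimately show ?thesis by (intro del_edge)
      qed
    qed
  next
    case (ext v a b d)
    show ?thesis
    proof (cases "a \<in> V'")
      case True
      show ?thesis by (rule node[OF ext(1-5) True ext(7) s' c'])
    next
      case False
      then have "b \<in> V'" using ext(6) by auto
      moreover have "distinct [v, b, a, d]" using ext(4) by auto
      moreover have "{b, a} \<in> E'" "E = E' - {{b, a}} \<union> {{v, b}, {v, a}, {v, d}}"
        using ext(5,7) by (simp_all add: insert_commute)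
      ultimately show ?thesis using node[OF ext(1-3) _ _ _ _ s' c'] by blast
    qed
  qed
qed

end

text \<open>A step can disconnect the graph only along a bridge. If there is a bridge, the step is taken inside a
  smallest side of a bridge and keeps that bridge; a side consisting of one vertex of degree three
  is removed by inverting the one-extension at a loop.\<close>

lemma solid_imp_obtainable:
  "coded l G V E \<Longrightarrow> solid V E \<Longrightarrow> conn V E \<Longrightarrow> obtainable_from_K1_3 G"
proof (induction "graph_size V E" arbitrary: l G V E rule: less_induct)
  case (less V E l G)
  interpret coded l G V E by (rule less.prems(1))
  note s = less.prems(2) and c = less.prems(3)
  have fV: "finite V" using graph by (simp add: graph_def)
  have step: "obtainable_from_K1_3 G" if "step V' E' V E" "solid V' E'" "conn V' E'" for V' E'
    by (rule obtainable_step[OF _ c that]) (rule less.hyps)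
  let ?P = "\<lambda>S. S \<subset> V \<and> S \<noteq> {} \<and> card (cross V E S) = 1"
  show ?case
  proof (cases "\<exists>S. ?P S")
    case False
    obtain V' E' where st: "step V' E' V E" "solid V' E'" using reduction_free[OF s V_ne] .
    have "conn V' E'"
    proof (rule ccontr)
      assume "\<not> conn V' E'"
      then obtain W where W: "W \<subset> V'" "W \<noteq> {}" "cross V' E' W = {}" unfolding conn_cross by blast
      have no: "e \<inter> (V' - W) = {}" if "e \<in> E'" "e \<inter> W \<noteq> {}" for e using W(3) that unfolding cross_def by blast
      obtain S where "W \<subseteq> S" "S \<subset> V" "card (cross V E S) = 1"
        using bridge_of_disconnection[OF st(1) c W(1,2) no] by metis
      then show False using False W(2) by blast
    qed
    then show ?thesis using step st by blast
  next
    case True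
    \<comment> \<open>Minimality protects connectedness: a disconnection caused inside
      \<open>V2\<close> would yield a bridge with a smaller side.\<close>
    then obtain V2 where V2: "?P V2" and min: "\<And>S. ?P S \<Longrightarrow> card V2 \<le> card S"
      using ex_has_least_nat[of ?P _ card] by metis
    define V1 where "V1 = V - V2"
    obtain f where f: "cross V E V2 = {f}" using V2 by (metis card_1_singletonE)
    have fc: "f \<in> E" "f \<inter> V2 \<noteq> {}" "f \<inter> V1 \<noteq> {}" using f unfolding cross_def V1_def by blast+
    obtain u w where uw: "u \<in> f" "u \<in> V1" "w \<in> f" "w \<in> V2" using fc by blast
    have dis: "V1 \<inter> V2 = {}" and VV: "V = V1 \<union> V2" using V2 unfolding V1_def by blast+
    have "u \<noteq> w" using uw dis by blast
    moreover have "card f = 2" using graph fc(1) by (simp add: graph_def)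
    ultimately have feq: "f = {u, w}" using pair_other[of f u w] uw by simp
    have uwE: "{u, w} \<in> E" using fc(1) feq by simp
    have only: "e = {u, w}" if "e \<in> E" "e \<inter> V1 \<noteq> {}" "e \<inter> V2 \<noteq> {}" for e
    proof -
      have "e \<in> cross V E V2" using that unfolding cross_def V1_def by blast
      then show ?thesis using f feq by simp
    qed
    have uniq: "t \<in> V" if "p \<in> V1" "q \<in> V2" "{p, t} \<in> E" "{q, t} \<in> E" for p q t
    proof (rule ccontr)
      assume t: "t \<notin> V"
      have "{p, t} = {q, t}" by (rule unique_outer[OF that(3,4) _ _ t]) simp_all
      then have "p = q" using that(1,2) t VV by (auto simp: doubleton_eq_iff)
      then show False using that(1,2) dis by blast
    qed
    have sub: "V1 \<subset> V" "V2 \<subset> V" "V2 \<subseteq> V" using V2 VV uw(4) dis by blast+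
    have s2: "solid V2 E" using solid_contract[OF s sub(3)] .
    have fV2: "finite V2" using finite_subset[OF sub(3) fV] .
    have bridge: ?thesis
      if st: "step V2' E' V2 E" "solid V2' E'" "w \<in> V2'" "{u, w} \<in> E'" for V2' E'
    proof -
      let ?V = "V1 \<union> V2'"
      note comp' = bridge_compose[OF s VV dis uw(2,4) uwE _ _ st]
      have comp: "step ?V E' V E" "solid ?V E'"
        by (rule comp'; (rule only uniq; assumption))+
      have sub': "V2' \<subseteq> V2" using step_subset[OF st(1)] .
      have kept: "e \<in> E'" if e: "e \<in> E" "e \<inter> V1 \<noteq> {}" for e
      proof (cases "e \<inter> V2 = {}")
        case True
        then show ?thesis using step_outside[OF st(1)] e(1) by blast
      next
        case False
        then show ?thesis using only[OF e False] st(4) by simp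
      qed
      have "conn ?V E'"
      proof (rule ccontr)
        assume "\<not> conn ?V E'"
        then obtain W0 where W0: "W0 \<subset> ?V" "W0 \<noteq> {}" "cross ?V E' W0 = {}" unfolding conn_cross by blast
        \<comment> \<open>Of the two parts the one without \<open>u\<close> is taken. It does not
          meet \<open>V1\<close>, where all edges are kept, and does not contain \<open>w\<close>,
          so the bridge found for it has a side properly inside \<open>V2\<close>.\<close>
        define W where "W = (if u \<in> W0 then ?V - W0 else W0)"
        have W: "W \<subset> ?V" "W \<noteq> {}" "u \<notin> W" using W0 unfolding W_def by (auto split: if_splits)
        have no: "e \<inter> (?V - W) = {}" if "e \<in> E'" "e \<inter> W \<noteq> {}" for e
        proof -
          have "e \<inter> W0 = {} \<or> e \<inter> (?V - W0) = {}" using W0(3) that(1) unfolding cross_def by blast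
          moreover have "?V - (?V - W0) = W0" using W0(1) by blast
          ultimately show ?thesis using that(2) unfolding W_def by (simp split: if_splits)
        qed
        have W1: "V1 \<inter> W = {}"
        proof (rule ccontr)
          let ?S = "V1 \<inter> W"
          assume ne: "?S \<noteq> {}"
          have "?S \<subset> V" using W(3) uw(2) sub(1) by blast
          then have "cross V E ?S \<noteq> {}" using c ne unfolding conn_cross by simp
          then obtain e where e: "e \<in> E" "e \<inter> ?S \<noteq> {}" "e \<inter> (V - ?S) \<noteq> {}" unfolding cross_def by blast
          have e1: "e \<inter> V1 \<noteq> {}" using e(2) by blast
          have "e \<in> E'" using kept[OF e(1) e1] .
          then have eW: "e \<inter> (?V - W) = {}" using no e(2) by blast
          then have "e \<inter> V2 \<noteq> {}" using e(3) VV by blast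
          then have "e = {u, w}" using only[OF e(1) e1] by simp
          then show False using eW W(3) uw(2) by simp
        qed
        have wW: "w \<notin> W"
        proof
          assume "w \<in> W"
          then have "{u, w} \<inter> (?V - W) = {}" using no[OF st(4)] by simp
          then show False using W(3) uw(2) by simp
        qed
        obtain S where S: "W \<subseteq> S" "S \<subseteq> W \<union> (V - ?V)" "S \<subset> V" "card (cross V E S) = 1"
        proof (rule bridge_of_disconnection[OF comp(1) c W(1,2)])
        qed (rule no that; assumption)+
        have "S \<noteq> {}" using S(1) W(2) by blast
        then have "card V2 \<le> card S" using min S(3,4) by simp
        moreover have "S \<subset> V2" using S(2) W(1) W1 wW sub' st(3) VV uw(4) by blast
        then have "card S < card V2" using fV2 by (rule psubset_card_mono[rotated])
        ultimately show False by simp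
      qed
      then show ?thesis using step comp by blast
    qed
    show ?thesis
    proof (cases "2 \<le> card V2")
      case True
      have "rooted V2 E w u" unfolding rooted_def
      proof (intro conjI ballI impI)
        show "w \<in> V2" "u \<notin> V2" "{w, u} \<in> E" using uw dis uwE by (auto simp: insert_commute)
        fix q assume q: "q \<in> V2" "{q, u} \<in> E"
        then have "{q, u} = {u, w}" using only[OF q(2)] uw(2) by simp
        then show "q = w" using q(1) \<open>u \<notin> V2\<close> by (auto simp: doubleton_eq_iff)
      qed
      then obtain V2' E' where st: "step V2' E' V2 E" "solid V2' E'" "rooted V2' E' w u"
        using reduction_rooted[OF s2 _ True] by metis
      then show ?thesis using bridge[OF st(1,2)] by (auto simp: rooted_def insert_commute)
    next
      case False
      have V2w: "V2 = {w}"
      proof -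
        have "card V2 \<le> Suc 0" using False by simp
        then have all: "\<forall>a\<in>V2. \<forall>b\<in>V2. a = b" using card_le_Suc0_iff_eq[OF fV2] by simp
        have "q = w" if "q \<in> V2" for q by (rule bspec[OF bspec[OF all that] uw(4)])
        then have "V2 \<subseteq> {w}" by blast
        then show ?thesis using uw(4) by (intro subset_antisym) simp_all
      qed
      have gw: "graph {w} E" using graph by (simp add: graph_def)
      have n3: "3 \<le> card (nb E {w})" using s2 V2w by (simp add: solid_def bal_def)
      have fn: "finite (nb E {w})" using finite_nb[OF gw] .
      have un: "u \<in> nb E {w}" using uwE \<open>u \<noteq> w\<close> by (auto simp: nb_def insert_commute)
      show ?thesis
      proof (cases "4 \<le> card (nb E {w})")
        case True
        have "card (nb E {w} - {u}) \<noteq> 0" using True un fn by simp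
        then obtain t where t: "t \<in> nb E {w}" "t \<noteq> u" by (metis card.empty Diff_iff ex_in_conv insertI1)
        then have tE: "{w, t} \<in> E" "t \<noteq> w" by (auto simp: nb_def)
        let ?E = "E - {{w, t}}"
        have st: "step {w} ?E {w} E" by (rule step_edge[of "{w, t}"]) (use tE in auto)
        have g': "graph {w} ?E" using step_graph[OF st gw] .
        have "nb E {w} - {t} \<subseteq> nb ?E {w}" by (auto simp: nb_def doubleton_eq_iff)
        then have "card (nb E {w} - {t}) \<le> card (nb ?E {w})" using finite_nb[OF g'] by (intro card_mono)
        then have "3 \<le> card (nb ?E {w})" using True t(1) fn by simp
        then have "solid {w} ?E" using solid_star[OF g'] by simp
        moreover have "{u, w} \<in> ?E" using uwE t(2) \<open>u \<noteq> w\<close> by (auto simp: doubleton_eq_iff)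
        ultimately show ?thesis using bridge[of "{w}" ?E] st V2w by simp
      next
        case False
        then have "card (nb E {w} - {u}) = 2" using n3 un fn by simp
        then obtain t1 t2 where t: "nb E {w} - {u} = {t1, t2}" "t1 \<noteq> t2" by (auto simp: card_2_iff)
        have nbw: "nb E {w} = {u, t1, t2}" using t(1) un by blast
        obtain x where x: "w = Inl x" "x \<in> verts G" using uw(4) sub(3) V by blast
        obtain p where p: "u = Inl p" "p \<in> verts G" using uw(2) sub(1) V by blast
        have px: "p \<in> verts G - {x}" using p x \<open>u \<noteq> w\<close> by auto
        have label: "\<exists>i. Loop x i \<in> loops G \<and> l (Loop x i) = t" if t: "t \<in> nb E {w}" "t \<noteq> u" for t
        proof -
          have tE: "{w, t} \<in> E" "t \<noteq> w" using t(1) by (auto simp: nb_def)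
          have "t \<notin> V1"
          proof
            assume "t \<in> V1"
            then have "{w, t} = {u, w}" using only[OF tE(1)] uw(4) by simp
            then show False using t(2) tE(2) by (auto simp: doubleton_eq_iff)
          qed
          then have "t \<notin> V" using VV V2w tE(2) by simp
          then show ?thesis using neighbour_element[of x t] tE x V by auto
        qed
        have "t1 \<in> nb E {w}" "t1 \<noteq> u" "t2 \<in> nb E {w}" "t2 \<noteq> u" using t(1) by blast+
        then obtain i j where ij: "Loop x i \<in> loops G" "l (Loop x i) = t1" "Loop x j \<in> loops G" "l (Loop x j) = t2"
          using label by metis
        have "i \<noteq> j" using ij t(2) by auto
        have xp: "Edge {x, p} \<in> edges G"
          using in_E_edge[of x p] uwE x p px by (simp add: insert_commute)
        have star: "{e \<in> E. Inl x \<in> e} = {{w, u}, {w, t1}, {w, t2}}"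
        proof
          show "{e \<in> E. Inl x \<in> e} \<subseteq> {{w, u}, {w, t1}, {w, t2}}"
          proof
            fix e assume e: "e \<in> {e \<in> E. Inl x \<in> e}"
            then have "card e = 2" "w \<in> e" using graph x(1) by (auto simp: graph_def)
            then obtain q where q: "q \<noteq> w" "q \<in> e" by (auto simp: card_2_iff)
            then have eq: "e = {w, q}" using pair_other[OF \<open>card e = 2\<close> \<open>w \<in> e\<close>] by simp
            then have "q \<in> nb E {w}" using e q(1) by (simp add: nb_def)
            then show "e \<in> {{w, u}, {w, t1}, {w, t2}}" using nbw eq by auto
          qed
          have "{w, q} \<in> E" if "q \<in> {u, t1, t2}" for q using that nbw by (auto simp: nb_def)
          then show "{{w, u}, {w, t1}, {w, t2}} \<subseteq> {e \<in> E. Inl x \<in> e}" using x(1) by simp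
        qed
        have at: "at x = {Edge {x, p}, Loop x i, Loop x j}"
          by (rule at_eqI[OF x(2)]) (use xp ij star x(1) p(1) in auto)
        \<comment> \<open>After its removal \<open>x\<close> is an outer vertex, so it may be a
          label, and the bridge becomes the loop at \<open>p\<close> with this label.\<close>
        have y: "Inl x \<notin> Inl ` (verts G - {x})" by auto
        have y': "Inl x \<notin> l ` (loops G - at x)"
        proof
          assume "Inl x \<in> l ` (loops G - at x)"
          then obtain z where "z \<in> loops G" "Inl x = l z" by blast
          then show False using outside[of z] x(2) by (metis imageI)
        qed
        let ?E1 = "insert {Inl p, Inl x} (E - code l ` at x)"
        obtain l' G' where G': "coded l' G' (V - {Inl x}) ?E1" "one_extension G' G"
          using one_extension_two_loops[OF px x(2) at \<open>i \<noteq> j\<close> y y'] by blast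
        have V1x: "V - {Inl x} = V1" using V2w x(1) unfolding V1_def by simp
        have cd: "coded l' G' V1 ?E1" using G'(1) V1x by simp
        have memE1: "e \<in> ?E1" if "e \<in> E" "w \<notin> e" for e using that code_at[OF x(2)] x(1) by auto
        have pxf: "{Inl p, Inl x} = {u, w}" using p(1) x(1) by simp
        \<comment> \<open>No edge at \<open>V1\<close> is lost, the only one leading to
          \<open>w\<close> being the bridge, so this is the graph seen from \<open>V1\<close> and
          inherits its solidity.\<close>
        have "inc V1 E \<subseteq> ?E1"
        proof
          fix e assume "e \<in> inc V1 E"
          then have e: "e \<in> E" "e \<inter> V1 \<noteq> {}" by (auto simp: inc_def)
          show "e \<in> ?E1"
          proof (cases "w \<in> e")
            case True
            then show ?thesis using only[OF e] uw(4) pxf by blast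
          qed (rule memE1[OF e(1)])
        qed
        then have s1: "solid V1 ?E1"
          using solid_cong[OF solid_contract[OF s] _ coded.graph[OF cd]] sub(1) by blast
        have c1: "conn V1 ?E1" unfolding conn_def
        proof (intro allI impI, elim conjE)
          fix S assume S: "S \<subset> V1" "S \<noteq> {}"
          define S' where "S' = (if u \<in> S then V1 - S else S)"
          have S': "S' \<subset> V" "S' \<noteq> {}" "u \<notin> S'" "S' \<subseteq> V1" using S sub(1) unfolding S'_def by (auto split: if_splits)
          have "cross V E S' \<noteq> {}" using c S' unfolding conn_cross by simp
          then obtain e where e: "e \<in> E" "e \<inter> S' \<noteq> {}" "e \<inter> (V - S') \<noteq> {}" unfolding cross_def by blast
          have we: "w \<notin> e"
          proof
            assume we: "w \<in> e"
            have "e \<inter> V1 \<noteq> {}" using e(2) S'(4) by blast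
            then have "e = {u, w}" using only[OF e(1)] we uw(4) by blast
            then show False using e(2) S'(3,4) uw(4) dis by blast
          qed
          have "e \<inter> (V1 - S') \<noteq> {}" using e(3) we VV V2w by blast
          then have "e \<inter> S \<noteq> {} \<and> e \<inter> (V1 - S) \<noteq> {}" using e(2) S(1) unfolding S'_def by (cases "u \<in> S") auto
          then show "\<exists>e\<in>?E1. e \<inter> S \<noteq> {} \<and> e \<inter> (V1 - S) \<noteq> {}" by (rule bexI[OF _ memE1[OF e(1) we]])
        qed
        have "?E1 \<subseteq> E" using uwE pxf by auto
        then have "inc V1 ?E1 \<subseteq> inc V1 E" by (rule inc_mono)
        moreover have "finite (inc V1 E)" using graph by (intro finite_inc) (simp add: graph_def)
        ultimately have "graph_size V1 ?E1 \<le> graph_size V1 E" by (simp add: graph_size_def card_mono)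
        also have "\<dots> < graph_size V E" by (rule graph_size_subset[OF graph sub(1)])
        finally have "obtainable_from_K1_3 G'" by (rule less.hyps[OF _ cd s1 c1])
        then show ?thesis using G'(2) by (rule obtainable_from_K1_3.extend)
      qed
    qed
  qed
qed

theorem theorem7p4:
  fixes G :: "'v lgraph"
  assumes "looped_simple_graph G"
  shows "(no_isolated_vertices G \<and> balanced G \<and> lc_connected G) \<longleftrightarrow> obtainable_from_K1_3 G"
proof
  assume a: "no_isolated_vertices G \<and> balanced G \<and> lc_connected G"
  obtain l where cd: "coded l G (Inl ` verts G) (code l ` elements G)" using exists_coding[OF assms] .
  interpret coded l G "Inl ` verts G" "code l ` elements G" by (rule cd)
  show "obtainable_from_K1_3 G" using solid_imp_obtainable[OF cd] connected_imp_solid a by blast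
next
  assume "obtainable_from_K1_3 G"
  then obtain l V E where cd: "coded l G V E" and s: "solid V E" "conn V E"
    using obtainable_imp_solid by blast
  interpret coded l G V E by (rule cd)
  show "no_isolated_vertices G \<and> balanced G \<and> lc_connected G"
    using solid_imp_no_isolated solid_imp_balanced solid_imp_connected s by blast
qed

end
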